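(* Let $\Bbbk$ be a field, $S=\Bbbk[x_1,\dots,x_n]$, let $\mathfrak{a}\subset S$ be a monomial ideal, let $R:=S/\mathfrak{a}$ and let $r:=\max(2,\operatorname{reg}R-2)$. If $K_R$ satisfies $(B_r)$, then $R$ is Golod.
   Context: $\operatorname{reg}R$ is the Castelnuovo–Mumford regularity of $R$ as an $S$-module (standard $\mathbb{Z}$-grading). $K_R$ is the Koszul complex over $R$ on the images of $x_1,\dots,x_n$, a differential graded algebra (DGA). Massey products: let $A$ be a DGA with differential $d$, $|\cdot|$ homological degree, $\bar a=(-1)^{|a|+1}a$. The binary Massey product $\mu_2(a_1,a_2)$ is the product in $H_*(A)$. For $k\ge 3$ and homogeneous $a_1,\dots,a_k\in H_*(A)$, $\mu_k(a_1,\dots,a_k)$ is defined if there are $a_{ij}\in A$ for $1\le i\le j\le k$, $(i,j)\ne(1,k)$, with $da_{ii}=0$, $[a_{ii}]=a_i$ and $da_{ij}=\sum_{v=i}^{j-1}\bar a_{iv}a_{v+1,j}$ for $i<j$; then $\mu_k(a_1,\dots,a_k)\subset H_*(A)$ is the set of all classes $[\sum_{v=1}^{k-1}\bar a_{1v}a_{v+1,k}]$ so obtained. $A$ satisfies $(B_r)$ if for all $2\le k\le r$ all $k$-ary Massey products of elements of positive homological degree are defined and contain only zero. $R$ is Golod if the product and all higher Massey products on $H_*(K_R)$ are trivial, i.e. all $k$-ary Massey products ($k\ge2$) of elements of positive homological degree are defined and contain only zero. *)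

theory Defs
  imports
    "HOL-Algebra.QuotRing"
    "HOL-Library.Poly_Mapping"
    "HOL-Library.FuncSet"
    "HOL-Library.Extended_Real"
begin

section \<open>Differential graded algebras and Massey products\<close>

text \<open>\<open>piece A p\<close> is the component of homological degree \<open>p\<close>; the differential lowers this
  degree by one.\<close>

record 'a dga = "'a ring" +
  piece :: "nat \<Rightarrow> 'a set"
  diff :: "'a \<Rightarrow> 'a"

definition cycles :: "('a, 'm) dga_scheme \<Rightarrow> 'a set" where
  "cycles A = {z \<in> carrier A. diff A z = \<zero>\<^bsub>A\<^esub>}"

definition boundaries :: "('a, 'm) dga_scheme \<Rightarrow> 'a set" where
  "boundaries A = diff A ` carrier A"

definition homology :: "('a, 'm) dga_scheme \<Rightarrow> 'a set ring" where
  "homology A = (A\<lparr>carrier := cycles A\<rparr>) Quot (boundaries A)"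

definition hclass :: "('a, 'm) dga_scheme \<Rightarrow> 'a \<Rightarrow> 'a set" where
  "hclass A z = boundaries A +>\<^bsub>A\<^esub> z"

definition homology_piece :: "('a, 'm) dga_scheme \<Rightarrow> nat \<Rightarrow> 'a set set" where
  "homology_piece A p = hclass A ` (cycles A \<inter> piece A p)"

text \<open>\<open>signed R k a\<close> is \<open>(-1)^k a\<close>.\<close>

definition signed :: "('a, 'm) ring_scheme \<Rightarrow> nat \<Rightarrow> 'a \<Rightarrow> 'a" where
  "signed R k a = (if even k then a else \<ominus>\<^bsub>R\<^esub> a)"

text \<open>The entry \<open>a i j\<close> of a defining system for classes of degrees \<open>p 1, \<dots>, p k\<close> has the degree
  that the equation for its differential dictates.\<close>

definition entry_deg :: "(nat \<Rightarrow> nat) \<Rightarrow> nat \<Rightarrow> nat \<Rightarrow> nat" where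
  "entry_deg p i j = (\<Sum>v = i..j. p v) + (j - i)"

text \<open>The sum of \<open>\<bar>(a i v) a (v+1) j\<close> over \<open>i \<le> v < j\<close>, where \<open>\<bar>a = (-1)^(|a|+1) a\<close>.\<close>

definition massey_sum ::
    "('a, 'm) dga_scheme \<Rightarrow> (nat \<Rightarrow> nat) \<Rightarrow> (nat \<Rightarrow> nat \<Rightarrow> 'a) \<Rightarrow> nat \<Rightarrow> nat \<Rightarrow> 'a" where
  "massey_sum A p a i j =
     (\<Oplus>\<^bsub>A\<^esub>v\<in>{i..<j}. signed A (entry_deg p i v + 1) (a i v) \<otimes>\<^bsub>A\<^esub> a (v + 1) j)"

definition defining_system ::
    "('a, 'm) dga_scheme \<Rightarrow> nat \<Rightarrow> (nat \<Rightarrow> nat) \<Rightarrow> (nat \<Rightarrow> 'a set) \<Rightarrow> (nat \<Rightarrow> nat \<Rightarrow> 'a) \<Rightarrow> bool" where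
  "defining_system A k p \<alpha> a \<longleftrightarrow>
     (\<forall>i j. 1 \<le> i \<and> i \<le> j \<and> j \<le> k \<and> (i, j) \<noteq> (1, k) \<longrightarrow> a i j \<in> piece A (entry_deg p i j)) \<and>
     (\<forall>i\<in>{1..k}. diff A (a i i) = \<zero>\<^bsub>A\<^esub> \<and> hclass A (a i i) = \<alpha> i) \<and>
     (\<forall>i j. 1 \<le> i \<and> i < j \<and> j \<le> k \<and> (i, j) \<noteq> (1, k) \<longrightarrow> diff A (a i j) = massey_sum A p a i j)"

text \<open>Massey products of \<open>\<alpha> 1, \<dots>, \<alpha> k\<close> with \<open>\<alpha> i\<close> homogeneous of degree \<open>p i\<close>, for \<open>k \<ge> 2\<close>.
  The degrees are arguments because the class zero does not determine its degree. The binary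
  product is defined separately: the general formula would change it by a sign.\<close>

definition massey_defined ::
    "('a, 'm) dga_scheme \<Rightarrow> nat \<Rightarrow> (nat \<Rightarrow> nat) \<Rightarrow> (nat \<Rightarrow> 'a set) \<Rightarrow> bool" where
  "massey_defined A k p \<alpha> \<longleftrightarrow> k = 2 \<or> (\<exists>a. defining_system A k p \<alpha> a)"

definition massey_product ::
    "('a, 'm) dga_scheme \<Rightarrow> nat \<Rightarrow> (nat \<Rightarrow> nat) \<Rightarrow> (nat \<Rightarrow> 'a set) \<Rightarrow> 'a set set" where
  "massey_product A k p \<alpha> =
     (if k = 2 then {\<alpha> 1 \<otimes>\<^bsub>homology A\<^esub> \<alpha> 2}
      else {hclass A (massey_sum A p a 1 k) | a. defining_system A k p \<alpha> a})"

definition massey_trivial :: "('a, 'm) dga_scheme \<Rightarrow> nat \<Rightarrow> bool" where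
  "massey_trivial A k \<longleftrightarrow>
     (\<forall>p \<alpha>. (\<forall>i\<in>{1..k}. p i > 0 \<and> \<alpha> i \<in> homology_piece A (p i)) \<longrightarrow>
        massey_defined A k p \<alpha> \<and> massey_product A k p \<alpha> \<subseteq> {\<zero>\<^bsub>homology A\<^esub>})"

definition satisfies_B :: "('a, 'm) dga_scheme \<Rightarrow> nat \<Rightarrow> bool" where
  "satisfies_B A r \<longleftrightarrow> (\<forall>k. 2 \<le> k \<and> k \<le> r \<longrightarrow> massey_trivial A k)"

section \<open>The Koszul complex\<close>

text \<open>The exterior algebra over \<open>R\<close> on \<open>e 0, \<dots>, e (n-1)\<close> with \<open>d (e i) = x i\<close>. An element is its
  coefficient function \<open>I \<mapsto> f I\<close> with respect to the basis elements
  \<open>e I = e i\<^sub>1 \<and> \<dots> \<and> e i\<^sub>p\<close>, where \<open>I = {i\<^sub>1 < \<dots> < i\<^sub>p}\<close> is a subset of \<open>{..<n}\<close>. Thus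
  \<open>e J \<and> e L = (-1)^(inversions J L) e (J \<union> L)\<close> for disjoint \<open>J\<close>, \<open>L\<close>, and \<open>d (e I)\<close> is the sum of
  \<open>(-1)^(card {j \<in> I. j < i}) x i e (I - {i})\<close> over \<open>i \<in> I\<close>.\<close>

definition inversions :: "nat set \<Rightarrow> nat set \<Rightarrow> nat" where
  "inversions J L = card {(j, l) \<in> J \<times> L. l < j}"

definition koszul :: "('a, 'm) ring_scheme \<Rightarrow> nat \<Rightarrow> (nat \<Rightarrow> 'a) \<Rightarrow> (nat set \<Rightarrow> 'a) dga" where
  "koszul R n x =
    \<lparr> carrier = Pow {..<n} \<rightarrow>\<^sub>E carrier R,
      mult = (\<lambda>f g. \<lambda>I\<in>Pow {..<n}.
        \<Oplus>\<^bsub>R\<^esub>J\<in>Pow I. signed R (inversions J (I - J)) (f J \<otimes>\<^bsub>R\<^esub> g (I - J))),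
      one = (\<lambda>I\<in>Pow {..<n}. if I = {} then \<one>\<^bsub>R\<^esub> else \<zero>\<^bsub>R\<^esub>),
      zero = (\<lambda>I\<in>Pow {..<n}. \<zero>\<^bsub>R\<^esub>),
      add = (\<lambda>f g. \<lambda>I\<in>Pow {..<n}. f I \<oplus>\<^bsub>R\<^esub> g I),
      piece = (\<lambda>p. {f \<in> Pow {..<n} \<rightarrow>\<^sub>E carrier R. \<forall>I\<in>Pow {..<n}. card I \<noteq> p \<longrightarrow> f I = \<zero>\<^bsub>R\<^esub>}),
      diff = (\<lambda>f. \<lambda>I\<in>Pow {..<n}.
        \<Oplus>\<^bsub>R\<^esub>i\<in>{..<n} - I. signed R (card {j \<in> I. j < i}) (x i \<otimes>\<^bsub>R\<^esub> f (insert i I))) \<rparr>"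

section \<open>Polynomial rings and monomial ideals\<close>

text \<open>The variables are indexed by \<open>0, \<dots>, n-1\<close>.\<close>

type_synonym 'k pol = "(nat \<Rightarrow>\<^sub>0 nat) \<Rightarrow>\<^sub>0 'k"

definition pol_ring :: "nat \<Rightarrow> 'k::field pol ring" where
  "pol_ring n = \<lparr> carrier = {f. \<forall>m\<in>Poly_Mapping.keys f. Poly_Mapping.keys m \<subseteq> {..<n}},
     mult = (*), one = 1, zero = 0, add = (+) \<rparr>"

definition mon :: "(nat \<Rightarrow>\<^sub>0 nat) \<Rightarrow> 'k::field pol" where
  "mon m = Poly_Mapping.single m 1"

definition var :: "nat \<Rightarrow> 'k::field pol" where
  "var i = mon (Poly_Mapping.single i 1)"

definition monomial_ideal :: "nat \<Rightarrow> 'k::field pol set \<Rightarrow> bool" where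
  "monomial_ideal n \<aa> \<longleftrightarrow>
     (\<exists>M. (\<forall>m\<in>M. Poly_Mapping.keys m \<subseteq> {..<n}) \<and> \<aa> = Idl\<^bsub>pol_ring n\<^esub> (mon ` M))"

definition quot_ring :: "nat \<Rightarrow> 'k::field pol set \<Rightarrow> 'k pol set ring" where
  "quot_ring n \<aa> = pol_ring n Quot \<aa>"

definition quot_class :: "nat \<Rightarrow> 'k::field pol set \<Rightarrow> 'k pol \<Rightarrow> 'k pol set" where
  "quot_class n \<aa> f = \<aa> +>\<^bsub>pol_ring n\<^esub> f"

definition koszul_quot :: "nat \<Rightarrow> 'k::field pol set \<Rightarrow> (nat set \<Rightarrow> 'k pol set) dga" where
  "koszul_quot n \<aa> = koszul (quot_ring n \<aa>) n (\<lambda>i. quot_class n \<aa> (var i))"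

definition golod :: "nat \<Rightarrow> 'k::field pol set \<Rightarrow> bool" where
  "golod n \<aa> \<longleftrightarrow> (\<forall>k\<ge>2. massey_trivial (koszul_quot n \<aa>) k)"

section \<open>Castelnuovo-Mumford regularity\<close>

definition total_deg :: "(nat \<Rightarrow>\<^sub>0 nat) \<Rightarrow> nat" where
  "total_deg m = (\<Sum>i\<in>Poly_Mapping.keys m. Poly_Mapping.lookup m i)"

text \<open>The degree is an integer; zero is homogeneous of every degree.\<close>

definition homogeneous :: "int \<Rightarrow> 'k::field pol \<Rightarrow> bool" where
  "homogeneous d f \<longleftrightarrow> (\<forall>m\<in>Poly_Mapping.keys f. int (total_deg m) = d)"

text \<open>Data of a complex \<open>\<dots> \<rightarrow> F 2 \<rightarrow> F 1 \<rightarrow> F 0 \<rightarrow> S/\<aa> \<rightarrow> 0\<close> with \<open>S = pol_ring n\<close>: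
  \<open>F i\<close> is free on \<open>rank i\<close> generators, generator \<open>c < rank i\<close> having degree \<open>gdeg i c\<close>;
  \<open>dmat i c b\<close> is the entry in row \<open>c\<close> and column \<open>b\<close> of the matrix of \<open>F (i+1) \<rightarrow> F i\<close>;
  \<open>aug c\<close> is the image in \<open>S/\<aa>\<close> of generator \<open>c\<close> of \<open>F 0\<close>.\<close>

record (overloaded) 'k resolution =
  rank :: "nat \<Rightarrow> nat"
  gdeg :: "nat \<Rightarrow> nat \<Rightarrow> int"
  dmat :: "nat \<Rightarrow> nat \<Rightarrow> nat \<Rightarrow> 'k pol"
  aug :: "nat \<Rightarrow> 'k pol set"

definition free_mod :: "nat \<Rightarrow> 'k::field resolution \<Rightarrow> nat \<Rightarrow> (nat \<Rightarrow> 'k pol) set" where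
  "free_mod n F i = {..<rank F i} \<rightarrow>\<^sub>E carrier (pol_ring n)"

definition res_map :: "'k::field resolution \<Rightarrow> nat \<Rightarrow> (nat \<Rightarrow> 'k pol) \<Rightarrow> (nat \<Rightarrow> 'k pol)" where
  "res_map F i v = (\<lambda>c\<in>{..<rank F i}. \<Sum>b<rank F (i + 1). dmat F i c b * v b)"

definition res_zero :: "'k::field resolution \<Rightarrow> nat \<Rightarrow> (nat \<Rightarrow> 'k pol)" where
  "res_zero F i = (\<lambda>c\<in>{..<rank F i}. 0)"

definition res_aug ::
    "nat \<Rightarrow> 'k::field pol set \<Rightarrow> 'k resolution \<Rightarrow> (nat \<Rightarrow> 'k pol) \<Rightarrow> 'k pol set" where
  "res_aug n \<aa> F v =
     (\<Oplus>\<^bsub>quot_ring n \<aa>\<^esub>c\<in>{..<rank F 0}. quot_class n \<aa> (v c) \<otimes>\<^bsub>quot_ring n \<aa>\<^esub> aug F c)"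

definition graded_free_resolution :: "nat \<Rightarrow> 'k::field pol set \<Rightarrow> 'k resolution \<Rightarrow> bool" where
  "graded_free_resolution n \<aa> F \<longleftrightarrow>
     (\<forall>c<rank F 0. \<exists>f\<in>carrier (pol_ring n). homogeneous (gdeg F 0 c) f \<and> aug F c = quot_class n \<aa> f) \<and>
     (\<forall>i. \<forall>c<rank F i. \<forall>b<rank F (i + 1).
        dmat F i c b \<in> carrier (pol_ring n) \<and>
        homogeneous (gdeg F (i + 1) b - gdeg F i c) (dmat F i c b)) \<and>
     res_aug n \<aa> F ` free_mod n F 0 = carrier (quot_ring n \<aa>) \<and>
     {v \<in> free_mod n F 0. res_aug n \<aa> F v = \<zero>\<^bsub>quot_ring n \<aa>\<^esub>} = res_map F 0 ` free_mod n F 1 \<and>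
     (\<forall>i. {v \<in> free_mod n F (i + 1). res_map F i v = res_zero F i} =
        res_map F (i + 1) ` free_mod n F (i + 2))"

definition minimal_graded_free_resolution :: "nat \<Rightarrow> 'k::field pol set \<Rightarrow> 'k resolution \<Rightarrow> bool" where
  "minimal_graded_free_resolution n \<aa> F \<longleftrightarrow>
     graded_free_resolution n \<aa> F \<and>
     (\<forall>i. \<forall>c<rank F i. \<forall>b<rank F (i + 1). dmat F i c b \<in> Idl\<^bsub>pol_ring n\<^esub> (var ` {..<n}))"

text \<open>The regularity of \<open>S/\<aa>\<close> is the largest \<open>j - i\<close> such that a generator of degree \<open>j\<close> occurs in
  homological degree \<open>i\<close> of the minimal graded free resolution. For homogeneous \<open>\<aa>\<close> such a
  resolution exists and is unique up to isomorphism, so the infimum below is over one value. The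
  supremum is a maximum unless \<open>\<aa> = S\<close>, in which case it is \<open>-\<infinity>\<close>.\<close>

definition regularity :: "nat \<Rightarrow> 'k::field pol set \<Rightarrow> ereal" where
  "regularity n \<aa> =
     (INF F \<in> {F. minimal_graded_free_resolution n \<aa> F}.
        SUP (i, c) \<in> {(i, c). c < rank F i}. ereal (of_int (gdeg F i c - int i)))"

end

theory Submission
  imports Defs
begin

text \<open>
  Represent \<open>K\<^sub>R\<close> by the \<open>\<nat>\<^sup>n\<close>-graded algebra \<open>C\<close> on the basis \<open>x\<^sup>m e\<^sub>I\<close> with \<open>x\<^sup>m\<close> outside \<open>\<aa>\<close>, and
  argue by induction on \<open>k\<close>, where \<open>k > r\<close>. As all shorter Massey products vanish, a multihomogeneous
  section \<open>h\<close> of the differential on boundaries completes every word \<open>z\<^sub>1 \<dots> z\<^sub>k\<close> of cycles to a canonical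
  defining system; its Massey element \<open>\<theta>(z\<^sub>1 \<dots> z\<^sub>k)\<close> is multilinear, and modulo boundaries it
  represents the Massey product, depends only on the classes of the \<open>z\<^sub>i\<close>, and vanishes on shuffles
  by graded commutativity. Hence if \<open>\<theta>\<close> vanishes on all words starting with the letter \<open>\<alpha>\<close>, it
  vanishes on all words containing \<open>\<alpha>\<close>.

  It suffices to treat letters of multidegrees \<open>u\<^sub>1, \<dots>, u\<^sub>k\<close> and homological degrees \<open>p\<^sub>1, \<dots>, p\<^sub>k\<close>.
  If two multidegrees share a variable \<open>v\<close>, project away the contractible part of \<open>C\<close> in which
  multiplication by \<open>x\<^sub>v\<close> is not zero; what remains in positive \<open>v\<close>-degree has zero products. If some
  \<open>|u\<^sub>i| - p\<^sub>i \<le> 1\<close>, the letter is a sum of products \<open>d(e\<^sub>V) e\<^sub>V'\<close> with \<open>x\<^sub>v x\<^sub>v' \<in> \<aa>\<close> for \<open>v \<in> V\<close>,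
  \<open>v' \<in> V'\<close>, and a Mayer--Vietoris argument splits its neighbour into cycles that extend over \<open>V\<close> or over
  \<open>V'\<close>, for which an explicit defining system gives a boundary. If all \<open>|u\<^sub>i| - p\<^sub>i \<ge> 2\<close>, then \<open>\<theta>\<close> is a
  cycle of homological degree \<open>P\<close> and internal degree at least \<open>P + k + 2 > P + reg R\<close>, so it bounds
  because \<open>Tor\<^sub>P(R, S/(x\<^sub>1, \<dots>, x\<^sub>n))\<close> vanishes there.
\<close>

section \<open>Words and partitions into blocks\<close>

text \<open>Massey products are sets of classes and cannot be added, so they cannot be split along a
  decomposition of a letter. Fixing one additive section \<open>h\<close> repairs this: the
  canonical system is determined by the word, and \<theta> is additive in each letter. The price is
  a comparison with arbitrary systems. Such a system is a sum over partitions into blocks, and every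
  partition but the finest yields a word of fewer than k letters, whose \<theta> bounds by
  induction. Products of two letters must bound beforehand, both to start the canonical systems and
  for the Mayer-Vietoris splitting; this is the 2 in the maximum. The other constant is a count:
  \<theta> of letters of homological degrees p_i has degree P = sum p_i + k - 2, and if each letter
  has internal degree at least p_i + 2, then \<theta> has internal degree at least sum p_i + 2k = P
  + k + 2. Letters just below this bound can be written down: a cycle with squarefree multidegree
  and internal degree p + 1 is a locally constant function on a graph of variables.\<close>

definition sg :: "nat \<Rightarrow> 'x::ab_group_add \<Rightarrow> 'x" where
  "sg k x = (if even k then x else - x)"

lemma sg_add_right: "sg k (x + y) = sg k x + sg k y"
  by (simp add: sg_def)

lemma sg_0 [simp]: "sg k 0 = 0" "sg 0 x = x"
  by (simp_all add: sg_def)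

lemma sg_minus: "sg k (- x) = - sg k x"
  by (simp add: sg_def)

lemma sg_sg: "sg j (sg k x) = sg (j + k) x"
  by (simp add: sg_def)

lemma sg_cong: "even j = even k \<Longrightarrow> sg j x = sg k x"
  by (simp add: sg_def)

lemma sg_Suc: "sg (Suc k) x = - sg k x"
  by (simp add: sg_def)

lemma sg_double [simp]: "sg k (sg k x) = x"
  by (simp add: sg_def)

lemma sg_sum: "sg k (sum f A) = (\<Sum>i\<in>A. sg k (f i))"
  by (simp add: sg_def sum_negf)

definition splits :: "('b list \<Rightarrow> 'b list \<Rightarrow> 'x::comm_monoid_add) \<Rightarrow> 'b list \<Rightarrow> 'x" where
  "splits G w = (\<Sum>m\<in>{1..<length w}. G (take m w) (drop m w))"

lemma splits_Cons:
  assumes "w \<noteq> []"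
  shows "splits G (x # w) = G [x] w + splits (\<lambda>u. G (x # u)) w"
proof -
  have "splits G (x # w) = (\<Sum>m\<in>{0..<length w}. G (take (Suc m) (x # w)) (drop (Suc m) (x # w)))"
    unfolding splits_def using sum.shift_bounds_Suc_ivl[of "\<lambda>m. G (take m (x # w)) (drop m (x # w))" 0 "length w"]
    by simp
  also have "\<dots> = G [x] w + (\<Sum>m\<in>{1..<length w}. G (x # take m w) (drop m w))"
    using assms by (simp add: sum.atLeast_Suc_lessThan)
  finally show ?thesis by (simp add: splits_def)
qed

lemma splits_short: "length w \<le> 1 \<Longrightarrow> splits G w = 0"
  by (simp add: splits_def)

text \<open>Deconcatenation is compatible with shuffles only when empty parts are allowed. For
  summands that vanish on empty words, such as those built from \<open>gam\<close>, both sums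
  agree.\<close>

definition all_splits :: "('b list \<Rightarrow> 'b list \<Rightarrow> 'x::comm_monoid_add) \<Rightarrow> 'b list \<Rightarrow> 'x" where
  "all_splits G w = (\<Sum>m\<le>length w. G (take m w) (drop m w))"

lemma all_splits_Cons: "all_splits G (x # w) = G [] (x # w) + all_splits (\<lambda>u. G (x # u)) w"
  unfolding all_splits_def list.size(4) add_0_right add_Suc_right by (subst sum.atMost_Suc_shift) simp

lemma splits_eq_all_splits:
  assumes "\<And>w. G [] w = 0" "\<And>w. G w [] = 0"
  shows "splits G w = all_splits G w"
proof -
  have "{..length w} = insert 0 (insert (length w) {1..<length w})" by auto
  then have "all_splits G w = (\<Sum>m\<in>insert 0 (insert (length w) {1..<length w}). G (take m w) (drop m w))"
    by (simp add: all_splits_def)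
  also have "\<dots> = splits G w" unfolding splits_def
    by (rule sum.mono_neutral_right) (auto simp: assms)
  finally show ?thesis by simp
qed

text \<open>The sum of \<open>F [c i\<^sub>1 j\<^sub>1, \<dots>, c i\<^sub>q j\<^sub>q]\<close> over all partitions of \<open>{i..j}\<close> into consecutive
  intervals \<open>{i\<^sub>1..j\<^sub>1}, \<dots>, {i\<^sub>q..j\<^sub>q}\<close>.\<close>

function block_sum :: "(nat \<Rightarrow> nat \<Rightarrow> 'b) \<Rightarrow> ('b list \<Rightarrow> 'x::comm_monoid_add) \<Rightarrow> nat \<Rightarrow> nat \<Rightarrow> 'x" where
  "block_sum c F i j = F [c i j] + (\<Sum>v\<in>{i..<j}. block_sum c (\<lambda>w. F (c i v # w)) (Suc v) j)"
  by auto
termination by (relation "measure (\<lambda>(c, F, i, j). j - i)") auto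

declare block_sum.simps [simp del]

lemma block_sum_self [simp]: "block_sum c F i i = F [c i i]"
  by (subst block_sum.simps) simp

text \<open>Parametricity of the recursion in its summands. With equality as \<open>R\<close> it is
  a congruence rule; with a relation that ignores its second argument it keeps a block sum inside a
  set closed under addition.\<close>

lemma block_sum_rel:
  fixes c :: "nat \<Rightarrow> nat \<Rightarrow> 'b"
  assumes "i \<le> j"
    and "\<And>w. w \<noteq> [] \<Longrightarrow> set w \<subseteq> {c i' j' | i' j'. i \<le> i' \<and> i' \<le> j' \<and> j' \<le> j} \<Longrightarrow>
           length w \<le> Suc j - i \<Longrightarrow> R (F w) (F' w)"
    and "\<And>x x' y y'. R x x' \<Longrightarrow> R y y' \<Longrightarrow> R (x + y) (x' + y')" and "R 0 0"
  shows "R (block_sum c F i j) (block_sum c F' i j)"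
  using assms(1,2)
proof (induction "j - i" arbitrary: i F F' rule: less_induct)
  case less
  have *: "R (sum f A) (sum g A)" if "finite A" "\<And>x. x \<in> A \<Longrightarrow> R (f x) (g x)" for f g and A :: "nat set"
    using that by (induction A rule: finite_induct) (auto intro: assms(3,4))
  have "R (F [c i j]) (F' [c i j])"
    using less.prems(1) by (intro less.prems(2)) auto
  moreover have "R (\<Sum>v\<in>{i..<j}. block_sum c (\<lambda>w. F (c i v # w)) (Suc v) j)
      (\<Sum>v\<in>{i..<j}. block_sum c (\<lambda>w. F' (c i v # w)) (Suc v) j)"
  proof (rule *)
    fix v assume v: "v \<in> {i..<j}"
    show "R (block_sum c (\<lambda>w. F (c i v # w)) (Suc v) j) (block_sum c (\<lambda>w. F' (c i v # w)) (Suc v) j)"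
    proof (rule less.hyps)
      fix w :: "'b list"
      assume w: "set w \<subseteq> {c i' j' | i' j'. Suc v \<le> i' \<and> i' \<le> j' \<and> j' \<le> j}"
        "length w \<le> Suc j - Suc v"
      have "set w \<subseteq> {c i' j' | i' j'. i \<le> i' \<and> i' \<le> j' \<and> j' \<le> j}"
        by (rule order_trans[OF w(1)]) (use v in auto, metis Suc_leD le_trans)
      moreover have "c i v \<in> {c i' j' | i' j'. i \<le> i' \<and> i' \<le> j' \<and> j' \<le> j}"
        using v by (intro CollectI exI[of _ i] exI[of _ v]) auto
      ultimately show "R (F (c i v # w)) (F' (c i v # w))"
        using v w(2) by (intro less.prems(2)) auto
    qed (use v in auto)
  qed simp
  ultimately show ?case
    by (subst (1 2) block_sum.simps) (rule assms(3))
qed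

lemma block_sum_cong:
  assumes "i \<le> j"
    and "\<And>w. w \<noteq> [] \<Longrightarrow> set w \<subseteq> {c i' j' | i' j'. i \<le> i' \<and> i' \<le> j' \<and> j' \<le> j} \<Longrightarrow>
           length w \<le> Suc j - i \<Longrightarrow> F w = F' w"
  shows "block_sum c F i j = block_sum c F' i j"
  by (rule block_sum_rel[where R = "(=)"]) (use assms in auto)

lemma block_sum_cong_blocks:
  assumes "i \<le> j" and "\<And>i' j'. i \<le> i' \<Longrightarrow> i' \<le> j' \<Longrightarrow> j' \<le> j \<Longrightarrow> c i' j' = c' i' j'"
  shows "block_sum c F i j = block_sum c' F i j"
  using assms
proof (induction "j - i" arbitrary: i F rule: less_induct)
  case less
  have "(\<Sum>v\<in>{i..<j}. block_sum c (\<lambda>w. F (c i v # w)) (Suc v) j) =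
        (\<Sum>v\<in>{i..<j}. block_sum c' (\<lambda>w. F (c' i v # w)) (Suc v) j)"
  proof (rule sum.cong[OF refl])
    fix v assume v: "v \<in> {i..<j}"
    then have "c i v = c' i v" using less.prems by auto
    moreover have "block_sum c (\<lambda>w. F (c i v # w)) (Suc v) j = block_sum c' (\<lambda>w. F (c i v # w)) (Suc v) j"
      using v less.prems by (intro less.hyps) auto
    ultimately show "block_sum c (\<lambda>w. F (c i v # w)) (Suc v) j = block_sum c' (\<lambda>w. F (c' i v # w)) (Suc v) j"
      by simp
  qed
  moreover have "c i j = c' i j" using less.prems by auto
  ultimately show ?case by (subst (1 2) block_sum.simps) simp
qed

lemma block_sum_add:
  "block_sum c (\<lambda>w. F w + F' w) i j = block_sum c F i j + block_sum c F' i j"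
proof (induction "j - i" arbitrary: i F F' rule: less_induct)
  case less
  have "(\<Sum>v\<in>{i..<j}. block_sum c (\<lambda>w. F (c i v # w) + F' (c i v # w)) (Suc v) j) =
     (\<Sum>v\<in>{i..<j}. block_sum c (\<lambda>w. F (c i v # w)) (Suc v) j + block_sum c (\<lambda>w. F' (c i v # w)) (Suc v) j)"
    by (intro sum.cong refl less.hyps) auto
  then show ?case
    by (subst (1 2 3) block_sum.simps) (simp add: sum.distrib algebra_simps)
qed

lemma block_sum_hom:
  assumes "\<And>x y. f (x + y) = f x + f y" and "f 0 = 0"
  shows "f (block_sum c F i j) = block_sum c (\<lambda>w. f (F w)) i j"
proof (induction "j - i" arbitrary: i F rule: less_induct)
  case less
  have s: "f (sum g A) = (\<Sum>x\<in>A. f (g x))" for g and A :: "nat set"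
    by (induction A rule: infinite_finite_induct) (auto simp: assms)
  have "(\<Sum>v\<in>{i..<j}. f (block_sum c (\<lambda>w. F (c i v # w)) (Suc v) j)) =
     (\<Sum>v\<in>{i..<j}. block_sum c (\<lambda>w. f (F (c i v # w))) (Suc v) j)"
    by (intro sum.cong refl less.hyps) auto
  then show ?case
    by (subst (1 2) block_sum.simps) (simp add: assms s)
qed

lemma sum_triangle_swap:
  fixes f :: "nat \<Rightarrow> nat \<Rightarrow> 'x::comm_monoid_add"
  shows "(\<Sum>v\<in>{i..<j}. \<Sum>v'\<in>{Suc v..<j}. f v v') = (\<Sum>v'\<in>{i..<j}. \<Sum>v\<in>{i..<v'}. f v v')"
proof -
  have "(\<Sum>v\<in>{i..<j}. \<Sum>v'\<in>{Suc v..<j}. f v v') = (\<Sum>v\<in>{i..<j}. \<Sum>v'\<in>{v' \<in> {i..<j}. v < v'}. f v v')"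
    by (intro sum.cong) auto
  also have "\<dots> = (\<Sum>v'\<in>{i..<j}. \<Sum>v\<in>{v \<in> {i..<j}. v < v'}. f v v')"
    by (rule sum.swap_restrict) auto
  also have "\<dots> = (\<Sum>v'\<in>{i..<j}. \<Sum>v\<in>{i..<v'}. f v v')"
    by (intro sum.cong) auto
  finally show ?thesis .
qed

text \<open>A partition of \<open>{i..j}\<close> with a marked gap between two consecutive blocks is
  a cut point v with a partition on either side. This turns cuts of words into the sum over v that
  defines a Massey element.\<close>

lemma block_sum_splits:
  assumes "i \<le> j"
  shows "block_sum c (splits G) i j = (\<Sum>v\<in>{i..<j}. block_sum c (\<lambda>u. block_sum c (G u) (Suc v) j) i v)"
  using assms
proof (induction "j - i" arbitrary: i G rule: less_induct)
  case less
  have 1: "block_sum c (\<lambda>w. splits G (c i v # w)) (Suc v) j =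
      block_sum c (G [c i v]) (Suc v) j +
      (\<Sum>v'\<in>{Suc v..<j}. block_sum c (\<lambda>u. block_sum c (G (c i v # u)) (Suc v') j) (Suc v) v')"
    if v: "v \<in> {i..<j}" for v
  proof -
    have "block_sum c (\<lambda>w. splits G (c i v # w)) (Suc v) j =
        block_sum c (\<lambda>w. G [c i v] w + splits (\<lambda>u. G (c i v # u)) w) (Suc v) j"
      using v by (intro block_sum_cong splits_Cons) auto
    also have "\<dots> = block_sum c (G [c i v]) (Suc v) j + block_sum c (splits (\<lambda>u. G (c i v # u))) (Suc v) j"
      by (rule block_sum_add)
    also have "block_sum c (splits (\<lambda>u. G (c i v # u))) (Suc v) j =
        (\<Sum>v'\<in>{Suc v..<j}. block_sum c (\<lambda>u. block_sum c (G (c i v # u)) (Suc v') j) (Suc v) v')"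
      using v by (intro less.hyps) auto
    finally show ?thesis .
  qed
  have "block_sum c (splits G) i j = (\<Sum>v\<in>{i..<j}. block_sum c (\<lambda>w. splits G (c i v # w)) (Suc v) j)"
    by (subst block_sum.simps) (simp add: splits_short)
  also have "\<dots> = (\<Sum>v\<in>{i..<j}. block_sum c (G [c i v]) (Suc v) j) +
      (\<Sum>v\<in>{i..<j}. \<Sum>v'\<in>{Suc v..<j}. block_sum c (\<lambda>u. block_sum c (G (c i v # u)) (Suc v') j) (Suc v) v')"
    using 1 by (simp add: sum.distrib)
  \<comment> \<open>With the cut v' as outer index, the inner terms are the recursion of the left
    block sum, sorted by the end v of its first block.\<close>
  also have "\<dots> = (\<Sum>v'\<in>{i..<j}. block_sum c (G [c i v']) (Suc v') j +
      (\<Sum>v\<in>{i..<v'}. block_sum c (\<lambda>u. block_sum c (G (c i v # u)) (Suc v') j) (Suc v) v'))"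
    by (simp only: sum_triangle_swap sum.distrib)
  also have "\<dots> = (\<Sum>v\<in>{i..<j}. block_sum c (\<lambda>u. block_sum c (G u) (Suc v) j) i v)"
    by (intro sum.cong refl, subst (3) block_sum.simps) simp
  finally show ?case .
qed

text \<open>Only the partition into singletons has as many blocks as there are elements; every other
  one gives a shorter word, whose value lies in \<open>D\<close> by hypothesis.\<close>

lemma block_sum_full_length:
  fixes c :: "nat \<Rightarrow> nat \<Rightarrow> 'b" and F :: "'b list \<Rightarrow> 'x::ab_group_add"
  assumes "i \<le> j" and D: "0 \<in> D" "\<And>x y. x \<in> D \<Longrightarrow> y \<in> D \<Longrightarrow> x + y \<in> D"
    and "\<And>w. w \<noteq> [] \<Longrightarrow> set w \<subseteq> {c i' j' | i' j'. i \<le> i' \<and> i' \<le> j' \<and> j' \<le> j} \<Longrightarrow>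
           length w < Suc j - i \<Longrightarrow> F w \<in> D"
  shows "block_sum c F i j - F (map (\<lambda>v. c v v) [i..<Suc j]) \<in> D"
  using assms(1,4)
proof (induction "j - i" arbitrary: i F rule: less_induct)
  case less
  show ?case
  proof (cases "i = j")
    case True
    then show ?thesis using D by simp
  next
    case False
    with less.prems have ij: "i < j" by simp
    let ?B = "\<lambda>v. block_sum c (\<lambda>w. F (c i v # w)) (Suc v) j"
    have sub: "set w \<subseteq> {c i' j' | i' j'. i \<le> i' \<and> i' \<le> j' \<and> j' \<le> j}"
      if "set w \<subseteq> {c i' j' | i' j'. Suc v \<le> i' \<and> i' \<le> j' \<and> j' \<le> j}" "i \<le> v" for w v
      by (rule order_trans[OF that(1)]) (use that(2) in auto, metis Suc_leD le_trans)
    have mem: "c i v \<in> {c i' j' | i' j'. i \<le> i' \<and> i' \<le> j' \<and> j' \<le> j}" if "i \<le> v" "v \<le> j" for v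
      using that by (intro CollectI exI[of _ i] exI[of _ v]) auto
    have 1: "F [c i j] \<in> D"
      using ij mem[of j] by (intro less.prems) auto
    have 2: "?B i - F (c i i # map (\<lambda>v. c v v) [Suc i..<Suc j]) \<in> D"
    proof (rule less.hyps)
      fix w :: "'b list"
      assume w: "set w \<subseteq> {c i' j' | i' j'. Suc i \<le> i' \<and> i' \<le> j' \<and> j' \<le> j}" "length w < Suc j - Suc i"
      show "F (c i i # w) \<in> D"
        using ij w(2) sub[OF w(1)] mem[of i] by (intro less.prems) auto
    qed (use ij in auto)
    have 3: "(\<Sum>v\<in>{Suc i..<j}. ?B v) \<in> D"
    proof -
      have B: "?B v \<in> D" if v: "v \<in> {Suc i..<j}" for v
      proof (rule block_sum_rel[where R = "\<lambda>x _. x \<in> D" and F' = "\<lambda>_. 0"])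
        fix w :: "'b list"
        assume w: "set w \<subseteq> {c i' j' | i' j'. Suc v \<le> i' \<and> i' \<le> j' \<and> j' \<le> j}" "length w \<le> Suc j - Suc v"
        show "F (c i v # w) \<in> D"
          using v w(2) sub[OF w(1)] mem[of v] by (intro less.prems) auto
      qed (use v D in auto)
      have "sum ?B A \<in> D" if "finite A" "\<And>v. v \<in> A \<Longrightarrow> ?B v \<in> D" for A
        using that by (induction A rule: finite_induct) (auto intro: D)
      from this[of "{Suc i..<j}"] B show ?thesis by simp
    qed
    have "block_sum c F i j = F [c i j] + (?B i + (\<Sum>v\<in>{Suc i..<j}. ?B v))"
      by (subst block_sum.simps) (use ij in \<open>simp add: sum.atLeast_Suc_lessThan\<close>)
    then have "block_sum c F i j - F (map (\<lambda>v. c v v) [i..<Suc j]) =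
      F [c i j] + ((?B i - F (c i i # map (\<lambda>v. c v v) [Suc i..<Suc j])) + (\<Sum>v\<in>{Suc i..<j}. ?B v))"
      using ij by (simp add: upt_conv_Cons del: upt_Suc)
    then show ?thesis using 1 2 3 by (simp add: D)
  qed
qed

section \<open>Canonical defining systems\<close>

text \<open>Apart from commutativity and the value of \<open>bar\<close>, the identities hold on the
  whole type, so that computations need no side conditions on carriers. \<open>d_mul\<close> is the
  graded Leibniz rule, as \<open>bar\<close> is (-1)^(p+1) on \<open>G p\<close>. Elements of
  \<open>C\<close> are not assumed to be sums of homogeneous ones.\<close>

locale cdga =
  fixes C :: "'x::ab_group_add set"
    and mul :: "'x \<Rightarrow> 'x \<Rightarrow> 'x" (infixl "\<star>" 70)
    and d :: "'x \<Rightarrow> 'x"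
    and bar :: "'x \<Rightarrow> 'x"
    and G :: "nat \<Rightarrow> 'x set"
  assumes C_0: "0 \<in> C"
    and C_add: "x \<in> C \<Longrightarrow> y \<in> C \<Longrightarrow> x + y \<in> C"
    and C_neg: "x \<in> C \<Longrightarrow> - x \<in> C"
    and G_sub: "G p \<subseteq> C"
    and G_0: "0 \<in> G p"
    and G_add: "x \<in> G p \<Longrightarrow> y \<in> G p \<Longrightarrow> x + y \<in> G p"
    and G_neg: "x \<in> G p \<Longrightarrow> - x \<in> G p"
    and d_G: "x \<in> G (Suc p) \<Longrightarrow> d x \<in> G p"
    and mul_G: "x \<in> G p \<Longrightarrow> y \<in> G q \<Longrightarrow> x \<star> y \<in> G (p + q)"
    and mul_add_left: "(x + y) \<star> z = x \<star> z + y \<star> z"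
    and mul_add_right: "x \<star> (y + z) = x \<star> y + x \<star> z"
    and mul_assoc: "(x \<star> y) \<star> z = x \<star> (y \<star> z)"
    and mul_comm: "x \<in> G p \<Longrightarrow> y \<in> G q \<Longrightarrow> y \<star> x = sg (p * q) (x \<star> y)"
    and d_add: "d (x + y) = d x + d y"
    and d_d: "d (d x) = 0"
    and d_mul: "d (x \<star> y) = d x \<star> y - bar x \<star> d y"
    and bar_add: "bar (x + y) = bar x + bar y"
    and bar_bar: "bar (bar x) = x"
    and bar_d: "bar (d x) = - d (bar x)"
    and bar_mul: "bar (x \<star> y) = - (bar x \<star> bar y)"
    and bar_G: "x \<in> G p \<Longrightarrow> bar x = sg (Suc p) x"
begin

lemma mul_0 [simp]: "0 \<star> x = 0" "x \<star> 0 = 0"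
  using mul_add_left[of 0 0 x] mul_add_right[of x 0 0] by simp_all

lemma mul_neg [simp]: "- x \<star> y = - (x \<star> y)" "x \<star> - y = - (x \<star> y)"
  using mul_add_left[of x "- x" y] mul_add_right[of x y "- y"]
  by (simp_all add: eq_neg_iff_add_eq_0 add.commute)

lemma mul_sum_right: "x \<star> sum f A = (\<Sum>i\<in>A. x \<star> f i)"
  by (induction A rule: infinite_finite_induct) (auto simp: mul_add_right)

lemma mul_sg: "sg k x \<star> y = sg k (x \<star> y)" "x \<star> sg k y = sg k (x \<star> y)"
  by (simp_all add: sg_def)

lemma d_0 [simp]: "d 0 = 0"
  using d_add[of 0 0] by simp

lemma d_neg: "d (- x) = - d x"
  using d_add[of x "- x"] by (simp add: eq_neg_iff_add_eq_0 add.commute)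

lemma d_sum: "d (sum f A) = (\<Sum>i\<in>A. d (f i))"
  by (induction A rule: infinite_finite_induct) (auto simp: d_add)

lemma bar_0 [simp]: "bar 0 = 0"
  using bar_add[of 0 0] by simp

lemma bar_neg: "bar (- x) = - bar x"
  using bar_add[of x "- x"] by (simp add: eq_neg_iff_add_eq_0 add.commute)

lemma bar_G_mem: "x \<in> G p \<Longrightarrow> bar x \<in> G p"
  by (simp add: bar_G sg_def G_neg)

lemma G_sum: "(\<And>i. i \<in> A \<Longrightarrow> f i \<in> G p) \<Longrightarrow> sum f A \<in> G p"
  by (induction A rule: infinite_finite_induct) (auto intro: G_add G_0)

definition D :: "'x set" where "D = d ` C"

lemma D_0: "0 \<in> D"
  using C_0 d_0 unfolding D_def by (metis imageI)

lemma D_add: "x \<in> D \<Longrightarrow> y \<in> D \<Longrightarrow> x + y \<in> D"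
  unfolding D_def by (auto simp flip: d_add intro: C_add)

lemma D_neg: "x \<in> D \<Longrightarrow> - x \<in> D"
  unfolding D_def by (auto simp flip: d_neg intro: C_neg)

lemma D_neg_iff: "- x \<in> D \<longleftrightarrow> x \<in> D"
  using D_neg[of x] D_neg[of "- x"] by auto

lemma D_diff: "x \<in> D \<Longrightarrow> y \<in> D \<Longrightarrow> x - y \<in> D"
  using D_add[of x "- y"] D_neg by simp

lemma D_sg: "sg k x \<in> D \<longleftrightarrow> x \<in> D"
  by (simp add: sg_def D_neg_iff)

lemma D_sum: "(\<And>i. i \<in> A \<Longrightarrow> f i \<in> D) \<Longrightarrow> sum f A \<in> D"
  by (induction A rule: infinite_finite_induct) (auto intro: D_add D_0)

lemma D_d: "x \<in> G p \<Longrightarrow> d x \<in> D"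
  using G_sub unfolding D_def by auto

section \<open>Defining systems on the level of cycles\<close>

definition msum :: "(nat \<Rightarrow> nat \<Rightarrow> 'x) \<Rightarrow> nat \<Rightarrow> nat \<Rightarrow> 'x" where
  "msum a i j = (\<Sum>v\<in>{i..<j}. bar (a i v) \<star> a (Suc v) j)"

text \<open>For i = j the sum on the right is empty, so the same equation makes the diagonal entries
  cycles; their classes are left free.\<close>

definition system :: "nat \<Rightarrow> (nat \<Rightarrow> nat) \<Rightarrow> (nat \<Rightarrow> nat \<Rightarrow> 'x) \<Rightarrow> bool" where
  "system k p a \<longleftrightarrow>
     (\<forall>i j. 1 \<le> i \<and> i \<le> j \<and> j \<le> k \<and> (i, j) \<noteq> (1, k) \<longrightarrow>
        a i j \<in> G (entry_deg p i j) \<and> d (a i j) = msum a i j)"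

text \<open>Existence of systems is a separate matter: once this notion holds for all shorter
  lengths, canonical systems exist by \<open>good_trivial_systems\<close>. Length two fits in
  uniformly, since \<open>D\<close> is closed under signs.\<close>

definition trivial_systems :: "nat \<Rightarrow> bool" where
  "trivial_systems k \<longleftrightarrow> (\<forall>p a. (\<forall>i\<in>{1..k}. p i > 0) \<longrightarrow> system k p a \<longrightarrow> msum a 1 k \<in> D)"

definition letters :: "'x set" where
  "letters = {z. d z = 0 \<and> (\<exists>p>0. z \<in> G p)}"

text \<open>Given an operator \<open>h\<close> that inverts \<open>d\<close> on boundaries, \<open>gam h\<close> of a word of cycles is the entry
  belonging to that word in the canonical defining system, and \<open>th h\<close> of the word is the
  element \<open>\<theta>\<close> of which this entry is the image under \<open>h\<close>.\<close>

function gam :: "('x \<Rightarrow> 'x) \<Rightarrow> 'x list \<Rightarrow> 'x" where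
  "gam h w = (if length w \<le> 1 then sum_list w
     else h (\<Sum>m\<in>{1..<length w}. bar (gam h (take m w)) \<star> gam h (drop m w)))"
  by auto
termination by (relation "measure (\<lambda>(h, w). length w)") auto

declare gam.simps [simp del]

definition th :: "('x \<Rightarrow> 'x) \<Rightarrow> 'x list \<Rightarrow> 'x" where
  "th h = splits (\<lambda>u v. bar (gam h u) \<star> gam h v)"

lemma gam_Nil [simp]: "gam h [] = 0"
  by (simp add: gam.simps)

lemma gam_single [simp]: "gam h [z] = z"
  by (simp add: gam.simps)

lemma gam_long: "2 \<le> length w \<Longrightarrow> gam h w = h (th h w)"
  by (subst gam.simps) (simp add: th_def splits_def)

lemma th_single [simp]: "th h [z] = 0"
  by (simp add: th_def splits_short)

text \<open>That \<open>d\<close> undoes \<open>h\<close> is kept apart, in \<open>good\<close>: it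
  is required only at the elements \<theta> that occur, and the projected operators
  \<open>hv\<close> are shown to satisfy it only there.\<close>

definition homotopy_op :: "('x \<Rightarrow> 'x) \<Rightarrow> bool" where
  "homotopy_op h \<longleftrightarrow> (\<forall>x y. h (x + y) = h x + h y) \<and> (\<forall>p x. x \<in> G p \<longrightarrow> h x \<in> G (Suc p))"

lemma homotopy_op_0: "homotopy_op h \<Longrightarrow> h 0 = 0"
  unfolding homotopy_op_def by (metis add_cancel_right_right)

definition homogeneous_word :: "'x list \<Rightarrow> nat list \<Rightarrow> bool" where
  "homogeneous_word = list_all2 (\<lambda>z p. z \<in> G p \<and> d z = 0 \<and> 0 < p)"

text \<open>Degrees as in the bar construction, each letter raised by one. In these terms
  \<open>gam\<close> has degree \<open>sdeg\<close> - 1 and \<open>th\<close> has degree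
  \<open>sdeg\<close> - 2.\<close>

definition sdeg :: "nat list \<Rightarrow> nat" where "sdeg ps = sum_list (map Suc ps)"

lemma sdeg_append: "sdeg (ps @ qs) = sdeg ps + sdeg qs"
  by (simp add: sdeg_def)

lemma homogeneous_word_sdeg: "homogeneous_word w ps \<Longrightarrow> 2 * length w \<le> sdeg ps"
  unfolding homogeneous_word_def sdeg_def
  by (induction rule: list_all2_induct) auto

lemma homogeneous_word_take: "homogeneous_word w ps \<Longrightarrow> homogeneous_word (take m w) (take m ps)"
  and homogeneous_word_drop: "homogeneous_word w ps \<Longrightarrow> homogeneous_word (drop m w) (drop m ps)"
  and homogeneous_word_append: "homogeneous_word w ps \<Longrightarrow> homogeneous_word w' ps' \<Longrightarrow>
     homogeneous_word (w @ w') (ps @ ps')"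
  and homogeneous_word_length: "homogeneous_word w ps \<Longrightarrow> length w = length ps"
  unfolding homogeneous_word_def
  by (auto intro: list_all2_takeI list_all2_dropI list_all2_appendI dest: list_all2_lengthD)

lemma homogeneous_word_letters: "homogeneous_word w ps \<Longrightarrow> set w \<subseteq> letters"
  unfolding homogeneous_word_def letters_def by (induction rule: list_all2_induct) auto

lemma homogeneous_word_ex: "set w \<subseteq> letters \<Longrightarrow> \<exists>ps. homogeneous_word w ps"
  unfolding homogeneous_word_def by (induction w) (force simp: letters_def list_all2_Cons1)+

lemma th_gam_G:
  assumes h: "homotopy_op h"
  shows "homogeneous_word w ps \<Longrightarrow> w \<noteq> [] \<Longrightarrow> gam h w \<in> G (sdeg ps - 1) \<and> th h w \<in> G (sdeg ps - 2)"
proof (induction w arbitrary: ps rule: length_induct)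
  case (1 w)
  have th: "th h w \<in> G (sdeg ps - 2)"
    unfolding th_def splits_def
  proof (rule G_sum)
    fix m assume m: "m \<in> {1..<length w}"
    have t: "homogeneous_word (take m w) (take m ps)" "homogeneous_word (drop m w) (drop m ps)"
      using 1(2) by (auto intro: homogeneous_word_take homogeneous_word_drop)
    have "gam h (take m w) \<in> G (sdeg (take m ps) - 1)"
      using m by (intro 1(1)[rule_format, THEN conjunct1] t) auto
    moreover have "gam h (drop m w) \<in> G (sdeg (drop m ps) - 1)"
      using m by (intro 1(1)[rule_format, THEN conjunct1] t) auto
    ultimately have "bar (gam h (take m w)) \<star> gam h (drop m w) \<in> G (sdeg (take m ps) - 1 + (sdeg (drop m ps) - 1))"
      by (intro mul_G bar_G_mem)
    also have "sdeg (take m ps) - 1 + (sdeg (drop m ps) - 1) = sdeg ps - 2"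
      using homogeneous_word_sdeg[OF t(1)] homogeneous_word_sdeg[OF t(2)] m
        sdeg_append[of "take m ps" "drop m ps"] by auto
    finally show "bar (gam h (take m w)) \<star> gam h (drop m w) \<in> G (sdeg ps - 2)" .
  qed
  have "gam h w \<in> G (sdeg ps - 1)"
  proof (cases "2 \<le> length w")
    case True
    then have "gam h w \<in> G (Suc (sdeg ps - 2))"
      using th h by (simp add: gam_long homotopy_op_def)
    also have "Suc (sdeg ps - 2) = sdeg ps - 1"
      using True homogeneous_word_sdeg[OF 1(2)] by simp
    finally show ?thesis .
  next
    case False
    then obtain z where w: "w = [z]" using 1(3) by (cases w) (auto simp: Suc_le_eq)
    then obtain p where "ps = [p]" "z \<in> G p"
      using 1(2) by (auto simp: homogeneous_word_def list_all2_Cons1)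
    then show ?thesis by (simp add: w sdeg_def)
  qed
  with th show ?case by simp
qed

lemmas gam_G = th_gam_G[THEN conjunct1] and th_G = th_gam_G[THEN conjunct2]

lemma gam_C:
  assumes "homotopy_op h" "set w \<subseteq> letters"
  shows "gam h w \<in> C"
proof (cases "w = []")
  case False
  obtain ps where "homogeneous_word w ps" using homogeneous_word_ex[OF assms(2)] by blast
  then show ?thesis using gam_G[OF assms(1) _ False] G_sub by blast
qed (simp add: C_0)

text \<open>\<open>h\<close> produces defining systems for all words over \<open>L\<close> of length at most \<open>k\<close>.\<close>

definition good :: "'x set \<Rightarrow> nat \<Rightarrow> ('x \<Rightarrow> 'x) \<Rightarrow> bool" where
  "good L k h \<longleftrightarrow> L \<subseteq> letters \<and> homotopy_op h \<and>
     (\<forall>w. set w \<subseteq> L \<and> 2 \<le> length w \<and> length w < k \<longrightarrow> d (gam h w) = th h w)"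

lemma good_D:
  assumes "good L k h" "set w \<subseteq> L" "1 \<le> length w" "length w < k"
  shows "d (gam h w) = th h w" "th h w \<in> D"
proof -
  show 1: "d (gam h w) = th h w"
  proof (cases "length w = 1")
    case True
    then obtain z where "w = [z]" by (auto simp: length_Suc_conv)
    then show ?thesis using assms by (auto simp: good_def letters_def)
  next
    case False
    then show ?thesis using assms unfolding good_def by auto
  qed
  have "gam h w \<in> C" using assms by (intro gam_C) (auto simp: good_def)
  then show "th h w \<in> D" unfolding D_def 1[symmetric] by blast
qed

definition sub :: "'b list \<Rightarrow> nat \<Rightarrow> nat \<Rightarrow> 'b list" where
  "sub w i j = take (Suc j - i) (drop (i - 1) w)"

lemma length_sub: "1 \<le> i \<Longrightarrow> j \<le> length w \<Longrightarrow> length (sub w i j) = Suc j - i"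
  by (auto simp: sub_def)

lemma set_sub: "set (sub w i j) \<subseteq> set w"
  unfolding sub_def by (meson order_trans set_drop_subset set_take_subset)

lemma sub_self: "1 \<le> i \<Longrightarrow> i \<le> length w \<Longrightarrow> sub w i i = [w ! (i - 1)]"
  by (simp add: sub_def take_Suc hd_drop_conv_nth)

lemma sub_all: "length w = k \<Longrightarrow> sub w 1 k = w"
  by (simp add: sub_def)

lemma th_sub:
  assumes "1 \<le> i" "i \<le> j" "j \<le> length w"
  shows "th h (sub w i j) = msum (\<lambda>i j. gam h (sub w i j)) i j"
proof -
  have "(\<Sum>v\<in>{i..<j}. bar (gam h (sub w i v)) \<star> gam h (sub w (Suc v) j)) =
        (\<Sum>m\<in>{1..<Suc j - i}. bar (gam h (take m (sub w i j))) \<star> gam h (drop m (sub w i j)))"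
  proof (rule sum.reindex_bij_witness[where i = "\<lambda>m. i + m - 1" and j = "\<lambda>v. Suc v - i"])
    fix v assume v: "v \<in> {i..<j}"
    have "Suc v - i \<le> Suc j - i" using v by auto
    then have "take (Suc v - i) (sub w i j) = sub w i v"
      by (simp add: sub_def min_absorb1)
    moreover have "drop (Suc v - i) (sub w i j) = sub w (Suc v) j"
      using v assms by (simp add: sub_def drop_take)
    ultimately show "bar (gam h (take (Suc v - i) (sub w i j))) \<star> gam h (drop (Suc v - i) (sub w i j)) =
        bar (gam h (sub w i v)) \<star> gam h (sub w (Suc v) j)" by simp
  qed (use assms in auto)
  then show ?thesis
    using assms by (simp add: th_def splits_def msum_def length_sub)
qed

lemma sdeg_sub:
  assumes "1 \<le> i" "i \<le> j" "j \<le> length ps"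
  shows "sdeg (sub ps i j) - 1 = entry_deg (\<lambda>i. ps ! (i - 1)) i j"
proof -
  have "sdeg (sub ps i j) = (\<Sum>m = 0..<Suc j - i. Suc (ps ! (i - 1 + m)))"
    using assms by (simp add: sdeg_def sum_list_sum_nth sub_def min_absorb2)
  also have "\<dots> = (\<Sum>v = i..j. Suc (ps ! (v - 1)))"
    by (rule sum.reindex_bij_witness[where j = "\<lambda>m. i + m" and i = "\<lambda>v. v - i"]) (use assms in auto)
  also have "\<dots> = (\<Sum>v = i..j. ps ! (v - 1)) + (Suc j - i)"
    using sum.distrib[of "\<lambda>v. ps ! (v - 1)" "\<lambda>v. 1" "{i..j}"] by simp
  finally show ?thesis using assms by (simp add: entry_deg_def)
qed

lemma gam_system:
  assumes good: "good L k h" and w: "set w \<subseteq> L" "length w = k" and ps: "homogeneous_word w ps"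
  shows "system k (\<lambda>i. ps ! (i - 1)) (\<lambda>i j. gam h (sub w i j))"
proof -
  have "gam h (sub w i j) \<in> G (entry_deg (\<lambda>i. ps ! (i - 1)) i j) \<and>
      d (gam h (sub w i j)) = msum (\<lambda>i j. gam h (sub w i j)) i j"
    if ij: "1 \<le> i" "i \<le> j" "j \<le> k" "(i, j) \<noteq> (1, k)" for i j
  proof
    have len: "length (sub w i j) = Suc j - i" "length ps = k"
      using ij w homogeneous_word_length[OF ps] by (auto simp: length_sub)
    have "homogeneous_word (sub w i j) (sub ps i j)"
      unfolding sub_def by (intro homogeneous_word_take homogeneous_word_drop ps)
    then have "gam h (sub w i j) \<in> G (sdeg (sub ps i j) - 1)"
      using good len ij by (intro gam_G) (auto simp: good_def)
    then show "gam h (sub w i j) \<in> G (entry_deg (\<lambda>i. ps ! (i - 1)) i j)"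
      using ij len sdeg_sub[of i j ps] by simp
    have "d (gam h (sub w i j)) = th h (sub w i j)"
    proof (rule good_D[OF good])
      show "set (sub w i j) \<subseteq> L" using set_sub w by fastforce
    qed (use len ij in \<open>auto simp: less_diff_conv\<close>)
    then show "d (gam h (sub w i j)) = msum (\<lambda>i j. gam h (sub w i j)) i j"
      using ij w by (simp add: th_sub)
  qed
  then show ?thesis unfolding system_def by blast
qed

section \<open>Arbitrary systems compared with canonical ones\<close>

lemma entry_deg_split:
  assumes "i \<le> v" "v < j"
  shows "Suc (entry_deg p i v) + Suc (entry_deg p (Suc v) j) = Suc (entry_deg p i j)"
proof -
  have "{i..j} = {i..v} \<union> {Suc v..j}" using assms by auto
  then have "(\<Sum>v = i..j. p v) = (\<Sum>v = i..v. p v) + (\<Sum>v = Suc v..j. p v)"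
    by (simp add: sum.union_disjoint)
  then show ?thesis using assms by (simp add: entry_deg_def)
qed

lemma entry_deg_pos: "\<forall>i\<in>{1..k}. 0 < p i \<Longrightarrow> 1 \<le> i \<Longrightarrow> i \<le> j \<Longrightarrow> j \<le> k \<Longrightarrow> 0 < entry_deg p i j"
  unfolding entry_deg_def by (rule trans_less_add1, rule sum_pos) auto

lemma block_sum_gam_G:
  assumes h: "homotopy_op h" and "i \<le> j"
    and c: "\<And>i' j'. i \<le> i' \<Longrightarrow> i' \<le> j' \<Longrightarrow> j' \<le> j \<Longrightarrow>
      c i' j' \<in> G (entry_deg p i' j') \<and> d (c i' j') = 0 \<and> 0 < entry_deg p i' j'"
    and u: "homogeneous_word u us" and s: "sdeg us + Suc (entry_deg p i j) = Suc e"
  shows "block_sum c (\<lambda>w. gam h (u @ w)) i j \<in> G e"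
  using assms(2-)
proof (induction "j - i" arbitrary: i u us rule: less_induct)
  case less
  have "gam h (u @ [c i j]) \<in> G (sdeg (us @ [entry_deg p i j]) - 1)"
  proof (rule gam_G[OF h])
    show "homogeneous_word (u @ [c i j]) (us @ [entry_deg p i j])"
      using less.prems by (intro homogeneous_word_append) (auto simp: homogeneous_word_def)
  qed simp
  then have 1: "gam h (u @ [c i j]) \<in> G e"
    using less.prems(4) by (simp add: sdeg_append) (simp add: sdeg_def)
  have "block_sum c (\<lambda>w. gam h (u @ c i v # w)) (Suc v) j \<in> G e" if v: "v \<in> {i..<j}" for v
  proof -
    have "block_sum c (\<lambda>w. gam h ((u @ [c i v]) @ w)) (Suc v) j \<in> G e"
    proof (rule less.hyps)
      show "homogeneous_word (u @ [c i v]) (us @ [entry_deg p i v])"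
        using less.prems v by (intro homogeneous_word_append) (auto simp: homogeneous_word_def)
      show "sdeg (us @ [entry_deg p i v]) + Suc (entry_deg p (Suc v) j) = Suc e"
        using entry_deg_split[of i v j p] v less.prems(4) by (simp add: sdeg_append) (simp add: sdeg_def)
    qed (use v less.prems(2) in auto)
    then show ?thesis by simp
  qed
  with 1 show ?case by (subst block_sum.simps) (auto intro!: G_add G_sum)
qed

text \<open>Every defining system is a sum over partitions into blocks of values of \<open>gam\<close> at cycles
  attached to the blocks.\<close>

lemma system_blocks:
  assumes good: "good letters k h" and p: "\<forall>i\<in>{1..k}. 0 < p i" and a: "system k p a"
  shows "\<exists>c. \<forall>i j. 1 \<le> i \<and> i \<le> j \<and> j \<le> k \<and> (i, j) \<noteq> (1, k) \<and> j - i < N \<longrightarrow>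
     a i j = block_sum c (gam h) i j \<and> c i j \<in> G (entry_deg p i j) \<and> d (c i j) = 0"
proof (induction N)
  case 0
  then show ?case by simp
next
  case (Suc N)
  then obtain c where c: "\<And>i j. 1 \<le> i \<Longrightarrow> i \<le> j \<Longrightarrow> j \<le> k \<Longrightarrow> (i, j) \<noteq> (1, k) \<Longrightarrow> j - i < N \<Longrightarrow>
     a i j = block_sum c (gam h) i j \<and> c i j \<in> G (entry_deg p i j) \<and> d (c i j) = 0" by blast
  have h: "homotopy_op h" using good by (simp add: good_def)
  \<comment> \<open>The partitions into at least two blocks use only cycles already chosen, so the
    cycle of the new interval must be the remainder a i j - R i j.\<close>
  define R where "R i j = (\<Sum>v\<in>{i..<j}. block_sum c (\<lambda>w. gam h (c i v # w)) (Suc v) j)" for i j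
  define c' where "c' i j = (if j - i < N then c i j else a i j - R i j)" for i j
  have cl: "c i j \<in> letters"
    if "1 \<le> i" "i \<le> j" "j \<le> k" "(i, j) \<noteq> (1, k)" "j - i < N" for i j
    using c[OF that] entry_deg_pos[OF p that(1-3)] by (auto simp: letters_def)
  have "a i j = block_sum c' (gam h) i j \<and> c' i j \<in> G (entry_deg p i j) \<and> d (c' i j) = 0"
    if ij: "1 \<le> i" "i \<le> j" "j \<le> k" "(i, j) \<noteq> (1, k)" and N: "j - i < Suc N" for i j
  proof (cases "j - i < N")
    case True
    have "block_sum c' (gam h) i j = block_sum c (gam h) i j"
      by (rule block_sum_cong_blocks) (use ij True in \<open>auto simp: c'_def\<close>)
    then show ?thesis using c ij True by (simp add: c'_def)
  next
    case False
    have sm: "block_sum c' F i' j' = block_sum c F i' j'" if "i \<le> i'" "i' \<le> j'" "j' \<le> j" "j' - i' < N"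
      for F :: "'x list \<Rightarrow> 'x" and i' j'
      by (rule block_sum_cong_blocks) (use that in \<open>auto simp: c'_def\<close>)
    have civ: "c' i v = c i v" if "i \<le> v" "v < j" for v
      using that N by (auto simp: c'_def)
    have "(\<Sum>v\<in>{i..<j}. block_sum c' (\<lambda>w. gam h (c' i v # w)) (Suc v) j) = R i j"
      unfolding R_def by (rule sum.cong) (use N in \<open>auto simp: sm civ\<close>)
    then have 1: "block_sum c' (gam h) i j = a i j"
      by (subst block_sum.simps) (use False in \<open>simp add: c'_def\<close>)
    have RG: "R i j \<in> G (entry_deg p i j)"
      unfolding R_def
    proof (rule G_sum)
      fix v assume v: "v \<in> {i..<j}"
      have "block_sum c (\<lambda>w. gam h ([c i v] @ w)) (Suc v) j \<in> G (entry_deg p i j)"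
      proof (rule block_sum_gam_G[OF h, where p = p and us = "[entry_deg p i v]"])
        show "homogeneous_word [c i v] [entry_deg p i v]"
          using c[of i v] v ij N entry_deg_pos[OF p, of i v] by (auto simp: homogeneous_word_def)
        show "sdeg [entry_deg p i v] + Suc (entry_deg p (Suc v) j) = Suc (entry_deg p i j)"
          using entry_deg_split[of i v j p] v by (simp add: sdeg_def)
        fix i' j' assume "Suc v \<le> i'" "i' \<le> j'" "j' \<le> j"
        then show "c i' j' \<in> G (entry_deg p i' j') \<and> d (c i' j') = 0 \<and> 0 < entry_deg p i' j'"
          using c[of i' j'] ij v N entry_deg_pos[OF p, of i' j'] by auto
      qed (use v in auto)
      then show "block_sum c (\<lambda>w. gam h (c i v # w)) (Suc v) j \<in> G (entry_deg p i j)" by simp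
    qed
    \<comment> \<open>\<open>d\<close> turns \<open>gam\<close> into \<open>th\<close>, which cuts
      words of blocks; regrouping by cut points gives products of shorter entries, that is d (a i
      j). Hence the remainder is a cycle.\<close>
    have "d (R i j) = (\<Sum>v\<in>{i..<j}. block_sum c (\<lambda>w. d (gam h (c i v # w))) (Suc v) j)"
      unfolding R_def by (simp add: d_sum block_sum_hom[of d, OF d_add])
    also have "\<dots> = (\<Sum>v\<in>{i..<j}. block_sum c (\<lambda>w. th h (c i v # w)) (Suc v) j)"
    proof (intro sum.cong refl block_sum_cong)
      fix v and w :: "'x list"
      assume v: "v \<in> {i..<j}" and w: "w \<noteq> []" "length w \<le> Suc j - Suc v"
        "set w \<subseteq> {c i' j' |i' j'. Suc v \<le> i' \<and> i' \<le> j' \<and> j' \<le> j}"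
      have "set w \<subseteq> letters"
        by (rule order_trans[OF w(3)]) (use v ij N in \<open>auto intro!: cl\<close>)
      then show "d (gam h (c i v # w)) = th h (c i v # w)"
        using v ij N w cl[of i v] by (intro good_D[OF good]) auto
    qed auto
    also have "\<dots> = block_sum c (th h) i j"
      by (subst (2) block_sum.simps) simp
    also have "\<dots> = (\<Sum>v\<in>{i..<j}. block_sum c (\<lambda>u. block_sum c (\<lambda>w. bar (gam h u) \<star> gam h w) (Suc v) j) i v)"
      unfolding th_def by (rule block_sum_splits[OF ij(2)])
    also have "\<dots> = (\<Sum>v\<in>{i..<j}. bar (block_sum c (gam h) i v) \<star> block_sum c (gam h) (Suc v) j)"
    proof (rule sum.cong[OF refl])
      fix v
      have "block_sum c (\<lambda>w. bar (gam h u) \<star> gam h w) (Suc v) j = bar (gam h u) \<star> block_sum c (gam h) (Suc v) j" for u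
        by (rule block_sum_hom[symmetric]) (simp_all add: mul_add_right)
      then show "block_sum c (\<lambda>u. block_sum c (\<lambda>w. bar (gam h u) \<star> gam h w) (Suc v) j) i v =
          bar (block_sum c (gam h) i v) \<star> block_sum c (gam h) (Suc v) j"
        using block_sum_hom[of "\<lambda>x. bar x \<star> block_sum c (gam h) (Suc v) j" c "gam h" i v]
        by (simp add: bar_add mul_add_left)
    qed
    also have "\<dots> = msum a i j"
      unfolding msum_def by (intro sum.cong refl) (use c ij N in auto)
    also have "\<dots> = d (a i j)" using a ij unfolding system_def by auto
    finally have "d (c' i j) = 0" using False d_add[of "a i j" "- R i j"] by (simp add: c'_def d_neg)
    moreover have "a i j \<in> G (entry_deg p i j)" using a ij unfolding system_def by auto
    ultimately show ?thesis using 1 RG False G_add[OF _ G_neg, of "a i j" _ "R i j"] by (simp add: c'_def)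
  qed
  then show ?case by blast
qed

text \<open>The Massey element of an arbitrary system is a block sum of \<open>th\<close>. Words
  with fewer than k blocks contribute boundaries, so modulo \<open>D\<close> only the word of
  diagonal entries counts.\<close>

lemma msum_th_diag:
  assumes good: "good letters k h" and p: "\<forall>i\<in>{1..k}. 0 < p i" and a: "system k p a" and k: "2 \<le> k"
  shows "msum a 1 k - th h (map (\<lambda>i. a i i) [1..<Suc k]) \<in> D"
proof -
  obtain c0 where "\<forall>i j. 1 \<le> i \<and> i \<le> j \<and> j \<le> k \<and> (i, j) \<noteq> (1, k) \<and> j - i < Suc k \<longrightarrow>
     a i j = block_sum c0 (gam h) i j \<and> c0 i j \<in> G (entry_deg p i j) \<and> d (c0 i j) = 0"
    using system_blocks[OF good p a, of "Suc k"] by blast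
  then have c0: "\<And>i j. 1 \<le> i \<Longrightarrow> i \<le> j \<Longrightarrow> j \<le> k \<Longrightarrow> (i, j) \<noteq> (1, k) \<Longrightarrow>
     a i j = block_sum c0 (gam h) i j \<and> c0 i j \<in> G (entry_deg p i j) \<and> d (c0 i j) = 0"
    by (simp add: less_Suc_eq_le)
  \<comment> \<open>The pair (1, k) is not an entry of the system. The value 0 is harmless, because
    \<open>th\<close> of a one-letter word is 0.\<close>
  define c where "c i j = (if (i, j) = (1, k) then 0 else c0 i j)" for i j
  have c: "a i j = block_sum c (gam h) i j \<and> c i j \<in> G (entry_deg p i j) \<and> d (c i j) = 0"
    if "1 \<le> i" "i \<le> j" "j \<le> k" "(i, j) \<noteq> (1, k)" for i j
  proof -
    have "block_sum c (gam h) i j = block_sum c0 (gam h) i j"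
      by (rule block_sum_cong_blocks) (use that in \<open>auto simp: c_def\<close>)
    then show ?thesis using c0[OF that] that by (auto simp: c_def)
  qed
  have cl: "c i j \<in> letters" if "1 \<le> i" "i \<le> j" "j \<le> k" for i j
  proof (cases "(i, j) = (1, k)")
    case True
    then show ?thesis using G_0[of 1] by (auto simp: c_def letters_def)
  next
    case False
    then show ?thesis using c[OF that] entry_deg_pos[OF p that] by (auto simp: letters_def)
  qed
  have "msum a 1 k = (\<Sum>v\<in>{1..<k}. bar (block_sum c (gam h) 1 v) \<star> block_sum c (gam h) (Suc v) k)"
    unfolding msum_def by (intro sum.cong refl) (use c in auto)
  also have "\<dots> = (\<Sum>v\<in>{1..<k}. block_sum c (\<lambda>u. block_sum c (\<lambda>w. bar (gam h u) \<star> gam h w) (Suc v) k) 1 v)"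
  proof (rule sum.cong[OF refl])
    fix v
    have "block_sum c (\<lambda>w. bar (gam h u) \<star> gam h w) (Suc v) k = bar (gam h u) \<star> block_sum c (gam h) (Suc v) k" for u
      by (rule block_sum_hom[symmetric]) (simp_all add: mul_add_right)
    then show "bar (block_sum c (gam h) 1 v) \<star> block_sum c (gam h) (Suc v) k =
        block_sum c (\<lambda>u. block_sum c (\<lambda>w. bar (gam h u) \<star> gam h w) (Suc v) k) 1 v"
      using block_sum_hom[of "\<lambda>x. bar x \<star> block_sum c (gam h) (Suc v) k" c "gam h" 1 v]
      by (simp add: bar_add mul_add_left)
  qed
  also have "\<dots> = block_sum c (th h) 1 k"
    unfolding th_def using k by (intro block_sum_splits[symmetric]) auto
  finally have 1: "msum a 1 k = block_sum c (th h) 1 k" .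
  have 2: "block_sum c (th h) 1 k - th h (map (\<lambda>v. c v v) [1..<Suc k]) \<in> D"
  proof (rule block_sum_full_length)
    fix w assume w: "w \<noteq> []" "set w \<subseteq> {c i' j' |i' j'. 1 \<le> i' \<and> i' \<le> j' \<and> j' \<le> k}" "length w < Suc k - 1"
    have "set w \<subseteq> letters"
      by (rule order_trans[OF w(2)]) (use cl in auto)
    then show "th h w \<in> D"
      using w by (intro good_D(2)[OF good]) (auto simp: Suc_le_eq)
  qed (use k D_0 D_add in auto)
  have "map (\<lambda>v. c v v) [1..<Suc k] = map (\<lambda>i. a i i) [1..<Suc k]"
  proof (rule map_cong[OF refl])
    fix x assume "x \<in> set [1..<Suc k]"
    then show "c x x = a x x" using c[of x x] k by auto
  qed
  with 1 2 show ?thesis by (simp only:)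
qed

text \<open>By induction on the word: its proper subwords already form a system, triviality of
  shorter Massey products makes its \<open>th\<close> bound, and then \<open>h\<close> supplies the
  next entry.\<close>

lemma good_trivial_systems:
  assumes L: "L \<subseteq> letters" and h: "homotopy_op h"
    and t: "\<And>j. 2 \<le> j \<Longrightarrow> j < k \<Longrightarrow> trivial_systems j"
    and dh: "\<And>w. set w \<subseteq> L \<Longrightarrow> 2 \<le> length w \<Longrightarrow> length w < k \<Longrightarrow> th h w \<in> D \<Longrightarrow> d (h (th h w)) = th h w"
  shows "good L k h"
proof -
  have "d (gam h w) = th h w" if "set w \<subseteq> L" "2 \<le> length w" "length w < k" for w
    using that
  proof (induction w rule: length_induct)
    case (1 w)
    have g: "good L (length w) h"
      using L h 1 unfolding good_def by auto
    obtain ps where ps: "homogeneous_word w ps" using homogeneous_word_ex[of w] L 1 by auto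
    have pos: "\<forall>i\<in>{1..length w}. 0 < ps ! (i - 1)"
      using ps unfolding homogeneous_word_def by (auto simp: list_all2_conv_all_nth)
    have "msum (\<lambda>i j. gam h (sub w i j)) 1 (length w) \<in> D"
      by (rule t[unfolded trivial_systems_def, rule_format, OF _ _ _ gam_system[OF g 1(2) refl ps]])
         (use pos 1(3,4) in auto)
    then have "th h w \<in> D"
      using th_sub[of 1 "length w" w h] sub_all[of w, OF refl] 1(3) by simp
    then show ?case using dh[of w] 1(2-) by (simp add: gam_long)
  qed
  then show ?thesis using L h unfolding good_def by blast
qed

text \<open>The canonical system of \<open>h'\<close> is one of the arbitrary systems that can be
  compared with \<open>h\<close>, and its diagonal is the word itself. This permits passing to an
  operator adapted to one variable.\<close>

lemma th_indep:
  assumes good: "good letters k h" and good': "good L k h'" and w: "set w \<subseteq> L" "length w = k" and k: "2 \<le> k"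
  shows "th h' w - th h w \<in> D"
proof -
  obtain ps where ps: "homogeneous_word w ps"
    using homogeneous_word_ex[of w] w good' by (auto simp: good_def)
  have pos: "\<forall>i\<in>{1..k}. 0 < ps ! (i - 1)"
    using ps w unfolding homogeneous_word_def by (auto simp: list_all2_conv_all_nth)
  have "msum (\<lambda>i j. gam h' (sub w i j)) 1 k - th h (map (\<lambda>i. gam h' (sub w i i)) [1..<Suc k]) \<in> D"
    by (rule msum_th_diag[OF good pos gam_system[OF good' w ps] k])
  moreover have "msum (\<lambda>i j. gam h' (sub w i j)) 1 k = th h' w"
    using th_sub[of 1 k w h'] sub_all[OF w(2)] w k by simp
  moreover have "map (\<lambda>i. gam h' (sub w i i)) [1..<Suc k] = w"
    by (rule nth_equalityI) (use w in \<open>auto simp: sub_self simp del: upt_Suc\<close>)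
  ultimately show ?thesis by simp
qed

lemma trivial_systems_words:
  assumes "good letters k h" "2 \<le> k" "\<And>w. set w \<subseteq> letters \<Longrightarrow> length w = k \<Longrightarrow> th h w \<in> D"
  shows "trivial_systems k"
  unfolding trivial_systems_def
proof (intro allI impI)
  fix p a assume p: "\<forall>i\<in>{1..k}. 0 < p i" and a: "system k p a"
  have "a i i \<in> letters" if "1 \<le> i" "i \<le> k" for i
  proof -
    have "a i i \<in> G (entry_deg p i i)" "d (a i i) = 0"
      using a that assms(2) unfolding system_def by (auto simp: msum_def)
    then show ?thesis using entry_deg_pos[OF p, of i i] that by (auto simp: letters_def)
  qed
  then have "th h (map (\<lambda>i. a i i) [1..<Suc k]) \<in> D"
    by (intro assms(3)) auto
  from D_add[OF msum_th_diag[OF assms(1) p a assms(2)] this] show "msum a 1 k \<in> D"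
    by (simp only: diff_add_cancel)
qed

end

section \<open>Shuffles\<close>

text \<open>The linear extension of \<open>F\<close> evaluated on the signed shuffle product.
  Passing on \<open>F\<close> with the chosen letters as a prefix avoids formal sums of words. In
  the application \<open>s\<close> is the degree raised by one, as in the bar construction.\<close>

fun shuffle_sum :: "('b \<Rightarrow> nat) \<Rightarrow> ('b list \<Rightarrow> 'x::ab_group_add) \<Rightarrow> 'b list \<Rightarrow> 'b list \<Rightarrow> 'x" where
  "shuffle_sum s F [] v = F v"
| "shuffle_sum s F (a # u) [] = F (a # u)"
| "shuffle_sum s F (a # u) (b # v) = shuffle_sum s (\<lambda>w. F (a # w)) u (b # v) +
     sg (s b * sum_list (map s (a # u))) (shuffle_sum s (\<lambda>w. F (b # w)) (a # u) v)"

lemma shuffle_sum_Nil_right [simp]: "shuffle_sum s F u [] = F u"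
  by (cases u) auto

lemma shuffle_sum_cong:
  assumes "\<And>w. set w = set u \<union> set v \<Longrightarrow> length w = length u + length v \<Longrightarrow> F w = F' w"
  shows "shuffle_sum s F u v = shuffle_sum s F' u v"
  using assms
proof (induction s F u v arbitrary: F' rule: shuffle_sum.induct)
  case (3 s F a u b v)
  have "shuffle_sum s (\<lambda>w. F (a # w)) u (b # v) = shuffle_sum s (\<lambda>w. F' (a # w)) u (b # v)"
    by (rule "3.IH"(1), rule "3.prems") auto
  moreover have "shuffle_sum s (\<lambda>w. F (b # w)) (a # u) v = shuffle_sum s (\<lambda>w. F' (b # w)) (a # u) v"
    by (rule "3.IH"(2), rule "3.prems") auto
  ultimately show ?case by simp
qed auto

lemma shuffle_sum_add:
  "shuffle_sum s (\<lambda>w. F w + F' w) u v = shuffle_sum s F u v + shuffle_sum s F' u v"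
proof (induction s F u v arbitrary: F' rule: shuffle_sum.induct)
  case (3 s F a u b v)
  show ?case
    unfolding shuffle_sum.simps "3.IH" sg_add_right by (simp only: ac_simps)
qed auto

lemma shuffle_sum_hom:
  assumes "\<And>x y. f (x + y) = f x + f y"
  shows "f (shuffle_sum s F u v) = shuffle_sum s (\<lambda>w. f (F w)) u v"
proof -
  have 0: "f 0 = 0" using assms[of 0 0] by simp
  have "f (- x) = - f x" for x
    using assms[of x "- x"] 0 by (simp add: eq_neg_iff_add_eq_0 add.commute)
  then have "f (sg k x) = sg k (f x)" for k x by (simp add: sg_def)
  then show ?thesis
    by (induction s F u v rule: shuffle_sum.induct) (simp_all add: assms)
qed

text \<open>Deconcatenation is a homomorphism for the shuffle product.\<close>

lemma shuffle_sum_all_splits: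
  fixes G :: "'b list \<Rightarrow> 'b list \<Rightarrow> 'x::ab_group_add"
  defines "S \<equiv> \<lambda>s u. sum_list (map s u)"
  shows "shuffle_sum s (all_splits G) u v =
    (\<Sum>i\<le>length u. \<Sum>j\<le>length v. sg (S s (drop i u) * S s (take j v))
       (shuffle_sum s (\<lambda>x. shuffle_sum s (G x) (drop i u) (drop j v)) (take i u) (take j v)))"
  (is "_ = (\<Sum>i\<le>_. \<Sum>j\<le>_. ?T G u v i j)")
proof (induction "length u + length v" arbitrary: u v G rule: less_induct)
  case less
  show ?case
  proof (cases u)
    case Nil
    then show ?thesis by (simp add: all_splits_def S_def)
  next
    case [simp]: (Cons a u')
    show ?thesis
    proof (cases v)
      case Nil
      have "(\<Sum>i\<le>length u. ?T G u [] i 0) = (\<Sum>i\<le>length u. G (take i u) (drop i u))"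
        by (intro sum.cong) (auto simp: S_def)
      then show ?thesis using Nil by (simp only:) (simp add: all_splits_def)
    next
      case [simp]: (Cons b v')
      let ?Ga = "\<lambda>x. G (a # x)" and ?Gb = "\<lambda>x. G (b # x)"
      let ?m = "length u'" and ?n = "length v'"
      let ?\<epsilon> = "s b * S s (a # u')"
      have IHa: "shuffle_sum s (all_splits ?Ga) u' (b # v') = (\<Sum>i\<le>?m. \<Sum>j\<le>Suc ?n. ?T ?Ga u' (b # v') i j)"
        using less[of u' "b # v'" ?Ga] by simp
      have IHb: "shuffle_sum s (all_splits ?Gb) (a # u') v' = (\<Sum>i\<le>Suc ?m. \<Sum>j\<le>?n. ?T ?Gb (a # u') v' i j)"
        using less[of "a # u'" v' ?Gb] by simp
      have L: "shuffle_sum s (all_splits G) u v = shuffle_sum s (G []) (a # u') (b # v')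
          + (\<Sum>i\<le>?m. \<Sum>j\<le>Suc ?n. ?T ?Ga u' (b # v') i j)
          + sg ?\<epsilon> (\<Sum>i\<le>Suc ?m. \<Sum>j\<le>?n. ?T ?Gb (a # u') v' i j)"
        unfolding IHa[symmetric] IHb[symmetric]
        by (simp add: all_splits_Cons shuffle_sum_add sg_add_right S_def)
      have T00: "?T G u v 0 0 = shuffle_sum s (G []) (a # u') (b # v')"
        by (simp add: S_def)
      have T0S: "?T G u v 0 (Suc j) = sg ?\<epsilon> (?T ?Gb (a # u') v' 0 j)" for j
        by (simp add: S_def sg_sg algebra_simps)
      have TS0: "?T G u v (Suc i) 0 = ?T ?Ga u' (b # v') i 0" for i
        by (simp add: S_def)
      \<comment> \<open>Shuffles of two nonempty prefixes begin with a or with b, one term each. The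
        parities agree because the letters of u' are distributed over \<open>take i u'\<close> and
        \<open>drop i u'\<close>.\<close>
      have TSS: "?T G u v (Suc i) (Suc j) = ?T ?Ga u' (b # v') i (Suc j) + sg ?\<epsilon> (?T ?Gb (a # u') v' (Suc i) j)" for i j
      proof -
        have 1: "S s u' = S s (take i u') + S s (drop i u')"
          unfolding S_def by (metis append_take_drop_id map_append sum_list.append)
        have "even (S s (drop i u') * (s b + S s (take j v')) + s b * (s a + S s (take i u'))) =
              even (s b * (s a + S s u') + S s (drop i u') * S s (take j v'))"
          unfolding 1 by (simp add: algebra_simps)
        then show ?thesis
          by (simp add: sg_add_right sg_sg S_def) (rule sg_cong, simp add: S_def)
      qed
      have "(\<Sum>i\<le>length u. \<Sum>j\<le>length v. ?T G u v i j) =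
          (\<Sum>j\<le>Suc ?n. ?T G u v 0 j) + (\<Sum>i\<le>?m. \<Sum>j\<le>Suc ?n. ?T G u v (Suc i) j)"
        by (simp only: \<open>u = a # u'\<close> \<open>v = b # v'\<close> list.size add_Suc_right add_0_right sum.atMost_Suc_shift[of _ ?m])
      also have "(\<Sum>j\<le>Suc ?n. ?T G u v 0 j) = ?T G u v 0 0 + (\<Sum>j\<le>?n. sg ?\<epsilon> (?T ?Gb (a # u') v' 0 j))"
        by (simp only: sum.atMost_Suc_shift T0S)
      also have "(\<Sum>i\<le>?m. \<Sum>j\<le>Suc ?n. ?T G u v (Suc i) j) =
         (\<Sum>i\<le>?m. \<Sum>j\<le>Suc ?n. ?T ?Ga u' (b # v') i j) + (\<Sum>i\<le>?m. \<Sum>j\<le>?n. sg ?\<epsilon> (?T ?Gb (a # u') v' (Suc i) j))"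
        by (simp only: sum.atMost_Suc_shift[of _ ?n] TS0 TSS sum.distrib add.assoc)
      finally show ?thesis
        unfolding L T00 sg_sum by (simp only: sum.atMost_Suc_shift[of _ ?m] ac_simps)
    qed
  qed
qed

text \<open>Among the shuffles of u with \<alpha> # v exactly one has all of u in front of \<alpha>,
  and it carries no sign; in all others \<alpha> stands further to the left.\<close>

lemma shuffle_sum_move:
  fixes \<alpha> :: 'b
  assumes "0 \<in> D" "\<And>x y. x \<in> D \<Longrightarrow> y \<in> D \<Longrightarrow> x + y \<in> D" "\<And>x. x \<in> D \<Longrightarrow> - x \<in> D"
    and "\<And>x y. set x \<subseteq> L \<Longrightarrow> set y \<subseteq> L \<Longrightarrow> length x < length u \<Longrightarrow>
           length x + length y = length u + length v \<Longrightarrow> F (x @ \<alpha> # y) \<in> D"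
    and "set u \<subseteq> L" "set v \<subseteq> L"
  shows "shuffle_sum s F u (\<alpha> # v) - F (u @ \<alpha> # v) \<in> D"
  using assms(4,5)
proof (induction u arbitrary: F)
  case Nil
  then show ?case using assms(1) by simp
next
  case (Cons a u)
  have sgD: "sg k x \<in> D" if "x \<in> D" for k x using that assms(3) by (simp add: sg_def)
  have 1: "shuffle_sum s (\<lambda>w. F (a # w)) u (\<alpha> # v) - F (a # (u @ \<alpha> # v)) \<in> D"
  proof (rule Cons.IH)
    fix x y assume xy: "set x \<subseteq> L" "set y \<subseteq> L" "length x < length u" "length x + length y = length u + length v"
    show "F (a # x @ \<alpha> # y) \<in> D"
      using Cons.prems(1)[of "a # x" y] Cons.prems(2) xy by simp
  qed (use Cons.prems in auto)
  have P: "shuffle_sum s F' u' v' \<in> D"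
    if "\<And>w. set w \<subseteq> set u' \<union> set v' \<Longrightarrow> length w = length u' + length v' \<Longrightarrow> F' w \<in> D" for F' u' v'
    using that
  proof (induction s F' u' v' rule: shuffle_sum.induct)
    case (3 s F' a u b v)
    have "shuffle_sum s (\<lambda>w. F' (a # w)) u (b # v) \<in> D"
      by (rule "3.IH"(1), rule "3.prems") auto
    moreover have "shuffle_sum s (\<lambda>w. F' (b # w)) (a # u) v \<in> D"
      by (rule "3.IH"(2), rule "3.prems") auto
    ultimately show ?case by (simp add: assms(2) sgD)
  qed auto
  have 2: "shuffle_sum s (\<lambda>w. F (\<alpha> # w)) (a # u) v \<in> D"
  proof (rule P)
    fix w assume w: "set w \<subseteq> set (a # u) \<union> set v" "length w = length (a # u) + length v"
    show "F (\<alpha> # w) \<in> D"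
      using Cons.prems(1)[of "[]" w] Cons.prems(2) assms(6) w by auto
  qed
  from assms(2)[OF 1 sgD[OF 2, of "s \<alpha> * sum_list (map s (a # u))"]]
  show ?case by (simp add: algebra_simps)
qed

section \<open>Shuffle relations, multilinearity and invariance of \<theta>\<close>

context cdga
begin

text \<open>A letter may lie in several pieces, as 0 does; signs need one choice.\<close>

definition deg :: "'x \<Rightarrow> nat" where "deg z = (SOME p. 0 < p \<and> z \<in> G p)"

lemma deg: "z \<in> letters \<Longrightarrow> 0 < deg z \<and> z \<in> G (deg z)"
  unfolding deg_def letters_def by (rule someI_ex) auto

lemma homogeneous_word_deg: "set w \<subseteq> letters \<Longrightarrow> homogeneous_word w (map deg w)"
  unfolding homogeneous_word_def
  by (induction w) (auto simp: deg, auto simp: letters_def)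

text \<open>The vanishing is exact, not only modulo boundaries. Deconcatenation turns the shuffle
  into products of shuffled prefixes with shuffled suffixes. Proper shuffles vanish by induction;
  what is left are the products of \<open>gam\<close> at u and \<open>gam\<close> at v in either
  order, and these cancel by graded commutativity.\<close>

lemma gam_shuffle:
  assumes h: "homotopy_op h"
  defines "s \<equiv> \<lambda>z. Suc (deg z)"
  shows "u \<noteq> [] \<Longrightarrow> v \<noteq> [] \<Longrightarrow> set u \<subseteq> letters \<Longrightarrow> set v \<subseteq> letters \<Longrightarrow>
     shuffle_sum s (th h) u v = 0 \<and> shuffle_sum s (gam h) u v = 0"
proof (induction "length u + length v" arbitrary: u v rule: less_induct)
  case less
  let ?Q = "shuffle_sum s (gam h)"
  let ?S = "\<lambda>u. sum_list (map s u)"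
  let ?n = "length u" and ?m = "length v"
  define f where "f i j = sg (?S (drop i u) * ?S (take j v)) (bar (?Q (take i u) (take j v)) \<star> ?Q (drop i u) (drop j v))" for i j
  have "th h w = all_splits (\<lambda>u v. bar (gam h u) \<star> gam h v) w" for w
    unfolding th_def by (rule splits_eq_all_splits) auto
  then have th: "th h = all_splits (\<lambda>u v. bar (gam h u) \<star> gam h v)" by auto
  have in1: "shuffle_sum s (\<lambda>y. bar (gam h x) \<star> gam h y) p q = bar (gam h x) \<star> ?Q p q" for x p q
    by (rule shuffle_sum_hom[symmetric]) (rule mul_add_right)
  have in2: "shuffle_sum s (\<lambda>x. bar (gam h x) \<star> z) p q = bar (?Q p q) \<star> z" for z p q
    by (rule shuffle_sum_hom[symmetric, where f = "\<lambda>x. bar x \<star> z"]) (simp add: bar_add mul_add_left)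
  have sum: "shuffle_sum s (th h) u v = (\<Sum>i\<le>?n. \<Sum>j\<le>?m. f i j)"
    unfolding th shuffle_sum_all_splits f_def in1 in2 ..
  have Q0: "?Q p q = 0" if "p \<noteq> []" "q \<noteq> []" "set p \<subseteq> letters" "set q \<subseteq> letters"
    "length p + length q < ?n + ?m" for p q
    using less.hyps[OF that(5) that(1-4)] by simp
  have sub: "set (take i u) \<subseteq> letters" "set (drop i u) \<subseteq> letters" "set (take i v) \<subseteq> letters" "set (drop i v) \<subseteq> letters" for i
    using less.prems set_take_subset set_drop_subset by (meson order_trans)+
  have nm: "0 < ?n" "0 < ?m" using less.prems by auto
  \<comment> \<open>One of the two factors is \<open>gam\<close> of the empty word or a shuffle of
    nonempty words of smaller total length.\<close>
  have f0: "f i j = 0" if "i \<le> ?n" "j \<le> ?m" "(i, j) \<noteq> (0, ?m)" "(i, j) \<noteq> (?n, 0)" for i j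
  proof -
    have "i \<noteq> 0 \<or> j \<noteq> ?m" "i \<noteq> ?n \<or> j \<noteq> 0" using that by auto
    then have "i = 0 \<and> j = 0 \<or> i = ?n \<and> j = ?m \<or> 0 < i \<and> 0 < j \<and> (i < ?n \<or> j < ?m) \<or>
        i < ?n \<and> j < ?m \<and> (0 < i \<or> 0 < j)"
      using that(1,2) nm by arith
    then consider "i = 0" "j = 0" | "i = ?n" "j = ?m" | "0 < i" "0 < j" "i < ?n \<or> j < ?m" |
        "i < ?n" "j < ?m" "0 < i \<or> 0 < j"
      by blast
    then show ?thesis
    proof cases
      case 3
      have "?Q (take i u) (take j v) = 0"
        by (rule Q0) (use 3 that less.prems sub in auto)
      then show ?thesis by (simp add: f_def)
    next
      case 4
      have "?Q (drop i u) (drop j v) = 0"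
        by (rule Q0) (use 4 that less.prems sub in auto)
      then show ?thesis by (simp add: f_def)
    qed (auto simp: f_def)
  qed
  have "(\<Sum>i\<le>?n. \<Sum>j\<le>?m. f i j) = (\<Sum>(i, j)\<in>{..?n} \<times> {..?m}. f i j)"
    by (rule sum.cartesian_product)
  also have "\<dots> = (\<Sum>(i, j)\<in>{(0, ?m), (?n, 0)}. f i j)"
  proof (rule sum.mono_neutral_right)
    have "f i j = 0" if "(i, j) \<in> {..?n} \<times> {..?m} - {(0, ?m), (?n, 0)}" for i j
      by (rule f0) (use that in auto)
    then show "\<forall>x\<in>{..?n} \<times> {..?m} - {(0, ?m), (?n, 0)}. (case x of (i, j) \<Rightarrow> f i j) = 0"
      by (intro ballI) (simp only: split_paired_all prod.case)
  qed auto
  also have "\<dots> = f 0 ?m + f ?n 0" using nm by simp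
  also have "\<dots> = 0"
  proof -
    let ?a = "gam h u" and ?b = "gam h v"
    have S: "sdeg (map deg w) = ?S w" for w by (induction w) (auto simp: sdeg_def s_def)
    have a: "?a \<in> G (?S u - 1)" and b: "?b \<in> G (?S v - 1)"
      using gam_G[OF h homogeneous_word_deg] less.prems S by auto
    have "2 * ?n \<le> ?S u" "2 * ?m \<le> ?S v"
      unfolding S[symmetric]
      by (intro homogeneous_word_sdeg homogeneous_word_deg less.prems)+
    then have "0 < ?S u" "0 < ?S v" using nm by linarith+
    then obtain p q where pq: "?S u = Suc p" "?S v = Suc q" by (metis Suc_pred)
    \<comment> \<open>Written as multiples of \<open>?a\<close> times \<open>?b\<close>, the two
      terms have signs (-1)^p and (-1)^(p+1).\<close>
    have "f 0 ?m = sg (Suc p * Suc q) (bar ?b \<star> ?a)" "f ?n 0 = bar ?a \<star> ?b"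
      using pq by (auto simp: f_def)
    moreover have "bar ?b = sg (Suc q) ?b" "bar ?a = sg (Suc p) ?a" "?b \<star> ?a = sg (p * q) (?a \<star> ?b)"
      using bar_G[OF a] bar_G[OF b] mul_comm[OF a b] pq by simp_all
    ultimately show ?thesis by (simp add: mul_sg sg_sg) (simp add: sg_def)
  qed
  finally have 1: "shuffle_sum s (th h) u v = 0" using sum by simp
  have "shuffle_sum s (gam h) u v = shuffle_sum s (\<lambda>w. h (th h w)) u v"
    by (rule shuffle_sum_cong, rule gam_long) (use nm in linarith)
  also have "\<dots> = h (shuffle_sum s (th h) u v)"
    using h by (intro shuffle_sum_hom[symmetric]) (simp add: homotopy_op_def)
  finally show ?case using 1 homotopy_op_0[OF h] by simp
qed

text \<open>Modulo shuffles every word is a combination of words beginning with a prescribed letter.\<close>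

lemma th_move:
  assumes h: "homotopy_op h" and L: "L \<subseteq> letters" "\<alpha> \<in> letters"
    and first: "\<And>w. set w \<subseteq> L \<Longrightarrow> Suc (length w) = k \<Longrightarrow> th h (\<alpha> # w) \<in> D"
  shows "set x \<subseteq> L \<Longrightarrow> set y \<subseteq> L \<Longrightarrow> Suc (length x + length y) = k \<Longrightarrow> th h (x @ \<alpha> # y) \<in> D"
proof (induction "length x" arbitrary: x y rule: less_induct)
  case less
  show ?case
  proof (cases "x = []")
    case True
    then show ?thesis using first less.prems by simp
  next
    case False
    let ?s = "\<lambda>z. Suc (deg z)"
    have "shuffle_sum ?s (th h) x (\<alpha> # y) - th h (x @ \<alpha> # y) \<in> D"
    proof (rule shuffle_sum_move[where L = L])
      fix x' y' assume xy: "set x' \<subseteq> L" "set y' \<subseteq> L" "length x' < length x" "length x' + length y' = length x + length y"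
      then show "th h (x' @ \<alpha> # y') \<in> D" using less.prems by (intro less.hyps) auto
    qed (use less.prems D_0 D_add D_neg in auto)
    moreover have "shuffle_sum ?s (th h) x (\<alpha> # y) = 0"
      using gam_shuffle[OF h, of x "\<alpha> # y"] False less.prems L by auto
    ultimately show ?thesis using D_neg_iff by simp
  qed
qed

lemma gam_th_add:
  assumes h: "homotopy_op h"
  shows "gam h (u @ (y + y') # v) = gam h (u @ y # v) + gam h (u @ y' # v) \<and>
         th h (u @ (y + y') # v) = th h (u @ y # v) + th h (u @ y' # v)"
proof (induction "length u + length v" arbitrary: u v rule: less_induct)
  case less
  let ?w = "\<lambda>y. u @ y # v"
  have "th h (?w (y + y')) = th h (?w y) + th h (?w y')"
    unfolding th_def splits_def length_append list.size sum.distrib[symmetric]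
  proof (rule sum.cong[OF refl])
    fix m assume m: "m \<in> {1..<length u + (length v + Suc 0)}"
    show "bar (gam h (take m (?w (y + y')))) \<star> gam h (drop m (?w (y + y'))) =
      bar (gam h (take m (?w y))) \<star> gam h (drop m (?w y)) + bar (gam h (take m (?w y'))) \<star> gam h (drop m (?w y'))"
    proof (cases "m \<le> length u")
      case True
      have "gam h (drop m u @ (y + y') # v) = gam h (drop m u @ y # v) + gam h (drop m u @ y' # v)"
        using less[of "drop m u" v] m True by auto
      then show ?thesis using True by (simp add: mul_add_right)
    next
      case False
      then obtain l where l: "m = length u + Suc l" "l < length v"
        using m less_imp_Suc_add[of "length u" m] by auto
      have "gam h (u @ (y + y') # take l v) = gam h (u @ y # take l v) + gam h (u @ y' # take l v)"
        using less[of u "take l v"] l by auto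
      then show ?thesis using l by (simp add: mul_add_left bar_add)
    qed
  qed
  moreover have "gam h (?w (y + y')) = gam h (?w y) + gam h (?w y')"
  proof (cases "2 \<le> length u + Suc (length v)")
    case True
    with calculation h show ?thesis by (simp add: gam_long homotopy_op_def)
  next
    case False
    then have "u = [] \<and> v = []" by (cases u; cases v; simp)
    then show ?thesis by simp
  qed
  ultimately show ?case by simp
qed

lemmas th_add = gam_th_add[THEN conjunct2]

lemma th_0: "homotopy_op h \<Longrightarrow> th h (u @ 0 # v) = 0"
  using th_add[of h u 0 0 v] by simp

lemma th_neg: "homotopy_op h \<Longrightarrow> th h (u @ (- y) # v) = - th h (u @ y # v)"
  using th_add[of h u y "- y" v] th_0[of h u v] by (simp add: eq_neg_iff_add_eq_0 add.commute)

lemma th_sg: "homotopy_op h \<Longrightarrow> th h (u @ sg k y # v) = sg k (th h (u @ y # v))"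
  by (simp add: sg_def th_neg)

lemma th_sum: "homotopy_op h \<Longrightarrow> th h (u @ sum f A # v) = (\<Sum>i\<in>A. th h (u @ f i # v))"
  by (induction A rule: infinite_finite_induct) (auto simp: th_0 th_add)

text \<open>Multilinear expansion, one letter at a time from the left; the growing prefix consists
  of letters already in \<open>B\<close>.\<close>

lemma th_decompose:
  assumes h: "homotopy_op h"
    and dec: "\<And>z. z \<in> L \<Longrightarrow> \<exists>A f. finite (A :: 'i set) \<and> z = sum f A \<and> f ` A \<subseteq> B"
    and B: "\<And>w. set w \<subseteq> B \<Longrightarrow> length w = k \<Longrightarrow> th h w \<in> D"
  shows "set w \<subseteq> L \<Longrightarrow> length w = k \<Longrightarrow> th h w \<in> D"
proof -
  have "th h (u @ w) \<in> D" if "set u \<subseteq> B" "set w \<subseteq> L" "length u + length w = k" for u w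
    using that
  proof (induction w arbitrary: u)
    case Nil
    then show ?case using B by simp
  next
    case (Cons z w)
    then obtain A f where A: "finite (A :: 'i set)" "z = sum f A" "f ` A \<subseteq> B" using dec[of z] by auto
    have "th h (u @ f i # w) \<in> D" if "i \<in> A" for i
      using Cons.IH[of "u @ [f i]"] Cons.prems A(3) that by auto
    then show ?case using A by (simp add: th_sum[OF h] D_sum)
  qed
  from this[of "[]"] show "set w \<subseteq> L \<Longrightarrow> length w = k \<Longrightarrow> th h w \<in> D" by simp
qed

text \<open>The differential of the product at one cut produces a second cut. Each pair l < m arises
  twice, from the left factor at m and from the right factor at l, with opposite signs.\<close>

lemma th_cycle: "d (th h w) = 0" if good: "good L k h" and w: "set w \<subseteq> L" "length w \<le> k"
proof -
  let ?F = "\<lambda>u v. bar (gam h u) \<star> gam h v"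
  let ?g = "gam h" and ?n = "length w"
  define g where "g i j = gam h (take (j - i) (drop i w))" for i j
  have g_d: "d (g i j) = (\<Sum>m\<in>{i<..<j}. bar (g i m) \<star> g m j)" if "i < j" "j \<le> ?n" "j - i < k" for i j
  proof -
    have "d (g i j) = th h (take (j - i) (drop i w))"
      unfolding g_def
    proof (rule good_D[OF good])
      show "set (take (j - i) (drop i w)) \<subseteq> L"
        using w(1) set_take_subset[of "j - i" "drop i w"] set_drop_subset[of i w] by blast
    qed (use that in auto)
    also have "\<dots> = (\<Sum>m\<in>{i<..<j}. bar (g i m) \<star> g m j)"
      unfolding th_def splits_def g_def
    proof (rule sum.reindex_bij_witness[where i = "\<lambda>m. m - i" and j = "\<lambda>m. m + i"])
      fix m assume "m \<in> {1..<length (take (j - i) (drop i w))}"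
      then have m: "1 \<le> m" "m < j - i" by auto
      then show "bar (gam h (take (m + i - i) (drop i w))) \<star> gam h (take (j - (m + i)) (drop (m + i) w)) =
          bar (gam h (take m (take (j - i) (drop i w)))) \<star> gam h (drop m (take (j - i) (drop i w)))"
        by (simp add: min_absorb1 drop_take add.commute)
    qed (use that in auto)
    finally show ?thesis .
  qed
  have "th h w = (\<Sum>m\<in>{0<..<?n}. bar (g 0 m) \<star> g m ?n)"
    unfolding th_def splits_def g_def by (intro sum.cong) auto
  then have "d (th h w) = (\<Sum>m\<in>{0<..<?n}. d (bar (g 0 m)) \<star> g m ?n - g 0 m \<star> d (g m ?n))"
    by (simp add: d_sum d_mul bar_bar)
  also have "\<dots> = (\<Sum>m\<in>{0<..<?n}. (\<Sum>l\<in>{0<..<m}. g 0 l \<star> (bar (g l m) \<star> g m ?n)) - (\<Sum>l\<in>{m<..<?n}. g 0 m \<star> (bar (g m l) \<star> g l ?n)))"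
  proof (rule sum.cong[OF refl])
    fix m assume m: "m \<in> {0<..<?n}"
    have bsum: "bar (sum f A) = (\<Sum>i\<in>A. bar (f i))" for f and A :: "nat set"
      by (induction A rule: infinite_finite_induct) (auto simp: bar_add)
    have msum: "sum f A \<star> x = (\<Sum>i\<in>A. f i \<star> x)" for f x and A :: "nat set"
      by (induction A rule: infinite_finite_induct) (auto simp: mul_add_left)
    have "d (bar (g 0 m)) = - bar (d (g 0 m))" using bar_d[of "g 0 m"] by simp
    also have "\<dots> = (\<Sum>l\<in>{0<..<m}. g 0 l \<star> bar (g l m))"
      using m w(2) by (subst g_d) (auto simp: bsum bar_mul bar_bar sum_negf)
    finally have "d (bar (g 0 m)) \<star> g m ?n = (\<Sum>l\<in>{0<..<m}. g 0 l \<star> (bar (g l m) \<star> g m ?n))"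
      by (simp add: msum mul_assoc)
    moreover have "g 0 m \<star> d (g m ?n) = (\<Sum>l\<in>{m<..<?n}. g 0 m \<star> (bar (g m l) \<star> g l ?n))"
      using m w(2) by (subst g_d) (auto simp: mul_sum_right)
    ultimately show "d (bar (g 0 m)) \<star> g m ?n - g 0 m \<star> d (g m ?n) =
      (\<Sum>l\<in>{0<..<m}. g 0 l \<star> (bar (g l m) \<star> g m ?n)) - (\<Sum>l\<in>{m<..<?n}. g 0 m \<star> (bar (g m l) \<star> g l ?n))"
      by simp
  qed
  also have "\<dots> = 0"
  proof -
    let ?f = "\<lambda>l m. g 0 l \<star> (bar (g l m) \<star> g m ?n)"
    have "(\<Sum>m\<in>{0<..<?n}. \<Sum>l\<in>{0<..<m}. ?f l m) = (\<Sum>m\<in>{0<..<?n}. \<Sum>l\<in>{l\<in>{0<..<?n}. l < m}. ?f l m)"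
      by (intro sum.cong) auto
    also have "\<dots> = (\<Sum>l\<in>{0<..<?n}. \<Sum>m\<in>{m\<in>{0<..<?n}. l < m}. ?f l m)"
      by (rule sum.swap_restrict) auto
    also have "\<dots> = (\<Sum>l\<in>{0<..<?n}. \<Sum>m\<in>{l<..<?n}. ?f l m)"
      by (intro sum.cong) auto
    finally show ?thesis by (simp add: sum_subtractf)
  qed
  finally show ?thesis .
qed


text \<open>There is an explicit system with diagonal d y, w: canonical below the first row, and
  with multiples of \<open>bar y\<close> in it. The formula for the first row makes sense in
  position (1, k) too, so the Massey element is the differential of that entry.\<close>

lemma th_exact_first:
  assumes good: "good letters k h" and y: "y \<in> G (Suc p)" "0 < p"
    and w: "set w \<subseteq> letters" "w \<noteq> []" "Suc (length w) = k"
  shows "th h (d y # w) \<in> D"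
proof -
  let ?w = "d y # w" and ?g = "\<lambda>i j. gam h (sub (d y # w) i j)"
  define ps where "ps = p # map deg w"
  define pf where "pf i = ps ! (i - 1)" for i :: nat
  \<comment> \<open>The sign is the one for which the differential of the new entry is bar (d y)
    times g plus y times d g, the two parts of the sum over v.\<close>
  define a where "a i j = (if i = 1 \<and> j \<noteq> 1 then - (bar y \<star> ?g 2 j) else ?g i j)" for i j
  have hw: "homogeneous_word ?w ps"
    using homogeneous_word_deg[OF w(1)] y d_G[OF y(1)]
    by (simp add: homogeneous_word_def ps_def d_d)
  have wl: "set ?w \<subseteq> letters" by (rule homogeneous_word_letters[OF hw])
  have k: "2 \<le> k" using w by (cases w) auto
  have S: "system k pf ?g"
    unfolding pf_def by (rule gam_system[OF good wl _ hw]) (use w in simp)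
  have gG: "?g i j \<in> G (entry_deg pf i j)" and gd: "d (?g i j) = msum ?g i j"
    if "1 \<le> i" "i \<le> j" "j \<le> k" "(i, j) \<noteq> (1, k)" for i j
    using S that unfolding system_def by blast+
  have pos: "\<forall>i\<in>{1..k}. 0 < pf i"
    using hw w(3) unfolding homogeneous_word_def pf_def by (auto simp: list_all2_conv_all_nth)
  have g11: "?g 1 1 = d y" by (simp add: sub_def)
  have aG: "a 1 j \<in> G (entry_deg pf 1 j)" and ad: "d (a 1 j) = msum a 1 j" if j: "2 \<le> j" "j \<le> k" for j
  proof -
    have g: "?g 2 j \<in> G (entry_deg pf 2 j)" "d (?g 2 j) = msum ?g 2 j"
      using gG[of 2 j] gd[of 2 j] j by auto
    have "Suc p + entry_deg pf 2 j = entry_deg pf 1 j"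
      using entry_deg_split[of 1 1 j pf] j by (simp add: entry_deg_def pf_def ps_def numeral_2_eq_2)
    then show "a 1 j \<in> G (entry_deg pf 1 j)"
      using mul_G[OF bar_G_mem[OF y(1)] g(1)] j by (simp add: a_def G_neg)
    have "{1..<j} = insert 1 {2..<j}" using j by auto
    then have "msum a 1 j = bar (d y) \<star> ?g 2 j + (\<Sum>v\<in>{2..<j}. bar (- (bar y \<star> ?g 2 v)) \<star> ?g (Suc v) j)"
      using g11 j by (simp add: msum_def a_def numeral_2_eq_2)
    also have "(\<Sum>v\<in>{2..<j}. bar (- (bar y \<star> ?g 2 v)) \<star> ?g (Suc v) j) = y \<star> msum ?g 2 j"
      by (simp add: msum_def mul_sum_right bar_neg bar_mul bar_bar mul_assoc)
    also have "bar (d y) \<star> ?g 2 j + y \<star> msum ?g 2 j = d (a 1 j)"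
      using j g(2) by (simp add: a_def d_neg d_mul bar_bar bar_d)
    finally show "d (a 1 j) = msum a 1 j" ..
  qed
  have "system k pf a"
    unfolding system_def
  proof (intro allI impI)
    fix i j assume ij: "1 \<le> i \<and> i \<le> j \<and> j \<le> k \<and> (i, j) \<noteq> (1, k)"
    show "a i j \<in> G (entry_deg pf i j) \<and> d (a i j) = msum a i j"
    proof (cases "i = 1 \<and> j \<noteq> 1")
      case True
      then show ?thesis using aG[of j] ad[of j] ij by auto
    next
      case False
      then have "msum a i j = msum ?g i j"
        unfolding msum_def using ij by (intro sum.cong) (auto simp: a_def)
      then show ?thesis using gG[of i j] gd[of i j] ij False by (auto simp: a_def)
    qed
  qed
  from msum_th_diag[OF good pos this k]
  have "msum a 1 k - th h (map (\<lambda>i. a i i) [1..<Suc k]) \<in> D" .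
  moreover have "map (\<lambda>i. a i i) [1..<Suc k] = ?w"
    by (rule nth_equalityI) (use w(3) in \<open>auto simp: a_def sub_self simp del: upt_Suc\<close>)
  moreover have "msum a 1 k \<in> D"
    using D_d[OF aG[of k]] ad[of k] k by simp
  ultimately show ?thesis
    using D_diff[of "msum a 1 k" "msum a 1 k - th h (d y # w)"] by simp
qed

lemma th_homologous_first:
  assumes good: "good letters k h" and y: "y \<in> G (Suc p)" "0 < p" "x - x' = d y"
    and w: "set w \<subseteq> letters" "w \<noteq> []" "Suc (length w) = k"
  shows "th h (x # w) \<in> D \<longleftrightarrow> th h (x' # w) \<in> D"
proof -
  have "x = d y + x'" using y(3) by (simp add: algebra_simps)
  then have e: "th h (x # w) = th h (d y # w) + th h (x' # w)"
    using th_add[of h "[]" "d y" x' w] good by (simp add: good_def)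
  show ?thesis
    using th_exact_first[OF good y(1,2) w] D_add D_diff unfolding e by (metis add_diff_cancel_left')
qed

text \<open>A boundary in first position is covered by \<open>th_exact_first\<close>, and
  \<open>th_move\<close> carries this to every position; the letters are then exchanged one by
  one.\<close>

lemma th_homologous:
  assumes good: "good letters k h" and k: "2 \<le> k"
    and xy: "list_all2 (\<lambda>x x'. x \<in> letters \<and> x' \<in> letters \<and> (\<exists>p>0. \<exists>y\<in>G (Suc p). x - x' = d y)) w w'"
    and "length w = k"
  shows "th h w - th h w' \<in> D"
proof -
  have h: "homotopy_op h" using good by (simp add: good_def)
  have "th h (u @ w) - th h (u @ w') \<in> D" if "set u \<subseteq> letters" "length u + length w = k" for u
    using xy that
  proof (induction arbitrary: u rule: list_all2_induct)
    case Nil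
    then show ?case by (simp add: D_0)
  next
    case (Cons x w x' w')
    then obtain p y where y: "0 < p" "y \<in> G (Suc p)" "x - x' = d y" by blast
    have ww: "set w \<subseteq> letters" "length w = length w'"
      using Cons.hyps(2) by (auto simp: list_all2_conv_all_nth in_set_conv_nth)
    have dl: "d y \<in> letters" using y d_G d_d by (auto simp: letters_def)
    have "th h (u @ d y # w) \<in> D"
    proof (rule th_move[OF h order_refl dl])
      fix v assume "set v \<subseteq> letters" "Suc (length v) = k"
      then show "th h (d y # v) \<in> D"
        using k by (intro th_exact_first[OF good y(2,1)]) auto
    qed (use Cons ww in auto)
    moreover have "x = d y + x'" using y(3) by (simp add: algebra_simps)
    ultimately have "th h (u @ x # w) - th h (u @ x' # w) \<in> D"
      by (simp add: th_add[OF h])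
    moreover have "th h ((u @ [x']) @ w) - th h ((u @ [x']) @ w') \<in> D"
      using Cons by (intro Cons.IH) auto
    ultimately show ?case using D_add by fastforce
  qed
  from this[of "[]"] show ?thesis using assms(4) by simp
qed

text \<open>If the second letter is the image of a cycle \<open>bt\<close> under a contraction \<open>\<rho>\<close>, then the products
  of \<open>e\<close> with the values of \<open>gam\<close> at words that begin with \<open>bt\<close> complete a defining system.\<close>

lemma th_contraction:
  assumes good: "good letters k h" and k: "k = length cs + 2"
    and A: "A \<in> G pA" "0 < pA" "d A = 0"
    and bt: "bt \<in> G (pb + e)" "d bt = 0" "0 < pb"
    and cs: "set cs \<subseteq> letters"
    and E: "E \<in> G q" "q + e = Suc pA"
    and \<rho>_add: "\<And>x y. \<rho> (x + y) = \<rho> x + \<rho> y"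
    and \<rho>_G: "\<And>x p. x \<in> G (p + e) \<Longrightarrow> \<rho> x \<in> G p"
    and \<rho>_d: "\<And>x. d (\<rho> x) = sg e (\<rho> (d x))"
    and \<rho>_bar: "\<And>x. bar (\<rho> x) = sg e (\<rho> (bar x))"
    and AE: "\<And>x. x \<in> P \<Longrightarrow> bar A \<star> \<rho> x = d E \<star> x"
    and \<rho>_mul: "\<And>x y. x \<in> P \<Longrightarrow> y \<in> Q \<Longrightarrow> \<rho> (bar x \<star> y) = \<rho> (bar x) \<star> y"
    and P: "\<And>n. n \<le> length cs \<Longrightarrow> gam h (bt # take n cs) \<in> P"
    and Q: "\<And>u. set u \<subseteq> set cs \<Longrightarrow> u \<noteq> [] \<Longrightarrow> gam h u \<in> Q"
  shows "th h (A # \<rho> bt # cs) \<in> D"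
proof -
  have h: "homotopy_op h" using good by (simp add: good_def)
  let ?w = "A # \<rho> bt # cs"
  let ?ps = "(pb + e) # map deg cs"
  define q where "q i j = gam h (sub (bt # cs) (i - 1) (j - 1))" for i j
  \<comment> \<open>Row 2 is contracted, row 1 carries E times the uncontracted entries. Since bar A
    times a contracted entry is d E times the uncontracted one, row 1 has the right differential,
    also at j = k, where it exhibits the Massey element as a boundary.\<close>
  define a where "a i j = (if i = 1 then if j = 1 then A else E \<star> q 2 j
     else if i = 2 then \<rho> (q 2 j) else q i j)" for i j
  define pf where "pf i = (if i = 1 then pA else if i = 2 then pb else deg (cs ! (i - 3)))" for i :: nat
  have hw: "homogeneous_word (bt # cs) ?ps"
    using homogeneous_word_deg[OF cs] bt by (simp add: homogeneous_word_def)
  then have wl: "set (bt # cs) \<subseteq> letters" by (rule homogeneous_word_letters)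
  have "0 < deg (cs ! m)" if "m < length cs" for m
    using deg cs nth_mem[OF that] by blast
  then have pf: "\<forall>i\<in>{1..k}. 0 < pf i"
    using A(2) bt(3) k by (auto simp: pf_def)
  \<comment> \<open>Before contraction, the entries of row 2 exceed the degree prescribed by their
    position by e, which \<rho> takes away.\<close>
  have ent: "sdeg (sub ?ps (i - 1) (j - 1)) - 1 = entry_deg pf i j + (if i = 2 then e else 0)"
    if ij: "2 \<le> i" "i \<le> j" "j \<le> k" for i j
  proof -
    have "sdeg (sub ?ps (i - 1) (j - 1)) - 1 = entry_deg (\<lambda>i. ?ps ! (i - 1)) (i - 1) (j - 1)"
      using ij k by (intro sdeg_sub) auto
    also have "\<dots> = (\<Sum>v = i..j. ?ps ! (v - 2)) + (j - i)"
      unfolding entry_deg_def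
      by (intro arg_cong2[where f = "(+)"] sum.reindex_bij_witness[where i = "\<lambda>v. v - 1" and j = Suc])
         (use ij in \<open>auto simp: numeral_2_eq_2\<close>)
    also have "(\<Sum>v = i..j. ?ps ! (v - 2)) = (\<Sum>v = i..j. pf v + (if v = 2 then e else 0))"
    proof (rule sum.cong[OF refl])
      fix v assume v: "v \<in> {i..j}"
      show "?ps ! (v - 2) = pf v + (if v = 2 then e else 0)"
      proof (cases "v = 2")
        case False
        then have "v - 2 = Suc (v - 3)" using v ij by auto
        moreover have "v - 3 < length cs" using False v ij k by auto
        ultimately show ?thesis using False v ij by (simp add: pf_def)
      qed (simp add: pf_def)
    qed
    also have "\<dots> = (\<Sum>v = i..j. pf v) + (if i = 2 then e else 0)"
      using ij by (simp add: sum.distrib sum.delta)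
    finally show ?thesis by (simp add: entry_deg_def)
  qed
  have qG: "q i j \<in> G (entry_deg pf i j + (if i = 2 then e else 0))"
    and qd: "d (q i j) = (\<Sum>v\<in>{i..<j}. bar (q i v) \<star> q (Suc v) j)"
    if ij: "2 \<le> i" "i \<le> j" "j \<le> k" for i j
  proof -
    let ?s = "sub (bt # cs) (i - 1) (j - 1)"
    have len: "length ?s = Suc j - i" using ij k by (subst length_sub) auto
    have "homogeneous_word ?s (sub ?ps (i - 1) (j - 1))"
      unfolding sub_def by (intro homogeneous_word_take homogeneous_word_drop hw)
    then have "q i j \<in> G (sdeg (sub ?ps (i - 1) (j - 1)) - 1)"
      unfolding q_def using len ij by (intro gam_G[OF h]) auto
    then show "q i j \<in> G (entry_deg pf i j + (if i = 2 then e else 0))" using ent[OF ij] by simp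
    have "d (q i j) = th h ?s"
      unfolding q_def
    proof (rule good_D[OF good])
      show "set ?s \<subseteq> letters" using wl set_sub by (rule order_trans[rotated])
    qed (use len ij in auto)
    also have "\<dots> = (\<Sum>v\<in>{i - 1..<j - 1}. bar (q i (Suc v)) \<star> q (Suc (Suc v)) j)"
      using ij k by (subst th_sub) (auto simp: msum_def q_def)
    also have "\<dots> = (\<Sum>v\<in>{i..<j}. bar (q i v) \<star> q (Suc v) j)"
      by (rule sum.reindex_bij_witness[where i = "\<lambda>v. v - 1" and j = Suc]) (use ij in auto)
    finally show "d (q i j) = (\<Sum>v\<in>{i..<j}. bar (q i v) \<star> q (Suc v) j)" .
  qed
  have qP: "q 2 j \<in> P" if "2 \<le> j" "j \<le> k" for j
  proof -
    have "sub (bt # cs) 1 (j - 1) = bt # take (j - 2) cs"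
      using that by (auto simp: sub_def take_Cons' numeral_2_eq_2)
    then show ?thesis using P[of "j - 2"] that k by (simp add: q_def)
  qed
  have qQ: "q i j \<in> Q" if "3 \<le> i" "i \<le> j" "j \<le> k" for i j
  proof -
    have "set (sub (bt # cs) (i - 1) (j - 1)) \<subseteq> set cs"
    proof -
      have "drop (i - 1 - 1) (bt # cs) = drop (i - 3) cs"
        using that by (simp add: drop_Cons' numeral_3_eq_3)
      then show ?thesis unfolding sub_def by (metis order_trans set_drop_subset set_take_subset)
    qed
    moreover have "length (sub (bt # cs) (i - 1) (j - 1)) = Suc j - i"
      using that k by (subst length_sub) auto
    ultimately show ?thesis unfolding q_def using that by (intro Q) auto
  qed
  have \<rho>0: "\<rho> 0 = 0" using \<rho>_add[of 0 0] by simp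
  have \<rho>_sum: "\<rho> (sum f B) = (\<Sum>i\<in>B. \<rho> (f i))" for f and B :: "nat set"
    by (induction B rule: infinite_finite_induct) (auto simp: \<rho>_add \<rho>0)
  have a2: "d (a 2 j) = msum a 2 j" if j: "2 \<le> j" "j \<le> k" for j
  proof -
    have "d (a 2 j) = sg e (\<rho> (d (q 2 j)))" by (simp add: a_def \<rho>_d)
    also have "\<dots> = (\<Sum>v\<in>{2..<j}. sg e (\<rho> (bar (q 2 v) \<star> q (Suc v) j)))"
      using j by (simp add: qd \<rho>_sum sg_sum)
    also have "\<dots> = (\<Sum>v\<in>{2..<j}. bar (\<rho> (q 2 v)) \<star> q (Suc v) j)"
    proof (rule sum.cong[OF refl])
      fix v assume v: "v \<in> {2..<j}"
      have "\<rho> (bar (q 2 v) \<star> q (Suc v) j) = \<rho> (bar (q 2 v)) \<star> q (Suc v) j"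
        by (rule \<rho>_mul) (use v j in \<open>auto intro!: qP qQ\<close>)
      then show "sg e (\<rho> (bar (q 2 v) \<star> q (Suc v) j)) = bar (\<rho> (q 2 v)) \<star> q (Suc v) j"
        by (simp add: \<rho>_bar mul_sg)
    qed
    also have "\<dots> = msum a 2 j"
      unfolding msum_def by (intro sum.cong) (auto simp: a_def)
    finally show ?thesis .
  qed
  have a1G: "a 1 j \<in> G (entry_deg pf 1 j)" and a1: "d (a 1 j) = msum a 1 j" if j: "2 \<le> j" "j \<le> k" for j
  proof -
    have "Suc pA + entry_deg pf 2 j = entry_deg pf 1 j"
      using entry_deg_split[of 1 1 j pf] j by (simp add: entry_deg_def pf_def numeral_2_eq_2)
    then have s: "q' + (entry_deg pf 2 j + e) = entry_deg pf 1 j" if "q' + e = Suc pA" for q' using that by simp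
    show "a 1 j \<in> G (entry_deg pf 1 j)"
      using mul_G[OF E(1) qG[of 2 j]] j s[OF E(2)] by (simp add: a_def)
    have "{1..<j} = insert 1 {2..<j}" using j by auto
    then have "msum a 1 j = bar A \<star> \<rho> (q 2 j) + (\<Sum>v\<in>{2..<j}. bar (E \<star> q 2 v) \<star> q (Suc v) j)"
      using j by (simp add: msum_def a_def numeral_2_eq_2)
    also have "(\<Sum>v\<in>{2..<j}. bar (E \<star> q 2 v) \<star> q (Suc v) j) = - (bar E \<star> d (q 2 j))"
      using j by (simp add: qd mul_sum_right bar_mul mul_assoc sum_negf)
    also have "bar A \<star> \<rho> (q 2 j) = d E \<star> q 2 j" using j by (intro AE qP) auto
    finally have "msum a 1 j = d (E \<star> q 2 j)" by (simp add: d_mul)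
    moreover have "a 1 j = E \<star> q 2 j" using j by (simp add: a_def)
    ultimately show "d (a 1 j) = msum a 1 j" by simp
  qed
  have sys: "system k pf a"
    unfolding system_def
  proof (intro allI impI)
    fix i j assume ij: "1 \<le> i \<and> i \<le> j \<and> j \<le> k \<and> (i, j) \<noteq> (1, k)"
    consider "i = 1" "j = 1" | "i = 1" "2 \<le> j" | "i = 2" | "3 \<le> i" using ij by linarith
    then show "a i j \<in> G (entry_deg pf i j) \<and> d (a i j) = msum a i j"
    proof cases
      case 1
      then show ?thesis using A by (simp add: a_def msum_def entry_deg_def pf_def)
    next
      case 2
      then show ?thesis using a1G a1 ij by auto
    next
      case 3
      then have "a i j \<in> G (entry_deg pf i j)"
        using qG[of 2 j] ij by (auto simp: a_def intro!: \<rho>_G)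
      then show ?thesis using 3 a2 ij by auto
    next
      case 4
      then have "msum a i j = (\<Sum>v\<in>{i..<j}. bar (q i v) \<star> q (Suc v) j)"
        unfolding msum_def by (intro sum.cong) (auto simp: a_def)
      then show ?thesis using qG[of i j] qd[of i j] 4 ij by (auto simp: a_def)
    qed
  qed
  have "msum a 1 k - th h (map (\<lambda>i. a i i) [1..<Suc k]) \<in> D"
    by (rule msum_th_diag[OF good pf sys]) (use k in simp)
  moreover have "map (\<lambda>i. a i i) [1..<Suc k] = ?w"
  proof (rule nth_equalityI)
    fix m assume "m < length (map (\<lambda>i. a i i) [1..<Suc k])"
    then have m: "m < k" by (simp del: upt_Suc)
    have "q i i = (bt # cs) ! (i - 2)" if "2 \<le> i" "i \<le> k" for i
      using that k unfolding q_def by (subst sub_self) (auto simp: numeral_2_eq_2)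
    moreover have "q 2 (Suc (Suc 0)) = bt" by (simp add: q_def sub_def)
    ultimately show "map (\<lambda>i. a i i) [1..<Suc k] ! m = ?w ! m"
      using m by (cases m; cases "m - 1") (auto simp: a_def simp del: upt_Suc)
  qed (use k in \<open>simp del: upt_Suc\<close>)
  moreover have "msum a 1 k \<in> D"
    using D_d[OF a1G[of k]] a1[of k] k by simp
  ultimately show ?thesis
    using D_diff[of "msum a 1 k" "msum a 1 k - th h ?w"] by simp
qed

end

section \<open>The Koszul complex of a monomial quotient\<close>

definition lin :: "('a \<Rightarrow> 'k \<Rightarrow> 'x) \<Rightarrow> ('a \<Rightarrow>\<^sub>0 'k::ab_group_add) \<Rightarrow> 'x::ab_group_add" where
  "lin \<phi> f = (\<Sum>a\<in>Poly_Mapping.keys f. \<phi> a (Poly_Mapping.lookup f a))"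

definition additive_in :: "('a \<Rightarrow> 'k::ab_group_add \<Rightarrow> 'x::ab_group_add) \<Rightarrow> bool" where
  "additive_in \<phi> \<longleftrightarrow> (\<forall>a c c'. \<phi> a (c + c') = \<phi> a c + \<phi> a c')"

lemma additive_in_0: "additive_in \<phi> \<Longrightarrow> \<phi> a 0 = 0"
  unfolding additive_in_def by (metis add_cancel_right_right)

lemma lin_superset:
  assumes "additive_in \<phi>" "finite A" "Poly_Mapping.keys f \<subseteq> A"
  shows "lin \<phi> f = (\<Sum>a\<in>A. \<phi> a (Poly_Mapping.lookup f a))"
  unfolding lin_def
  by (rule sum.mono_neutral_left) (use assms additive_in_0 in \<open>auto simp: in_keys_iff\<close>)

lemma lin_add:
  assumes "additive_in \<phi>"
  shows "lin \<phi> (f + g) = lin \<phi> f + lin \<phi> g"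
proof -
  let ?A = "Poly_Mapping.keys f \<union> Poly_Mapping.keys g"
  have "lin \<phi> (f + g) = (\<Sum>a\<in>?A. \<phi> a (Poly_Mapping.lookup (f + g) a))"
    by (rule lin_superset[OF assms]) (auto simp: Poly_Mapping.keys_add)
  also have "\<dots> = (\<Sum>a\<in>?A. \<phi> a (Poly_Mapping.lookup f a)) + (\<Sum>a\<in>?A. \<phi> a (Poly_Mapping.lookup g a))"
    using assms by (simp add: lookup_add additive_in_def sum.distrib)
  also have "\<dots> = lin \<phi> f + lin \<phi> g"
    by (simp add: lin_superset[OF assms, of ?A])
  finally show ?thesis .
qed

lemma lin_single: "additive_in \<phi> \<Longrightarrow> lin \<phi> (Poly_Mapping.single a c) = \<phi> a c"
  by (cases "c = 0") (auto simp: lin_def additive_in_0)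

definition additive_map :: "('x::ab_group_add \<Rightarrow> 'y::ab_group_add) \<Rightarrow> bool" where
  "additive_map f \<longleftrightarrow> (\<forall>x y. f (x + y) = f x + f y)"

lemma additive_add: "additive_map f \<Longrightarrow> f (x + y) = f x + f y"
  by (simp add: additive_map_def)

lemma additive_0: "additive_map f \<Longrightarrow> f 0 = 0"
  unfolding additive_map_def by (metis add_cancel_right_right)

lemma additive_neg: "additive_map f \<Longrightarrow> f (- x) = - f x"
  by (metis additive_0 additive_add add_eq_0_iff)

lemma additive_diff: "additive_map f \<Longrightarrow> f (x - y) = f x - f y"
  using additive_add[of f x "- y"] additive_neg[of f y] by simp

lemma additive_sum: "additive_map f \<Longrightarrow> f (sum g A) = (\<Sum>i\<in>A. f (g i))"
  by (induction A rule: infinite_finite_induct) (auto simp: additive_0 additive_add)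

lemma additive_sg: "additive_map f \<Longrightarrow> f (sg k x) = sg k (f x)"
  by (simp add: sg_def additive_neg)

lemma additive_sg_fun: "additive_map (sg k)"
  by (simp add: additive_map_def sg_add_right)

lemma additive_lin: "additive_in \<phi> \<Longrightarrow> additive_map (lin \<phi>)"
  by (simp add: additive_map_def lin_add)

lemma sum_singles: "(\<Sum>a\<in>Poly_Mapping.keys f. Poly_Mapping.single a (Poly_Mapping.lookup f a)) = f"
  by (rule poly_mapping_eqI)
     (simp add: lookup_sum lookup_single when_def in_keys_iff sum.delta not_in_keys_iff_lookup_eq_zero)

text \<open>The principle by which identities are reduced to basis elements. As the coefficient
  stays inside \<open>single\<close>, additivity suffices.\<close>

lemma additive_eq_on:
  assumes "additive_map f" "additive_map g" "Poly_Mapping.keys x \<subseteq> K"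
    and "\<And>a c. a \<in> K \<Longrightarrow> f (Poly_Mapping.single a c) = g (Poly_Mapping.single a c)"
  shows "f x = g x"
proof -
  have "f x = f (\<Sum>a\<in>Poly_Mapping.keys x. Poly_Mapping.single a (Poly_Mapping.lookup x a))"
    by (simp add: sum_singles)
  also have "\<dots> = g (\<Sum>a\<in>Poly_Mapping.keys x. Poly_Mapping.single a (Poly_Mapping.lookup x a))"
    using assms by (auto simp: additive_sum intro!: sum.cong)
  also have "\<dots> = g x" by (simp add: sum_singles)
  finally show ?thesis .
qed

lemma additive_eq:
  assumes "additive_map f" "additive_map g"
    and "\<And>a c. f (Poly_Mapping.single a c) = g (Poly_Mapping.single a c)"
  shows "f x = g x"
  by (rule additive_eq_on[where K = UNIV]) (use assms in auto)

lemma keys_sum_sub: "(\<And>i. i \<in> A \<Longrightarrow> Poly_Mapping.keys (f i) \<subseteq> K) \<Longrightarrow> Poly_Mapping.keys (sum f A) \<subseteq> K"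
proof (induction A rule: infinite_finite_induct)
  case (insert x F)
  then have "Poly_Mapping.keys (f x) \<union> Poly_Mapping.keys (sum f F) \<subseteq> K" by auto
  then show ?case unfolding sum.insert[OF insert(1,2)] by (rule order_trans[OF Poly_Mapping.keys_add])
qed auto

lemma additive_eq_pair:
  assumes "additive_map f" "additive_map g"
    and "\<And>a b c. f (Poly_Mapping.single (a, b) c) = g (Poly_Mapping.single (a, b) c)"
  shows "f x = g x"
proof (rule additive_eq[OF assms(1,2)])
  fix p c
  show "f (Poly_Mapping.single p c) = g (Poly_Mapping.single p c)"
    by (cases p) (simp only: assms(3))
qed

lemma additive_keys:
  assumes "additive_map f" "Poly_Mapping.keys x \<subseteq> K"
    and "\<And>a c. a \<in> K \<Longrightarrow> Poly_Mapping.keys (f (Poly_Mapping.single a c)) \<subseteq> K'"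
  shows "Poly_Mapping.keys (f x) \<subseteq> K'"
proof -
  have "f x = f (\<Sum>a\<in>Poly_Mapping.keys x. Poly_Mapping.single a (Poly_Mapping.lookup x a))"
    by (simp add: sum_singles)
  also have "\<dots> = (\<Sum>a\<in>Poly_Mapping.keys x. f (Poly_Mapping.single a (Poly_Mapping.lookup x a)))"
    by (rule additive_sum[OF assms(1)])
  finally have e: "f x = (\<Sum>a\<in>Poly_Mapping.keys x. f (Poly_Mapping.single a (Poly_Mapping.lookup x a)))" .
  show ?thesis unfolding e
    by (rule keys_sum_sub, rule assms(3)) (use assms(2) in blast)
qed

lemma keys_sg [simp]: "Poly_Mapping.keys (sg k x) = Poly_Mapping.keys x"
  by (simp add: sg_def)

lemma single_sg: "Poly_Mapping.single a (sg k c) = sg k (Poly_Mapping.single a c)"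
  by (simp add: sg_def single_uminus)

lemma sg_mult: "sg j a * sg k b = sg (j + k) (a * b :: 'k::ring)"
  by (simp add: sg_def)

lemma sg_mult_left: "sg j a * b = sg j (a * b :: 'k::ring)" and sg_mult_right: "a * sg j b = sg j (a * b)"
  by (simp_all add: sg_def)

section \<open>The Koszul algebra on monomials times exterior monomials\<close>

type_synonym mono = "nat \<Rightarrow>\<^sub>0 nat"
type_synonym 'k kel = "(mono \<times> nat set) \<Rightarrow>\<^sub>0 'k"

definition xvar :: "nat \<Rightarrow> mono" where "xvar i = Poly_Mapping.single i 1"

lemma keys_xvar [simp]: "Poly_Mapping.keys (xvar i) = {i}"
  by (simp add: xvar_def)

definition below :: "nat set \<Rightarrow> nat \<Rightarrow> nat" where "below I i = card {j \<in> I. j < i}"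

text \<open>An element of \<open>'k kel\<close> is a linear combination of the \<open>x^m e_I\<close>, encoded as \<open>(m, I)\<close>. For a set
  \<open>N\<close> of monomials spanning an ideal, the operations below are those of the Koszul complex modulo \<open>N\<close>;
  the products with \<open>e_I\<close> for infinite \<open>I\<close> are set to \<open>0\<close> to make all identities unconditional.\<close>

definition kbase :: "mono set \<Rightarrow> mono \<times> nat set \<Rightarrow> 'k::field \<Rightarrow> mono \<times> nat set \<Rightarrow> 'k \<Rightarrow> 'k kel" where
  "kbase N = (\<lambda>(m, I) a (m', J) b. if finite I \<and> finite J \<and> I \<inter> J = {} \<and> m + m' \<notin> N
     then Poly_Mapping.single (m + m', I \<union> J) (sg (inversions I J) (a * b)) else 0)"

definition kmul :: "mono set \<Rightarrow> 'k::field kel \<Rightarrow> 'k kel \<Rightarrow> 'k kel" where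
  "kmul N x y = lin (\<lambda>p a. lin (kbase N p a) y) x"

definition kdif :: "mono set \<Rightarrow> 'k::field kel \<Rightarrow> 'k kel" where
  "kdif N = lin (\<lambda>(m, I) a. \<Sum>i\<in>I. if m + xvar i \<notin> N
     then Poly_Mapping.single (m + xvar i, I - {i}) (sg (below I i) a) else 0)"

definition kbar :: "'k::field kel \<Rightarrow> 'k kel" where
  "kbar = lin (\<lambda>(m, I) a. Poly_Mapping.single (m, I) (sg (Suc (card I)) a))"

definition restr :: "'a set \<Rightarrow> ('a \<Rightarrow>\<^sub>0 'k::ab_group_add) \<Rightarrow> ('a \<Rightarrow>\<^sub>0 'k)" where
  "restr K = lin (\<lambda>a c. if a \<in> K then Poly_Mapping.single a c else 0)"

lemma additive_in_kbase: "additive_in (kbase N p a)"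
  by (auto simp: additive_in_def kbase_def single_add sg_add_right algebra_simps split: prod.splits)

lemma kbase_add_left: "kbase N p (a + a') q b = kbase N p a q b + kbase N p a' q b"
  by (auto simp: kbase_def single_add sg_add_right algebra_simps split: prod.splits)

lemma additive_in_kbase_left: "additive_in (\<lambda>p a. lin (kbase N p a) y)"
  by (simp add: additive_in_def lin_def sum.distrib kbase_add_left)

lemma kmul_add_left: "kmul N (x + x') y = kmul N x y + kmul N x' y"
  unfolding kmul_def by (rule lin_add[OF additive_in_kbase_left])

lemma kmul_add_right: "kmul N x (y + y') = kmul N x y + kmul N x y'"
  by (simp add: kmul_def lin_add[OF additive_in_kbase]) (simp add: lin_def sum.distrib)

lemma kmul_single: "kmul N (Poly_Mapping.single (m, I) a) (Poly_Mapping.single (m', J) b) =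
   (if finite I \<and> finite J \<and> I \<inter> J = {} \<and> m + m' \<notin> N
     then Poly_Mapping.single (m + m', I \<union> J) (sg (inversions I J) (a * b)) else 0)"
  unfolding kmul_def
  by (subst lin_single[OF additive_in_kbase_left], subst lin_single[OF additive_in_kbase]) (simp add: kbase_def)

lemma additive_kmul_left: "additive_map (\<lambda>x. kmul N x y)" and additive_kmul_right: "additive_map (kmul N x)"
  by (simp_all add: additive_map_def kmul_add_left kmul_add_right)

lemma additive_in_kdif: "additive_in (\<lambda>(m, I) a. \<Sum>i\<in>I. if m + xvar i \<notin> N
     then Poly_Mapping.single (m + xvar i, I - {i}) (sg (below I i) (a::'k::field)) else 0)"
  by (auto simp: additive_in_def single_add sg_add_right sum.distrib[symmetric] intro!: sum.cong)

lemma additive_kdif: "additive_map (kdif N)"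
  unfolding kdif_def by (rule additive_lin[OF additive_in_kdif])

lemma kdif_single: "kdif N (Poly_Mapping.single (m, I) a) = (\<Sum>i\<in>I. if m + xvar i \<notin> N
     then Poly_Mapping.single (m + xvar i, I - {i}) (sg (below I i) a) else 0)"
  unfolding kdif_def by (subst lin_single[OF additive_in_kdif]) simp

lemma additive_in_kbar: "additive_in (\<lambda>(m, I) a. Poly_Mapping.single (m, I) (sg (Suc (card I)) (a::'k::field)))"
  by (auto simp: additive_in_def single_add sg_add_right)

lemma additive_kbar: "additive_map kbar"
  unfolding kbar_def by (rule additive_lin[OF additive_in_kbar])

lemma kbar_single: "kbar (Poly_Mapping.single (m, I) a) = Poly_Mapping.single (m, I) (sg (Suc (card I)) a)"
  unfolding kbar_def by (subst lin_single[OF additive_in_kbar]) simp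

lemma additive_in_restr: "additive_in (\<lambda>a c. if a \<in> K then Poly_Mapping.single a c else 0)"
  by (auto simp: additive_in_def single_add)

lemma additive_restr: "additive_map (restr K)"
  unfolding restr_def by (rule additive_lin[OF additive_in_restr])

lemma restr_single: "restr K (Poly_Mapping.single a c) = (if a \<in> K then Poly_Mapping.single a c else 0)"
  unfolding restr_def by (rule lin_single[OF additive_in_restr])

lemma lookup_restr: "Poly_Mapping.lookup (restr K x) a = (if a \<in> K then Poly_Mapping.lookup x a else 0)"
  unfolding restr_def lin_def lookup_sum
  by (subst sum.cong[OF refl, where h = "\<lambda>b. if b = a then (if a \<in> K then Poly_Mapping.lookup x a else 0) else 0"])
     (auto simp: lookup_single when_def in_keys_iff)

lemma keys_restr: "Poly_Mapping.keys (restr K x) = Poly_Mapping.keys x \<inter> K"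
  by (auto simp: in_keys_iff lookup_restr split: if_splits)

lemma restr_id: "Poly_Mapping.keys x \<subseteq> K \<Longrightarrow> restr K x = x"
  by (rule poly_mapping_eqI) (auto simp: lookup_restr in_keys_iff)

lemma restr_sum_partition:
  assumes "finite S" "f ` Poly_Mapping.keys x \<subseteq> S"
  shows "x = (\<Sum>s\<in>S. restr {a. f a = s} x)"
proof (rule poly_mapping_eqI)
  fix a
  have "Poly_Mapping.lookup (\<Sum>s\<in>S. restr {a. f a = s} x) a = (\<Sum>s\<in>S. if s = f a then Poly_Mapping.lookup x a else 0)"
    by (auto simp: lookup_sum lookup_restr intro!: sum.cong)
  also have "\<dots> = Poly_Mapping.lookup x a"
  proof (cases "f a \<in> S")
    case False
    then have "a \<notin> Poly_Mapping.keys x" using assms by auto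
    then show ?thesis using False by (auto simp: in_keys_iff intro!: sum.neutral)
  qed (use assms in \<open>simp add: sum.delta\<close>)
  finally show "Poly_Mapping.lookup x a = Poly_Mapping.lookup (\<Sum>s\<in>S. restr {a. f a = s} x) a" ..
qed

lemma inversions_Un_left: "finite I \<Longrightarrow> finite J \<Longrightarrow> finite L \<Longrightarrow> I \<inter> J = {} \<Longrightarrow>
    inversions (I \<union> J) L = inversions I L + inversions J L"
  unfolding inversions_def
  by (subst card_Un_disjoint[symmetric]) (auto intro!: arg_cong[where f = card] intro: finite_subset[of _ "(I \<union> J) \<times> L"])

lemma inversions_Un_right: "finite I \<Longrightarrow> finite J \<Longrightarrow> finite L \<Longrightarrow> J \<inter> L = {} \<Longrightarrow>
    inversions I (J \<union> L) = inversions I J + inversions I L"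
  unfolding inversions_def
  by (subst card_Un_disjoint[symmetric]) (auto intro!: arg_cong[where f = card] intro: finite_subset[of _ "I \<times> (J \<union> L)"])

lemma inversions_single_left: "inversions {i} J = below J i"
  unfolding inversions_def below_def
  by (rule bij_betw_same_card[where f = snd]) (auto simp: bij_betw_def inj_on_def image_def)

definition above :: "nat set \<Rightarrow> nat \<Rightarrow> nat" where "above I i = card {j \<in> I. i < j}"

lemma inversions_single_right: "inversions I {i} = above I i"
  unfolding inversions_def above_def
  by (rule bij_betw_same_card[where f = fst]) (auto simp: bij_betw_def inj_on_def image_def)

lemma inversions_empty [simp]: "inversions {} J = 0" "inversions I {} = 0"
  by (simp_all add: inversions_def)

lemma inversions_remove_left: "finite I \<Longrightarrow> finite J \<Longrightarrow> i \<in> I \<Longrightarrow>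
    inversions I J = inversions (I - {i}) J + below J i"
  using inversions_Un_left[of "I - {i}" "{i}" J] by (simp add: insert_absorb inversions_single_left)

lemma inversions_remove_right: "finite I \<Longrightarrow> finite J \<Longrightarrow> i \<in> J \<Longrightarrow>
    inversions I J = inversions I (J - {i}) + above I i"
  using inversions_Un_right[of I "J - {i}" "{i}"] by (simp add: insert_absorb inversions_single_right)

lemma inversions_comm: "finite I \<Longrightarrow> finite J \<Longrightarrow> I \<inter> J = {} \<Longrightarrow> inversions I J + inversions J I = card I * card J"
proof -
  assume f: "finite I" "finite J" "I \<inter> J = {}"
  have "inversions J I = card {(i, j) \<in> I \<times> J. i < j}"
    unfolding inversions_def
    by (rule bij_betw_same_card[where f = "\<lambda>(a, b). (b, a)"]) (auto simp: bij_betw_def inj_on_def image_def)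
  then have "inversions I J + inversions J I = card ({(i, j) \<in> I \<times> J. j < i} \<union> {(i, j) \<in> I \<times> J. i < j})"
    unfolding inversions_def using f
    by (subst card_Un_disjoint) (auto intro: finite_subset[of _ "I \<times> J"])
  also have "{(i, j) \<in> I \<times> J. j < i} \<union> {(i, j) \<in> I \<times> J. i < j} = I \<times> J"
    using f(3) by force
  finally show ?thesis by (simp add: card_cartesian_product)
qed

lemma below_Un: "finite I \<Longrightarrow> finite J \<Longrightarrow> I \<inter> J = {} \<Longrightarrow> below (I \<union> J) i = below I i + below J i"
  unfolding below_def
  by (subst card_Un_disjoint[symmetric]) (auto intro!: arg_cong[where f = card])

lemma below_above: "finite I \<Longrightarrow> i \<notin> I \<Longrightarrow> below I i + above I i = card I"
  unfolding below_def above_def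
  by (subst card_Un_disjoint[symmetric]) (auto intro!: arg_cong[where f = card], metis linorder_neqE_nat)

lemma below_remove: "finite I \<Longrightarrow> j \<in> I \<Longrightarrow> below I i = below (I - {j}) i + (if j < i then 1 else 0)"
proof -
  assume I: "finite I" "j \<in> I"
  have "below I i = below (I - {j}) i + below {j} i"
    using below_Un[of "I - {j}" "{j}" i] I by (simp add: insert_absorb)
  also have "below {j} i = (if j < i then 1 else 0)"
    by (simp add: below_def Collect_conv_if)
  finally show ?thesis .
qed

lemma above_remove_self: "above (I - {i}) i = above I i" and below_remove_self: "below (I - {i}) i = below I i"
  unfolding above_def below_def by (auto intro!: arg_cong[where f = card])

lemma additive_comps:
  "additive_map (\<lambda>x. x)"
  "additive_map f \<Longrightarrow> additive_map (\<lambda>x. kmul N (f x) y)"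
  "additive_map f \<Longrightarrow> additive_map (\<lambda>x. kmul N z (f x))"
  "additive_map f \<Longrightarrow> additive_map (\<lambda>x. kdif N (f x))"
  "additive_map f \<Longrightarrow> additive_map (\<lambda>x. kbar (f x))"
  "additive_map f \<Longrightarrow> additive_map (\<lambda>x. restr K (f x))"
  "additive_map g \<Longrightarrow> additive_map (\<lambda>x. - g x)"
  "additive_map g \<Longrightarrow> additive_map (\<lambda>x. sg k (g x))"
  "additive_map g \<Longrightarrow> additive_map g' \<Longrightarrow> additive_map (\<lambda>x. g x + g' x)"
  "additive_map g \<Longrightarrow> additive_map g' \<Longrightarrow> additive_map (\<lambda>x. g x - g' x)"
  "additive_map (\<lambda>x. 0)"
  by (simp_all add: additive_map_def kmul_add_left kmul_add_right additive_add[OF additive_kdif]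
      additive_add[OF additive_kbar] additive_add[OF additive_restr] sg_add_right)

text \<open>Closure under multiplication by monomials: the form in which a monomial ideal enters the
  algebra.\<close>

definition upset :: "mono set \<Rightarrow> bool" where "upset N \<longleftrightarrow> (\<forall>m m'. m \<in> N \<longrightarrow> m + m' \<in> N)"

lemma upsetD: "upset N \<Longrightarrow> m \<in> N \<Longrightarrow> m + m' \<in> N" "upset N \<Longrightarrow> m' \<in> N \<Longrightarrow> m + m' \<in> N"
  by (auto simp: upset_def) (metis add.commute)

lemma single_cong_sg: "even j = even k \<Longrightarrow> a = a' \<Longrightarrow> Poly_Mapping.single a (sg j c) = Poly_Mapping.single a' (sg k c)"
  by (simp add: sg_def)

lemma kmul_0 [simp]: "kmul N 0 y = 0" "kmul N x 0 = 0"
  using additive_0[OF additive_kmul_left] additive_0[OF additive_kmul_right] by auto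

lemma kdif_0 [simp]: "kdif N 0 = 0" by (rule additive_0[OF additive_kdif])

lemma kbar_0 [simp]: "kbar 0 = 0" by (rule additive_0[OF additive_kbar])

lemma kmul_assoc:
  fixes x y z :: "'k::field kel"
  assumes "upset N"
  shows "kmul N (kmul N x y) z = kmul N x (kmul N y z)"
proof (rule additive_eq_pair[where x = x])
  fix m :: mono and I and a :: 'k
  show "kmul N (kmul N (Poly_Mapping.single (m, I) a) y) z = kmul N (Poly_Mapping.single (m, I) a) (kmul N y z)"
  proof (rule additive_eq_pair[where x = y])
    fix m' :: mono and J and b :: 'k
    show "kmul N (kmul N (Poly_Mapping.single (m, I) a) (Poly_Mapping.single (m', J) b)) z =
       kmul N (Poly_Mapping.single (m, I) a) (kmul N (Poly_Mapping.single (m', J) b) z)"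
    proof (rule additive_eq_pair[where x = z])
      fix m'' :: mono and L and c :: 'k
      show "kmul N (kmul N (Poly_Mapping.single (m, I) a) (Poly_Mapping.single (m', J) b)) (Poly_Mapping.single (m'', L) c) =
         kmul N (Poly_Mapping.single (m, I) a) (kmul N (Poly_Mapping.single (m', J) b) (Poly_Mapping.single (m'', L) c))"
      proof (cases "finite I \<and> finite J \<and> finite L \<and> I \<inter> J = {} \<and> I \<inter> L = {} \<and> J \<inter> L = {} \<and> m + m' + m'' \<notin> N")
        case True
        then have "m + m' \<notin> N" "m' + m'' \<notin> N"
          using upsetD[OF assms] by (metis add.assoc)+
        with True show ?thesis
          by (auto simp: kmul_single Int_Un_distrib Int_Un_distrib2 Un_assoc add.assoc sg_mult_left sg_mult_right
              sg_sg inversions_Un_left inversions_Un_right mult.assoc intro!: single_cong_sg)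
      next
        case False
        then show ?thesis
          by (auto simp: kmul_single add.assoc Int_Un_distrib Int_Un_distrib2)
      qed
    qed (intro additive_comps)+
  qed (intro additive_comps)+
qed (intro additive_comps)+

lemma kbar_kbar:
  fixes x :: "'k::field kel"
  shows "kbar (kbar x) = x"
proof (rule additive_eq_pair[where x = x])
  fix m :: mono and I and a :: 'k
  show "kbar (kbar (Poly_Mapping.single (m, I) a)) = Poly_Mapping.single (m, I) a"
    by (simp add: kbar_single)
qed (intro additive_comps)+

lemma kbar_kmul:
  fixes x y :: "'k::field kel"
  shows "kbar (kmul N x y) = - kmul N (kbar x) (kbar y)"
proof (rule additive_eq_pair[where x = x])
  fix m :: mono and I and a :: 'k
  show "kbar (kmul N (Poly_Mapping.single (m, I) a) y) = - kmul N (kbar (Poly_Mapping.single (m, I) a)) (kbar y)"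
  proof (rule additive_eq_pair[where x = y])
    fix m' :: mono and J and b :: 'k
    show "kbar (kmul N (Poly_Mapping.single (m, I) a) (Poly_Mapping.single (m', J) b)) =
       - kmul N (kbar (Poly_Mapping.single (m, I) a)) (kbar (Poly_Mapping.single (m', J) b))"
      by (auto simp: kmul_single kbar_single card_Un_disjoint sg_mult sg_sg sg_Suc single_uminus[symmetric]
          sg_minus[symmetric] intro!: single_cong_sg)
  qed (intro additive_comps)+
qed (intro additive_comps)+

lemma kbar_kdif:
  fixes x :: "'k::field kel"
  shows "kbar (kdif N x) = - kdif N (kbar x)"
proof (rule additive_eq_pair[where x = x])
  fix m :: mono and I and a :: 'k
  show "kbar (kdif N (Poly_Mapping.single (m, I) a)) = - kdif N (kbar (Poly_Mapping.single (m, I) a))"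
  proof (cases "finite I")
    case True
    have "kbar (if m + xvar i \<notin> N then Poly_Mapping.single (m + xvar i, I - {i}) (sg (below I i) a) else 0) =
        - (if m + xvar i \<notin> N then Poly_Mapping.single (m + xvar i, I - {i}) (sg (below I i) (sg (Suc (card I)) a)) else 0)"
      if "i \<in> I" for i
    proof -
      have "card I = Suc (card (I - {i}))" using True that by (metis card_Suc_Diff1)
      then show ?thesis
        by (auto simp: kbar_single sg_sg single_uminus[symmetric] sg_Suc[symmetric] intro!: single_cong_sg)
    qed
    then show ?thesis
      by (simp add: kdif_single kbar_single additive_sum[OF additive_kbar] sum_negf[symmetric] cong: sum.cong)
  qed (simp add: kdif_single kbar_single)
qed (intro additive_comps)+

lemma antisymmetric_sum:
  fixes f :: "nat \<Rightarrow> nat \<Rightarrow> 'x::ab_group_add"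
  assumes "finite I" "\<And>i j. i \<in> I \<Longrightarrow> j \<in> I \<Longrightarrow> i \<noteq> j \<Longrightarrow> f j i = - f i j"
  shows "(\<Sum>i\<in>I. \<Sum>j\<in>I - {i}. f i j) = 0"
proof -
  have "(\<Sum>j\<in>I - {i}. f i j) = (\<Sum>j\<in>{j \<in> I. j < i}. f i j) + (\<Sum>j\<in>{j \<in> I. i < j}. f i j)" for i
    using assms(1) by (subst sum.union_disjoint[symmetric]) (auto intro!: sum.cong)
  then have "(\<Sum>i\<in>I. \<Sum>j\<in>I - {i}. f i j) =
      (\<Sum>i\<in>I. \<Sum>j\<in>{j \<in> I. j < i}. f i j) + (\<Sum>i\<in>I. \<Sum>j\<in>{j \<in> I. i < j}. f i j)"
    by (simp add: sum.distrib)
  also have "(\<Sum>i\<in>I. \<Sum>j\<in>{j \<in> I. i < j}. f i j) = (\<Sum>j\<in>I. \<Sum>i\<in>{i \<in> I. i < j}. f i j)"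
    by (rule sum.swap_restrict) (use assms in auto)
  also have "\<dots> = - (\<Sum>i\<in>I. \<Sum>j\<in>{j \<in> I. j < i}. f i j)"
    unfolding sum_negf[symmetric] by (intro sum.cong refl assms(2)) auto
  finally show ?thesis by simp
qed

lemma kdif_kdif:
  fixes x :: "'k::field kel"
  assumes "upset N"
  shows "kdif N (kdif N x) = 0"
proof (rule additive_eq_pair[where x = x and g = "\<lambda>x. 0"])
  fix m :: mono and I and a :: 'k
  define f where "f i j = (if m + xvar i + xvar j \<notin> N
     then Poly_Mapping.single (m + xvar i + xvar j, I - {i} - {j}) (sg (below (I - {i}) j + below I i) a) else 0)" for i j
  have "kdif N (if m + xvar i \<notin> N then Poly_Mapping.single (m + xvar i, I - {i}) (sg (below I i) a) else 0) =
      (\<Sum>j\<in>I - {i}. f i j)" for i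
  proof (cases "m + xvar i \<in> N")
    case True
    then show ?thesis using upsetD(1)[OF assms True] by (simp add: f_def)
  qed (simp add: kdif_single sg_sg f_def cong: if_cong)
  then have "kdif N (kdif N (Poly_Mapping.single (m, I) a)) = (\<Sum>i\<in>I. \<Sum>j\<in>I - {i}. f i j)"
    by (simp add: kdif_single additive_sum[OF additive_kdif])
  also have "\<dots> = 0"
  proof (cases "finite I")
    case True
    show ?thesis
    proof (rule antisymmetric_sum[OF True])
      fix i j assume ij: "i \<in> I" "j \<in> I" "i \<noteq> j"
      have "odd (below (I - {i}) j + below I i) = even (below (I - {j}) i + below I j)"
        using below_remove[OF True ij(1), of j] below_remove[OF True ij(2), of i] ij(3) by auto
      then have "sg (below (I - {j}) i + below I j) a = - sg (below (I - {i}) j + below I i) a"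
        by (auto simp: sg_def)
      moreover have "m + xvar j + xvar i = m + xvar i + xvar j" "I - {j} - {i} = I - {i} - {j}"
        by (auto simp: ac_simps)
      ultimately show "f j i = - f i j" by (simp add: f_def single_uminus)
    qed
  qed simp
  finally show "kdif N (kdif N (Poly_Mapping.single (m, I) a)) = 0" .
qed (intro additive_comps)+

text \<open>For disjoint I and J the terms match one by one. If I and J share exactly one index l,
  the product is 0 and the two ways of removing l cancel. With more shared indices every term is
  0.\<close>

lemma kdif_kmul_single:
  assumes up: "upset N"
  shows "kdif N (kmul N (Poly_Mapping.single (m, I) a) (Poly_Mapping.single (m', J) b)) =
    kmul N (kdif N (Poly_Mapping.single (m, I) a)) (Poly_Mapping.single (m', J) b) -
    kmul N (kbar (Poly_Mapping.single (m, I) a)) (kdif N (Poly_Mapping.single (m', J) b))"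
proof (cases "finite I \<and> finite J")
  case False
  have "kmul N (Poly_Mapping.single (m, I) a) (Poly_Mapping.single (m', J) b) = 0"
    using False by (auto simp: kmul_single)
  moreover have "kmul N (kdif N (Poly_Mapping.single (m, I) a)) (Poly_Mapping.single (m', J) b) = 0"
    using False by (cases "finite I")
      (auto simp: kdif_single additive_sum[OF additive_kmul_left] kmul_single intro!: sum.neutral)
  moreover have "kmul N (kbar (Poly_Mapping.single (m, I) a)) (kdif N (Poly_Mapping.single (m', J) b)) = 0"
    using False by (cases "finite J")
      (auto simp: kdif_single kbar_single additive_sum[OF additive_kmul_right] kmul_single intro!: sum.neutral)
  ultimately show ?thesis by simp
next
  case True
  then have fin: "finite I" "finite J" by auto
  define M where "M i = m + m' + xvar i" for i
  define L where "L i = (if (I - {i}) \<inter> J = {} \<and> M i \<notin> N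
     then Poly_Mapping.single (M i, (I - {i}) \<union> J) (sg (below I i + inversions (I - {i}) J) (a * b)) else 0)" for i
  define R where "R i = (if I \<inter> (J - {i}) = {} \<and> M i \<notin> N
     then Poly_Mapping.single (M i, I \<union> (J - {i})) (sg (card I + below J i + inversions I (J - {i})) (a * b)) else 0)" for i
  have "kmul N (if m + xvar i \<notin> N then Poly_Mapping.single (m + xvar i, I - {i}) (sg (below I i) a) else 0)
      (Poly_Mapping.single (m', J) b) = L i" for i
  proof (cases "m + xvar i \<in> N")
    case True
    then have "M i \<in> N" using upsetD(1)[OF up True, of m'] by (simp add: M_def ac_simps)
    with True show ?thesis by (simp add: L_def)
  next
    case False
    have "m + xvar i + m' = M i" by (simp add: M_def ac_simps)
    then show ?thesis using False fin
      by (auto simp: kmul_single L_def sg_mult_left sg_sg intro!: single_cong_sg)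
  qed
  then have 1: "kmul N (kdif N (Poly_Mapping.single (m, I) a)) (Poly_Mapping.single (m', J) b) = (\<Sum>i\<in>I. L i)"
    by (simp add: kdif_single additive_sum[OF additive_kmul_left])
  have "kmul N (kbar (Poly_Mapping.single (m, I) a))
      (if m' + xvar i \<notin> N then Poly_Mapping.single (m' + xvar i, J - {i}) (sg (below J i) b) else 0) = - R i" for i
  proof (cases "m' + xvar i \<in> N")
    case True
    then have "M i \<in> N" using upsetD(2)[OF up True, of m] by (simp add: M_def ac_simps)
    with True show ?thesis by (simp add: R_def)
  next
    case False
    have "m + (m' + xvar i) = M i" by (simp add: M_def ac_simps)
    then show ?thesis using False fin
      by (auto simp: kbar_single kmul_single R_def sg_mult sg_sg single_uminus[symmetric] sg_Suc[symmetric]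
          intro!: single_cong_sg)
  qed
  then have 2: "- kmul N (kbar (Poly_Mapping.single (m, I) a)) (kdif N (Poly_Mapping.single (m', J) b)) = (\<Sum>i\<in>J. R i)"
    by (simp add: kdif_single additive_sum[OF additive_kmul_right] sum_negf)
  have "kdif N (kmul N (Poly_Mapping.single (m, I) a) (Poly_Mapping.single (m', J) b)) = (\<Sum>i\<in>I. L i) + (\<Sum>i\<in>J. R i)"
  proof (cases "I \<inter> J = {}")
    case disj: True
    have LI: "L i = (if M i \<notin> N then Poly_Mapping.single (M i, (I \<union> J) - {i}) (sg (below (I \<union> J) i + inversions I J) (a * b)) else 0)"
      if "i \<in> I" for i
    proof -
      have s: "(I - {i}) \<union> J = (I \<union> J) - {i}" "(I - {i}) \<inter> J = {}" using disj that by auto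
      show ?thesis unfolding L_def s using inversions_remove_left[OF fin that] below_Un[OF fin disj, of i]
        by (auto intro!: single_cong_sg)
    qed
    have RJ: "R i = (if M i \<notin> N then Poly_Mapping.single (M i, (I \<union> J) - {i}) (sg (below (I \<union> J) i + inversions I J) (a * b)) else 0)"
      if "i \<in> J" for i
    proof -
      have i: "i \<notin> I" using disj that by auto
      then have s: "I \<union> (J - {i}) = (I \<union> J) - {i}" "I \<inter> (J - {i}) = {}" using disj by auto
      show ?thesis unfolding R_def s
        using inversions_remove_right[OF fin that] below_Un[OF fin disj, of i] below_above[OF fin(1) i, symmetric]
        by (auto intro!: single_cong_sg)
    qed
    show ?thesis
    proof (cases "m + m' \<in> N")
      case True
      then have "M i \<in> N" for i using upsetD(1)[OF up] by (simp add: M_def)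
      then show ?thesis using True by (simp add: kmul_single L_def R_def)
    next
      case False
      have "kdif N (kmul N (Poly_Mapping.single (m, I) a) (Poly_Mapping.single (m', J) b)) =
        (\<Sum>i\<in>I \<union> J. if M i \<notin> N then Poly_Mapping.single (M i, (I \<union> J) - {i}) (sg (below (I \<union> J) i + inversions I J) (a * b)) else 0)"
        using False fin disj by (auto simp: kmul_single kdif_single sg_sg M_def intro!: sum.cong)
      also have "\<dots> = (\<Sum>i\<in>I. L i) + (\<Sum>i\<in>J. R i)"
        by (simp add: sum.union_disjoint[OF fin disj] LI RJ cong: sum.cong)
      finally show ?thesis .
    qed
  next
    case nd: False
    then obtain l where l: "l \<in> I" "l \<in> J" by auto
    have L0: "(\<Sum>i\<in>I. L i) = L l"
    proof (subst sum.remove[OF fin(1) l(1)])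
      have "L i = 0" if "i \<in> I - {l}" for i using l that by (auto simp: L_def)
      then show "L l + sum L (I - {l}) = L l" by simp
    qed
    have R0: "(\<Sum>i\<in>J. R i) = R l"
    proof (subst sum.remove[OF fin(2) l(2)])
      have "R i = 0" if "i \<in> J - {l}" for i using l that by (auto simp: R_def)
      then show "R l + sum R (J - {l}) = R l" by simp
    qed
    have "L l + R l = 0"
    proof (cases "(I - {l}) \<inter> J = {}")
      case True
      then have s: "I \<inter> (J - {l}) = {}" "I \<union> (J - {l}) = (I - {l}) \<union> J" using l by auto
      have "inversions (I - {l}) J = inversions (I - {l}) (J - {l}) + above I l"
        using inversions_remove_right[of "I - {l}" J l] fin l above_remove_self by simp
      moreover have "inversions I (J - {l}) = inversions (I - {l}) (J - {l}) + below J l"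
        using inversions_remove_left[of I "J - {l}" l] fin l below_remove_self by simp
      moreover have "Suc (below I l + above I l) = card I"
        using below_above[of "I - {l}" l] fin l above_remove_self[of I l] below_remove_self[of I l]
        by (metis Diff_iff card_Suc_Diff1 finite_Diff singletonI)
      ultimately have "odd (below I l + inversions (I - {l}) J) = even (card I + below J l + inversions I (J - {l}))"
        by presburger
      then have "sg (below I l + inversions (I - {l}) J) (a * b) = - sg (card I + below J l + inversions I (J - {l})) (a * b)"
        by (auto simp: sg_def)
      then show ?thesis using True s by (simp add: L_def R_def single_uminus)
    next
      case False
      then have "I \<inter> (J - {l}) \<noteq> {}" by auto
      then show ?thesis using False by (simp add: L_def R_def)
    qed
    then show ?thesis using nd L0 R0 by (simp add: kmul_single)
  qed
  then show ?thesis using 1 2 by simp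
qed

lemma kdif_kmul:
  fixes x y :: "'k::field kel"
  assumes "upset N"
  shows "kdif N (kmul N x y) = kmul N (kdif N x) y - kmul N (kbar x) (kdif N y)"
proof (rule additive_eq_pair[where x = x])
  fix m :: mono and I and a :: 'k
  show "kdif N (kmul N (Poly_Mapping.single (m, I) a) y) =
     kmul N (kdif N (Poly_Mapping.single (m, I) a)) y - kmul N (kbar (Poly_Mapping.single (m, I) a)) (kdif N y)"
  proof (rule additive_eq_pair[where x = y])
    fix m' :: mono and J and b :: 'k
    show "kdif N (kmul N (Poly_Mapping.single (m, I) a) (Poly_Mapping.single (m', J) b)) =
       kmul N (kdif N (Poly_Mapping.single (m, I) a)) (Poly_Mapping.single (m', J) b) -
       kmul N (kbar (Poly_Mapping.single (m, I) a)) (kdif N (Poly_Mapping.single (m', J) b))"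
      by (rule kdif_kmul_single[OF assms])
  qed (intro additive_comps)+
qed (intro additive_comps)+

definition kbasis :: "nat \<Rightarrow> mono set \<Rightarrow> (mono \<times> nat set) set" where
  "kbasis n N = {(m, I). Poly_Mapping.keys m \<subseteq> {..<n} \<and> I \<subseteq> {..<n} \<and> m \<notin> N}"

definition kC :: "nat \<Rightarrow> mono set \<Rightarrow> 'k::field kel set" where
  "kC n N = {x. Poly_Mapping.keys x \<subseteq> kbasis n N}"

definition kG :: "nat \<Rightarrow> mono set \<Rightarrow> nat \<Rightarrow> 'k::field kel set" where
  "kG n N p = {x. Poly_Mapping.keys x \<subseteq> kbasis n N \<inter> {(m, I). card I = p}}"

lemma keys_add_sub: "Poly_Mapping.keys x \<subseteq> K \<Longrightarrow> Poly_Mapping.keys y \<subseteq> K \<Longrightarrow> Poly_Mapping.keys (x + y) \<subseteq> K"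
  by (meson Poly_Mapping.keys_add Un_least order_trans)

lemma keys_kdif:
  assumes "Poly_Mapping.keys x \<subseteq> K"
    and "\<And>m I i. (m, I) \<in> K \<Longrightarrow> finite I \<Longrightarrow> i \<in> I \<Longrightarrow> m + xvar i \<notin> N \<Longrightarrow> (m + xvar i, I - {i}) \<in> K'"
  shows "Poly_Mapping.keys (kdif N x) \<subseteq> K'"
proof (rule additive_keys[OF additive_kdif assms(1)])
  fix p and a :: 'a assume p: "p \<in> K"
  obtain m I where mI: "p = (m, I)" by (cases p)
  have "Poly_Mapping.keys (if m + xvar i \<notin> N then Poly_Mapping.single (m + xvar i, I - {i}) (sg (below I i) a) else 0) \<subseteq> K'"
    if "i \<in> I" "finite I" for i
    using assms(2)[of m I i] p mI that by auto
  then show "Poly_Mapping.keys (kdif N (Poly_Mapping.single p a)) \<subseteq> K'"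
    unfolding mI kdif_single by (cases "finite I") (rule keys_sum_sub, blast, simp)
qed

lemma keys_kmul:
  assumes "Poly_Mapping.keys x \<subseteq> K" "Poly_Mapping.keys y \<subseteq> L"
    and "\<And>m I m' J. (m, I) \<in> K \<Longrightarrow> (m', J) \<in> L \<Longrightarrow> finite I \<Longrightarrow> finite J \<Longrightarrow> I \<inter> J = {} \<Longrightarrow> m + m' \<notin> N \<Longrightarrow>
      (m + m', I \<union> J) \<in> K'"
  shows "Poly_Mapping.keys (kmul N x y) \<subseteq> K'"
proof (rule additive_keys[OF additive_kmul_left assms(1)])
  fix p and a :: 'a assume p: "p \<in> K"
  show "Poly_Mapping.keys (kmul N (Poly_Mapping.single p a) y) \<subseteq> K'"
  proof (rule additive_keys[OF additive_kmul_right assms(2)])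
    fix q and b :: 'a assume q: "q \<in> L"
    obtain m I m' J where "p = (m, I)" "q = (m', J)" by (cases p; cases q) blast
    then show "Poly_Mapping.keys (kmul N (Poly_Mapping.single p a) (Poly_Mapping.single q b)) \<subseteq> K'"
      using p q assms(3)[of m I m' J] by (simp add: kmul_single)
  qed
qed

lemma keys_kbar: "Poly_Mapping.keys (kbar x) \<subseteq> Poly_Mapping.keys x"
  by (rule additive_keys[OF additive_kbar order_refl]) (auto simp: kbar_single split: if_splits)

lemma keys_mono_add: "Poly_Mapping.keys m \<subseteq> {..<n} \<Longrightarrow> Poly_Mapping.keys m' \<subseteq> {..<n} \<Longrightarrow> Poly_Mapping.keys (m + m' :: mono) \<subseteq> {..<n}"
  by (rule keys_add_sub)

lemma kbasis_fin: "(m, I) \<in> kbasis n N \<Longrightarrow> finite I"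
  unfolding kbasis_def by (auto intro: finite_subset)

lemma kbasis_kdif: "(m, I) \<in> kbasis n N \<Longrightarrow> i \<in> I \<Longrightarrow> m + xvar i \<notin> N \<Longrightarrow> (m + xvar i, I - {i}) \<in> kbasis n N"
  unfolding kbasis_def using keys_mono_add[of m n "xvar i"] by auto

lemma kbasis_kmul: "(m, I) \<in> kbasis n N \<Longrightarrow> (m', J) \<in> kbasis n N \<Longrightarrow> m + m' \<notin> N \<Longrightarrow> (m + m', I \<union> J) \<in> kbasis n N"
  unfolding kbasis_def using keys_mono_add[of m n m'] by auto

lemma kdif_kC: "x \<in> kC n N \<Longrightarrow> kdif N x \<in> kC n N"
  unfolding kC_def mem_Collect_eq
  by (rule keys_kdif[where K = "kbasis n N"]) (simp_all add: kbasis_kdif)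

lemma kbar_kG_eq:
  assumes "x \<in> kG n N p"
  shows "kbar x = sg (Suc p) x"
proof (rule additive_eq_on[where x = x and g = "sg (Suc p)" and K = "{(m, I). card I = p}"])
  show "Poly_Mapping.keys x \<subseteq> {(m, I). card I = p}" using assms by (auto simp: kG_def)
qed (auto simp: kbar_single single_sg additive_kbar additive_sg_fun)

lemma kmul_comm:
  fixes x y :: "'k::field kel"
  assumes "x \<in> kG n N p" "y \<in> kG n N q"
  shows "kmul N y x = sg (p * q) (kmul N x y)"
proof (rule additive_eq_on[where x = x])
  fix s and a :: 'k assume s: "s \<in> kbasis n N \<inter> {(m, I). card I = p}"
  show "kmul N y (Poly_Mapping.single s a) = sg (p * q) (kmul N (Poly_Mapping.single s a) y)"
  proof (rule additive_eq_on[where x = y])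
    fix t and b :: 'k assume t: "t \<in> kbasis n N \<inter> {(m, I). card I = q}"
    obtain m I m' J where [simp]: "s = (m, I)" "t = (m', J)" by (metis prod.exhaust)
    have fin: "finite I" "finite J" using s t kbasis_fin by auto
    have c: "card I = p" "card J = q" using s t by auto
    have "even (inversions J I) = even (p * q + inversions I J)" if "I \<inter> J = {}"
    proof -
      have "even (p * q) = even (inversions I J + inversions J I)"
        using inversions_comm[OF fin that] c by simp
      then show ?thesis by auto
    qed
    then show "kmul N (Poly_Mapping.single t b) (Poly_Mapping.single s a) =
        sg (p * q) (kmul N (Poly_Mapping.single s a) (Poly_Mapping.single t b))"
      by (auto simp: kmul_single single_sg[symmetric] sg_sg Int_commute add.commute[of m'] Un_commute mult.commute[of b]
          intro!: single_cong_sg)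
  qed (use assms in \<open>auto simp: kG_def additive_comps additive_kmul_left additive_kmul_right\<close>)
qed (use assms in \<open>auto simp: kG_def additive_comps additive_kmul_left additive_kmul_right\<close>)

lemma cdga_koszul:
  assumes up: "upset N"
  shows "cdga (kC n N) (kmul N) (kdif N) kbar (kG n N :: nat \<Rightarrow> 'k::field kel set)"
proof
  fix x y :: "'k kel" and p q
  show "kdif N x \<in> kG n N p" if "x \<in> kG n N (Suc p)"
    using that unfolding kG_def mem_Collect_eq
    by (rule keys_kdif) (auto simp: kbasis_kdif)
  show "kmul N x y \<in> kG n N (p + q)" if "x \<in> kG n N p" "y \<in> kG n N q"
    using that unfolding kG_def mem_Collect_eq
    by (rule keys_kmul) (auto simp: kbasis_kmul card_Un_disjoint)
  show "kbar x = sg (Suc p) x" if "x \<in> kG n N p" using that by (rule kbar_kG_eq)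
  show "kmul N y x = sg (p * q) (kmul N x y)" if "x \<in> kG n N p" "y \<in> kG n N q"
    using that by (rule kmul_comm)
  show "kG n N p \<subseteq> (kC n N :: 'k kel set)" by (auto simp: kG_def kC_def)
qed (auto simp: kC_def kG_def kmul_add_left kmul_add_right kmul_assoc[OF up] kdif_kdif[OF up] kdif_kmul[OF up]
    kbar_kbar kbar_kmul kbar_kdif additive_add[OF additive_kdif] additive_add[OF additive_kbar]
    keys_add_sub)

section \<open>Multidegrees and a multihomogeneous section of the differential\<close>

definition ind :: "nat set \<Rightarrow> mono" where "ind I = (\<Sum>i\<in>I. xvar i)"

text \<open>e_i gets the multidegree of x_i; then the differential preserves multidegrees and
  products add them.\<close>

definition mdeg :: "mono \<times> nat set \<Rightarrow> mono" where "mdeg a = fst a + ind (snd a)"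

lemma lookup_xvar: "Poly_Mapping.lookup (xvar i) v = (if i = v then 1 else 0)"
  by (simp add: xvar_def lookup_single when_def)

lemma lookup_ind: "finite I \<Longrightarrow> Poly_Mapping.lookup (ind I) v = (if v \<in> I then 1 else 0)"
  by (simp add: ind_def lookup_sum lookup_xvar sum.delta)

lemma ind_insert: "finite I \<Longrightarrow> i \<notin> I \<Longrightarrow> ind (insert i I) = xvar i + ind I"
  by (simp add: ind_def)

lemma ind_remove: "finite I \<Longrightarrow> i \<in> I \<Longrightarrow> ind I = xvar i + ind (I - {i})"
  unfolding ind_def by (rule sum.remove)

lemma ind_Un: "finite I \<Longrightarrow> finite J \<Longrightarrow> I \<inter> J = {} \<Longrightarrow> ind (I \<union> J) = ind I + ind J"
  unfolding ind_def by (rule sum.union_disjoint)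

lemma ind_empty [simp]: "ind {} = 0" by (simp add: ind_def)

lemma mdeg_step: "finite I \<Longrightarrow> i \<in> I \<Longrightarrow> mdeg (m + xvar i, I - {i}) = mdeg (m, I)"
  by (simp add: mdeg_def ind_remove[of I i] ac_simps)

lemma mdeg_mul: "finite I \<Longrightarrow> finite J \<Longrightarrow> I \<inter> J = {} \<Longrightarrow> mdeg (m + m', I \<union> J) = mdeg (m, I) + mdeg (m', J)"
  by (simp add: mdeg_def ind_Un ac_simps)

text \<open>Scalars serve to take a linear section of the differential and, later, to normalise a
  coefficient.\<close>

definition kscale :: "'k::field \<Rightarrow> ('a \<Rightarrow>\<^sub>0 'k) \<Rightarrow> ('a \<Rightarrow>\<^sub>0 'k)" where
  "kscale c = lin (\<lambda>a b. Poly_Mapping.single a (c * b))"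

lemma additive_in_kscale: "additive_in (\<lambda>a b. Poly_Mapping.single a (c * b :: 'k::field))"
  by (simp add: additive_in_def single_add algebra_simps)

lemma additive_kscale: "additive_map (kscale c)"
  unfolding kscale_def by (rule additive_lin[OF additive_in_kscale])

lemma kscale_single: "kscale c (Poly_Mapping.single a b) = Poly_Mapping.single a (c * b)"
  unfolding kscale_def by (rule lin_single[OF additive_in_kscale])

lemma lookup_kscale: "Poly_Mapping.lookup (kscale c x) a = c * Poly_Mapping.lookup x a"
proof -
  have "Poly_Mapping.lookup (kscale c x) a = (\<Sum>b\<in>Poly_Mapping.keys x. if b = a then c * Poly_Mapping.lookup x a else 0)"
    unfolding kscale_def lin_def lookup_sum by (intro sum.cong) (auto simp: lookup_single when_def)
  then show ?thesis by (auto simp: in_keys_iff)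
qed

lemma keys_kscale: "Poly_Mapping.keys (kscale c x) \<subseteq> Poly_Mapping.keys x"
  by (auto simp: in_keys_iff lookup_kscale)

lemma vector_space_kscale: "vector_space (kscale :: 'k::field \<Rightarrow> ('a \<Rightarrow>\<^sub>0 'k) \<Rightarrow> _)"
  by unfold_locales (auto intro!: poly_mapping_eqI simp: lookup_kscale lookup_add algebra_simps)

lemma kdif_kscale:
  fixes x :: "'k::field kel"
  shows "kdif N (kscale c x) = kscale c (kdif N x)"
proof (rule additive_eq_pair[where x = x])
  fix m :: mono and I and a :: 'k
  show "kdif N (kscale c (Poly_Mapping.single (m, I) a)) = kscale c (kdif N (Poly_Mapping.single (m, I) a))"
    unfolding kscale_single kdif_single additive_sum[OF additive_kscale]
    by (intro sum.cong) (auto simp: kscale_single sg_mult_right additive_0[OF additive_kscale])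
  show "additive_map (\<lambda>x. kscale c (kdif N x))"
    by (simp add: additive_map_def additive_add[OF additive_kdif] additive_add[OF additive_kscale])
qed (intro additive_comps additive_kscale)

definition sdg :: "mono \<times> nat set \<Rightarrow> mono \<times> nat" where "sdg a = (mdeg a, card (snd a))"

lemma kdif_restr:
  fixes x :: "'k::field kel"
  shows "kdif N (restr {a. sdg a = (u, Suc p)} x) = restr {a. sdg a = (u, p)} (kdif N x)"
proof (rule additive_eq_pair[where x = x])
  fix m :: mono and I and a :: 'k
  show "kdif N (restr {a. sdg a = (u, Suc p)} (Poly_Mapping.single (m, I) a)) =
     restr {a. sdg a = (u, p)} (kdif N (Poly_Mapping.single (m, I) a))"
  proof (cases "finite I")
    case True
    have s: "sdg (m + xvar i, I - {i}) = (u, p) \<longleftrightarrow> sdg (m, I) = (u, Suc p)" if "i \<in> I" for i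
    proof -
      have "card I = Suc (card (I - {i}))" using True that by (metis card_Suc_Diff1)
      then show ?thesis using mdeg_step[OF True that] by (simp add: sdg_def)
    qed
    have "restr {a. sdg a = (u, p)} (if m + xvar i \<notin> N then Poly_Mapping.single (m + xvar i, I - {i}) (sg (below I i) a) else 0) =
       (if sdg (m, I) = (u, Suc p) then (if m + xvar i \<notin> N then Poly_Mapping.single (m + xvar i, I - {i}) (sg (below I i) a) else 0) else 0)"
      if "i \<in> I" for i
      using s[OF that] by (auto simp: restr_single additive_0[OF additive_restr])
    then show ?thesis
      by (auto simp: restr_single kdif_single additive_sum[OF additive_restr] cong: sum.cong)
  qed (simp add: kdif_single restr_single additive_0[OF additive_restr])
qed (intro additive_comps)+

text \<open>A linear section of the differential on its image, made multihomogeneous by projecting.\<close>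

lemma koszul_homotopy:
  "\<exists>h. additive_map h \<and> (\<forall>x. h x \<in> kC n N) \<and>
     (\<forall>x a. a \<in> Poly_Mapping.keys (h x) \<longrightarrow>
        (\<exists>b\<in>Poly_Mapping.keys x. mdeg a = mdeg b \<and> card (snd a) = Suc (card (snd b)))) \<and>
     (\<forall>y\<in>kC n N. kdif N (h (kdif N y)) = kdif N (y :: 'k::field kel))"
proof -
  interpret vector_space "kscale :: 'k \<Rightarrow> 'k kel \<Rightarrow> 'k kel" by (rule vector_space_kscale)
  interpret pair: vector_space_pair "kscale :: 'k \<Rightarrow> 'k kel \<Rightarrow> 'k kel" "kscale :: 'k \<Rightarrow> 'k kel \<Rightarrow> 'k kel"
    by (intro vector_space_pair.intro vector_space_kscale)
  have sub: "subspace (kC n N :: 'k kel set)"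
    unfolding subspace_def kC_def mem_Collect_eq
    by (intro conjI ballI allI impI) (simp, simp add: keys_add_sub, rule order_trans[OF keys_kscale], simp)
  have lin: "Vector_Spaces.linear kscale kscale (kdif N :: 'k kel \<Rightarrow> 'k kel)"
    unfolding Vector_Spaces.linear_iff
    by (simp add: additive_add[OF additive_kdif] kdif_kscale vector_space_kscale)
  obtain g where g: "g ` UNIV \<subseteq> (kC n N :: 'k kel set)" "Vector_Spaces.linear kscale kscale g"
    "\<And>v. v \<in> kdif N ` kC n N \<Longrightarrow> kdif N (g v) = v"
    using pair.linear_exists_right_inverse_on[OF lin sub] by blast
  have g_add: "g (x + y) = g x + g y" for x y using g(2) unfolding Vector_Spaces.linear_iff by blast
  have g0: "g 0 = 0" using g_add[of 0 0] by simp
  define up where "up t = (fst t, Suc (snd t))" for t :: "mono \<times> nat"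
  \<comment> \<open>\<open>g\<close> need not respect degrees. On each basis element only the
    component of the same multidegree and the next homological degree is kept; all others have their
    differentials in different degrees.\<close>
  define \<phi> where "\<phi> a c = restr {b. sdg b = up (sdg a)} (g (Poly_Mapping.single a c))" for a and c :: 'k
  define h where "h = lin \<phi>"
  have addi: "additive_in \<phi>"
    by (simp add: additive_in_def \<phi>_def single_add g_add additive_add[OF additive_restr])
  have h: "additive_map h" unfolding h_def by (rule additive_lin[OF addi])
  have hs: "h (Poly_Mapping.single a c) = \<phi> a c" for a c unfolding h_def by (rule lin_single[OF addi])
  have gC: "Poly_Mapping.keys (g x) \<subseteq> kbasis n N" for x using g(1) by (auto simp: kC_def)
  have hC: "h x \<in> kC n N" for x
    unfolding kC_def mem_Collect_eq
    by (rule additive_keys[OF h subset_UNIV]) (use gC in \<open>auto simp: hs \<phi>_def keys_restr\<close>)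
  have hk: "Poly_Mapping.keys (h x) \<subseteq> {a. \<exists>b\<in>Poly_Mapping.keys x. sdg a = up (sdg b)}" for x
    by (rule additive_keys[OF h order_refl]) (auto simp: hs \<phi>_def keys_restr)
  have hP: "h x = restr {b. sdg b = up t} (g x)" if "Poly_Mapping.keys x \<subseteq> {a. sdg a = t}" for x t
  proof (rule additive_eq_on[OF h _ that])
    show "additive_map (\<lambda>x. restr {b. sdg b = up t} (g x))"
      by (simp add: additive_map_def g_add additive_add[OF additive_restr])
  qed (simp add: hs \<phi>_def)
  \<comment> \<open>The homogeneous components of a boundary are boundaries of components of y, so
    \<open>g\<close> inverts the differential on each of them, and the projection commutes with the
    differential.\<close>
  have "kdif N (h (kdif N y)) = kdif N y" if y: "y \<in> kC n N" for y
  proof -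
    let ?b = "kdif N y"
    let ?S = "sdg ` Poly_Mapping.keys ?b"
    let ?P = "\<lambda>t. restr {a. sdg a = t} ?b"
    have b: "?b = (\<Sum>t\<in>?S. ?P t)" by (rule restr_sum_partition) auto
    have *: "kdif N (h (?P t)) = ?P t" for t
    proof -
      obtain u p where t: "t = (u, p)" by (cases t)
      have Pt: "?P t = kdif N (restr {a. sdg a = (u, Suc p)} y)"
        unfolding t by (rule kdif_restr[symmetric])
      have "restr {a. sdg a = (u, Suc p)} y \<in> kC n N"
        using y by (auto simp: kC_def keys_restr)
      then have gP: "kdif N (g (?P t)) = ?P t" by (intro g(3)) (auto simp: Pt)
      have "h (?P t) = restr {b. sdg b = up t} (g (?P t))"
        by (rule hP) (auto simp: keys_restr)
      then have "kdif N (h (?P t)) = restr {a. sdg a = t} (kdif N (g (?P t)))"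
        by (simp add: t up_def kdif_restr)
      also have "\<dots> = ?P t" unfolding gP by (rule restr_id) (auto simp: keys_restr)
      finally show ?thesis .
    qed
    have "kdif N (h ?b) = kdif N (h (\<Sum>t\<in>?S. ?P t))" using b by simp
    also have "\<dots> = (\<Sum>t\<in>?S. kdif N (h (?P t)))"
      by (simp add: additive_sum[OF h] additive_sum[OF additive_kdif])
    also have "\<dots> = (\<Sum>t\<in>?S. ?P t)" by (simp only: *)
    also have "\<dots> = ?b" using b by simp
    finally show ?thesis .
  qed
  then show ?thesis
    using h hC hk by (intro exI[of _ h]) (auto simp: sdg_def up_def subset_iff)
qed

section \<open>Contraction with e_V, a left inverse of left multiplication by e_V\<close>

definition contr :: "nat set \<Rightarrow> 'k::field kel \<Rightarrow> 'k kel" where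
  "contr V = lin (\<lambda>(m, I) a. if V \<subseteq> I \<and> finite I
     then Poly_Mapping.single (m, I - V) (sg (inversions V (I - V)) a) else 0)"

lemma additive_in_contr: "additive_in (\<lambda>(m, I) a. if V \<subseteq> I \<and> finite I
     then Poly_Mapping.single (m, I - V) (sg (inversions V (I - V)) (a::'k::field)) else 0)"
  by (auto simp: additive_in_def single_add sg_add_right)

lemma additive_contr: "additive_map (contr V)"
  unfolding contr_def by (rule additive_lin[OF additive_in_contr])

lemma contr_single: "contr V (Poly_Mapping.single (m, I) a) = (if V \<subseteq> I \<and> finite I
     then Poly_Mapping.single (m, I - V) (sg (inversions V (I - V)) a) else 0)"
  unfolding contr_def by (subst lin_single[OF additive_in_contr]) simp

lemma additive_contr_comp: "additive_map f \<Longrightarrow> additive_map (\<lambda>x. contr V (f x))"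
  by (simp add: additive_map_def additive_add[OF additive_contr])

lemmas additive_comps' = additive_comps additive_contr_comp

lemma contr_0 [simp]: "contr V 0 = 0" by (rule additive_0[OF additive_contr])

lemma keys_contr:
  "Poly_Mapping.keys (contr V x) \<subseteq> {(m, I - V) | m I. (m, I) \<in> Poly_Mapping.keys x \<and> V \<subseteq> I \<and> finite I}"
proof (rule additive_keys[OF additive_contr order_refl])
  fix p and a :: 'a assume p: "p \<in> Poly_Mapping.keys x"
  obtain m I where "p = (m, I)" by (cases p)
  then show "Poly_Mapping.keys (contr V (Poly_Mapping.single p a)) \<subseteq>
      {(m, I - V) | m I. (m, I) \<in> Poly_Mapping.keys x \<and> V \<subseteq> I \<and> finite I}"
    using p by (simp add: contr_single) blast
qed

text \<open>Terms that remove an index of V leave nothing to contract. For an index i outside V the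
  signs differ by the elements of V below i and those above i, card V in all.\<close>

lemma kdif_contr:
  fixes x :: "'k::field kel"
  assumes V: "finite V"
  shows "kdif N (contr V x) = sg (card V) (contr V (kdif N x))"
proof (rule additive_eq_pair[where x = x])
  fix m :: mono and I and a :: 'k
  show "kdif N (contr V (Poly_Mapping.single (m, I) a)) = sg (card V) (contr V (kdif N (Poly_Mapping.single (m, I) a)))"
  proof (cases "finite I \<and> V \<subseteq> I")
    case False
    have "contr V (if m + xvar i \<notin> N then Poly_Mapping.single (m + xvar i, I - {i}) (sg (below I i) a) else 0) = 0" for i
      using False by (auto simp: contr_single)
    then show ?thesis using False by (auto simp: contr_single kdif_single additive_sum[OF additive_contr])
  next
    case True
    then have I: "finite I" "V \<subseteq> I" by auto
    have "kdif N (contr V (Poly_Mapping.single (m, I) a)) = (\<Sum>i\<in>I - V. if m + xvar i \<notin> N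
        then Poly_Mapping.single (m + xvar i, I - V - {i}) (sg (below (I - V) i) (sg (inversions V (I - V)) a)) else 0)"
      using I by (simp add: contr_single kdif_single)
    also have "\<dots> = (\<Sum>i\<in>I - V. sg (card V) (contr V (if m + xvar i \<notin> N
        then Poly_Mapping.single (m + xvar i, I - {i}) (sg (below I i) a) else 0)))"
    proof (rule sum.cong[OF refl])
      fix i assume i: "i \<in> I - V"
      have "V \<subseteq> I - {i}" "I - V - {i} = I - {i} - V" using i I by auto
      moreover have "inversions V (I - V) = inversions V (I - {i} - V) + above V i"
        using inversions_remove_right[of V "I - V" i] V I i calculation(2) by auto
      moreover have "below I i = below V i + below (I - V) i"
        using below_Un[of V "I - V" i] V I by (simp add: Un_absorb1)
      moreover have "card V = below V i + above V i" using below_above[OF V] i by simp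
      ultimately show "(if m + xvar i \<notin> N
        then Poly_Mapping.single (m + xvar i, I - V - {i}) (sg (below (I - V) i) (sg (inversions V (I - V)) a)) else 0) =
        sg (card V) (contr V (if m + xvar i \<notin> N then Poly_Mapping.single (m + xvar i, I - {i}) (sg (below I i) a) else 0))"
        using I by (auto simp: contr_single sg_sg single_sg[symmetric] intro!: single_cong_sg)
    qed
    also have "\<dots> = (\<Sum>i\<in>I. sg (card V) (contr V (if m + xvar i \<notin> N
        then Poly_Mapping.single (m + xvar i, I - {i}) (sg (below I i) a) else 0)))"
      by (rule sum.mono_neutral_left) (use I in \<open>auto simp: contr_single\<close>)
    also have "\<dots> = sg (card V) (contr V (kdif N (Poly_Mapping.single (m, I) a)))"
      by (simp add: kdif_single additive_sum[OF additive_contr] sg_sum)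
    finally show ?thesis .
  qed
qed (intro additive_comps')+

lemma kbar_contr:
  fixes x :: "'k::field kel"
  assumes V: "finite V"
  shows "kbar (contr V x) = sg (card V) (contr V (kbar x))"
proof (rule additive_eq_pair[where x = x])
  fix m :: mono and I and a :: 'k
  have "card I = card V + card (I - V)" if "V \<subseteq> I" "finite I"
    using that V card_Diff_subset[OF V that(1)] card_mono[OF that(2,1)] by simp
  then show "kbar (contr V (Poly_Mapping.single (m, I) a)) = sg (card V) (contr V (kbar (Poly_Mapping.single (m, I) a)))"
    by (auto simp: contr_single kbar_single sg_sg single_sg[symmetric] intro!: single_cong_sg)
qed (intro additive_comps')+

lemma contr_kmul:
  fixes x y :: "'k::field kel"
  assumes V: "finite V" and y: "Poly_Mapping.keys y \<subseteq> {(m, J). finite J \<and> J \<inter> V = {}}"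
  shows "contr V (kmul N x y) = kmul N (contr V x) y"
proof (rule additive_eq_pair[where x = x])
  fix m :: mono and I and a :: 'k
  show "contr V (kmul N (Poly_Mapping.single (m, I) a) y) = kmul N (contr V (Poly_Mapping.single (m, I) a)) y"
  proof (rule additive_eq_on[OF _ _ y])
    fix q :: "mono \<times> nat set" and b :: 'k assume q: "q \<in> {(m, J). finite J \<and> J \<inter> V = {}}"
    then obtain m' J where [simp]: "q = (m', J)" and J: "finite J" "J \<inter> V = {}" by auto
    show "contr V (kmul N (Poly_Mapping.single (m, I) a) (Poly_Mapping.single q b)) =
      kmul N (contr V (Poly_Mapping.single (m, I) a)) (Poly_Mapping.single q b)"
    proof (cases "finite I \<and> V \<subseteq> I")
      case True
      then have I: "finite I" "V \<subseteq> I" by auto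
      show ?thesis
      proof (cases "I \<inter> J = {}")
        case IJ: True
        have s: "I \<union> J - V = (I - V) \<union> J" "(I - V) \<inter> J = {}" "V \<subseteq> I \<union> J" using J IJ I by auto
        have "inversions I J = inversions V J + inversions (I - V) J"
          using inversions_Un_left[of V "I - V" J] V I J by (simp add: Un_absorb1)
        moreover have "inversions V (I \<union> J - V) = inversions V (I - V) + inversions V J"
          unfolding s using inversions_Un_right[of V "I - V" J] V I J s by simp
        ultimately show ?thesis using I J IJ s
          by (auto simp: kmul_single contr_single sg_sg sg_mult_left intro!: single_cong_sg)
      next
        case False
        then have "(I - V) \<inter> J \<noteq> {}" using J by auto
        then show ?thesis using False by (simp add: kmul_single contr_single)
      qed
    next
      case False
      then have "\<not> V \<subseteq> I \<union> J \<or> infinite I" using J by auto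
      then show ?thesis using False by (auto simp: kmul_single contr_single)
    qed
  qed (intro additive_comps')+
qed (intro additive_comps')+

lemma contr_contr_disjoint:
  fixes x :: "'k::field kel"
  assumes V: "finite V" "finite W" "V \<inter> W = {}"
  shows "contr W (contr V x) = sg (card V * card W) (contr V (contr W x))"
proof (rule additive_eq_pair[where x = x])
  fix m :: mono and I and a :: 'k
  show "contr W (contr V (Poly_Mapping.single (m, I) a)) = sg (card V * card W) (contr V (contr W (Poly_Mapping.single (m, I) a)))"
  proof (cases "finite I \<and> V \<subseteq> I \<and> W \<subseteq> I")
    case True
    then have I: "finite I" "V \<subseteq> I" "W \<subseteq> I" by auto
    have s: "W \<subseteq> I - V" "V \<subseteq> I - W" "I - V - W = I - W - V" using I V by auto
    have e: "I - V = W \<union> (I - W - V)" "I - W = V \<union> (I - W - V)" using I V by auto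
    have 1: "inversions V (I - V) = inversions V W + inversions V (I - W - V)"
      by (subst e(1), rule inversions_Un_right) (use V I in auto)
    have 2: "inversions W (I - W) = inversions W V + inversions W (I - W - V)"
      by (subst e(2), rule inversions_Un_right) (use V I in auto)
    have 3: "inversions V W + inversions W V = card V * card W" by (rule inversions_comm[OF V])
    have "sg (inversions W (I - V - W)) (sg (inversions V (I - V)) a) =
       sg (card V * card W) (sg (inversions V (I - W - V)) (sg (inversions W (I - W)) a))"
      unfolding sg_sg 1 2 s(3) 3[symmetric] by (rule sg_cong) auto
    then show ?thesis using I s by (simp add: contr_single single_sg[symmetric])
  next
    case False
    then show ?thesis using V by (auto simp: contr_single)
  qed
qed (intro additive_comps')+

lemma contr_contr_overlap:
  fixes x :: "'k::field kel"
  assumes V: "V \<inter> W \<noteq> {}"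
  shows "contr W (contr V x) = 0"
proof (rule additive_eq_pair[where x = x and g = "\<lambda>x. 0"])
  fix m :: mono and I and a :: 'k
  have "\<not> W \<subseteq> I - V" using V by auto
  then show "contr W (contr V (Poly_Mapping.single (m, I) a)) = 0" by (simp add: contr_single)
qed (intro additive_comps')+

definition ext :: "nat set \<Rightarrow> 'k::field \<Rightarrow> 'k kel" where "ext V t = Poly_Mapping.single (0, V) t"

lemma contr_ext:
  fixes y :: "'k::field kel"
  assumes V: "finite V" and y: "Poly_Mapping.keys y \<subseteq> {(m, J). finite J \<and> J \<inter> V = {} \<and> m \<notin> N}"
  shows "contr V (kmul N (ext V 1) y) = y"
proof (rule additive_eq_on[OF _ _ y])
  fix q :: "mono \<times> nat set" and b :: 'k assume q: "q \<in> {(m, J). finite J \<and> J \<inter> V = {} \<and> m \<notin> N}"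
  then obtain m J where [simp]: "q = (m, J)" and J: "finite J" "J \<inter> V = {}" "m \<notin> N" by auto
  have "V \<inter> J = {}" "V \<union> J - V = J" using J by auto
  then show "contr V (kmul N (ext V 1) (Poly_Mapping.single q b)) = Poly_Mapping.single q b"
    using J V by (simp add: ext_def kmul_single contr_single)
qed (intro additive_comps')+

section \<open>The homotopy that divides by one variable\<close>

definition vhom :: "nat \<Rightarrow> 'k::field kel \<Rightarrow> 'k kel" where
  "vhom v = lin (\<lambda>(m, I) a. if v \<notin> I \<and> v \<in> Poly_Mapping.keys m
     then Poly_Mapping.single (m - xvar v, insert v I) (sg (below I v) a) else 0)"

lemma additive_in_vhom: "additive_in (\<lambda>(m, I) a. if v \<notin> I \<and> v \<in> Poly_Mapping.keys m
     then Poly_Mapping.single (m - xvar v, insert v I) (sg (below I v) (a::'k::field)) else 0)"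
  by (auto simp: additive_in_def single_add sg_add_right)

lemma additive_vhom: "additive_map (vhom v)"
  unfolding vhom_def by (rule additive_lin[OF additive_in_vhom])

lemma vhom_single: "vhom v (Poly_Mapping.single (m, I) a) = (if v \<notin> I \<and> v \<in> Poly_Mapping.keys m
     then Poly_Mapping.single (m - xvar v, insert v I) (sg (below I v) a) else 0)"
  unfolding vhom_def by (subst lin_single[OF additive_in_vhom]) simp

text \<open>\<open>vhom\<close> inverts the term of the differential that trades e_v for x_v. The
  map is therefore homotopic to the identity and replaces cycles by homologous ones.\<close>

definition vproj :: "mono set \<Rightarrow> nat \<Rightarrow> 'k::field kel \<Rightarrow> 'k kel" where
  "vproj N v x = x - kdif N (vhom v x) - vhom v (kdif N x)"

lemma additive_vproj: "additive_map (vproj N v)"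
  by (simp add: additive_map_def vproj_def additive_add[OF additive_vhom] additive_add[OF additive_kdif])

lemma mono_split: "v \<in> Poly_Mapping.keys m \<Longrightarrow> m - xvar v + xvar v = (m :: mono)"
  by (rule poly_mapping_eqI) (auto simp: lookup_add lookup_minus lookup_xvar in_keys_iff)

lemma mono_split': "v \<in> Poly_Mapping.keys m \<Longrightarrow> m + xvar i - xvar v = (m - xvar v + xvar i :: mono)"
  by (rule poly_mapping_eqI) (auto simp: lookup_add lookup_minus lookup_xvar in_keys_iff)

lemma keys_mono_minus: "Poly_Mapping.keys (m - m' :: mono) \<subseteq> Poly_Mapping.keys m"
  by (auto simp: in_keys_iff lookup_minus)

text \<open>The complement of the image of \<open>vproj N v\<close> is contractible, and two elements of the image of
  positive degree in the variable \<open>v\<close> have product \<open>0\<close>.\<close>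

lemma vproj_single_in:
  assumes "finite I" "v \<in> I" "m \<notin> N"
  shows "vproj N v (Poly_Mapping.single (m, I) a) = (if m + xvar v \<in> N then Poly_Mapping.single (m, I) a else 0)"
proof -
  have "vhom v (if m + xvar i \<notin> N then Poly_Mapping.single (m + xvar i, I - {i}) (sg (below I i) a) else 0) =
      (if i = v then if m + xvar v \<notin> N then Poly_Mapping.single (m, I) a else 0 else 0)" if "i \<in> I" for i
  proof (cases "i = v")
    case True
    have "v \<in> Poly_Mapping.keys (m + xvar v)" by (simp add: in_keys_iff lookup_add lookup_xvar)
    then show ?thesis using True assms
      by (auto simp: vhom_single insert_absorb below_remove_self additive_0[OF additive_vhom])
  next
    case False
    then show ?thesis using assms by (simp add: vhom_single additive_0[OF additive_vhom])
  qed
  then have "vhom v (kdif N (Poly_Mapping.single (m, I) a)) = (if m + xvar v \<notin> N then Poly_Mapping.single (m, I) a else 0)"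
    using assms by (simp add: kdif_single additive_sum[OF additive_vhom] cong: sum.cong)
  then show ?thesis using assms by (simp add: vproj_def vhom_single)
qed

text \<open>In d h + h d the element itself appears once, and the other terms cancel in pairs except
  where x_i takes m into \<open>N\<close> but not m / x_v. These exceptional terms contain e_v and
  are annihilated by x_v.\<close>

lemma keys_vproj_notin:
  assumes up: "upset N" and I: "finite I" "v \<notin> I" "v \<in> Poly_Mapping.keys m" "m \<notin> N"
  shows "Poly_Mapping.keys (vproj N v (Poly_Mapping.single (m, I) a)) \<subseteq>
    (\<lambda>i. (m - xvar v + xvar i, insert v I - {i})) ` {i \<in> I. m - xvar v + xvar i \<notin> N \<and> m + xvar i \<in> N}"
    (is "_ \<subseteq> ?K")
proof -
  let ?m = "m - xvar v"
  define t where "t i = Poly_Mapping.single (?m + xvar i, insert v I - {i}) (sg (below (insert v I) i + below I v) a)" for i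
  have below_v: "below (insert v I) i = below I i + (if v < i then 1 else 0)" for i
    using below_remove[of "insert v I" v i] I by simp
  have "kdif N (vhom v (Poly_Mapping.single (m, I) a)) = (\<Sum>i\<in>insert v I. if ?m + xvar i \<notin> N then t i else 0)"
    using I by (simp add: vhom_single kdif_single t_def sg_sg cong: if_cong)
  also have "\<dots> = Poly_Mapping.single (m, I) a + (\<Sum>i\<in>I. if ?m + xvar i \<notin> N then t i else 0)"
    using I mono_split[OF I(3)] below_v[of v] by (simp add: t_def) (simp add: sg_def)
  finally have 1: "kdif N (vhom v (Poly_Mapping.single (m, I) a)) =
     Poly_Mapping.single (m, I) a + (\<Sum>i\<in>I. if ?m + xvar i \<notin> N then t i else 0)" .
  have "vhom v (if m + xvar i \<notin> N then Poly_Mapping.single (m + xvar i, I - {i}) (sg (below I i) a) else 0) =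
     (if m + xvar i \<notin> N then - t i else 0)" if "i \<in> I" for i
  proof -
    have "i \<noteq> v" using that I by auto
    then have "insert v (I - {i}) = insert v I - {i}" "v \<in> Poly_Mapping.keys (m + xvar i)" "v \<notin> I - {i}"
      using I by (auto simp: in_keys_iff lookup_add)
    moreover have "odd (below (I - {i}) v + below I i) = even (below (insert v I) i + below I v)"
      using below_v[of i] below_remove[OF I(1) that, of v] \<open>i \<noteq> v\<close> by auto
    ultimately show ?thesis using mono_split'[OF I(3), of i]
      by (auto simp: vhom_single additive_0[OF additive_vhom] t_def sg_sg single_uminus[symmetric] sg_def)
  qed
  then have 2: "vhom v (kdif N (Poly_Mapping.single (m, I) a)) = (\<Sum>i\<in>I. if m + xvar i \<notin> N then - t i else 0)"
    by (simp add: kdif_single additive_sum[OF additive_vhom] cong: sum.cong)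
  have "(if ?m + xvar i \<notin> N then t i else 0) + (if m + xvar i \<notin> N then - t i else 0) =
     (if ?m + xvar i \<notin> N \<and> m + xvar i \<in> N then t i else 0)" for i
  proof -
    have "m + xvar i = ?m + xvar i + xvar v" using mono_split[OF I(3)] by (metis add.assoc add.commute)
    then have "?m + xvar i \<in> N \<Longrightarrow> m + xvar i \<in> N" using upsetD(1)[OF up] by metis
    then show ?thesis by auto
  qed
  then have "(\<Sum>i\<in>I. if ?m + xvar i \<notin> N then t i else 0) + (\<Sum>i\<in>I. if m + xvar i \<notin> N then - t i else 0) =
      (\<Sum>i\<in>I. if ?m + xvar i \<notin> N \<and> m + xvar i \<in> N then t i else 0)"
    unfolding sum.distrib[symmetric] by (rule sum.cong[OF refl])
  then have "vproj N v (Poly_Mapping.single (m, I) a) = - (\<Sum>i\<in>I. if ?m + xvar i \<notin> N \<and> m + xvar i \<in> N then t i else 0)"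
    unfolding vproj_def 1 2 by (simp only: diff_add_eq_diff_diff_swap[symmetric] diff_diff_eq minus_add_distrib[symmetric] diff_add_cancel diff_self) (simp add: algebra_simps)
  then have e: "Poly_Mapping.keys (vproj N v (Poly_Mapping.single (m, I) a)) =
     Poly_Mapping.keys (\<Sum>i\<in>I. if ?m + xvar i \<notin> N \<and> m + xvar i \<in> N then t i else 0)" by simp
  show ?thesis unfolding e
    by (rule keys_sum_sub) (auto simp: t_def)
qed

section \<open>Letters of overlapping multidegrees and letters of low degree\<close>

lemma kG_homotopy:
  fixes h :: "'k::field kel \<Rightarrow> 'k kel"
  assumes "\<And>x. h x \<in> kC n N"
    and "\<And>x a. a \<in> Poly_Mapping.keys (h x) \<Longrightarrow>
       \<exists>b\<in>Poly_Mapping.keys x. mdeg a = mdeg b \<and> card (snd a) = Suc (card (snd b))"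
    and x: "x \<in> kG n N p"
  shows "h x \<in> kG n N (Suc p)"
  unfolding kG_def mem_Collect_eq
proof
  fix a assume a: "a \<in> Poly_Mapping.keys (h x)"
  then have "a \<in> kbasis n N" using assms(1)[of x] by (auto simp: kC_def)
  moreover obtain b where "b \<in> Poly_Mapping.keys x" "card (snd a) = Suc (card (snd b))"
    using assms(2)[OF a] by blast
  ultimately show "a \<in> kbasis n N \<inter> {(m, I). card I = Suc p}" using x by (auto simp: kG_def)
qed

text \<open>The setting of the inductive step. As k is at least 3, \<open>ts\<close> makes products
  of two letters bound. The condition on 0 says that the ideal is proper; otherwise the complex is
  zero.\<close>

locale koszul_step =
  fixes n :: nat and N :: "mono set" and k :: nat and h :: "'k::field kel \<Rightarrow> 'k kel"
  assumes up: "upset N" and N0: "0 \<notin> N" and k3: "3 \<le> k"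
    and h_add: "h (x + y) = h x + h y"
    and h_C: "h x \<in> kC n N"
    and h_keys: "a \<in> Poly_Mapping.keys (h x) \<Longrightarrow>
       \<exists>b\<in>Poly_Mapping.keys x. mdeg a = mdeg b \<and> card (snd a) = Suc (card (snd b))"
    and h_d: "y \<in> kC n N \<Longrightarrow> kdif N (h (kdif N y)) = kdif N y"
    and ts: "2 \<le> j \<Longrightarrow> j < k \<Longrightarrow> cdga.trivial_systems (kC n N) (kmul N) (kdif N) kbar (kG n N :: nat \<Rightarrow> 'k kel set) j"
begin

sublocale cdga "kC n N" "kmul N" "kdif N" kbar "kG n N :: nat \<Rightarrow> 'k kel set"
  by (rule cdga_koszul[OF up])

lemma hop: "homotopy_op h"
  unfolding homotopy_op_def using kG_homotopy[of h, OF h_C h_keys] h_add by blast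

lemma h_D: "y \<in> D \<Longrightarrow> kdif N (h y) = y"
  unfolding D_def using h_d by auto

lemma good_h: "good letters k h"
  by (rule good_trivial_systems[OF order_refl hop ts]) (auto intro: h_D)

text \<open>0 is pure of every multidegree, so it has to be excluded whenever a multidegree is read
  off from a letter.\<close>

definition pure :: "mono \<Rightarrow> nat \<Rightarrow> 'k kel \<Rightarrow> bool" where
  "pure u p z \<longleftrightarrow> z \<in> kG n N p \<and> kdif N z = 0 \<and> 0 < p \<and> Poly_Mapping.keys z \<subseteq> {a. mdeg a = u}"

lemma pure_letters: "pure u p z \<Longrightarrow> z \<in> letters"
  by (auto simp: pure_def letters_def)

lemma keys_kG: "z \<in> kG n N p \<Longrightarrow> Poly_Mapping.keys z \<subseteq> kbasis n N"
  by (auto simp: kG_def)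

lemma gam_th_mdeg:
  "list_all2 (\<lambda>z u. Poly_Mapping.keys z \<subseteq> {a. mdeg a = u}) w us \<Longrightarrow>
     Poly_Mapping.keys (gam h w) \<subseteq> {a. mdeg a = sum_list us} \<and>
     Poly_Mapping.keys (th h w) \<subseteq> {a. mdeg a = sum_list us}"
proof (induction w arbitrary: us rule: length_induct)
  case (1 w)
  have th: "Poly_Mapping.keys (th h w) \<subseteq> {a. mdeg a = sum_list us}"
    unfolding th_def splits_def
  proof (rule keys_sum_sub)
    fix i assume i: "i \<in> {1..<length w}"
    have l: "Poly_Mapping.keys (gam h (take i w)) \<subseteq> {a. mdeg a = sum_list (take i us)}"
      using i by (intro 1(1)[rule_format, THEN conjunct1] list_all2_takeI 1(2)) auto
    have r: "Poly_Mapping.keys (gam h (drop i w)) \<subseteq> {a. mdeg a = sum_list (drop i us)}"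
      using i by (intro 1(1)[rule_format, THEN conjunct1] list_all2_dropI 1(2)) auto
    show "Poly_Mapping.keys (kmul N (kbar (gam h (take i w))) (gam h (drop i w))) \<subseteq> {a. mdeg a = sum_list us}"
    proof (rule keys_kmul[OF order_trans[OF keys_kbar l] r])
      fix m I m' J
      assume "(m, I) \<in> {a. mdeg a = sum_list (take i us)}" "(m', J) \<in> {a. mdeg a = sum_list (drop i us)}"
        "finite I" "finite J" "I \<inter> J = {}"
      then have "mdeg (m + m', I \<union> J) = sum_list (take i us) + sum_list (drop i us)"
        by (simp add: mdeg_mul)
      also have "\<dots> = sum_list us" by (metis append_take_drop_id sum_list_append)
      finally show "(m + m', I \<union> J) \<in> {a. mdeg a = sum_list us}" by simp
    qed
  qed
  have "Poly_Mapping.keys (gam h w) \<subseteq> {a. mdeg a = sum_list us}"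
  proof (cases "2 \<le> length w")
    case True
    show ?thesis
    proof
      fix a assume "a \<in> Poly_Mapping.keys (gam h w)"
      then have a: "a \<in> Poly_Mapping.keys (h (th h w))" using True by (simp add: gam_long)
      obtain b where "b \<in> Poly_Mapping.keys (th h w)" "mdeg a = mdeg b"
        using h_keys[OF a] by blast
      then show "a \<in> {a. mdeg a = sum_list us}" using th by auto
    qed
  next
    case False
    then consider "w = []" | z where "w = [z]"
      by (cases w) (auto simp: not_le less_Suc_eq)
    then show ?thesis
      using 1(2) by cases (auto simp: list_all2_Cons1)
  qed
  with th show ?case by simp
qed

text \<open>Here j counts the letters of positive degree in v that enter an element, after
  projection; for j = 1 the elements contain e_v and are killed by x_v. Since e_v squares to 0,
  products add j and nothing is left from j = 2 on.\<close>

definition EK :: "nat \<Rightarrow> nat \<Rightarrow> (mono \<times> nat set) set" where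
  "EK v j = kbasis n N \<inter> (if j = 0 then {a. Poly_Mapping.lookup (mdeg a) v = 0}
     else if j = 1 then {(m, I). v \<in> I \<and> m + xvar v \<in> N} else {})"

definition Ev :: "nat \<Rightarrow> nat \<Rightarrow> 'k kel set" where
  "Ev v j = {x. Poly_Mapping.keys x \<subseteq> EK v j}"

lemma mdeg_lookup: "finite I \<Longrightarrow> Poly_Mapping.lookup (mdeg (m, I)) v = Poly_Mapping.lookup m v + (if v \<in> I then 1 else 0)"
  by (simp add: mdeg_def lookup_add lookup_ind)

lemma EK_kmul:
  assumes "(m, I) \<in> EK v i" "(m', J) \<in> EK v j" "finite I" "finite J" "I \<inter> J = {}" "m + m' \<notin> N"
  shows "(m + m', I \<union> J) \<in> EK v (i + j)"
proof -
  have b: "(m + m', I \<union> J) \<in> kbasis n N" using assms by (auto simp: EK_def intro: kbasis_kmul)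
  have ij: "i \<le> 1" "j \<le> 1" using assms by (auto simp: EK_def split: if_splits)
  consider "i = 0" "j = 0" | "i = 1" "j = 0" | "i = 0" "j = 1" | "i = 1" "j = 1" using ij by linarith
  then show ?thesis
  proof cases
    case 1
    then show ?thesis using assms b by (auto simp: EK_def mdeg_mul lookup_add)
  next
    case 2
    have "m + xvar v + m' \<in> N" by (rule upsetD(1)[OF up]) (use assms(1) 2 in \<open>auto simp: EK_def\<close>)
    then show ?thesis using assms b 2 by (auto simp: EK_def ac_simps)
  next
    case 3
    have "m + (m' + xvar v) \<in> N" by (rule upsetD(2)[OF up]) (use assms(2) 3 in \<open>auto simp: EK_def\<close>)
    then show ?thesis using assms b 3 by (auto simp: EK_def ac_simps)
  next
    case 4
    then show ?thesis using assms by (auto simp: EK_def)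
  qed
qed

lemma Ev_kmul: "x \<in> Ev v i \<Longrightarrow> y \<in> Ev v j \<Longrightarrow> kmul N x y \<in> Ev v (i + j)"
  unfolding Ev_def mem_Collect_eq by (rule keys_kmul) (auto intro: EK_kmul)

lemma Ev_0 [simp]: "0 \<in> Ev v j" by (simp add: Ev_def)

lemma Ev_2: "2 \<le> j \<Longrightarrow> x \<in> Ev v j \<longleftrightarrow> x = 0"
  by (auto simp: Ev_def EK_def)

lemma Ev_sum: "(\<And>i. i \<in> A \<Longrightarrow> f i \<in> Ev v j) \<Longrightarrow> sum f A \<in> Ev v j"
  unfolding Ev_def mem_Collect_eq by (rule keys_sum_sub)

lemma Ev_kbar: "x \<in> Ev v j \<Longrightarrow> kbar x \<in> Ev v j"
  unfolding Ev_def mem_Collect_eq by (rule order_trans[OF keys_kbar])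

lemma vproj_Ev0: "x \<in> Ev v 0 \<Longrightarrow> vproj N v x = x"
proof -
  assume x: "x \<in> Ev v 0"
  have *: "vhom v y = 0" if "y \<in> Ev v 0" for y :: "'k kel"
  proof (rule additive_eq_on[where f = "vhom v" and x = y and g = "\<lambda>_. 0" and K = "EK v 0"])
    show "Poly_Mapping.keys y \<subseteq> EK v 0" using that by (simp add: Ev_def)
    fix a and c :: 'k assume a: "a \<in> EK v 0"
    obtain m I where mI: "a = (m, I)" by (cases a)
    then have "finite I" using a kbasis_fin by (auto simp: EK_def)
    then have "v \<notin> Poly_Mapping.keys m" using a mI by (auto simp: EK_def mdeg_lookup in_keys_iff)
    then show "vhom v (Poly_Mapping.single a c) = 0" by (simp add: mI vhom_single)
  qed (auto simp: additive_vhom additive_comps)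
  have "kdif N x \<in> Ev v 0"
    unfolding Ev_def mem_Collect_eq
  proof (rule keys_kdif)
    show "Poly_Mapping.keys x \<subseteq> EK v 0" using x by (simp add: Ev_def)
    fix m I i assume "(m, I) \<in> EK v 0" "finite I" "i \<in> I" "m + xvar i \<notin> N"
    then show "(m + xvar i, I - {i}) \<in> EK v 0"
      by (simp add: EK_def kbasis_kdif mdeg_step)
  qed
  then show ?thesis using x by (simp add: vproj_def *)
qed

lemma vproj_Ev1: "x \<in> Ev v 1 \<Longrightarrow> vproj N v x = x"
proof -
  assume x: "x \<in> Ev v 1"
  show ?thesis
  proof (rule additive_eq_on[where g = "\<lambda>x. x" and K = "EK v 1" and f = "vproj N v" and x = x])
    show "Poly_Mapping.keys x \<subseteq> EK v 1" using x by (simp add: Ev_def)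
    fix a and c :: 'k assume a: "a \<in> EK v 1"
    obtain m I where mI: "a = (m, I)" by (cases a)
    then have "finite I" "v \<in> I" "m + xvar v \<in> N" "m \<notin> N" using a kbasis_fin by (auto simp: EK_def kbasis_def)
    then show "vproj N v (Poly_Mapping.single a c) = Poly_Mapping.single a c"
      by (simp add: mI vproj_single_in)
  qed (auto simp: additive_vproj additive_comps)
qed

lemma vproj_in_Ev1:
  assumes "Poly_Mapping.keys x \<subseteq> kbasis n N \<inter> {a. 0 < Poly_Mapping.lookup (mdeg a) v}"
  shows "vproj N v x \<in> Ev v 1"
  unfolding Ev_def mem_Collect_eq
proof (rule additive_keys[OF additive_vproj assms])
  fix a and c :: 'k assume a: "a \<in> kbasis n N \<inter> {a. 0 < Poly_Mapping.lookup (mdeg a) v}"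
  obtain m I where mI: "a = (m, I)" by (cases a)
  have I: "finite I" "m \<notin> N" "Poly_Mapping.keys m \<subseteq> {..<n}" "I \<subseteq> {..<n}"
    using a mI kbasis_fin by (auto simp: kbasis_def)
  show "Poly_Mapping.keys (vproj N v (Poly_Mapping.single a c)) \<subseteq> EK v 1"
  proof (cases "v \<in> I")
    case True
    then show ?thesis using I a mI by (auto simp: mI vproj_single_in EK_def)
  next
    case False
    then have v: "v \<in> Poly_Mapping.keys m" using a mI I by (auto simp: mdeg_lookup in_keys_iff)
    show ?thesis
      unfolding mI
    proof (rule order_trans[OF keys_vproj_notin[OF up I(1) False v I(2)]], rule image_subsetI)
      fix i assume i: "i \<in> {i \<in> I. m - xvar v + xvar i \<notin> N \<and> m + xvar i \<in> N}"
      have "m - xvar v + xvar i + xvar v = m + xvar i"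
        using mono_split[OF v] by (metis add.assoc add.commute)
      moreover have "Poly_Mapping.keys (m - xvar v + xvar i) \<subseteq> {..<n}"
        using i I keys_mono_minus[of m "xvar v"] by (intro keys_mono_add) auto
      ultimately show "(m - xvar v + xvar i, insert v I - {i}) \<in> EK v 1"
        using i I v False by (auto simp: EK_def kbasis_def)
    qed
  qed
qed

lemma vhom_kG:
  fixes x :: "'k kel"
  shows "x \<in> kG n N p \<Longrightarrow> vhom v x \<in> kG n N (Suc p)"
  unfolding kG_def mem_Collect_eq
proof (rule additive_keys[OF additive_vhom, where K = "kbasis n N \<inter> {(m, I). card I = p}"])
  fix a and c :: 'k assume a: "a \<in> kbasis n N \<inter> {(m, I). card I = p}"
  obtain m I where mI: "a = (m, I)" by (cases a)
  have I: "finite I" "m \<notin> N" "Poly_Mapping.keys m \<subseteq> {..<n}" "I \<subseteq> {..<n}" "card I = p"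
    using a mI kbasis_fin by (auto simp: kbasis_def)
  show "Poly_Mapping.keys (vhom v (Poly_Mapping.single a c)) \<subseteq> kbasis n N \<inter> {(m, I). card I = Suc p}"
  proof (cases "v \<notin> I \<and> v \<in> Poly_Mapping.keys m")
    case True
    then have "m - xvar v \<notin> N" using upsetD(1)[OF up, of "m - xvar v" "xvar v"] mono_split I by metis
    then show ?thesis using True I keys_mono_minus[of m "xvar v"]
      by (auto simp: mI vhom_single kbasis_def)
  next
    case False
    then show ?thesis unfolding mI vhom_single by (simp only: if_False) simp
  qed
qed

lemma vproj_cycle:
  fixes z :: "'k kel"
  assumes "z \<in> kG n N p" "kdif N z = 0"
  shows "vproj N v z \<in> kG n N p" "kdif N (vproj N v z) = 0" "z - vproj N v z = kdif N (vhom v z)"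
proof -
  show e: "z - vproj N v z = kdif N (vhom v z)"
    using assms by (simp add: vproj_def additive_0[OF additive_vhom])
  then have e': "vproj N v z = z + - kdif N (vhom v z)" by (simp add: algebra_simps)
  show "vproj N v z \<in> kG n N p"
    unfolding e' by (rule G_add[OF assms(1) G_neg[OF d_G[OF vhom_kG[OF assms(1)]]]])
  show "kdif N (vproj N v z) = 0"
    unfolding e' by (simp only: d_add d_neg d_d assms minus_zero add_0)
qed

text \<open>\<open>vproj\<close> commutes with the differential and fixes the spaces
  \<open>Ev v j\<close>. So this is still a section on boundaries lying there, and it maps each of
  these spaces to itself.\<close>

definition hv :: "nat \<Rightarrow> 'k kel \<Rightarrow> 'k kel" where "hv v x = vproj N v (h x)"

lemma hv_Ev: "x \<in> Ev v j \<Longrightarrow> hv v x \<in> Ev v j"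
proof -
  assume x: "x \<in> Ev v j"
  have kb: "Poly_Mapping.keys (h x) \<subseteq> kbasis n N" using h_C by (auto simp: kC_def)
  consider "j = 0" | "j = 1" | "2 \<le> j" by linarith
  then show ?thesis
  proof cases
    case 1
    have "h x \<in> Ev v 0"
      unfolding Ev_def EK_def using kb h_keys x 1 by (fastforce simp: Ev_def EK_def)
    then show ?thesis using 1 by (simp add: hv_def vproj_Ev0)
  next
    case 2
    have "0 < Poly_Mapping.lookup (mdeg a) v" if a: "a \<in> Poly_Mapping.keys (h x)" for a
    proof -
      obtain b where b: "b \<in> Poly_Mapping.keys x" "mdeg a = mdeg b" using h_keys[OF a] by blast
      then have bE: "b \<in> EK v 1" using x 2 by (auto simp: Ev_def)
      obtain m I where "b = (m, I)" by (cases b)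
      then show ?thesis using b bE kbasis_fin by (auto simp: EK_def mdeg_lookup)
    qed
    then have "Poly_Mapping.keys (h x) \<subseteq> kbasis n N \<inter> {a. 0 < Poly_Mapping.lookup (mdeg a) v}"
      using kb by blast
    from vproj_in_Ev1[OF this] show ?thesis using 2 by (simp add: hv_def)
  next
    case 3
    then show ?thesis using x homotopy_op_0[OF hop] additive_0[OF additive_vproj] by (simp add: Ev_2 hv_def)
  qed
qed

lemma hop_hv: "homotopy_op (hv v)"
  unfolding homotopy_op_def
proof (intro conjI allI impI)
  fix p and x :: "'k kel" assume "x \<in> kG n N p"
  then have hx: "h x \<in> kG n N (Suc p)" using hop by (simp add: homotopy_op_def)
  show "hv v x \<in> kG n N (Suc p)"
    unfolding hv_def vproj_def
    using hx vhom_kG[OF hx, of v] vhom_kG[OF d_G[OF hx], of v] d_G[of "vhom v (h x)" "Suc p"] G_add G_neg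
    by (metis diff_conv_add_uminus)
qed (simp add: hv_def h_add additive_add[OF additive_vproj])

text \<open>The index counts letters outside \<open>Ev v 0\<close>; products add it and
  \<open>hv v\<close> preserves it. With two such letters \<theta> is 0 on the nose.\<close>

lemma gam_hv_Ev:
  "set w \<subseteq> Ev v 0 \<union> Ev v 1 \<Longrightarrow>
     gam (hv v) w \<in> Ev v (length (filter (\<lambda>z. z \<notin> Ev v 0) w)) \<and>
     th (hv v) w \<in> Ev v (length (filter (\<lambda>z. z \<notin> Ev v 0) w))"
proof (induction w rule: length_induct)
  case (1 w)
  let ?c = "\<lambda>w. length (filter (\<lambda>z. z \<notin> Ev v 0) w)"
  have th: "th (hv v) w \<in> Ev v (?c w)"
    unfolding th_def splits_def
  proof (rule Ev_sum)
    fix i assume i: "i \<in> {1..<length w}"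
    have "gam (hv v) (take i w) \<in> Ev v (?c (take i w))"
      using i 1(2) set_take_subset[of i w] by (intro 1(1)[rule_format, THEN conjunct1]) auto
    moreover have "gam (hv v) (drop i w) \<in> Ev v (?c (drop i w))"
      using i 1(2) set_drop_subset[of i w] by (intro 1(1)[rule_format, THEN conjunct1]) auto
    ultimately have "kmul N (kbar (gam (hv v) (take i w))) (gam (hv v) (drop i w)) \<in> Ev v (?c (take i w) + ?c (drop i w))"
      by (intro Ev_kmul Ev_kbar)
    also have "?c (take i w) + ?c (drop i w) = ?c w"
      by (metis append_take_drop_id filter_append length_append)
    finally show "kmul N (kbar (gam (hv v) (take i w))) (gam (hv v) (drop i w)) \<in> Ev v (?c w)" .
  qed
  have "gam (hv v) w \<in> Ev v (?c w)"
  proof (cases "2 \<le> length w")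
    case True
    then show ?thesis using hv_Ev[OF th] by (simp add: gam_long)
  next
    case False
    then consider "w = []" | z where "w = [z]"
      by (cases w) (auto simp: not_le less_Suc_eq)
    then show ?thesis using 1(2) by cases auto
  qed
  with th show ?case by simp
qed

lemma good_hv: "good (letters \<inter> (Ev v 0 \<union> Ev v 1)) k (hv v)"
proof (rule good_trivial_systems[OF _ hop_hv ts])
  fix w assume w: "set w \<subseteq> letters \<inter> (Ev v 0 \<union> Ev v 1)" "th (hv v) w \<in> D"
  let ?y = "th (hv v) w"
  let ?c = "length (filter (\<lambda>z. z \<notin> Ev v 0) w)"
  have y: "?y \<in> Ev v ?c" using gam_hv_Ev w by auto
  have "vproj N v ?y = ?y"
    using y vproj_Ev0 vproj_Ev1 Ev_2[of ?c ?y v] additive_0[OF additive_vproj]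
    by (cases "?c = 0"; cases "?c = 1") (auto simp: numeral_2_eq_2 Suc_le_eq)
  moreover have "kdif N (vproj N v x) = vproj N v (kdif N x)" for x :: "'k kel"
    using d_d[of x] d_d[of "vhom v x"] d_add d_neg
    by (simp add: vproj_def additive_diff[OF additive_kdif] additive_0[OF additive_vhom])
  ultimately show "kdif N (hv v ?y) = ?y"
    by (simp add: hv_def h_D[OF w(2)])
qed auto

text \<open>Neither passing to homologous letters nor changing the operator alters \<theta> modulo
  boundaries. For projected letters and \<open>hv v\<close>, two factors that contain e_v meet and
  \<theta> is 0.\<close>

lemma th_overlap:
  assumes w: "length w = k"
    and pure: "\<And>z. z \<in> set w \<Longrightarrow> \<exists>u p. pure u p z"
    and two: "2 \<le> length (filter (\<lambda>z. \<exists>a\<in>Poly_Mapping.keys z. 0 < Poly_Mapping.lookup (mdeg a) v) w)"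
  shows "th h w \<in> D"
proof -
  define pos where "pos z \<longleftrightarrow> (\<exists>a\<in>Poly_Mapping.keys z. 0 < Poly_Mapping.lookup (mdeg a) v)" for z :: "'k kel"
  define f where "f z = (if pos z then vproj N v z else z)" for z :: "'k kel"
  have fE: "f z \<in> Ev v 0 \<union> Ev v 1" "pos z \<Longrightarrow> f z \<in> Ev v 1" if z: "z \<in> set w" for z
  proof -
    obtain u p where P: "pure u p z" using pure[OF z] by blast
    have kb: "Poly_Mapping.keys z \<subseteq> kbasis n N" using P keys_kG by (auto simp: pure_def)
    show 1: "f z \<in> Ev v 1" if "pos z"
    proof -
      have "Poly_Mapping.keys z \<subseteq> kbasis n N \<inter> {a. 0 < Poly_Mapping.lookup (mdeg a) v}"
      proof -
        have "0 < Poly_Mapping.lookup u v" using P that unfolding pos_def pure_def by auto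
        then show ?thesis using kb P unfolding pure_def by auto
      qed
      from vproj_in_Ev1[OF this] show ?thesis using that by (simp add: f_def)
    qed
    show "f z \<in> Ev v 0 \<union> Ev v 1"
    proof (cases "pos z")
      case False
      then show ?thesis using kb by (auto simp: f_def pos_def Ev_def EK_def)
    qed (use 1 in simp)
  qed
  have fl: "z \<in> letters \<and> f z \<in> letters \<and> (\<exists>p>0. \<exists>y\<in>kG n N (Suc p). z - f z = kdif N y)" if z: "z \<in> set w" for z
  proof -
    obtain u p where P: "pure u p z" using pure[OF z] by blast
    then have p: "z \<in> kG n N p" "kdif N z = 0" "0 < p" by (auto simp: pure_def)
    show ?thesis
    proof (cases "pos z")
      case True
      then show ?thesis
        using p vproj_cycle[OF p(1,2), of v] vhom_kG[OF p(1)] pure_letters[OF P] unfolding f_def letters_def by auto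
    next
      case False
      then show ?thesis using pure_letters[OF P] G_0 p(3) by (auto simp: f_def intro!: exI[of _ p] bexI[of _ 0])
    qed
  qed
  have "list_all2 (\<lambda>x x'. x \<in> letters \<and> x' \<in> letters \<and> (\<exists>p>0. \<exists>y\<in>kG n N (Suc p). x - x' = kdif N y)) w (map f w)"
    using fl by (auto simp: list_all2_conv_all_nth)
  then have diff: "th h w - th h (map f w) \<in> D"
    using th_homologous[OF good_h _ _ w] k3 by auto
  have "th h (map f w) \<in> D"
  \<comment> \<open>A projected letter may be 0 and would then escape the count, but in that case
    \<theta> vanishes by additivity.\<close>
  proof (cases "0 \<in> set (map f w)")
    case True
    then obtain x y where "map f w = x @ 0 # y" by (meson split_list)
    then show ?thesis using th_0[OF hop, of x y] D_0 by simp
  next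
    case False
    have "filter (\<lambda>z. z \<notin> Ev v 0) (map f w) = map f (filter pos w)"
      unfolding filter_map comp_def
    proof (rule arg_cong[where f = "map f"], rule filter_cong[OF refl])
      fix z assume z: "z \<in> set w"
      show "(f z \<notin> Ev v 0) = pos z"
      proof
        assume p: "pos z"
        have "f z \<in> Ev v 1" by (rule fE(2)[OF z p])
        moreover have "f z \<in> set (map f w)" using z by simp
        then have "f z \<noteq> 0" using False by metis
        then obtain a where "a \<in> Poly_Mapping.keys (f z)"
          using keys_eq_empty[of "f z"] by blast
        ultimately have a: "a \<in> Poly_Mapping.keys (f z)" "a \<in> EK v 1"
          unfolding Ev_def by blast+
        obtain m I where "a = (m, I)" by (cases a)
        then have "a \<notin> EK v 0" using a(2) kbasis_fin by (auto simp: EK_def mdeg_lookup)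
        then show "f z \<notin> Ev v 0" using a(1) by (auto simp: Ev_def)
      next
        assume "f z \<notin> Ev v 0"
        moreover have "z \<in> Ev v 0" if "\<not> pos z"
          using that pure[OF z] keys_kG by (fastforce simp: pos_def Ev_def EK_def pure_def)
        ultimately show "pos z" by (cases "pos z") (simp_all add: f_def)
      qed
    qed
    then have "2 \<le> length (filter (\<lambda>z. z \<notin> Ev v 0) (map f w))"
      using two by (simp add: pos_def[abs_def])
    moreover have "th (hv v) (map f w) \<in> Ev v (length (filter (\<lambda>z. z \<notin> Ev v 0) (map f w)))"
      using gam_hv_Ev[of "map f w" v] fE by auto
    ultimately have "th (hv v) (map f w) = 0" by (simp add: Ev_2)
    moreover have "th (hv v) (map f w) - th h (map f w) \<in> D"
      by (rule th_indep[OF good_h good_hv]) (use w fl fE k3 in auto)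
    ultimately show ?thesis using D_neg_iff by simp
  qed
  from D_add[OF diff this] show ?thesis by simp
qed


text \<open>One half of d (e_V' e_V); the other half is, up to sign, the same expression with V and
  V' exchanged.\<close>

definition dlet :: "nat set \<Rightarrow> nat set \<Rightarrow> 'k \<Rightarrow> 'k kel" where
  "dlet V V' t = kmul N (kdif N (ext V' t)) (ext V 1)"

lemma ext_kG: "finite V \<Longrightarrow> V \<subseteq> {..<n} \<Longrightarrow> ext V t \<in> kG n N (card V)"
  using N0 by (auto simp: ext_def kG_def kbasis_def)

lemma ext_mdeg: "Poly_Mapping.keys (ext V t) \<subseteq> {a. mdeg a = ind V}"
  by (auto simp: ext_def mdeg_def)

lemma kbar_ext: "kbar (ext V t) = ext V (sg (Suc (card V)) t)"
  by (simp add: ext_def kbar_single)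

lemma kdif_ext: "kdif N (ext V t) = (\<Sum>i\<in>V. if xvar i \<notin> N
    then Poly_Mapping.single (xvar i, V - {i}) (sg (below V i) t) else 0)"
  by (simp add: ext_def kdif_single cong: if_cong)

lemma keys_kdif_ext: "finite V \<Longrightarrow> Poly_Mapping.keys (kdif N (ext V t)) \<subseteq> {(xvar i, V - {i}) | i. i \<in> V \<and> xvar i \<notin> N}"
  unfolding kdif_ext by (rule keys_sum_sub) auto

lemma mdeg_kdif:
  assumes "Poly_Mapping.keys x \<subseteq> {a. mdeg a = u}"
  shows "Poly_Mapping.keys (kdif N x) \<subseteq> {a. mdeg a = u}"
  by (rule keys_kdif[OF assms]) (simp add: mdeg_step)

lemma mdeg_kmul:
  assumes "Poly_Mapping.keys x \<subseteq> {a. mdeg a = u}" "Poly_Mapping.keys y \<subseteq> {a. mdeg a = u'}"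
  shows "Poly_Mapping.keys (kmul N x y) \<subseteq> {a. mdeg a = u + u'}"
  by (rule keys_kmul[OF assms]) (simp add: mdeg_mul)

lemma dlet_0 [simp]: "dlet V {} t = 0"
  by (simp add: dlet_def kdif_ext)

text \<open>This is where the hypothesis that all \<open>x_v x_v'\<close> with \<open>v \<in> V\<close> and \<open>v' \<in> V'\<close> vanish enters.\<close>

lemma kmul_kdif_ext_zero:
  assumes V': "finite V'" and prods: "\<And>v v'. v \<in> V \<Longrightarrow> v' \<in> V' \<Longrightarrow> xvar v + xvar v' \<in> N"
    and y: "Poly_Mapping.keys y \<subseteq> {(m, I). \<exists>v\<in>V. v \<in> Poly_Mapping.keys m}"
  shows "kmul N (kdif N (ext V' t)) y = 0"
proof -
  have "Poly_Mapping.keys (kmul N (kdif N (ext V' t)) y) \<subseteq> {}"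
  proof (rule keys_kmul[OF keys_kdif_ext[OF V'] y])
    fix m m' :: mono and I J :: "nat set"
    assume a: "(m, I) \<in> {(xvar i, V' - {i}) | i. i \<in> V' \<and> xvar i \<notin> N}"
      "(m', J) \<in> {(m, I). \<exists>v\<in>V. v \<in> Poly_Mapping.keys m}" "m + m' \<notin> N"
    then obtain i v where i: "m = xvar i" "i \<in> V'" and v: "v \<in> V" "v \<in> Poly_Mapping.keys m'" by auto
    have "m + m' = (xvar v + xvar i) + (m' - xvar v)"
      using mono_split[OF v(2)] i by (metis add.assoc add.commute)
    then have "m + m' \<in> N" using prods[OF v(1) i(2)] upsetD(1)[OF up] by metis
    with a(3) show "(m + m', I \<union> J) \<in> {}" by simp
  qed
  then show ?thesis by simp
qed

lemma th_two: "a \<in> letters \<Longrightarrow> b \<in> letters \<Longrightarrow> kmul N (kbar a) b \<in> D"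
  using good_D(2)[OF good_h, of "[a, b]"] k3 by (simp add: th_def splits_def)

lemma kmul_letters_D:
  assumes "a \<in> letters" "b \<in> letters"
  shows "kmul N a b \<in> D"
proof -
  obtain p where "a \<in> kG n N p" "0 < p" "kdif N a = 0" using assms(1) by (auto simp: letters_def)
  then have "kmul N (kbar a) b = sg (Suc p) (kmul N a b)" by (simp add: bar_G mul_sg)
  then show ?thesis using th_two[OF assms] D_sg by metis
qed

lemma contr_kG:
  assumes V: "finite V" and x: "x \<in> kG n N (p + card V)"
  shows "contr V x \<in> kG n N p"
  unfolding kG_def mem_Collect_eq
proof (rule order_trans[OF keys_contr], clarify)
  fix m I assume a: "(m, I) \<in> Poly_Mapping.keys x" "V \<subseteq> I" "finite I"
  then have "(m, I) \<in> kbasis n N" "card I = p + card V" using x by (auto simp: kG_def)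
  then show "(m, I - V) \<in> kbasis n N \<inter> {(m, I). card I = p}"
    using a V by (auto simp: kbasis_def card_Diff_subset)
qed

lemma contr_mdeg:
  assumes V: "finite V" and x: "Poly_Mapping.keys x \<subseteq> {a. mdeg a = u + ind V}"
  shows "Poly_Mapping.keys (contr V x) \<subseteq> {a. mdeg a = u}"
proof (rule order_trans[OF keys_contr], clarify)
  fix m I assume a: "(m, I) \<in> Poly_Mapping.keys x" "V \<subseteq> I" "finite I"
  have "ind I = ind (I - V) + ind V"
    using a V ind_Un[of "I - V" V] by (simp add: Un_absorb2 Int_commute)
  moreover have "mdeg (m, I) = u + ind V" using a x by auto
  ultimately show "mdeg (m, I - V) = u" by (simp add: mdeg_def add.assoc[symmetric])
qed

text \<open>Up to sign its differential is d (e_V') d (e_V), all of whose monomials are products x_v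
  x_v' in the ideal.\<close>

lemma dlet_cycle:
  assumes V: "finite V" "V \<subseteq> {..<n}" and V': "finite V'" "V' \<subseteq> {..<n}" "V' \<noteq> {}"
    and prods: "\<And>v v'. v \<in> V \<Longrightarrow> v' \<in> V' \<Longrightarrow> xvar v + xvar v' \<in> N"
  shows "dlet V V' t \<in> kG n N (card V' - 1 + card V)" "kdif N (dlet V V' t) = 0"
proof -
  have "ext V' t \<in> kG n N (Suc (card V' - 1))"
    using ext_kG[OF V'(1,2)] V' by (metis card_gt_0_iff Suc_diff_1)
  then show "dlet V V' t \<in> kG n N (card V' - 1 + card V)"
    unfolding dlet_def by (intro mul_G d_G ext_kG V)
  have "kbar (kdif N (ext V' t)) = - kdif N (ext V' (sg (Suc (card V')) t))"
    by (simp only: bar_d kbar_ext)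
  moreover have "kmul N (kdif N (ext V' (sg (Suc (card V')) t))) (kdif N (ext V 1)) = 0"
    by (rule kmul_kdif_ext_zero[OF V'(1) prods])
       (use keys_kdif_ext[OF V(1), of 1] in auto)
  ultimately show "kdif N (dlet V V' t) = 0"
    by (simp add: dlet_def d_mul d_d)
qed

text \<open>An instance of \<open>th_contraction\<close> with contraction by e_V and E = e_V'.
  Entries that begin with bt have positive degree in every variable of V, while the remaining
  letters avoid V, so that contraction commutes with right multiplication by their entries.\<close>

lemma th_extends:
  assumes V: "finite V" "V \<subseteq> {..<n}" "V \<noteq> {}" and V': "finite V'" "V' \<subseteq> {..<n}" "V' \<noteq> {}"
    and prods: "\<And>v v'. v \<in> V \<Longrightarrow> v' \<in> V' \<Longrightarrow> xvar v + xvar v' \<in> N"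
    and bt: "bt \<in> kG n N (pb + card V)" "kdif N bt = 0" "0 < pb" "Poly_Mapping.keys bt \<subseteq> {a. mdeg a = u + ind V}"
    and cs: "\<And>c. c \<in> set cs \<Longrightarrow> \<exists>u p. pure u p c \<and> (\<forall>v\<in>V. Poly_Mapping.lookup u v = 0)"
    and k: "k = length cs + 2"
  shows "th h (dlet V V' t # contr V bt # cs) \<in> D"
proof -
  let ?A = "dlet V V' t" and ?E = "ext V' t"
  let ?P = "{x. Poly_Mapping.keys x \<subseteq> kbasis n N \<inter> {a. \<forall>v\<in>V. 0 < Poly_Mapping.lookup (mdeg a) v}}"
  let ?Q = "{x. Poly_Mapping.keys x \<subseteq> {(m, J). finite J \<and> J \<inter> V = {}}}"
  note A = dlet_cycle[OF V(1,2) V' prods, of t]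
  have cl: "set cs \<subseteq> letters" using cs pure_letters by blast
  have pA: "0 < card V' - 1 + card V" using V by (simp add: card_gt_0_iff)
  \<comment> \<open>A basis element of positive degree in all of V either contains e_V, and e_V
    times its contraction gives it back, or its monomial is divisible by some x_v, and then d (e_V')
    annihilates it.\<close>
  have AE: "kmul N ?A (contr V x) = kmul N (kdif N ?E) x" if x: "x \<in> ?P" for x
  proof -
    have "kmul N (kdif N ?E) (kmul N (ext V 1) (contr V x)) = kmul N (kdif N ?E) x"
    proof (rule additive_eq_on[where x = x and f = "\<lambda>x. kmul N (kdif N ?E) (kmul N (ext V 1) (contr V x))"])
      show "Poly_Mapping.keys x \<subseteq> kbasis n N \<inter> {a. \<forall>v\<in>V. 0 < Poly_Mapping.lookup (mdeg a) v}" using x by simp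
      fix a and c :: 'k assume a: "a \<in> kbasis n N \<inter> {a. \<forall>v\<in>V. 0 < Poly_Mapping.lookup (mdeg a) v}"
      obtain m I where mI: "a = (m, I)" by (cases a)
      have I: "finite I" "m \<notin> N" using a mI kbasis_fin by (auto simp: kbasis_def)
      show "kmul N (kdif N ?E) (kmul N (ext V 1) (contr V (Poly_Mapping.single a c))) =
          kmul N (kdif N ?E) (Poly_Mapping.single a c)"
      proof (cases "V \<subseteq> I")
        case True
        have "V \<inter> (I - V) = {}" by auto
        then have "kmul N (ext V 1) (contr V (Poly_Mapping.single a c)) = Poly_Mapping.single a c"
          using True I V by (auto simp: mI contr_single ext_def kmul_single Un_absorb1)
        then show ?thesis by simp
      next
        case False
        then obtain v where v: "v \<in> V" "v \<notin> I" by auto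
        then have "v \<in> Poly_Mapping.keys m" using a mI I by (auto simp: mdeg_lookup in_keys_iff)
        then have "kmul N (kdif N ?E) (Poly_Mapping.single a c) = 0"
          by (intro kmul_kdif_ext_zero[OF V'(1) prods]) (use v mI in auto)
        then show ?thesis using False by (simp add: mI contr_single)
      qed
    qed (intro additive_comps')+
    then show ?thesis by (simp add: dlet_def mul_assoc)
  qed
  have gP: "gam h (bt # take i cs) \<in> ?P" if "i \<le> length cs" for i
  proof -
    obtain uc where uc: "\<forall>c\<in>set cs. \<exists>p. pure (uc c) p c"
      using cs by metis
    have "list_all2 (\<lambda>z u. Poly_Mapping.keys z \<subseteq> {a. mdeg a = u}) (bt # take i cs) ((u + ind V) # map uc (take i cs))"
    proof -
      have "list_all2 (\<lambda>z u. Poly_Mapping.keys z \<subseteq> {a. mdeg a = u}) (take i cs) (map uc (take i cs))"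
        using uc set_take_subset[of i cs] by (auto simp: list_all2_conv_all_nth pure_def)
      then show ?thesis using bt(4) by simp
    qed
    from gam_th_mdeg[OF this] have "Poly_Mapping.keys (gam h (bt # take i cs)) \<subseteq> {a. mdeg a = u + ind V + sum_list (map uc (take i cs))}"
      by (simp add: add.assoc)
    moreover have "0 < Poly_Mapping.lookup (u + ind V + w) v" if "v \<in> V" for v w
      using that V by (simp add: lookup_add lookup_ind)
    moreover have "bt \<in> letters"
      using bt V by (auto simp: letters_def intro!: exI[of _ "pb + card V"])
    then have "gam h (bt # take i cs) \<in> kC n N"
      using cl set_take_subset[of i cs] by (intro gam_C[OF hop]) auto
    ultimately show ?thesis by (auto simp: kC_def)
  qed
  have gQ: "gam h w \<in> ?Q" if w: "set w \<subseteq> set cs" "w \<noteq> []" for w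
  proof -
    obtain uc where uc: "\<forall>c\<in>set cs. (\<exists>p. pure (uc c) p c) \<and> (\<forall>v\<in>V. Poly_Mapping.lookup (uc c) v = 0)"
      using cs by metis
    have "list_all2 (\<lambda>z u. Poly_Mapping.keys z \<subseteq> {a. mdeg a = u}) w (map uc w)"
    proof -
      have "\<forall>c\<in>set w. Poly_Mapping.keys c \<subseteq> {a. mdeg a = uc c}"
        using uc w(1) unfolding pure_def by blast
      then show ?thesis by (simp add: list_all2_map2 list_all2_same)
    qed
    from gam_th_mdeg[OF this] have 1: "Poly_Mapping.keys (gam h w) \<subseteq> {a. mdeg a = sum_list (map uc w)}" by simp
    have 2: "Poly_Mapping.lookup (sum_list (map uc w)) v = 0" if "v \<in> V" for v
      using w(1) uc that by (induction w) (auto simp: lookup_add)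
    have 3: "gam h w \<in> kC n N" using cl w by (intro gam_C[OF hop]) auto
    have "finite J \<and> J \<inter> V = {}" if "(m, J) \<in> Poly_Mapping.keys (gam h w)" for m J
    proof -
      have f: "finite J" using that 3 kbasis_fin by (auto simp: kC_def)
      moreover have "Poly_Mapping.lookup (mdeg (m, J)) v = 0" if "v \<in> V" for v
        using 1 2[OF that] \<open>(m, J) \<in> _\<close> by auto
      then have "v \<notin> J" if "v \<in> V" for v using that mdeg_lookup[OF f, of m v] by fastforce
      ultimately show ?thesis by auto
    qed
    then show ?thesis by auto
  qed
  \<comment> \<open>The first letter of \<open>th_contraction\<close> acts through
    \<open>bar\<close>; entering with \<open>kbar ?A\<close> cancels this, and linearity removes the
    sign again.\<close>
  have "th h (kbar ?A # contr V bt # cs) \<in> D"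
  proof (rule th_contraction[OF good_h k, where P = ?P and Q = ?Q and E = ?E and q = "card V'" and e = "card V" and pb = pb and bt = bt and \<rho> = "contr V"])
    show "kbar ?A \<in> kG n N (card V' - 1 + card V)" by (rule bar_G_mem[OF A(1)])
    show "kdif N (kbar ?A) = 0" using bar_d[of ?A] A(2) by simp
    show "card V' + card V = Suc (card V' - 1 + card V)" using V' by (simp add: card_gt_0_iff)
    show "contr V (x + y) = contr V x + contr V y" for x y :: "'k kel" by (rule additive_add[OF additive_contr])
    show "contr V x \<in> kG n N p" if "x \<in> kG n N (p + card V)" for p and x :: "'k kel" using contr_kG[OF V(1) that] .
    show "kdif N (contr V x) = sg (card V) (contr V (kdif N x))" for x :: "'k kel" by (rule kdif_contr[OF V(1)])
    show "kbar (contr V x) = sg (card V) (contr V (kbar x))" for x :: "'k kel" by (rule kbar_contr[OF V(1)])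
    show "kmul N (kbar (kbar ?A)) (contr V x) = kmul N (kdif N ?E) x" if "x \<in> ?P" for x
      using AE[OF that] by (simp add: bar_bar)
    show "contr V (kmul N (kbar x) y) = kmul N (contr V (kbar x)) y" if "y \<in> ?Q" for x y
      using contr_kmul[OF V(1)] that by simp
  qed (use bt cl pA gP gQ ext_kG[OF V'(1,2)] in auto)
  moreover have "kbar ?A = sg (Suc (card V' - 1 + card V)) ?A" by (rule bar_G[OF A(1)])
  ultimately show ?thesis
    using th_sg[OF hop, of "[]" _ ?A] D_sg by simp
qed

text \<open>The difference is d (e_V' e_V). For V empty the second letter is 0, and the first one is
  itself a boundary.\<close>

lemma dlet_commute:
  assumes V: "finite V" "V \<subseteq> {..<n}" and V': "finite V'" "V' \<subseteq> {..<n}" "V' \<noteq> {}"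
  shows "\<exists>e. \<exists>y\<in>kG n N (Suc (card V' - 1 + card V)). dlet V V' t - sg e (dlet V' V t) = kdif N y"
proof -
  let ?y = "kmul N (ext V' t) (ext V 1)"
  have y: "?y \<in> kG n N (Suc (card V' - 1 + card V))"
  proof -
    have "0 < card V'" using V' by (simp add: card_gt_0_iff)
    then have "Suc (card V' - 1 + card V) = card V' + card V" by simp
    then show ?thesis using mul_G[OF ext_kG[OF V'(1,2), of t] ext_kG[OF V(1,2), of 1]] by simp
  qed
  have mv: "kmul N (kdif N (ext V 1)) (ext V' t) = dlet V' V t"
    unfolding dlet_def kdif_ext additive_sum[OF additive_kmul_left]
    by (intro sum.cong refl) (auto simp: ext_def kmul_single sg_mult_left)
  show ?thesis
  proof (cases "V = {}")
    case True
    have "kdif N (ext V (1::'k)) = 0" by (simp add: kdif_ext True)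
    then have "dlet V V' t = kdif N ?y" by (simp add: d_mul dlet_def)
    moreover have "dlet V' V t = 0" using True by simp
    ultimately show ?thesis using y by (intro exI[of _ 0] bexI[of _ ?y]) auto
  next
    case False
    then have "ext V 1 \<in> kG n N (Suc (card V - 1))"
      using ext_kG[OF V] V by (metis card_gt_0_iff Suc_diff_1)
    then have "kmul N (ext V' t) (kdif N (ext V 1)) = sg ((card V - 1) * card V') (kmul N (kdif N (ext V 1)) (ext V' t))"
      by (intro mul_comm[OF d_G ext_kG[OF V'(1,2)]])
    moreover have "kbar (ext V' t) = sg (Suc (card V')) (ext V' t)" by (rule bar_G[OF ext_kG[OF V'(1,2)]])
    ultimately have "kmul N (kbar (ext V' t)) (kdif N (ext V 1)) = sg (Suc (card V') + (card V - 1) * card V') (dlet V' V t)"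
      by (simp add: mul_sg sg_sg mv)
    then have "dlet V V' t - sg (Suc (card V') + (card V - 1) * card V') (dlet V' V t) = kdif N ?y"
      by (simp add: d_mul dlet_def)
    then show ?thesis using y by blast
  qed
qed

text \<open>Mayer--Vietoris: since the product of \<open>b\<close> with the first letter vanishes, \<open>b\<close> is a sum of two
  cycles which extend over \<open>V\<close> and \<open>V'\<close>, respectively.\<close>

lemma th_linear_letter:
  assumes V: "finite V" "V \<subseteq> {..<n}" and V': "finite V'" "V' \<subseteq> {..<n}" "V' \<noteq> {}"
    and pos: "0 < card V' - 1 + card V"
    and prods: "\<And>v v'. v \<in> V \<Longrightarrow> v' \<in> V' \<Longrightarrow> xvar v + xvar v' \<in> N"
    and disj: "V \<inter> V' = {} \<or> (\<exists>l. V' = {l})"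
    and b: "pure u p b" "\<And>v. v \<in> V \<union> V' \<Longrightarrow> Poly_Mapping.lookup u v = 0"
    and cs: "\<And>c. c \<in> set cs \<Longrightarrow> \<exists>u p. pure u p c \<and> (\<forall>v\<in>V \<union> V'. Poly_Mapping.lookup u v = 0)"
    and k: "k = length cs + 2"
  shows "th h (dlet V V' t # b # cs) \<in> D"
proof -
  have bb: "b \<in> kG n N p" "kdif N b = 0" "0 < p" "Poly_Mapping.keys b \<subseteq> {a. mdeg a = u}"
    using b(1) by (auto simp: pure_def)
  have wl: "set (b # cs) \<subseteq> letters" "Suc (length (b # cs)) = k"
  proof -
    have "set cs \<subseteq> letters" using cs pure_letters by blast
    then show "set (b # cs) \<subseteq> letters" using pure_letters[OF b(1)] by simp
  qed (use k in simp)
  show ?thesis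
  proof (cases "V = {}")
    case True
    obtain e y where "y \<in> kG n N (Suc (card V' - 1 + card V))" "dlet V V' t - sg e (dlet V' V t) = kdif N y"
      using dlet_commute[OF V V'] by blast
    then have "dlet V V' t = kdif N y" "y \<in> kG n N (Suc (card V' - 1 + card V))" using True by auto
    then show ?thesis using th_exact_first[OF good_h _ pos wl(1) _ wl(2)] by simp
  next
    case Vne: False
    have bk: "(m, J) \<in> kbasis n N \<and> finite J \<and> J \<inter> (V \<union> V') = {} \<and> (\<forall>v\<in>V \<union> V'. v \<notin> Poly_Mapping.keys m)"
      if mJ: "(m, J) \<in> Poly_Mapping.keys b" for m J
    proof -
      have 1: "(m, J) \<in> kbasis n N" "finite J" using mJ keys_kG[OF bb(1)] kbasis_fin by auto
      have "Poly_Mapping.lookup (mdeg (m, J)) v = 0" if "v \<in> V \<union> V'" for v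
        using mJ bb(4) b(2)[OF that] by auto
      then have "v \<notin> J \<and> v \<notin> Poly_Mapping.keys m" if "v \<in> V \<union> V'" for v
        using that mdeg_lookup[OF 1(2), of m v] by (auto simp: in_keys_iff split: if_splits)
      then show ?thesis using 1 by auto
    qed
    \<comment> \<open>Up to sign, e_V times y0 is the product of the letters
      \<open>dlet V V' 1\<close> and b, hence a boundary; contracting it by e_V returns y0 = d (e_V'
      b).\<close>
    define y0 where "y0 = kmul N (kdif N (ext V' 1)) b"
    define y where "y = kmul N (ext V 1) y0"
    have y0k: "finite J \<and> (\<exists>i\<in>V'. i \<notin> J \<and> J \<inter> (V \<union> V') \<subseteq> V' - {i}) \<and> m \<notin> N"
      if "(m, J) \<in> Poly_Mapping.keys y0" for m J
    proof -
      have "Poly_Mapping.keys y0 \<subseteq> {(m, J). finite J \<and> (\<exists>i\<in>V'. i \<notin> J \<and> J \<inter> (V \<union> V') \<subseteq> V' - {i}) \<and> m \<notin> N}"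
        unfolding y0_def
      proof (rule keys_kmul[OF keys_kdif_ext[OF V'(1)] order_refl])
        fix m m' :: mono and I J :: "nat set"
        assume "(m, I) \<in> {(xvar i, V' - {i}) |i. i \<in> V' \<and> xvar i \<notin> N}" "(m', J) \<in> Poly_Mapping.keys b"
          "finite I" "m + m' \<notin> N"
        then show "(m + m', I \<union> J) \<in> {(m, J). finite J \<and> (\<exists>i\<in>V'. i \<notin> J \<and> J \<inter> (V \<union> V') \<subseteq> V' - {i}) \<and> m \<notin> N}"
          using bk[of m' J] by auto
      qed
      then show ?thesis using that by auto
    qed
    have y0V: "Poly_Mapping.keys y0 \<subseteq> {(m, J). finite J \<and> J \<inter> V = {} \<and> m \<notin> N}"
    proof clarify
      fix m J assume "(m, J) \<in> Poly_Mapping.keys y0"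
      from y0k[OF this] obtain i where "finite J" "i \<in> V'" "J \<inter> (V \<union> V') \<subseteq> V' - {i}" "m \<notin> N" by auto
      then show "finite J \<and> J \<inter> V = {} \<and> m \<notin> N" using disj by auto
    qed
    have yD: "y \<in> D"
    proof -
      have A: "dlet V V' 1 \<in> letters"
        unfolding letters_def using dlet_cycle[OF V V' prods, of 1] pos by blast
      have "ext V' 1 \<in> kG n N (Suc (card V' - 1))"
        using ext_kG[OF V'(1,2)] V' by (metis card_gt_0_iff Suc_diff_1)
      from mul_comm[OF ext_kG[OF V] d_G[OF this], of 1]
      have "dlet V V' 1 = sg (card V * (card V' - 1)) (kmul N (ext V 1) (kdif N (ext V' 1)))"
        by (simp add: dlet_def)
      then have "kmul N (dlet V V' 1) b = sg (card V * (card V' - 1)) y"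
        by (simp add: y_def y0_def mul_sg mul_assoc)
      moreover have "kmul N (dlet V V' 1) b \<in> D"
        by (rule kmul_letters_D[OF A pure_letters[OF b(1)]])
      ultimately show ?thesis by (simp add: D_sg)
    qed
    define s where "s = h y"
    have ds: "kdif N s = y" unfolding s_def by (rule h_D[OF yD])
    have y0m: "Poly_Mapping.keys y0 \<subseteq> {a. mdeg a = ind V' + u}"
      unfolding y0_def by (intro mdeg_kmul mdeg_kdif ext_mdeg bb)
    then have ym: "Poly_Mapping.keys y \<subseteq> {a. mdeg a = ind V + (ind V' + u)}"
      unfolding y_def by (intro mdeg_kmul ext_mdeg)
    have sm: "Poly_Mapping.keys s \<subseteq> {a. mdeg a = ind V + (ind V' + u)}"
    proof
      fix a assume "a \<in> Poly_Mapping.keys s"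
      then obtain b where "b \<in> Poly_Mapping.keys y" "mdeg a = mdeg b" unfolding s_def using h_keys by blast
      then show "a \<in> {a. mdeg a = ind V + (ind V' + u)}" using ym by auto
    qed
    have "ext V' 1 \<in> kG n N (Suc (card V' - 1))"
      using ext_kG[OF V'(1,2)] V' by (metis card_gt_0_iff Suc_diff_1)
    then have "y \<in> kG n N (card V + (card V' - 1 + p))"
      unfolding y_def y0_def by (intro mul_G ext_kG[OF V] d_G bb)
    then have "s \<in> kG n N (Suc (card V + (card V' - 1 + p)))"
      using hop unfolding s_def homotopy_op_def by blast
    moreover have "0 < card V'" using V' by (simp add: card_gt_0_iff)
    then have "Suc (card V + (card V' - 1 + p)) = p + card V + card V'" by simp
    ultimately have sG: "s \<in> kG n N (p + card V + card V')" by (simp add: ac_simps)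
    \<comment> \<open>Contracting d s = y by e_V shows that y0 is, up to sign, the differential of
      the contraction of s. Correcting e_V' b accordingly gives a cycle whose contraction by e_V' is
      b minus a signed double contraction of s.\<close>
    define bt1 where "bt1 = kmul N (ext V' 1) b - sg (card V) (contr V s)"
    \<comment> \<open>The cycle that accounts for the double contraction of s, taken in the other
      order. If V and V' meet, double contractions vanish and 0 is the right value.\<close>
    define bt2 where "bt2 = (if V \<inter> V' = {} then contr V' s else 0)"
    have y0V': "contr V y = y0" unfolding y_def by (rule contr_ext[OF V(1) y0V])
    have "kdif N (kmul N (ext V' 1) b) = y0" using bb(2) by (simp add: d_mul y0_def)
    then have d1: "kdif N bt1 = 0"
      by (simp add: bt1_def additive_diff[OF additive_kdif] additive_sg[OF additive_kdif] kdif_contr[OF V(1)] ds y0V')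
    have d2: "kdif N bt2 = 0"
    proof (cases "V \<inter> V' = {}")
      case True
      have "contr V' y = 0"
      proof -
        \<comment> \<open>d (e_V') has removed an index of V', and neither b nor e_V brings it
          back.\<close>
        have "Poly_Mapping.keys y \<subseteq> {(m, J). \<not> V' \<subseteq> J}"
          unfolding y_def
        proof (rule keys_kmul[OF _ order_refl, where K = "{(0, V)}"])
          fix m m' :: mono and I J :: "nat set" assume "(m, I) \<in> {(0, V)}" "(m', J) \<in> Poly_Mapping.keys y0"
          with y0k[of m' J] True show "(m + m', I \<union> J) \<in> {(m, J). \<not> V' \<subseteq> J}" by auto
        qed (auto simp: ext_def)
        then have "Poly_Mapping.keys (contr V' y) \<subseteq> {}" using keys_contr[of V' y] by fastforce
        then show ?thesis by simp
      qed
      then show ?thesis using True by (simp add: bt2_def kdif_contr[OF V'(1)] ds)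
    qed (simp add: bt2_def)
    have G1: "bt1 \<in> kG n N (p + card V')"
    proof -
      have "contr V s \<in> kG n N (p + card V')"
        by (rule contr_kG[OF V(1)]) (use sG in \<open>simp add: ac_simps\<close>)
      moreover have "kmul N (ext V' 1) b \<in> kG n N (p + card V')"
        using mul_G[OF ext_kG[OF V'(1,2), of 1] bb(1)] by (simp add: add.commute)
      ultimately have "kmul N (ext V' 1) b + - sg (card V) (contr V s) \<in> kG n N (p + card V')"
        by (intro G_add G_neg) (simp_all add: sg_def G_neg)
      then show ?thesis by (simp add: bt1_def)
    qed
    have m1: "Poly_Mapping.keys bt1 \<subseteq> {a. mdeg a = u + ind V'}"
    proof -
      have "Poly_Mapping.keys (contr V s) \<subseteq> {a. mdeg a = u + ind V'}"
        by (rule contr_mdeg[OF V(1)]) (use sm in \<open>simp add: ac_simps\<close>)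
      moreover have "Poly_Mapping.keys (kmul N (ext V' 1) b) \<subseteq> {a. mdeg a = u + ind V'}"
        using mdeg_kmul[OF ext_mdeg[of V' 1] bb(4)] by (simp add: add.commute)
      ultimately show ?thesis unfolding bt1_def
        by (intro order_trans[OF Poly_Mapping.keys_diff]) auto
    qed
    have G2: "bt2 \<in> kG n N (p + card V)"
      using contr_kG[OF V'(1) sG] G_0 by (simp add: bt2_def)
    have m2: "Poly_Mapping.keys bt2 \<subseteq> {a. mdeg a = u + ind V}"
    proof -
      have "Poly_Mapping.keys (contr V' s) \<subseteq> {a. mdeg a = u + ind V}"
        by (rule contr_mdeg[OF V'(1)]) (use sm in \<open>simp add: ac_simps\<close>)
      then show ?thesis by (simp add: bt2_def)
    qed
    have "contr V' (kmul N (ext V' 1) b) = b"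
      by (rule contr_ext[OF V'(1)]) (use bk in \<open>auto simp: kbasis_def\<close>)
    then have "contr V' bt1 = b - sg (card V) (contr V' (contr V s))"
      by (simp add: bt1_def additive_diff[OF additive_contr] additive_sg[OF additive_contr])
    moreover have "contr V bt2 = sg (card V * card V') (contr V' (contr V s))"
    proof (cases "V \<inter> V' = {}")
      case True
      then show ?thesis using contr_contr_disjoint[OF V(1) V'(1) True, of s] by (simp add: bt2_def)
    next
      case False
      then show ?thesis using contr_contr_overlap[OF False, of s] by (simp add: bt2_def)
    qed
    ultimately have b_eq: "b = contr V' bt1 + sg (card V + card V * card V') (contr V bt2)"
      by (simp add: sg_sg) (simp add: sg_def)
    have t2: "th h (dlet V V' t # contr V bt2 # cs) \<in> D"
      by (rule th_extends[OF V Vne V' prods G2 d2 bb(3) m2 _ k]) (use cs in blast)+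
    \<comment> \<open>\<open>bt1\<close> extends over V' instead of V, so the first letter is first
      exchanged for its homologous partner with V and V' interchanged.\<close>
    have t1: "th h (dlet V V' t # contr V' bt1 # cs) \<in> D"
    proof -
      have prods': "xvar v' + xvar v \<in> N" if "v' \<in> V'" "v \<in> V" for v v'
        using prods[OF that(2,1)] by (simp add: add.commute)
      have D1: "th h (dlet V' V t # contr V' bt1 # cs) \<in> D"
        by (rule th_extends[OF V' V Vne prods' G1 d1 bb(3) m1 _ k]) (use cs in blast)+
      obtain e z where z: "z \<in> kG n N (Suc (card V' - 1 + card V))" "dlet V V' t - sg e (dlet V' V t) = kdif N z"
        using dlet_commute[OF V V'] by blast
      have "contr V' bt1 \<in> letters"
        using contr_kG[OF V'(1) G1] bb(3) d1 kdif_contr[OF V'(1), of N bt1] by (auto simp: letters_def)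
      then have "set (contr V' bt1 # cs) \<subseteq> letters" using wl by auto
      from th_homologous_first[OF good_h z(1) pos z(2) this]
      have "th h (dlet V V' t # contr V' bt1 # cs) \<in> D \<longleftrightarrow> th h (sg e (dlet V' V t) # contr V' bt1 # cs) \<in> D"
        using k by simp
      then show ?thesis using D1 th_sg[OF hop, of "[]" e "dlet V' V t"] D_sg by simp
    qed
    have "th h ([dlet V V' t] @ b # cs) = th h ([dlet V V' t] @ contr V' bt1 # cs) +
        sg (card V + card V * card V') (th h ([dlet V V' t] @ contr V bt2 # cs))"
      by (subst b_eq) (simp only: th_add[OF hop] th_sg[OF hop])
    then show ?thesis using t1 t2 by (simp add: D_add D_sg)
  qed
qed

end

section \<open>Total degrees and coefficients of differentials\<close>

lemma total_deg_superset: "finite A \<Longrightarrow> Poly_Mapping.keys m \<subseteq> A \<Longrightarrow> total_deg m = (\<Sum>i\<in>A. Poly_Mapping.lookup m i)"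
  unfolding total_deg_def by (rule sum.mono_neutral_left) (auto simp: in_keys_iff)

lemma total_deg_add: "total_deg (m + m') = total_deg m + total_deg m'"
proof -
  let ?A = "Poly_Mapping.keys m \<union> Poly_Mapping.keys m'"
  have "total_deg (m + m') = (\<Sum>i\<in>?A. Poly_Mapping.lookup (m + m') i)"
    by (rule total_deg_superset[OF _ Poly_Mapping.keys_add]) simp
  then show ?thesis
    by (simp add: lookup_add sum.distrib total_deg_superset[of ?A m] total_deg_superset[of ?A m'])
qed

lemma total_deg_0 [simp]: "total_deg 0 = 0" by (simp add: total_deg_def)

lemma total_deg_xvar [simp]: "total_deg (xvar i) = 1"
  by (simp add: total_deg_def lookup_xvar)

lemma total_deg_ind: "finite I \<Longrightarrow> total_deg (ind I) = card I"
  by (induction I rule: finite_induct) (simp_all add: ind_insert total_deg_add)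

lemma total_deg_eq_0: "total_deg m = 0 \<Longrightarrow> m = 0"
  unfolding total_deg_def by (auto simp: in_keys_iff intro!: poly_mapping_eqI)

lemma total_deg_eq_1: "total_deg m = 1 \<Longrightarrow> \<exists>l. m = xvar l"
proof -
  assume m: "total_deg m = 1"
  then have "m \<noteq> 0" by auto
  then obtain l where l: "l \<in> Poly_Mapping.keys m" by (metis all_not_in_conv keys_eq_empty)
  have "total_deg (m - xvar l) = 0"
    using mono_split[OF l] m total_deg_add[of "m - xvar l" "xvar l"] by simp
  then have "m - xvar l = 0" by (rule total_deg_eq_0)
  then show ?thesis using mono_split[OF l] by auto
qed

lemma ind_inj: "finite I \<Longrightarrow> finite J \<Longrightarrow> ind I = ind J \<Longrightarrow> I = J"
  using lookup_ind by (metis one_neq_zero subsetI subset_antisym)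

lemma xvar_inj [simp]: "xvar i = xvar j \<longleftrightarrow> i = j"
  by (metis keys_xvar singleton_inject)

lemma single_of_keys: "Poly_Mapping.keys x \<subseteq> {a} \<Longrightarrow> x = Poly_Mapping.single a (Poly_Mapping.lookup x a)"
  by (rule poly_mapping_eqI) (auto simp: lookup_single when_def in_keys_iff)

lemma keys_kdif_single: "finite I \<Longrightarrow> Poly_Mapping.keys (kdif N (Poly_Mapping.single (m, I) c)) \<subseteq> {(m + xvar i, I - {i}) | i. i \<in> I \<and> m + xvar i \<notin> N}"
  unfolding kdif_single by (rule keys_sum_sub) auto

lemma lookup_kdif_single:
  assumes "finite I" "i \<in> I"
  shows "Poly_Mapping.lookup (kdif N (Poly_Mapping.single (m, I) c)) (m + xvar i, I - {i}) =
    (if m + xvar i \<notin> N then sg (below I i) c else 0)"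
proof -
  have "Poly_Mapping.lookup (kdif N (Poly_Mapping.single (m, I) c)) (m + xvar i, I - {i}) =
    (\<Sum>j\<in>I. if j = i then if m + xvar i \<notin> N then sg (below I i) c else 0 else 0)"
    unfolding kdif_single lookup_sum
  proof (rule sum.cong[OF refl])
    fix j assume "j \<in> I"
    then have "I - {j} = I - {i} \<longleftrightarrow> j = i" using assms by auto
    then show "Poly_Mapping.lookup (if m + xvar j \<notin> N then Poly_Mapping.single (m + xvar j, I - {j}) (sg (below I j) c) else 0)
        (m + xvar i, I - {i}) = (if j = i then if m + xvar i \<notin> N then sg (below I i) c else 0 else 0)"
      by (auto simp: lookup_single when_def)
  qed
  then show ?thesis using assms by simp
qed

section \<open>Letters of internal degree p or p + 1, and the inductive step\<close>

context koszul_step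
begin

lemma pure_disjoint:
  assumes "pure u p b" "\<And>v. v \<in> W \<Longrightarrow> Poly_Mapping.lookup u v = 0" "(m, J) \<in> Poly_Mapping.keys b"
  shows "finite J \<and> J \<inter> W = {} \<and> m \<notin> N"
proof -
  have 1: "(m, J) \<in> kbasis n N" using assms(1,3) keys_kG by (auto simp: pure_def)
  then have f: "finite J" by (rule kbasis_fin)
  have "Poly_Mapping.lookup (mdeg (m, J)) v = 0" if "v \<in> W" for v
    using assms(1,3) assms(2)[OF that] by (auto simp: pure_def)
  then have "v \<notin> J" if "v \<in> W" for v
    using that mdeg_lookup[OF f, of m v] by (auto split: if_splits)
  then show ?thesis using f 1 by (auto simp: kbasis_def)
qed

lemma pure_key:
  assumes "pure u p z" "(m, I) \<in> Poly_Mapping.keys z"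
  shows "finite I" "I \<subseteq> {..<n}" "card I = p" "m + ind I = u" "m \<notin> N" "Poly_Mapping.keys m \<subseteq> {..<n}"
    "total_deg u = total_deg m + p"
proof -
  have 1: "(m, I) \<in> kbasis n N" and c: "card I = p" and u: "m + ind I = u"
    using assms by (auto simp: pure_def kG_def mdeg_def)
  then show "finite I" "I \<subseteq> {..<n}" "card I = p" "m + ind I = u" "m \<notin> N" "Poly_Mapping.keys m \<subseteq> {..<n}"
    by (auto simp: kbasis_def intro: finite_subset)
  then show "total_deg u = total_deg m + p"
    using u by (auto simp: total_deg_add total_deg_ind)
qed

definition away :: "mono \<Rightarrow> 'k kel \<Rightarrow> bool" where
  "away u z \<longleftrightarrow> (\<exists>u' p'. pure u' p' z \<and> (\<forall>v. 0 < Poly_Mapping.lookup u v \<longrightarrow> Poly_Mapping.lookup u' v = 0))"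

text \<open>The letter is a multiple of e_I, which is then a cycle. Its product with b bounds and b
  avoids I, so contracting a primitive by e_I shows that b itself is a boundary.\<close>

lemma th_strand0:
  assumes \<alpha>: "pure u p \<alpha>" "\<alpha> \<noteq> 0" "total_deg u = p"
    and b: "away u b" and cs: "\<And>c. c \<in> set cs \<Longrightarrow> away u c" and k: "k = length cs + 2"
  shows "th h (\<alpha> # b # cs) \<in> D"
proof -
  have key: "m = 0 \<and> ind I = u" if "(m, I) \<in> Poly_Mapping.keys \<alpha>" for m I
    using pure_key[OF \<alpha>(1) that] \<alpha>(3) total_deg_eq_0[of m] by auto
  obtain m0 I where "(m0, I) \<in> Poly_Mapping.keys \<alpha>" using \<alpha>(2) by (metis all_not_in_conv keys_eq_empty surj_pair)
  then have I0: "(0, I) \<in> Poly_Mapping.keys \<alpha>" using key by auto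
  note I = pure_key[OF \<alpha>(1) I0]
  have "Poly_Mapping.keys \<alpha> \<subseteq> {(0, I)}"
  proof clarify
    fix m J assume J: "(m, J) \<in> Poly_Mapping.keys \<alpha>"
    show "m = 0 \<and> J = I"
      using key[OF J] key[OF I0] ind_inj[of J I] pure_key(1)[OF \<alpha>(1) J] I(1) by auto
  qed
  then obtain c where c: "\<alpha> = ext I c" unfolding ext_def by (metis single_of_keys)
  have "c \<noteq> 0" using \<alpha>(2) c by (auto simp: ext_def)
  then have "ext I 1 = kscale (inverse c) \<alpha>" by (simp add: c ext_def kscale_single)
  then have "kdif N (ext I (1::'k)) = kscale (inverse c) (kdif N \<alpha>)" by (simp add: kdif_kscale)
  then have cyc: "kdif N (ext I (1::'k)) = 0" using \<alpha>(1) by (simp add: pure_def additive_0[OF additive_kscale])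
  have p: "0 < p" using \<alpha>(1) by (simp add: pure_def)
  have e: "ext I (1::'k) \<in> kG n N p" using ext_kG[OF I(1,2), of 1] I(3) by simp
  obtain ub pb where b': "pure ub pb b" "\<And>v. 0 < Poly_Mapping.lookup u v \<Longrightarrow> Poly_Mapping.lookup ub v = 0"
    using b by (auto simp: away_def)
  have bb: "b \<in> kG n N pb" "0 < pb" using b'(1) by (auto simp: pure_def)
  let ?y = "kmul N (ext I 1) b"
  have "ext I (1::'k) \<in> letters" unfolding letters_def using e cyc p by blast
  then have yD: "?y \<in> D" by (rule kmul_letters_D[OF _ pure_letters[OF b'(1)]])
  have "0 < Poly_Mapping.lookup u v" if "v \<in> I" for v
    using that I(1,4) lookup_ind[OF I(1), of v] by auto
  then have "contr I ?y = b"
    using pure_disjoint[OF b'(1), of I] b'(2) by (intro contr_ext[OF I(1)]) auto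
  then have "kdif N (contr I (h ?y)) = sg p b"
    using kdif_contr[OF I(1), of N "h ?y"] h_D[OF yD] I(3) by simp
  then have db: "b = kdif N (sg p (contr I (h ?y)))"
    by (simp add: additive_sg[OF additive_kdif])
  have "?y \<in> kG n N (p + pb)" by (rule mul_G[OF e bb(1)])
  then have "h ?y \<in> kG n N (Suc pb + card I)"
    using hop I(3) by (simp add: homotopy_op_def add.commute)
  then have "contr I (h ?y) \<in> kG n N (Suc pb)" by (rule contr_kG[OF I(1)])
  then have yG: "sg p (contr I (h ?y)) \<in> kG n N (Suc pb)" by (simp add: sg_def G_neg)
  have cl: "set cs \<subseteq> letters" using cs pure_letters unfolding away_def by blast
  have "th h ([\<alpha>] @ b # cs) \<in> D"
  proof (rule th_move[OF hop order_refl pure_letters[OF b'(1)]])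
    fix w assume "set w \<subseteq> letters" "Suc (length w) = k"
    then show "th h (b # w) \<in> D"
      using k3 by (subst db, intro th_exact_first[OF good_h yG bb(2)]) auto
  qed (use cl k pure_letters[OF \<alpha>(1)] in auto)
  then show ?thesis by simp
qed

text \<open>A square x_l^2 in the multidegree leaves room for one basis element only, x_l e_I with l
  in I. It is a cycle just when x_l x_v lies in the ideal for all v in I, and then the letter is
  \<open>dlet I {l} c\<close>.\<close>

lemma th_strand1_square:
  assumes \<alpha>: "pure u p \<alpha>" "total_deg u = Suc p"
    and key: "(xvar l, I) \<in> Poly_Mapping.keys \<alpha>" "l \<in> I"
    and b: "away u b" and cs: "\<And>c. c \<in> set cs \<Longrightarrow> away u c" and k: "k = length cs + 2"
  shows "th h (\<alpha> # b # cs) \<in> D"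
proof -
  note I = pure_key[OF \<alpha>(1) key(1)]
  have ul: "Poly_Mapping.lookup u l = 2"
    using I(4) key(2) I(1) by (auto simp: lookup_add lookup_ind lookup_xvar)
  have "Poly_Mapping.keys \<alpha> \<subseteq> {(xvar l, I)}"
  proof clarify
    fix m J assume J: "(m, J) \<in> Poly_Mapping.keys \<alpha>"
    note J' = pure_key[OF \<alpha>(1) J]
    have "total_deg m = 1" using J'(7) \<alpha>(2) by simp
    then obtain l' where m: "m = xvar l'" using total_deg_eq_1 by blast
    have "Poly_Mapping.lookup (xvar l') l + (if l \<in> J then 1 else 0) = 2"
      using J'(1,4) m ul by (auto simp: lookup_add lookup_ind)
    then have "l' = l" by (auto simp: lookup_xvar split: if_splits)
    moreover have "xvar l + ind J = xvar l + ind I" using J'(4) I(4) m \<open>l' = l\<close> by simp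
    then have "ind J = ind I" by (rule add_left_imp_eq)
    then have "J = I" by (rule ind_inj[OF J'(1) I(1)])
    ultimately show "m = xvar l \<and> J = I" using m by simp
  qed
  then obtain c where c: "\<alpha> = Poly_Mapping.single (xvar l, I) c" by (metis single_of_keys)
  have c0: "c \<noteq> 0" using key(1) c by auto
  have prods: "xvar v + xvar v' \<in> N" if "v \<in> I" "v' \<in> {l}" for v v'
  proof (rule ccontr)
    assume "xvar v + xvar v' \<notin> N"
    then have "xvar l + xvar v \<notin> N" using that by (simp add: add.commute)
    then have "sg (below I v) c = 0"
      using lookup_kdif_single[OF I(1) that(1), of N "xvar l" c] \<alpha>(1) c by (simp add: pure_def)
    then show False using c0 by (simp add: sg_def split: if_splits)
  qed
  have "kdif N (ext {l} c) = Poly_Mapping.single (xvar l, {}) c"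
  proof -
    have "{j \<in> {l}. j < l} = {}" by auto
    then have "below {l} l = 0" unfolding below_def by simp
    then show ?thesis using I(5) by (simp add: kdif_ext)
  qed
  then have \<alpha>_eq: "\<alpha> = dlet I {l} c"
    using I(1,5) c by (simp add: dlet_def ext_def kmul_single)
  have pos: "0 < Poly_Mapping.lookup u v" if "v \<in> I \<union> {l}" for v
    using that I(1,4) key(2) lookup_ind[OF I(1), of v] by (auto simp: lookup_add)
  obtain ub pb where b': "pure ub pb b" "\<And>v. 0 < Poly_Mapping.lookup u v \<Longrightarrow> Poly_Mapping.lookup ub v = 0"
    using b by (auto simp: away_def)
  have l: "l < n" using key(2) I(2) by auto
  show ?thesis
    unfolding \<alpha>_eq
  proof (rule th_linear_letter[OF I(1,2) _ _ _ _ prods _ b'(1) _ _ k])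
    show "0 < card {l} - 1 + card I" using I(1) key(2) by (auto simp: card_gt_0_iff)
    show "Poly_Mapping.lookup ub v = 0" if "v \<in> I \<union> {l}" for v using b'(2)[OF pos[OF that]] .
    show "\<exists>u p. pure u p c \<and> (\<forall>v\<in>I \<union> {l}. Poly_Mapping.lookup u v = 0)" if "c \<in> set cs" for c
      using cs[OF that] pos unfolding away_def by blast
  qed (use l in auto)
qed

text \<open>The letter is a sum of c_l x_l e_(W-l). After a change of signs, the cycle condition
  says that coefficients at l and m agree whenever x_l x_m is outside the ideal: a locally constant
  function on a graph. Variables of different levels have products in the ideal, and each level set
  contributes one \<open>dlet\<close>.\<close>

lemma th_strand1_squarefree:
  assumes \<alpha>: "pure u p \<alpha>" "\<alpha> \<noteq> 0" "total_deg u = Suc p"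
    and sqf: "\<And>l I. (xvar l, I) \<in> Poly_Mapping.keys \<alpha> \<Longrightarrow> l \<notin> I"
    and b: "away u b" and cs: "\<And>c. c \<in> set cs \<Longrightarrow> away u c" and k: "k = length cs + 2"
  shows "th h (\<alpha> # b # cs) \<in> D"
proof -
  have key: "\<exists>l. m = xvar l \<and> l \<notin> I \<and> ind (insert l I) = u" if mI: "(m, I) \<in> Poly_Mapping.keys \<alpha>" for m I
  proof -
    note I = pure_key[OF \<alpha>(1) mI]
    have "total_deg m = 1" using I(7) \<alpha>(3) by simp
    then obtain l where "m = xvar l" using total_deg_eq_1 by blast
    then show ?thesis using sqf[of l I] mI I by (auto simp: ind_insert)
  qed
  obtain m0 I0 where k0: "(m0, I0) \<in> Poly_Mapping.keys \<alpha>" using \<alpha>(2) by (metis all_not_in_conv keys_eq_empty surj_pair)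
  then obtain l0 where l0: "m0 = xvar l0" "ind (insert l0 I0) = u" using key by blast
  define W where "W = insert l0 I0"
  have W: "finite W" "W \<subseteq> {..<n}" "ind W = u"
    using pure_key[OF \<alpha>(1) k0] l0 by (auto simp: W_def)
  define c where "c l = Poly_Mapping.lookup \<alpha> (xvar l, W - {l})" for l
  define c' where "c' l = sg (below W l) (c l)" for l
  let ?t = "\<lambda>l. Poly_Mapping.single (xvar l, W - {l}) (c l)"
  have keys: "Poly_Mapping.keys \<alpha> \<subseteq> (\<lambda>l. (xvar l, W - {l})) ` W"
  proof clarify
    fix m I assume mI: "(m, I) \<in> Poly_Mapping.keys \<alpha>"
    then obtain l where l: "m = xvar l" "l \<notin> I" "ind (insert l I) = u" using key by blast
    have "insert l I = W" using ind_inj[OF _ W(1)] l(3) W(3) pure_key(1)[OF \<alpha>(1) mI] by auto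
    then show "(m, I) \<in> (\<lambda>l. (xvar l, W - {l})) ` W" using l by auto
  qed
  have \<alpha>_sum: "\<alpha> = (\<Sum>l\<in>W. ?t l)"
  proof -
    have "\<alpha> = (\<Sum>a\<in>(\<lambda>l. (xvar l, W - {l})) ` W. Poly_Mapping.single a (Poly_Mapping.lookup \<alpha> a))"
      by (subst sum_singles[symmetric], rule sum.mono_neutral_left) (use keys W in \<open>auto simp: in_keys_iff\<close>)
    also have "\<dots> = (\<Sum>l\<in>W. ?t l)"
      by (subst sum.reindex) (auto simp: inj_on_def c_def)
    finally show ?thesis .
  qed
  have cN: "c l = 0" if "l \<in> W" "xvar l \<in> N" for l
    using pure_key(5)[OF \<alpha>(1), of "xvar l" "W - {l}"] that by (auto simp: c_def in_keys_iff)
  \<comment> \<open>Only the terms at l and m reach x_l x_m e_(W-l-m), so this coefficient of d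
    \<alpha> compares c_l with c_m; the signs in \<open>c'\<close> absorb the difference.\<close>
  have level: "c' l = c' m" if lm: "l \<in> W" "m \<in> W" "l \<noteq> m" "xvar l + xvar m \<notin> N" for l m
  proof -
    let ?a = "(xvar l + xvar m, W - {l} - {m})"
    have 1: "Poly_Mapping.lookup (kdif N (?t l)) ?a = sg (below (W - {l}) m) (c l)"
      using lookup_kdif_single[of "W - {l}" m N "xvar l" "c l"] lm W by simp
    have "?a = (xvar m + xvar l, W - {m} - {l})" by (auto simp: add.commute)
    then have 2: "Poly_Mapping.lookup (kdif N (?t m)) ?a = sg (below (W - {m}) l) (c m)"
      using lookup_kdif_single[of "W - {m}" l N "xvar m" "c m"] lm W by (simp add: add.commute)
    have 3: "Poly_Mapping.lookup (kdif N (?t j)) ?a = 0" if j: "j \<in> W - {l, m}" for j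
    proof -
      have "j \<in> W - {l} - {m}" using j by auto
      then have "?a \<notin> Poly_Mapping.keys (kdif N (?t j))"
        using keys_kdif_single[of "W - {j}" N "xvar j" "c j"] W by auto
      then show ?thesis by (simp add: in_keys_iff)
    qed
    have "0 = Poly_Mapping.lookup (kdif N \<alpha>) ?a" using \<alpha>(1) by (simp add: pure_def)
    also have "\<dots> = (\<Sum>j\<in>W. Poly_Mapping.lookup (kdif N (?t j)) ?a)"
      by (subst \<alpha>_sum) (simp add: additive_sum[OF additive_kdif] lookup_sum)
    also have "\<dots> = (\<Sum>j\<in>{l, m}. Poly_Mapping.lookup (kdif N (?t j)) ?a)"
      by (rule sum.mono_neutral_right) (use W lm 3 in auto)
    also have "\<dots> = sg (below (W - {l}) m) (c l) + sg (below (W - {m}) l) (c m)" using lm 1 2 by simp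
    finally have z: "sg (below (W - {l}) m) (c l) = - sg (below (W - {m}) l) (c m)" by (simp add: eq_neg_iff_add_eq_0)
    have par: "odd (below (W - {l}) m + below (W - {m}) l + below W l + below W m)"
      using below_remove[OF W(1) lm(1), of m] below_remove[OF W(1) lm(2), of l] lm(3) by auto
    have cl: "c l = - sg (below (W - {l}) m + below (W - {m}) l) (c m)"
      using arg_cong[OF z, of "sg (below (W - {l}) m)"] by (simp add: sg_minus sg_sg)
    show ?thesis
      unfolding c'_def cl using par by (auto simp: sg_minus sg_sg sg_def)
  qed
  \<comment> \<open>Variables in the ideal have coefficient 0. They are kept out of the level sets
    and fall into the complement W - V t, where their products with V t are in the ideal
    anyway.\<close>
  define W' where "W' = {l \<in> W. xvar l \<notin> N}"
  define V where "V t = {l \<in> W'. c' l = t}" for t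
  have VW: "V t \<subseteq> W" for t by (auto simp: V_def W'_def)
  \<comment> \<open>The terms of one level set are those of d (e_V) e_(W-V), up to a common sign
    that comes from reordering e_V e_(W-V).\<close>
  have dl: "(\<Sum>l\<in>V t. ?t l) = sg (inversions (V t) (W - V t)) (dlet (W - V t) (V t) t)" for t
  proof -
    let ?V = "V t" and ?V' = "W - V t"
    have fin: "finite ?V" "finite ?V'" using finite_subset[OF VW W(1)] W(1) by auto
    have "dlet ?V' ?V t = (\<Sum>l\<in>?V. kmul N (Poly_Mapping.single (xvar l, ?V - {l}) (sg (below ?V l) t)) (ext ?V' 1))"
      unfolding dlet_def kdif_ext additive_sum[OF additive_kmul_left]
      by (rule sum.cong) (auto simp: V_def W'_def)
    then have "sg (inversions ?V ?V') (dlet ?V' ?V t) =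
      (\<Sum>l\<in>?V. sg (inversions ?V ?V') (kmul N (Poly_Mapping.single (xvar l, ?V - {l}) (sg (below ?V l) t)) (ext ?V' 1)))"
      by (simp add: sg_sum)
    also have "\<dots> = (\<Sum>l\<in>?V. ?t l)"
    proof (rule sum.cong[OF refl])
      fix l assume l: "l \<in> ?V"
      have s: "(?V - {l}) \<inter> ?V' = {}" "(?V - {l}) \<union> ?V' = W - {l}" using VW l by auto
      have i: "inversions ?V ?V' = inversions (?V - {l}) ?V' + below ?V' l"
        by (rule inversions_remove_left[OF fin l])
      have "below W l = below ?V l + below ?V' l"
        using below_Un[OF fin, of l] VW by (simp add: Un_absorb1)
      then have e: "even (inversions ?V ?V' + (inversions (?V - {l}) ?V' + below ?V l)) = even (below W l)"
        using i by auto
      have "c l = sg (below W l) t" using l by (auto simp: V_def c'_def)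
      then have "c l = sg (inversions ?V ?V' + (inversions (?V - {l}) ?V' + below ?V l)) t"
        using sg_cong[OF e, of t] by simp
      then show "sg (inversions ?V ?V') (kmul N (Poly_Mapping.single (xvar l, ?V - {l}) (sg (below ?V l) t)) (ext ?V' 1)) = ?t l"
        using fin s l by (auto simp: ext_def kmul_single sg_sg single_sg[symmetric] V_def W'_def)
    qed
    finally show ?thesis ..
  qed
  have fW': "finite W'" using W by (simp add: W'_def)
  have "\<alpha> = (\<Sum>l\<in>W'. ?t l)"
    by (subst \<alpha>_sum, rule sum.mono_neutral_right) (use W cN in \<open>auto simp: W'_def\<close>)
  also have "\<dots> = (\<Sum>t\<in>c' ` W'. \<Sum>l\<in>V t. ?t l)"
    unfolding V_def by (rule sum.image_gen[OF fW'])
  also have "\<dots> = (\<Sum>t\<in>c' ` W'. sg (inversions (V t) (W - V t)) (dlet (W - V t) (V t) t))"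
    by (simp only: dl)
  finally have \<alpha>_dec: "\<alpha> = (\<Sum>t\<in>c' ` W'. sg (inversions (V t) (W - V t)) (dlet (W - V t) (V t) t))" .
  have pos: "0 < Poly_Mapping.lookup u v" if "v \<in> W" for v
    using that W lookup_ind[OF W(1), of v] by auto
  obtain ub pb where b': "pure ub pb b" "\<And>v. 0 < Poly_Mapping.lookup u v \<Longrightarrow> Poly_Mapping.lookup ub v = 0"
    using b by (auto simp: away_def)
  have cardW: "card W = Suc p"
    using W total_deg_ind[OF W(1)] \<alpha>(3) by simp
  have p: "0 < p" using \<alpha>(1) by (simp add: pure_def)
  have D: "th h (dlet (W - V t) (V t) t # b # cs) \<in> D" if t: "t \<in> c' ` W'" for t
  proof (rule th_linear_letter[OF _ _ _ _ _ _ _ _ b'(1) _ _ k])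
    show fin: "finite (W - V t)" "finite (V t)" using finite_subset[OF VW W(1)] W(1) by auto
    show "W - V t \<subseteq> {..<n}" "V t \<subseteq> {..<n}" using VW W by auto
    show ne: "V t \<noteq> {}" using t by (auto simp: V_def)
    have "card (V t) + card (W - V t) = card W"
      using card_Un_disjoint[OF fin(2,1)] VW by (simp add: Un_absorb1)
    then show "0 < card (V t) - 1 + card (W - V t)" using cardW p by linarith
    show "xvar v + xvar v' \<in> N" if v: "v \<in> W - V t" "v' \<in> V t" for v v'
    proof (cases "xvar v \<in> N")
      case True
      then show ?thesis by (rule upsetD(1)[OF up])
    next
      case False
      then have "c' v \<noteq> c' v'" using v by (auto simp: V_def W'_def)
      then show ?thesis using level[of v v'] v VW by blast
    qed
    show "(W - V t) \<inter> V t = {} \<or> (\<exists>l. V t = {l})" by auto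
    show "Poly_Mapping.lookup ub v = 0" if "v \<in> W - V t \<union> V t" for v
      using that VW by (intro b'(2) pos) auto
    show "\<exists>u p. pure u p c \<and> (\<forall>v\<in>W - V t \<union> V t. Poly_Mapping.lookup u v = 0)" if "c \<in> set cs" for c
      using cs[OF that] pos VW unfolding away_def by blast
  qed
  have "th h ([] @ \<alpha> # b # cs) = (\<Sum>t\<in>c' ` W'. sg (inversions (V t) (W - V t)) (th h ([] @ dlet (W - V t) (V t) t # b # cs)))"
    by (subst \<alpha>_dec) (simp only: th_sum[OF hop] th_sg[OF hop])
  then show ?thesis using D by (simp add: D_sum D_sg)
qed

text \<open>The multihomogeneous components of a cycle are cycles, since the differential preserves
  multidegrees.\<close>

lemma pure_decompose:
  assumes "z \<in> letters"
  shows "\<exists>A f. finite (A :: (mono \<times> nat) set) \<and> z = sum f A \<and> f ` A \<subseteq> {z. \<exists>u p. pure u p z}"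
proof -
  obtain p where p: "0 < p" "z \<in> kG n N p" "kdif N z = 0" using assms by (auto simp: letters_def)
  then obtain q where q: "p = Suc q" by (cases p) auto
  let ?A = "sdg ` Poly_Mapping.keys z" and ?f = "\<lambda>t. restr {a. sdg a = t} z"
  have "z = sum ?f ?A" by (rule restr_sum_partition) auto
  moreover have "\<exists>u p. pure u p (?f t)" if "t \<in> ?A" for t
  proof -
    obtain u where t: "t = (u, p)" using \<open>t \<in> ?A\<close> p(2) by (auto simp: sdg_def kG_def)
    have "kdif N (?f t) = 0" unfolding t q kdif_restr using p(3) by (simp add: additive_0[OF additive_restr])
    moreover have "?f t \<in> kG n N p" using p(2) by (auto simp: kG_def keys_restr)
    moreover have "Poly_Mapping.keys (?f t) \<subseteq> {a. mdeg a = u}" by (auto simp: keys_restr t sdg_def)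
    ultimately show ?thesis using p(1) unfolding pure_def by blast
  qed
  then have "?f ` ?A \<subseteq> {z. \<exists>u p. pure u p z}" by blast
  ultimately show ?thesis by (intro exI[of _ ?A] exI[of _ ?f] conjI) simp_all
qed

text \<open>The explicit constructions require the other letters to avoid the variables of \<alpha>.
  A letter that does not avoid them shares a variable with \<alpha>, and \<open>th_overlap\<close>
  applies.\<close>

lemma th_low_strand:
  assumes \<alpha>: "pure u p \<alpha>" "\<alpha> \<noteq> 0" "total_deg u \<le> Suc p"
    and w: "\<And>z. z \<in> set w \<Longrightarrow> \<exists>u p. pure u p z" "Suc (length w) = k"
  shows "th h (\<alpha> # w) \<in> D"
proof (cases "\<forall>z\<in>set w. away u z")
  case True
  then obtain b cs where bc: "w = b # cs" using w(2) k3 by (cases w) auto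
  have k: "k = length cs + 2" using w(2) bc by simp
  obtain m I where mI: "(m, I) \<in> Poly_Mapping.keys \<alpha>" using \<alpha>(2) by (metis all_not_in_conv keys_eq_empty surj_pair)
  have "p \<le> total_deg u" using pure_key(7)[OF \<alpha>(1) mI] by simp
  then consider "total_deg u = p" | "total_deg u = Suc p" using \<alpha>(3) by linarith
  then show ?thesis
  proof cases
    case 1
    then show ?thesis unfolding bc using True bc by (intro th_strand0[OF \<alpha>(1,2) 1 _ _ k]) auto
  next
    case 2
    show ?thesis
    proof (cases "\<exists>l I. (xvar l, I) \<in> Poly_Mapping.keys \<alpha> \<and> l \<in> I")
      case sq: True
      then obtain l I where l: "(xvar l, I) \<in> Poly_Mapping.keys \<alpha>" "l \<in> I" by blast
      show ?thesis unfolding bc by (rule th_strand1_square[OF \<alpha>(1) 2 l _ _ k]) (use True bc in auto)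
    next
      case False
      show ?thesis unfolding bc by (rule th_strand1_squarefree[OF \<alpha>(1,2) 2 _ _ _ k]) (use True bc False in auto)
    qed
  qed
next
  case False
  then obtain z where z: "z \<in> set w" "\<not> away u z" by blast
  obtain u' p' where z': "pure u' p' z" using w(1)[OF z(1)] by blast
  then obtain v where v: "0 < Poly_Mapping.lookup u v" "Poly_Mapping.lookup u' v \<noteq> 0"
    using z(2) by (auto simp: away_def)
  \<comment> \<open>0 is pure of multidegree 0 and therefore counts as away. A nonzero z really has
    terms of positive degree in v.\<close>
  have "z \<noteq> 0"
  proof
    assume "z = 0"
    then have "pure 0 p' z" using z' by (simp add: pure_def)
    then show False using z(2) unfolding away_def by (metis lookup_zero)
  qed
  let ?P = "\<lambda>z. \<exists>a\<in>Poly_Mapping.keys z. 0 < Poly_Mapping.lookup (mdeg a) v"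
  have nz: "?P y" if y: "pure s q y" "y \<noteq> 0" "0 < Poly_Mapping.lookup s v" for s q y
  proof -
    obtain a where "a \<in> Poly_Mapping.keys y" using y(2) by (metis all_not_in_conv keys_eq_empty)
    then show ?thesis using y(1,3) by (auto simp: pure_def)
  qed
  have 1: "?P \<alpha>" "?P z" using nz[OF \<alpha>(1,2) v(1)] nz[OF z' \<open>z \<noteq> 0\<close>] v(2) by auto
  have "filter ?P w \<noteq> []" using 1(2) z(1) by (auto simp: filter_empty_conv)
  then have "1 \<le> length (filter ?P w)" by (cases "filter ?P w") auto
  then have "2 \<le> length (filter ?P (\<alpha> # w))" using 1(1) by simp
  then show ?thesis by (intro th_overlap[where v = v]) (use w \<alpha>(1) in auto)
qed

lemma trivial_systems_step:
  assumes acyc: "\<And>z P J. z \<in> kG n N P \<Longrightarrow> kdif N z = 0 \<Longrightarrow>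
      (\<And>a. a \<in> Poly_Mapping.keys z \<Longrightarrow> total_deg (mdeg a) = J) \<Longrightarrow> P + k + 2 \<le> J \<Longrightarrow> z \<in> D"
  shows "trivial_systems k"
proof (rule trivial_systems_words[OF good_h])
  show "2 \<le> k" using k3 by simp
  let ?B = "{z. \<exists>u p. pure u p z}"
  fix w assume w: "set w \<subseteq> letters" "length w = k"
  show "th h w \<in> D"
  proof (rule th_decompose[OF hop pure_decompose _ w])
    fix w assume w: "set w \<subseteq> ?B" "length w = k"
    show "th h w \<in> D"
    proof (cases "\<exists>\<alpha>\<in>set w. \<exists>u p. pure u p \<alpha> \<and> total_deg u \<le> Suc p")
      case True
      then obtain \<alpha> u p where \<alpha>: "\<alpha> \<in> set w" "pure u p \<alpha>" "total_deg u \<le> Suc p" by blast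
      obtain x y where xy: "w = x @ \<alpha> # y" using \<alpha>(1) by (meson split_list)
      show ?thesis
      proof (cases "\<alpha> = 0")
        case True
        then show ?thesis using xy th_0[OF hop] D_0 by simp
      next
        case False
        have BL: "?B \<subseteq> letters" using pure_letters by blast
        have \<alpha>w: "th h (\<alpha> # v) \<in> D" if v: "set v \<subseteq> ?B" "Suc (length v) = k" for v
          by (rule th_low_strand[OF \<alpha>(2) False \<alpha>(3) _ v(2)]) (use v(1) in blast)
        have "set x \<subseteq> ?B" "set y \<subseteq> ?B" "Suc (length x + length y) = k"
          using w unfolding xy by simp_all
        from th_move[OF hop BL pure_letters[OF \<alpha>(2)] \<alpha>w this] show ?thesis unfolding xy .
      qed
    next
      case False
      have "\<forall>z\<in>set w. \<exists>up. pure (fst up) (snd up) z" using w(1) by auto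
      then obtain f where f: "\<forall>z\<in>set w. pure (fst (f z)) (snd (f z)) z" by (rule bchoice[THEN exE])
      define uc pc where "uc z = fst (f z)" and "pc z = snd (f z)" for z
      have up: "pure (uc z) (pc z) z" if "z \<in> set w" for z using f that by (simp add: uc_def pc_def)
      have big: "pc z + 2 \<le> total_deg (uc z)" if "z \<in> set w" for z
      proof -
        have "\<not> total_deg (uc z) \<le> Suc (pc z)" using False up[OF that] that by blast
        then show ?thesis by simp
      qed
      have hw: "homogeneous_word w (map pc w)"
        unfolding homogeneous_word_def list_all2_map2 list_all2_same using up by (auto simp: pure_def)
      have ne: "w \<noteq> []" using w k3 by auto
      have G: "th h w \<in> kG n N (sdeg (map pc w) - 2)" by (rule th_G[OF hop hw ne])
      have m: "Poly_Mapping.keys (th h w) \<subseteq> {a. mdeg a = sum_list (map uc w)}"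
        by (rule gam_th_mdeg[THEN conjunct2]) (use up in \<open>auto simp: list_all2_map2 list_all2_same pure_def\<close>)
      have t: "total_deg (sum_list (map uc w)) = (\<Sum>z\<leftarrow>w. total_deg (uc z))"
        by (induction w) (simp_all add: total_deg_add)
      \<comment> \<open>Each internal degree is at least p + 2, one more than the raised degree p +
        1.\<close>
      have s: "sdeg (map pc w) + length w \<le> (\<Sum>z\<leftarrow>w. total_deg (uc z))"
        using big
      proof (induction w)
        case (Cons a w)
        have "pc a + 2 \<le> total_deg (uc a)" by (rule Cons.prems) simp
        moreover have "sdeg (map pc w) + length w \<le> (\<Sum>z\<leftarrow>w. total_deg (uc z))"
          by (rule Cons.IH, rule Cons.prems) simp
        ultimately show ?case by (simp add: sdeg_def)
      qed (simp add: sdeg_def)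
      have cyc: "kdif N (th h w) = 0"
        by (rule th_cycle[OF good_h homogeneous_word_letters[OF hw]]) (use w in simp)
      have "2 * length w \<le> sdeg (map pc w)" by (rule homogeneous_word_sdeg[OF hw])
      \<comment> \<open>\<open>sdeg\<close> - 2 is the homological degree of \<theta>; the lower
        bound on \<open>sdeg\<close> keeps this subtraction of natural numbers exact.\<close>
      then have "sdeg (map pc w) - 2 + k + 2 \<le> total_deg (sum_list (map uc w))"
        using s t w(2) k3 by simp
      then show ?thesis using m by (intro acyc[OF G cyc]) auto
    qed
  qed
qed

end

section \<open>Regularity\<close>

definition emb :: "nat set \<Rightarrow> 'k::field pol \<Rightarrow> 'k kel" where
  "emb I = lin (\<lambda>m c. Poly_Mapping.single (m, I) c)"

definition kcomp :: "'k::field kel \<Rightarrow> nat set \<Rightarrow> 'k pol" where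
  "kcomp x I = lin (\<lambda>(m, J) c. if J = I then Poly_Mapping.single m c else 0) x"

lemma additive_emb: "additive_map (emb I)"
  unfolding emb_def by (rule additive_lin) (simp add: additive_in_def single_add)

lemma emb_single: "emb I (Poly_Mapping.single m c) = Poly_Mapping.single (m, I) c"
  unfolding emb_def by (rule lin_single) (simp add: additive_in_def single_add)

lemma additive_in_comp: "additive_in (\<lambda>(m, J) c. if J = I then Poly_Mapping.single m (c::'k::field) else 0)"
  by (auto simp: additive_in_def single_add)

lemma additive_comp: "additive_map (\<lambda>x. kcomp x I)"
  unfolding kcomp_def by (rule additive_lin[OF additive_in_comp])

lemma comp_single: "kcomp (Poly_Mapping.single (m, J) c) I = (if J = I then Poly_Mapping.single m c else 0)"
  unfolding kcomp_def by (subst lin_single[OF additive_in_comp]) simp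

lemma lookup_comp: "Poly_Mapping.lookup (kcomp x I) m = Poly_Mapping.lookup x (m, I)"
proof (rule additive_eq_pair[where x = x and f = "\<lambda>x. Poly_Mapping.lookup (kcomp x I) m" and g = "\<lambda>x. Poly_Mapping.lookup x (m, I)"])
  show "additive_map (\<lambda>x. Poly_Mapping.lookup (kcomp x I) m)"
    by (simp add: additive_map_def additive_add[OF additive_comp] lookup_add)
qed (auto simp: additive_map_def lookup_add comp_single lookup_single when_def)

lemma comp_emb: "kcomp (emb J p) I = (if I = J then p else 0)"
proof (rule additive_eq[where x = p and f = "\<lambda>p. kcomp (emb J p) I" and g = "\<lambda>p. if I = J then p else 0"])
  show "additive_map (\<lambda>p. kcomp (emb J p) I)"
    by (simp add: additive_map_def additive_add[OF additive_comp] additive_add[OF additive_emb])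
qed (auto simp: additive_map_def emb_single comp_single)

lemma comp_eqI: "(\<And>I. kcomp x I = kcomp y I) \<Longrightarrow> x = y"
  by (rule poly_mapping_eqI) (metis lookup_comp surj_pair)

definition Sn :: "nat \<Rightarrow> 'k::field pol set" where
  "Sn n = {f. \<forall>m\<in>Poly_Mapping.keys f. Poly_Mapping.keys m \<subseteq> {..<n}}"

lemma comp_Sn: "x \<in> kC n N \<Longrightarrow> kcomp x I \<in> Sn n"
  by (auto simp: kC_def kbasis_def Sn_def in_keys_iff lookup_comp)

lemma comp_out: "x \<in> kC n N \<Longrightarrow> \<not> I \<subseteq> {..<n} \<Longrightarrow> kcomp x I = 0"
  by (rule poly_mapping_eqI) (auto simp: kC_def kbasis_def lookup_comp in_keys_iff)

lemma kC_compI: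
  assumes "\<And>I. I \<subseteq> {..<n} \<Longrightarrow> kcomp x I \<in> Sn n" "\<And>I. \<not> I \<subseteq> {..<n} \<Longrightarrow> kcomp x I = 0"
  shows "x \<in> kC n {}"
  unfolding kC_def kbasis_def
proof clarify
  fix m I assume "(m, I) \<in> Poly_Mapping.keys x"
  then have m: "m \<in> Poly_Mapping.keys (kcomp x I)" by (simp add: in_keys_iff lookup_comp)
  have I: "I \<subseteq> {..<n}" by (rule ccontr) (use assms(2)[of I] m in simp)
  then show "Poly_Mapping.keys m \<subseteq> {..<n} \<and> I \<subseteq> {..<n} \<and> m \<notin> {}"
    using m assms(1) by (auto simp: Sn_def)
qed

definition assemble :: "nat \<Rightarrow> (nat set \<Rightarrow> 'k::field pol) \<Rightarrow> 'k kel" where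
  "assemble n w = (\<Sum>I\<in>Pow {..<n}. emb I (w I))"

lemma comp_assemble: "kcomp (assemble n w) I = (if I \<subseteq> {..<n} then w I else 0)"
proof -
  have "kcomp (assemble n w) I = (\<Sum>J\<in>Pow {..<n}. if J = I then w I else 0)"
    unfolding assemble_def additive_sum[OF additive_comp] by (intro sum.cong) (auto simp: comp_emb)
  then show ?thesis by (simp add: sum.delta)
qed

lemma assemble_kC: "(\<And>I. I \<subseteq> {..<n} \<Longrightarrow> w I \<in> Sn n) \<Longrightarrow> assemble n w \<in> kC n {}"
  by (rule kC_compI) (auto simp: comp_assemble)

text \<open>Multiplication by a polynomial, realised inside the Koszul algebra over S (empty
  \<open>N\<close>), so that compatibility with the differential is an instance of the Leibniz
  rule.\<close>

definition act :: "'k::field pol \<Rightarrow> 'k kel \<Rightarrow> 'k kel" where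
  "act p x = kmul {} (emb {} p) x"

lemma additive_act: "additive_map (act p)" and additive_act_left: "additive_map (\<lambda>p. act p x)"
  unfolding act_def by (auto simp: additive_map_def kmul_add_left kmul_add_right additive_add[OF additive_emb])

lemma act_single: "act (Poly_Mapping.single m a) (Poly_Mapping.single (m', J) b) =
    (if finite J then Poly_Mapping.single (m + m', J) (a * b) else 0)"
  by (simp add: act_def emb_single kmul_single)

lemma upset_empty: "upset {}" by (simp add: upset_def)

lemma kdif_act: "kdif {} (act p x) = act p (kdif {} x)"
proof -
  have "kdif {} (emb {} p) = (\<lambda>_. 0) p"
    by (rule additive_eq[where x = p])
       (auto simp: additive_map_def additive_add[OF additive_emb] additive_add[OF additive_kdif] emb_single kdif_single)
  moreover have "kbar (emb {} p) = - emb {} p"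
    by (rule additive_eq[where x = p])
       (auto simp: additive_map_def additive_add[OF additive_emb] additive_add[OF additive_kbar] emb_single kbar_single sg_def single_uminus)
  ultimately show ?thesis
    unfolding act_def kdif_kmul[OF upset_empty]
    by (simp add: additive_neg[OF additive_kmul_left])
qed

lemma comp_act:
  assumes "finite I"
  shows "kcomp (act p x) I = p * kcomp x I"
proof (rule additive_eq[where x = p and f = "\<lambda>p. kcomp (act p x) I"])
  fix m and a :: 'a
  show "kcomp (act (Poly_Mapping.single m a) x) I = Poly_Mapping.single m a * kcomp x I"
  proof (rule additive_eq_pair[where x = x and f = "\<lambda>x. kcomp (act (Poly_Mapping.single m a) x) I"])
    fix m' J b
    show "kcomp (act (Poly_Mapping.single m a) (Poly_Mapping.single (m', J) b)) I =
        Poly_Mapping.single m a * kcomp (Poly_Mapping.single (m', J) b) I"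
      using assms by (auto simp: act_single comp_single mult_single additive_0[OF additive_comp])
  qed (simp_all add: additive_map_def additive_add[OF additive_comp] additive_add[OF additive_act] algebra_simps)
qed (simp_all add: additive_map_def additive_add[OF additive_comp] additive_add[OF additive_act_left] algebra_simps)

lemma Sn_mult: "p \<in> Sn n \<Longrightarrow> q \<in> Sn n \<Longrightarrow> p * q \<in> Sn n"
proof -
  assume pq: "p \<in> Sn n" "q \<in> Sn n"
  have "Poly_Mapping.keys m \<subseteq> {..<n}" if m: "m \<in> Poly_Mapping.keys (p * q)" for m
  proof -
    obtain a b where "m = a + b" "a \<in> Poly_Mapping.keys p" "b \<in> Poly_Mapping.keys q"
      using keys_mult[of p q] m by blast
    then show ?thesis using pq keys_mono_add[of a n b] by (simp add: Sn_def)
  qed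
  then show ?thesis by (simp add: Sn_def)
qed

lemma Sn_add: "p \<in> Sn n \<Longrightarrow> q \<in> Sn n \<Longrightarrow> p + q \<in> Sn n"
  unfolding Sn_def using Poly_Mapping.keys_add[of p q] by blast

lemma Sn_0: "0 \<in> Sn n" by (simp add: Sn_def)

lemma Sn_sum: "(\<And>i. i \<in> A \<Longrightarrow> f i \<in> Sn n) \<Longrightarrow> sum f A \<in> Sn n"
  by (induction A rule: infinite_finite_induct) (auto simp: Sn_0 Sn_add)

lemma act_kC: "p \<in> Sn n \<Longrightarrow> x \<in> kC n {} \<Longrightarrow> act p x \<in> kC n {}"
proof (rule kC_compI)
  fix I assume p: "p \<in> Sn n" and x: "x \<in> kC n {}"
  show "kcomp (act p x) I \<in> Sn n" if "I \<subseteq> {..<n}"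
    using comp_act[OF finite_subset[OF that finite_lessThan], of p x] p comp_Sn[OF x, of I] by (simp add: Sn_mult)
  show "kcomp (act p x) I = 0" if "\<not> I \<subseteq> {..<n}"
  proof -
    have "Poly_Mapping.keys (act p x) \<subseteq> {(m, J). J \<subseteq> {..<n}}"
      unfolding act_def
    proof (rule keys_kmul[where K = "{(m, J). J = {}}"])
      show "Poly_Mapping.keys (emb {} p) \<subseteq> {(m, J). J = {}}"
        by (rule additive_keys[OF additive_emb subset_UNIV]) (auto simp: emb_single)
      show "Poly_Mapping.keys x \<subseteq> {(m, J). J \<subseteq> {..<n}}" using x by (auto simp: kC_def kbasis_def)
    qed auto
    then show ?thesis using that by (intro poly_mapping_eqI) (auto simp: lookup_comp in_keys_iff)
  qed
qed

lemma kC_add: "x \<in> kC n N \<Longrightarrow> y \<in> kC n N \<Longrightarrow> x + y \<in> kC n N"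
  unfolding kC_def mem_Collect_eq by (rule keys_add_sub)

lemma kC_0: "0 \<in> kC n N" by (simp add: kC_def)

lemma kC_sum: "(\<And>i. i \<in> A \<Longrightarrow> f i \<in> kC n N) \<Longrightarrow> sum f A \<in> kC n N"
  unfolding kC_def mem_Collect_eq by (rule keys_sum_sub)

lemma kC_neg: "x \<in> kC n N \<Longrightarrow> - x \<in> kC n N" by (simp add: kC_def)

lemma kC_restr: "x \<in> kC n N \<Longrightarrow> restr K x \<in> kC n N" by (auto simp: kC_def keys_restr)

definition wt :: "mono \<times> nat set \<Rightarrow> int" where "wt a = int (total_deg (mdeg a))"

lemma restr_act:
  assumes f: "homogeneous e f"
  shows "restr {a. wt a = J + e \<and> card (snd a) = q} (act f x) = act f (restr {a. wt a = J \<and> card (snd a) = q} x)"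
    (is "restr ?K _ = act f (restr ?L x)")
proof (rule additive_eq_pair[where x = x and f = "\<lambda>x. restr ?K (act f x)"])
  fix m I and c :: 'a
  show "restr ?K (act f (Poly_Mapping.single (m, I) c)) = act f (restr ?L (Poly_Mapping.single (m, I) c))"
  proof (rule additive_eq_on[where x = f and K = "Poly_Mapping.keys f" and f = "\<lambda>f. restr ?K (act f (Poly_Mapping.single (m, I) c))"])
    fix m' and a :: 'a assume "m' \<in> Poly_Mapping.keys f"
    then have "int (total_deg m') = e" using f by (auto simp: homogeneous_def)
    then have "(m' + m, I) \<in> ?K \<longleftrightarrow> (m, I) \<in> ?L"
      by (auto simp: wt_def mdeg_def total_deg_add)
    then show "restr ?K (act (Poly_Mapping.single m' a) (Poly_Mapping.single (m, I) c)) =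
        act (Poly_Mapping.single m' a) (restr ?L (Poly_Mapping.single (m, I) c))"
      by (auto simp: act_single restr_single additive_0[OF additive_act] additive_0[OF additive_restr])
  qed (auto simp: additive_map_def additive_add[OF additive_restr] additive_add[OF additive_act_left])
qed (simp_all add: additive_map_def additive_add[OF additive_restr] additive_add[OF additive_act])

lemma restr_card_act:
  "restr {a. card (snd a) = q} (act f x) = act f (restr {a. card (snd a) = q} x)"
    (is "restr ?K _ = _")
proof (rule additive_eq_pair[where x = x and f = "\<lambda>x. restr ?K (act f x)"])
  fix m I and c :: 'a
  show "restr ?K (act f (Poly_Mapping.single (m, I) c)) = act f (restr ?K (Poly_Mapping.single (m, I) c))"
  proof (rule additive_eq[where x = f and f = "\<lambda>f. restr ?K (act f (Poly_Mapping.single (m, I) c))"])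
    fix m' and a :: 'a
    show "restr ?K (act (Poly_Mapping.single m' a) (Poly_Mapping.single (m, I) c)) =
        act (Poly_Mapping.single m' a) (restr ?K (Poly_Mapping.single (m, I) c))"
      by (auto simp: act_single restr_single additive_0[OF additive_act] additive_0[OF additive_restr])
  qed (auto simp: additive_map_def additive_add[OF additive_restr] additive_add[OF additive_act_left])
qed (simp_all add: additive_map_def additive_add[OF additive_restr] additive_add[OF additive_act])

lemma kdif_restr_card: "kdif N (restr {a. card (snd a) = Suc q} x) = restr {a. card (snd a) = q} (kdif N x)"
proof (rule additive_eq_pair[where x = x])
  fix m :: mono and I and c :: 'a
  show "kdif N (restr {a. card (snd a) = Suc q} (Poly_Mapping.single (m, I) c)) = restr {a. card (snd a) = q} (kdif N (Poly_Mapping.single (m, I) c))"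
  proof (cases "finite I")
    case True
    have "card (I - {i}) = q \<longleftrightarrow> card I = Suc q" if "i \<in> I" for i
      using card_Suc_Diff1[OF True that] by linarith
    then have "restr {a. card (snd a) = q} (if m + xvar i \<notin> N then Poly_Mapping.single (m + xvar i, I - {i}) (sg (below I i) c) else 0) =
       (if card I = Suc q then (if m + xvar i \<notin> N then Poly_Mapping.single (m + xvar i, I - {i}) (sg (below I i) c) else 0) else 0)"
      if "i \<in> I" for i
      using that by (auto simp: restr_single additive_0[OF additive_restr])
    then show ?thesis
      by (auto simp: restr_single kdif_single additive_sum[OF additive_restr] cong: sum.cong)
  qed (simp add: kdif_single restr_single additive_0[OF additive_restr])
qed (intro additive_comps)+

text \<open>Left multiplication by e_i for the least index i, with x_i divided out; no sign occurs
  because nothing stands before e_i.\<close>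

definition khom :: "'k::field kel \<Rightarrow> 'k kel" where
  "khom = lin (\<lambda>(m, I) c. let S = Poly_Mapping.keys m \<union> I in
     if S = {} \<or> Min S \<in> I then 0 else Poly_Mapping.single (m - xvar (Min S), insert (Min S) I) c)"

lemma additive_in_khom: "additive_in (\<lambda>(m, I) c. let S = Poly_Mapping.keys m \<union> I in
     if S = {} \<or> Min S \<in> I then 0 else Poly_Mapping.single (m - xvar (Min S), insert (Min S) I) (c::'k::field))"
  by (auto simp: additive_in_def single_add Let_def)

lemma additive_khom: "additive_map khom"
  unfolding khom_def by (rule additive_lin[OF additive_in_khom])

lemma khom_single: "khom (Poly_Mapping.single (m, I) c) =
    (if Poly_Mapping.keys m \<union> I = {} \<or> Min (Poly_Mapping.keys m \<union> I) \<in> I then 0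
     else Poly_Mapping.single (m - xvar (Min (Poly_Mapping.keys m \<union> I)), insert (Min (Poly_Mapping.keys m \<union> I)) I) c)"
  unfolding khom_def by (subst lin_single[OF additive_in_khom]) (simp add: Let_def)

lemma khom_kC: "x \<in> kC n {} \<Longrightarrow> khom x \<in> kC n {}"
  unfolding kC_def mem_Collect_eq
proof (rule additive_keys[OF additive_khom, where K = "kbasis n {}"])
  fix a and c :: 'a assume a: "a \<in> kbasis n {}"
  obtain m I where [simp]: "a = (m, I)" by (cases a)
  let ?S = "Poly_Mapping.keys m \<union> I"
  have S: "finite ?S" "?S \<subseteq> {..<n}" using a by (auto simp: kbasis_def intro: finite_subset)
  show "Poly_Mapping.keys (khom (Poly_Mapping.single a c)) \<subseteq> kbasis n {}"
  proof (cases "?S = {} \<or> Min ?S \<in> I")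
    case False
    then have "Min ?S < n" using Min_in[OF S(1)] S(2) by auto
    then show ?thesis using a keys_mono_minus[of m "xvar (Min ?S)"] False
      by (auto simp: khom_single kbasis_def)
  qed (simp add: khom_single)
qed

lemma keys_mono_plus: "Poly_Mapping.keys (m + m' :: mono) = Poly_Mapping.keys m \<union> Poly_Mapping.keys m'"
  by (auto simp: in_keys_iff lookup_add)

text \<open>In every multidegree other than \<open>0\<close>, multiplication by \<open>e_i\<close> for the least \<open>i\<close> in the support
  gives a contracting homotopy of the Koszul complex of the polynomial ring.\<close>

lemma khom_homotopy_single:
  assumes I: "finite I" and S: "Poly_Mapping.keys m \<union> I \<noteq> {}"
  shows "kdif {} (khom (Poly_Mapping.single (m, I) c)) + khom (kdif {} (Poly_Mapping.single (m, I) c)) =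
    Poly_Mapping.single (m, I) (c::'k::field)"
proof -
  define i where "i = Min (Poly_Mapping.keys m \<union> I)"
  have iS: "i \<in> Poly_Mapping.keys m \<union> I" and imin: "\<And>j. j \<in> Poly_Mapping.keys m \<union> I \<Longrightarrow> i \<le> j"
    unfolding i_def using Min_in[OF _ S] Min_le[of "Poly_Mapping.keys m \<union> I"] I by auto
  have supp: "Poly_Mapping.keys (m + xvar j) \<union> (I - {j}) = Poly_Mapping.keys m \<union> I" if "j \<in> I" for j
    using that by (auto simp: keys_mono_plus)
  have kh: "khom (Poly_Mapping.single (m + xvar j, I - {j}) c') =
      (if i \<in> I - {j} then 0 else Poly_Mapping.single (m + xvar j - xvar i, insert i (I - {j})) c')" if "j \<in> I" for j c'
    unfolding khom_single supp[OF that] i_def[symmetric] using S by auto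
  have kd: "khom (kdif {} (Poly_Mapping.single (m, I) c)) =
     (\<Sum>j\<in>I. if i \<in> I - {j} then 0 else Poly_Mapping.single (m + xvar j - xvar i, insert i (I - {j})) (sg (below I j) c))"
    unfolding kdif_single additive_sum[OF additive_khom] by (rule sum.cong) (simp_all add: kh)
  show ?thesis
  proof (cases "i \<in> I")
    case True
    have "{j \<in> I. j < i} = {}" using imin by fastforce
    then have b0: "below I i = 0" unfolding below_def by simp
    have "khom (kdif {} (Poly_Mapping.single (m, I) c)) = (\<Sum>j\<in>I. if j = i then Poly_Mapping.single (m, I) c else 0)"
      unfolding kd by (rule sum.cong) (use True b0 in \<open>auto simp: insert_absorb\<close>)
    moreover have "khom (Poly_Mapping.single (m, I) c) = 0"
      using True by (simp add: khom_single i_def)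
    ultimately show ?thesis using True I by simp
  next
    case False
    then have im: "i \<in> Poly_Mapping.keys m" using iS by auto
    have "khom (Poly_Mapping.single (m, I) c) = Poly_Mapping.single (m - xvar i, insert i I) c"
      using False S by (auto simp: khom_single i_def)
    then have "kdif {} (khom (Poly_Mapping.single (m, I) c)) = (\<Sum>j\<in>insert i I. Poly_Mapping.single (m - xvar i + xvar j, insert i I - {j}) (sg (below (insert i I) j) c))"
      by (simp add: kdif_single)
    also have "\<dots> = Poly_Mapping.single (m, I) c + (\<Sum>j\<in>I. Poly_Mapping.single (m - xvar i + xvar j, insert i I - {j}) (sg (below (insert i I) j) c))"
    proof -
      have "{j \<in> insert i I. j < i} = {}" using imin by fastforce
      then have "below (insert i I) i = 0" unfolding below_def by simp
      then show ?thesis using I False mono_split[OF im] by simp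
    qed
    also have "(\<Sum>j\<in>I. Poly_Mapping.single (m - xvar i + xvar j, insert i I - {j}) (sg (below (insert i I) j) c)) =
       - (\<Sum>j\<in>I. Poly_Mapping.single (m + xvar j - xvar i, insert i (I - {j})) (sg (below I j) c))"
      unfolding sum_negf[symmetric]
    proof (rule sum.cong[OF refl])
      fix j assume j: "j \<in> I"
      then have "i \<noteq> j" "i \<le> j" using False imin[of j] by auto
      then have "below (insert i I) j = Suc (below I j)"
        using below_remove[of "insert i I" i j] I False by simp
      moreover have "insert i I - {j} = insert i (I - {j})" using \<open>i \<noteq> j\<close> by auto
      ultimately show "Poly_Mapping.single (m - xvar i + xvar j, insert i I - {j}) (sg (below (insert i I) j) c) =
         - Poly_Mapping.single (m + xvar j - xvar i, insert i (I - {j})) (sg (below I j) c)"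
        using mono_split'[OF im, of j] by (simp add: sg_Suc single_uminus)
    qed
    finally show ?thesis using False by (simp add: kd cong: sum.cong)
  qed
qed

lemma koszul_exact:
  assumes x: "x \<in> kC n {}" "(0, {}) \<notin> Poly_Mapping.keys x" "kdif {} x = 0"
  shows "x = kdif {} (khom x)"
proof -
  have "(\<lambda>x. kdif {} (khom x) + khom (kdif {} x)) x = x"
  proof (rule additive_eq_on[where x = x and K = "kbasis n {} - {(0, {})}" and g = "\<lambda>x. x"])
    show "Poly_Mapping.keys x \<subseteq> kbasis n {} - {(0, {})}" using x by (auto simp: kC_def)
    fix a and c :: 'a assume a: "a \<in> kbasis n {} - {(0, {})}"
    obtain m I where [simp]: "a = (m, I)" by (cases a)
    have "finite I" "Poly_Mapping.keys m \<union> I \<noteq> {}" using a kbasis_fin by auto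
    then show "kdif {} (khom (Poly_Mapping.single a c)) + khom (kdif {} (Poly_Mapping.single a c)) = Poly_Mapping.single a c"
      using khom_homotopy_single[of I m c] by simp
  qed (simp_all add: additive_map_def additive_add[OF additive_khom] additive_add[OF additive_kdif])
  then show ?thesis using x by (simp add: additive_0[OF additive_khom])
qed

section \<open>The double complex of a free resolution and the Koszul complex\<close>

definition kmap :: "'k::field resolution \<Rightarrow> nat \<Rightarrow> (nat \<Rightarrow> 'k kel) \<Rightarrow> nat \<Rightarrow> 'k kel" where
  "kmap F i \<phi> c = (\<Sum>b<rank F (i + 1). act (dmat F i c b) (\<phi> b))"

text \<open>A graded resolution restated with polynomials alone: equality in the quotient becomes
  the condition that all terms of a difference lie in \<open>N\<close>, and extensional vectors
  become conditions on indices below the rank. \<open>f\<close> lifts the augmentation.\<close>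

locale free_res =
  fixes n :: nat and N :: "mono set" and F :: "'k::field resolution" and f :: "nat \<Rightarrow> 'k pol"
  assumes up: "upset N"
    and f_Sn: "c < rank F 0 \<Longrightarrow> f c \<in> Sn n"
    and f_hom: "c < rank F 0 \<Longrightarrow> homogeneous (gdeg F 0 c) (f c)"
    and dmat_Sn: "c < rank F i \<Longrightarrow> b < rank F (i + 1) \<Longrightarrow> dmat F i c b \<in> Sn n"
    and dmat_hom: "c < rank F i \<Longrightarrow> b < rank F (i + 1) \<Longrightarrow> homogeneous (gdeg F (i + 1) b - gdeg F i c) (dmat F i c b)"
    and surj: "p \<in> Sn n \<Longrightarrow> \<exists>v. (\<forall>c<rank F 0. v c \<in> Sn n) \<and> Poly_Mapping.keys (p - (\<Sum>c<rank F 0. f c * v c)) \<subseteq> N"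
    and ker: "(\<And>c. c < rank F 0 \<Longrightarrow> v c \<in> Sn n) \<Longrightarrow> Poly_Mapping.keys (\<Sum>c<rank F 0. f c * v c) \<subseteq> N \<Longrightarrow>
        \<exists>w. (\<forall>b<rank F 1. w b \<in> Sn n) \<and> (\<forall>c<rank F 0. v c = (\<Sum>b<rank F 1. dmat F 0 c b * w b))"
    and im: "(\<And>b. b < rank F 1 \<Longrightarrow> w b \<in> Sn n) \<Longrightarrow>
        Poly_Mapping.keys (\<Sum>c<rank F 0. f c * (\<Sum>b<rank F 1. dmat F 0 c b * w b)) \<subseteq> N"
    and exact: "(\<And>b. b < rank F (i + 1) \<Longrightarrow> v b \<in> Sn n) \<Longrightarrow>
        (\<And>c. c < rank F i \<Longrightarrow> (\<Sum>b<rank F (i + 1). dmat F i c b * v b) = 0) \<Longrightarrow>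
        \<exists>w. (\<forall>b<rank F (i + 2). w b \<in> Sn n) \<and> (\<forall>c<rank F (i + 1). v c = (\<Sum>b<rank F (i + 2). dmat F (i + 1) c b * w b))"
    and cplx: "(\<And>b. b < rank F (i + 2) \<Longrightarrow> w b \<in> Sn n) \<Longrightarrow> c < rank F i \<Longrightarrow>
        (\<Sum>b<rank F (i + 1). dmat F i c b * (\<Sum>b'<rank F (i + 2). dmat F (i + 1) b b' * w b')) = 0"
begin

definition chain :: "nat \<Rightarrow> (nat \<Rightarrow> 'k kel) \<Rightarrow> bool" where
  "chain i \<phi> \<longleftrightarrow> (\<forall>b<rank F i. \<phi> b \<in> kC n {})"

lemma kmap_kC: "chain (i + 1) \<phi> \<Longrightarrow> c < rank F i \<Longrightarrow> kmap F i \<phi> c \<in> kC n {}"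
  unfolding kmap_def chain_def by (intro kC_sum act_kC dmat_Sn) auto

lemma kcomp_kmap: "finite I \<Longrightarrow> kcomp (kmap F i \<phi> c) I = (\<Sum>b<rank F (i + 1). dmat F i c b * kcomp (\<phi> b) I)"
  unfolding kmap_def by (simp add: additive_sum[OF additive_comp] comp_act)

lemma kdif_kmap: "kdif {} (kmap F i \<phi> c) = kmap F i (\<lambda>b. kdif {} (\<phi> b)) c"
  unfolding kmap_def by (simp add: additive_sum[OF additive_kdif] kdif_act)

lemma kmap_add: "kmap F i (\<lambda>b. \<phi> b + \<psi> b) c = kmap F i \<phi> c + kmap F i \<psi> c"
  unfolding kmap_def by (simp add: additive_add[OF additive_act] sum.distrib)

lemma kmap_0 [simp]: "kmap F i (\<lambda>b. 0) c = 0"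
  unfolding kmap_def by (simp add: additive_0[OF additive_act])

lemma kmap_cong: "(\<And>b. b < rank F (i + 1) \<Longrightarrow> \<phi> b = \<psi> b) \<Longrightarrow> kmap F i \<phi> c = kmap F i \<psi> c"
  unfolding kmap_def by (intro sum.cong) auto

lemma kC_eqI:
  assumes "x \<in> kC n N'" "y \<in> kC n N'" "\<And>I. I \<subseteq> {..<n} \<Longrightarrow> kcomp x I = kcomp y I"
  shows "x = y"
proof (rule comp_eqI)
  fix I show "kcomp x I = kcomp y I"
    using assms comp_out[of x n N' I] comp_out[of y n N' I] by (cases "I \<subseteq> {..<n}") auto
qed

lemma fin_sub: "I \<subseteq> {..<n} \<Longrightarrow> finite (I :: nat set)"
  by (rule finite_subset[OF _ finite_lessThan])

lemma kmap_kmap: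
  assumes \<phi>: "chain (i + 2) \<phi>" and c: "c < rank F i"
  shows "kmap F i (kmap F (i + 1) \<phi>) c = 0"
proof (rule kC_eqI[OF kmap_kC[OF _ c] kC_0])
  show "chain (i + 1) (kmap F (i + 1) \<phi>)"
    unfolding chain_def using kmap_kC[of "i + 1" \<phi>] \<phi> by simp
  fix I :: "nat set" assume I: "I \<subseteq> {..<n}"
  have "kcomp (kmap F i (kmap F (i + 1) \<phi>) c) I =
     (\<Sum>b<rank F (i + 1). dmat F i c b * (\<Sum>b'<rank F (i + 2). dmat F (i + 1) b b' * kcomp (\<phi> b') I))"
    by (simp add: kcomp_kmap fin_sub[OF I])
  also have "\<dots> = 0" using \<phi> by (intro cplx[OF _ c] comp_Sn) (auto simp: chain_def)
  finally show "kcomp (kmap F i (kmap F (i + 1) \<phi>) c) I = kcomp 0 I" by (simp add: additive_0[OF additive_comp])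
qed

text \<open>The Koszul complex is free over S, so exactness of the resolution applies to the
  coefficient of each e_I separately.\<close>

lemma kmap_lift:
  assumes \<phi>: "chain (i + 1) \<phi>" and 0: "\<And>c. c < rank F i \<Longrightarrow> kmap F i \<phi> c = 0"
  shows "\<exists>\<psi>. chain (i + 2) \<psi> \<and> (\<forall>b<rank F (i + 1). \<phi> b = kmap F (i + 1) \<psi> b)"
proof -
  have "\<exists>w. (\<forall>b<rank F (i + 2). w b \<in> Sn n) \<and>
      (\<forall>c<rank F (i + 1). kcomp (\<phi> c) I = (\<Sum>b<rank F (i + 2). dmat F (i + 1) c b * w b))" if I: "I \<subseteq> {..<n}" for I
  proof (rule exact)
    show "kcomp (\<phi> b) I \<in> Sn n" if "b < rank F (i + 1)" for b
      using \<phi> that by (auto simp: chain_def intro: comp_Sn)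
    show "(\<Sum>b<rank F (i + 1). dmat F i c b * kcomp (\<phi> b) I) = 0" if "c < rank F i" for c
      using kcomp_kmap[OF fin_sub[OF I], of i \<phi> c] 0[OF that] by (simp add: additive_0[OF additive_comp])
  qed
  then obtain w where w: "\<And>I. I \<subseteq> {..<n} \<Longrightarrow> (\<forall>b<rank F (i + 2). w I b \<in> Sn n) \<and>
      (\<forall>c<rank F (i + 1). kcomp (\<phi> c) I = (\<Sum>b<rank F (i + 2). dmat F (i + 1) c b * w I b))" by metis
  define \<psi> where "\<psi> b = assemble n (\<lambda>I. w I b)" for b
  have \<psi>: "chain (i + 2) \<psi>" unfolding chain_def \<psi>_def using w by (auto intro: assemble_kC)
  have "\<phi> b = kmap F (i + 1) \<psi> b" if b: "b < rank F (i + 1)" for b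
  proof (rule kC_eqI)
    show "\<phi> b \<in> kC n {}" using \<phi> b by (simp add: chain_def)
    show "kmap F (i + 1) \<psi> b \<in> kC n {}" using \<psi> b by (intro kmap_kC) simp_all
    fix I :: "nat set" assume I: "I \<subseteq> {..<n}"
    show "kcomp (\<phi> b) I = kcomp (kmap F (i + 1) \<psi> b) I"
      using w[OF I] b I by (simp add: kcomp_kmap fin_sub[OF I] \<psi>_def comp_assemble)
  qed
  with \<psi> show ?thesis by blast
qed

definition hpart :: "int \<Rightarrow> nat \<Rightarrow> 'k kel \<Rightarrow> 'k kel" where
  "hpart J q = restr {a. wt a = J \<and> card (snd a) = q}"

lemma additive_hpart: "additive_map (hpart J q)"
  unfolding hpart_def by (rule additive_restr)

text \<open>In total degree J, the coefficient of a generator has internal degree J minus the degree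
  of that generator; the maps of the resolution respect this.\<close>

lemma hpart_kmap:
  assumes "c < rank F i"
  shows "hpart (J - gdeg F i c) q (kmap F i \<phi> c) = kmap F i (\<lambda>b. hpart (J - gdeg F (i + 1) b) q (\<phi> b)) c"
  unfolding kmap_def additive_sum[OF additive_hpart]
proof (rule sum.cong[OF refl])
  fix b assume b: "b \<in> {..<rank F (i + 1)}"
  have e: "J - gdeg F i c = (J - gdeg F (i + 1) b) + (gdeg F (i + 1) b - gdeg F i c)" by simp
  show "hpart (J - gdeg F i c) q (act (dmat F i c b) (\<phi> b)) = act (dmat F i c b) (hpart (J - gdeg F (i + 1) b) q (\<phi> b))"
    unfolding hpart_def by (subst e, rule restr_act) (use dmat_hom[OF assms] b in simp)
qed

lemma hpart_id: "Poly_Mapping.keys x \<subseteq> {a. wt a = J \<and> card (snd a) = q} \<Longrightarrow> hpart J q x = x"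
  unfolding hpart_def by (rule restr_id)

lemma hpart_kC: "x \<in> kC n N' \<Longrightarrow> hpart J q x \<in> kC n N'"
  unfolding hpart_def by (rule kC_restr)

lemma keys_hpart: "Poly_Mapping.keys (hpart J q x) \<subseteq> {a. wt a = J \<and> card (snd a) = q}"
  by (auto simp: hpart_def keys_restr)

lemma kdif_keys_wt:
  assumes "Poly_Mapping.keys x \<subseteq> {a. wt a = J \<and> card (snd a) = Suc q}"
  shows "Poly_Mapping.keys (kdif N' x) \<subseteq> {a. wt a = J \<and> card (snd a) = q}"
  by (rule keys_kdif[OF assms]) (auto simp: wt_def mdeg_step)

text \<open>The double complex argument for \<open>Tor\<close>, one column at a time: a cycle in the Koszul complex of the
  image of \<open>F i\<close> bounds if \<open>F (i + q)\<close> has no generator of its degree.\<close>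

lemma tor_vanishing:
  assumes "\<And>b. b < rank F i \<Longrightarrow> \<phi> b \<in> kC n {} \<and> Poly_Mapping.keys (\<phi> b) \<subseteq> {a. wt a = J - gdeg F i b \<and> card (snd a) = q}"
    and "chain (i + 1) \<psi>" "\<And>b. b < rank F i \<Longrightarrow> kdif {} (\<phi> b) = kmap F i \<psi> b"
    and "\<And>c. c < rank F (i + q) \<Longrightarrow> gdeg F (i + q) c \<noteq> J"
  shows "\<exists>\<omega> \<chi>. chain i \<omega> \<and> chain (i + 1) \<chi> \<and> (\<forall>b<rank F i. \<phi> b = kdif {} (\<omega> b) + kmap F i \<chi> b)"
  using assms
proof (induction q arbitrary: i \<phi> \<psi>)
  case 0
  \<comment> \<open>In Koszul degree 0 only a constant term obstructs being a boundary. A constant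
    coefficient would force the generator to have degree J, which is excluded.\<close>
  have "\<phi> b = kdif {} (khom (\<phi> b))" if b: "b < rank F i" for b
  proof (rule koszul_exact)
    show "\<phi> b \<in> kC n {}" using 0(1)[OF b] by simp
    show "(0, {}) \<notin> Poly_Mapping.keys (\<phi> b)"
    proof
      assume "(0, {}) \<in> Poly_Mapping.keys (\<phi> b)"
      then have "wt (0, {}) = J - gdeg F i b" using 0(1)[OF b] by auto
      then show False using 0(4)[of b] b by (simp add: wt_def mdeg_def)
    qed
    have "Poly_Mapping.keys (kdif {} (\<phi> b)) \<subseteq> {}"
    proof (rule keys_kdif)
      show "Poly_Mapping.keys (\<phi> b) \<subseteq> {(m, I). card I = 0}" using 0(1)[OF b] by auto
    qed auto
    then show "kdif {} (\<phi> b) = 0" by simp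
  qed
  moreover have "chain i (\<lambda>b. khom (\<phi> b))" using 0(1) by (auto simp: chain_def intro: khom_kC)
  moreover have "chain (i + 1) (\<lambda>b. 0)" by (simp add: chain_def kC_0)
  ultimately show ?case by (intro exI[of _ "\<lambda>b. khom (\<phi> b)"] exI[of _ "\<lambda>b. 0"]) simp
next
  case (Suc q)
  \<comment> \<open>The given \<psi> may have components of wrong degree; cutting it down to the
    right one preserves the equation for d \<phi>.\<close>
  define \<psi>' where "\<psi>' b = hpart (J - gdeg F (i + 1) b) q (\<psi> b)" for b
  have \<psi>'C: "chain (i + 1) \<psi>'" using Suc.prems(2) by (auto simp: chain_def \<psi>'_def intro: hpart_kC)
  have d\<phi>: "kdif {} (\<phi> b) = kmap F i \<psi>' b" if b: "b < rank F i" for b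
  proof -
    have "kdif {} (\<phi> b) = hpart (J - gdeg F i b) q (kdif {} (\<phi> b))"
      by (rule hpart_id[symmetric], rule kdif_keys_wt) (use Suc.prems(1)[OF b] in simp)
    also have "\<dots> = kmap F i \<psi>' b"
      using Suc.prems(3)[OF b] hpart_kmap[OF b] by (simp add: \<psi>'_def[abs_def])
    finally show ?thesis .
  qed
  have d\<psi>': "chain (i + 1) (\<lambda>b. kdif {} (\<psi>' b))" using \<psi>'C by (auto simp: chain_def intro: kdif_kC)
  \<comment> \<open>Since d d \<phi> = 0, the resolution kills d \<psi>'. By exactness d \<psi>'
    comes from the next column, where the induction hypothesis applies with smaller q.\<close>
  have "kmap F i (\<lambda>b. kdif {} (\<psi>' b)) c = 0" if "c < rank F i" for c
    using d\<phi>[OF that, symmetric] kdif_kdif[OF upset_empty, of "\<phi> c"] by (simp add: kdif_kmap[symmetric])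
  from kmap_lift[OF d\<psi>' this] obtain \<psi>2 where \<psi>2: "chain (i + 2) \<psi>2" "\<And>b. b < rank F (i + 1) \<Longrightarrow> kdif {} (\<psi>' b) = kmap F (i + 1) \<psi>2 b"
    by blast
  have "\<exists>\<omega> \<chi>. chain (i + 1) \<omega> \<and> chain (i + 1 + 1) \<chi> \<and> (\<forall>b<rank F (i + 1). \<psi>' b = kdif {} (\<omega> b) + kmap F (i + 1) \<chi> b)"
  proof (rule Suc.IH)
    show "chain (i + 1 + 1) \<psi>2" using \<psi>2(1) by simp
    show "gdeg F (i + 1 + q) c \<noteq> J" if "c < rank F (i + 1 + q)" for c using Suc.prems(4)[of c] that by simp
    show "\<psi>' b \<in> kC n {} \<and> Poly_Mapping.keys (\<psi>' b) \<subseteq> {a. wt a = J - gdeg F (i + 1) b \<and> card (snd a) = q}"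
      if "b < rank F (i + 1)" for b
      using \<psi>'C that keys_hpart by (auto simp: chain_def \<psi>'_def)
  qed (use \<psi>2(2) in simp)
  then obtain \<omega> \<chi> where o: "chain (i + 1) \<omega>" "chain (i + 2) \<chi>"
    "\<And>b. b < rank F (i + 1) \<Longrightarrow> \<psi>' b = kdif {} (\<omega> b) + kmap F (i + 1) \<chi> b" by auto
  define \<omega>' where "\<omega>' b = restr {a. card (snd a) = Suc q} (\<omega> b)" for b
  have \<omega>'C: "chain (i + 1) \<omega>'" using o(1) by (auto simp: chain_def \<omega>'_def intro: kC_restr)
  \<comment> \<open>Subtracting the image of \<omega>' leaves a cycle, because consecutive maps of
    the resolution compose to 0. It has positive Koszul degree, where the complex over S is
    exact.\<close>
  define x where "x b = \<phi> b - kmap F i \<omega>' b" for b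
  have xC: "x b \<in> kC n {}" if b: "b < rank F i" for b
    using Suc.prems(1)[OF b] kC_neg[OF kmap_kC[OF \<omega>'C b]] kC_add[of "\<phi> b" n "{}" "- kmap F i \<omega>' b"] by (simp add: x_def)
  have restr_kmap: "restr {a. card (snd a) = q'} (kmap F i \<theta> b) = kmap F i (\<lambda>b. restr {a. card (snd a) = q'} (\<theta> b)) b" for q' \<theta> b
    unfolding kmap_def additive_sum[OF additive_restr] by (simp only: restr_card_act)
  have xk: "Poly_Mapping.keys (x b) \<subseteq> {a. card (snd a) = Suc q}" if b: "b < rank F i" for b
  proof -
    have "Poly_Mapping.keys (kmap F i \<omega>' b) \<subseteq> {a. card (snd a) = Suc q}"
      unfolding \<omega>'_def restr_kmap[symmetric] by (auto simp: keys_restr)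
    moreover have "Poly_Mapping.keys (\<phi> b) \<subseteq> {a. card (snd a) = Suc q}" using Suc.prems(1)[OF b] by auto
    ultimately show ?thesis unfolding x_def by (intro order_trans[OF Poly_Mapping.keys_diff]) auto
  qed
  have dx: "kdif {} (x b) = 0" if b: "b < rank F i" for b
  proof -
    have "kmap F i \<psi>' b = kmap F i (\<lambda>b. kdif {} (\<omega> b) + kmap F (i + 1) \<chi> b) b"
      by (rule kmap_cong) (use o(3) in simp)
    also have "\<dots> = kmap F i (\<lambda>b. kdif {} (\<omega> b)) b"
      using kmap_kmap[OF o(2) b] by (simp add: kmap_add)
    finally have "kdif {} (\<phi> b) = kdif {} (kmap F i \<omega> b)" using d\<phi>[OF b] by (simp add: kdif_kmap)
    moreover have "kdif {} (\<phi> b) = restr {a. card (snd a) = q} (kdif {} (\<phi> b))"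
      by (rule restr_id[symmetric], rule order_trans[OF kdif_keys_wt[where J = "J - gdeg F i b"]]) (use Suc.prems(1)[OF b] in auto)
    ultimately have "kdif {} (\<phi> b) = kdif {} (restr {a. card (snd a) = Suc q} (kmap F i \<omega> b))"
      by (simp add: kdif_restr_card)
    then show ?thesis by (simp add: x_def \<omega>'_def[abs_def] restr_kmap additive_diff[OF additive_kdif])
  qed
  have "\<phi> b = kdif {} (khom (x b)) + kmap F i \<omega>' b" if b: "b < rank F i" for b
  proof -
    have "x b = kdif {} (khom (x b))"
      by (rule koszul_exact[OF xC[OF b] _ dx[OF b]]) (use xk[OF b] in auto)
    then show ?thesis by (simp add: x_def)
  qed
  moreover have "chain i (\<lambda>b. khom (x b))" using xC by (auto simp: chain_def intro: khom_kC)
  ultimately show ?case using \<omega>'C by blast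
qed

definition kaug :: "(nat \<Rightarrow> 'k kel) \<Rightarrow> 'k kel" where
  "kaug \<phi> = (\<Sum>c<rank F 0. act (f c) (\<phi> c))"

lemma kcomp_kaug: "finite I \<Longrightarrow> kcomp (kaug \<phi>) I = (\<Sum>c<rank F 0. f c * kcomp (\<phi> c) I)"
  unfolding kaug_def by (simp add: additive_sum[OF additive_comp] comp_act)

lemma kaug_kC: "chain 0 \<phi> \<Longrightarrow> kaug \<phi> \<in> kC n {}"
  unfolding kaug_def chain_def by (intro kC_sum act_kC f_Sn) auto

text \<open>Reduction modulo the ideal, as the monomials outside \<open>N\<close> form a basis of
  the quotient; by \<open>kdif_std\<close> a chain map from the complex over S to the one over
  R.\<close>

definition std :: "'k kel \<Rightarrow> 'k kel" where "std = restr {(m, I). m \<notin> N}"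

lemma std_kC: "x \<in> kC n {} \<Longrightarrow> std x \<in> kC n N"
  by (auto simp: std_def kC_def keys_restr kbasis_def)

lemma additive_std: "additive_map std" unfolding std_def by (rule additive_restr)

lemma kdif_std: "kdif N (std x) = std (kdif {} x)"
proof (rule additive_eq_pair[where x = x and f = "\<lambda>x. kdif N (std x)"])
  fix m I and c :: 'k
  have "std (Poly_Mapping.single (m + xvar i, I - {i}) (sg (below I i) c)) =
      (if m + xvar i \<notin> N then Poly_Mapping.single (m + xvar i, I - {i}) (sg (below I i) c) else 0)" for i
    by (simp add: std_def restr_single)
  then have "std (kdif {} (Poly_Mapping.single (m, I) c)) = kdif N (Poly_Mapping.single (m, I) c)"
    by (simp add: kdif_single additive_sum[OF additive_std])
  moreover have "kdif N (std (Poly_Mapping.single (m, I) c)) = kdif N (Poly_Mapping.single (m, I) c)"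
    using upsetD(1)[OF up] by (auto simp: std_def restr_single kdif_single)
  ultimately show "kdif N (std (Poly_Mapping.single (m, I) c)) = std (kdif {} (Poly_Mapping.single (m, I) c))" by simp
qed (simp_all add: additive_map_def additive_add[OF additive_std] additive_add[OF additive_kdif])

lemma std_0_iff: "std x = 0 \<longleftrightarrow> (\<forall>I. Poly_Mapping.keys (kcomp x I) \<subseteq> N)"
proof -
  have "std x = 0 \<longleftrightarrow> Poly_Mapping.keys x \<inter> {(m, I). m \<notin> N} = {}"
    by (metis keys_eq_empty keys_restr std_def)
  also have "\<dots> \<longleftrightarrow> (\<forall>I. Poly_Mapping.keys (kcomp x I) \<subseteq> N)"
    unfolding subset_iff disjoint_iff in_keys_iff lookup_comp by auto
  finally show ?thesis .
qed

lemma hpart_kaug: "hpart J q (kaug \<phi>) = kaug (\<lambda>c. hpart (J - gdeg F 0 c) q (\<phi> c))"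
  unfolding kaug_def additive_sum[OF additive_hpart]
proof (rule sum.cong[OF refl])
  fix c assume c: "c \<in> {..<rank F 0}"
  have e: "J = (J - gdeg F 0 c) + gdeg F 0 c" by simp
  show "hpart J q (act (f c) (\<phi> c)) = act (f c) (hpart (J - gdeg F 0 c) q (\<phi> c))"
    unfolding hpart_def by (subst e, rule restr_act) (use f_hom c in simp)
qed

lemma hpart_std: "hpart J q (std x) = std (hpart J q x)"
  by (rule poly_mapping_eqI) (auto simp: hpart_def std_def lookup_restr)

lemma kdif_kaug: "kdif {} (kaug \<phi>) = kaug (\<lambda>c. kdif {} (\<phi> c))"
  unfolding kaug_def by (simp add: additive_sum[OF additive_kdif] kdif_act)

text \<open>Tor may be computed from either resolution. A lift of z along the augmentation of F 0
  has a differential that vanishes in the quotient, hence comes from F 1; this is the input of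
  \<open>tor_vanishing\<close> in column 0.\<close>

theorem koszul_cycle_bounds:
  fixes z :: "'k kel"
  assumes z: "z \<in> kG n N P" "kdif N z = 0" "\<And>a. a \<in> Poly_Mapping.keys z \<Longrightarrow> wt a = J"
    and no_gen: "\<And>c. c < rank F P \<Longrightarrow> gdeg F P c \<noteq> J"
  shows "z \<in> kdif N ` kC n N"
proof -
  have zC: "z \<in> kC n N" using z(1) by (auto simp: kG_def kC_def)
  have zC0: "z \<in> kC n {}" using zC by (auto simp: kC_def kbasis_def)
  have "\<exists>v. (\<forall>c<rank F 0. v c \<in> Sn n) \<and> Poly_Mapping.keys (kcomp z I - (\<Sum>c<rank F 0. f c * v c)) \<subseteq> N" for I
    by (rule surj[OF comp_Sn[OF zC]])
  then obtain v where v: "\<And>I. (\<forall>c<rank F 0. v I c \<in> Sn n) \<and> Poly_Mapping.keys (kcomp z I - (\<Sum>c<rank F 0. f c * v I c)) \<subseteq> N"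
    by metis
  define \<phi>0 where "\<phi>0 c = assemble n (\<lambda>I. v I c)" for c
  define \<phi> where "\<phi> c = hpart (J - gdeg F 0 c) P (\<phi>0 c)" for c
  have \<phi>0C: "chain 0 \<phi>0" unfolding chain_def \<phi>0_def using v by (auto intro: assemble_kC)
  then have \<phi>C: "chain 0 \<phi>" by (auto simp: chain_def \<phi>_def intro: hpart_kC)
  have "std (z - kaug \<phi>0) = 0"
    unfolding std_0_iff
  proof
    fix I
    show "Poly_Mapping.keys (kcomp (z - kaug \<phi>0) I) \<subseteq> N"
    proof (cases "I \<subseteq> {..<n}")
      case True
      have "kcomp (z - kaug \<phi>0) I = kcomp z I - (\<Sum>c<rank F 0. f c * v I c)"
        using True by (simp add: additive_diff[OF additive_comp] kcomp_kaug fin_sub[OF True] \<phi>0_def comp_assemble)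
      then show ?thesis using v by simp
    next
      case False
      then have "kcomp (z - kaug \<phi>0) I = 0"
        using comp_out[OF zC0 False] comp_out[OF kaug_kC[OF \<phi>0C] False] by (simp add: additive_diff[OF additive_comp])
      then show ?thesis by simp
    qed
  qed
  then have "std z = std (kaug \<phi>0)" by (simp add: additive_diff[OF additive_std])
  moreover have "std z = z" unfolding std_def by (rule restr_id) (use zC in \<open>auto simp: kC_def kbasis_def\<close>)
  ultimately have z0: "z = std (kaug \<phi>0)" by simp
  have "z = hpart J P z" by (rule hpart_id[symmetric]) (use z(1,3) in \<open>auto simp: kG_def\<close>)
  also have "\<dots> = std (kaug \<phi>)" by (subst z0) (simp add: hpart_std hpart_kaug \<phi>_def[abs_def])
  finally have z1: "z = std (kaug \<phi>)" .
  have std0: "std (kaug (\<lambda>c. kdif {} (\<phi> c))) = 0"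
    using z(2) z1 kdif_std[of "kaug \<phi>"] by (simp add: kdif_kaug)
  have d\<phi>C: "\<And>c. c < rank F 0 \<Longrightarrow> kdif {} (\<phi> c) \<in> kC n {}" using \<phi>C by (auto simp: chain_def intro: kdif_kC)
  have "\<exists>w. (\<forall>b<rank F 1. w b \<in> Sn n) \<and> (\<forall>c<rank F 0. kcomp (kdif {} (\<phi> c)) I = (\<Sum>b<rank F 1. dmat F 0 c b * w b))"
    if I: "I \<subseteq> {..<n}" for I
  proof (rule ker)
    show "kcomp (kdif {} (\<phi> c)) I \<in> Sn n" if "c < rank F 0" for c by (rule comp_Sn[OF d\<phi>C[OF that]])
    show "Poly_Mapping.keys (\<Sum>c<rank F 0. f c * kcomp (kdif {} (\<phi> c)) I) \<subseteq> N"
      using std0 unfolding std_0_iff by (metis kcomp_kaug[OF fin_sub[OF I]])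
  qed
  then obtain w where w: "\<And>I. I \<subseteq> {..<n} \<Longrightarrow> (\<forall>b<rank F 1. w I b \<in> Sn n) \<and>
      (\<forall>c<rank F 0. kcomp (kdif {} (\<phi> c)) I = (\<Sum>b<rank F 1. dmat F 0 c b * w I b))" by metis
  define \<psi> where "\<psi> b = assemble n (\<lambda>I. w I b)" for b
  have \<psi>C: "chain (0 + 1) \<psi>" unfolding chain_def \<psi>_def using w by (auto intro: assemble_kC)
  have d\<phi>: "kdif {} (\<phi> c) = kmap F 0 \<psi> c" if c: "c < rank F 0" for c
  proof (rule kC_eqI[OF d\<phi>C[OF c] kmap_kC[OF \<psi>C c]])
    fix I :: "nat set" assume I: "I \<subseteq> {..<n}"
    show "kcomp (kdif {} (\<phi> c)) I = kcomp (kmap F 0 \<psi> c) I"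
      using w[OF I] c I by (simp add: kcomp_kmap fin_sub[OF I] \<psi>_def comp_assemble)
  qed
  have "\<exists>\<omega> \<chi>. chain 0 \<omega> \<and> chain (0 + 1) \<chi> \<and> (\<forall>b<rank F 0. \<phi> b = kdif {} (\<omega> b) + kmap F 0 \<chi> b)"
  proof (rule tor_vanishing[OF _ \<psi>C])
    show "\<phi> b \<in> kC n {} \<and> Poly_Mapping.keys (\<phi> b) \<subseteq> {a. wt a = J - gdeg F 0 b \<and> card (snd a) = P}" if "b < rank F 0" for b
      using \<phi>C that keys_hpart by (auto simp: chain_def \<phi>_def)
  qed (use d\<phi> no_gen in simp_all)
  then obtain \<omega> \<chi> where o: "chain 0 \<omega>" "chain 1 \<chi>" "\<And>b. b < rank F 0 \<Longrightarrow> \<phi> b = kdif {} (\<omega> b) + kmap F 0 \<chi> b"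
    by auto
  have "kaug \<phi> = kaug (\<lambda>c. kdif {} (\<omega> c)) + kaug (kmap F 0 \<chi>)"
    unfolding kaug_def sum.distrib[symmetric] using o(3) by (intro sum.cong) (auto simp: additive_add[OF additive_act])
  \<comment> \<open>The map from F 1 to the quotient is 0, so only the boundary part of \<phi>
    survives reduction.\<close>
  moreover have "std (kaug (kmap F 0 \<chi>)) = 0"
    unfolding std_0_iff
  proof
    fix I
    have kC: "chain 0 (kmap F 0 \<chi>)" using kmap_kC[of 0 \<chi>] o(2) by (simp add: chain_def)
    show "Poly_Mapping.keys (kcomp (kaug (kmap F 0 \<chi>)) I) \<subseteq> N"
    proof (cases "I \<subseteq> {..<n}")
      case True
      have "kcomp (kaug (kmap F 0 \<chi>)) I = (\<Sum>c<rank F 0. f c * (\<Sum>b<rank F 1. dmat F 0 c b * kcomp (\<chi> b) I))"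
        by (simp add: kcomp_kaug kcomp_kmap fin_sub[OF True])
      moreover have "kcomp (\<chi> b) I \<in> Sn n" if "b < rank F 1" for b
        using o(2) that by (intro comp_Sn[where N = "{}"]) (simp add: chain_def)
      ultimately show ?thesis using im[of "\<lambda>b. kcomp (\<chi> b) I"] by simp
    next
      case False
      then show ?thesis using comp_out[OF kaug_kC[OF kC] False] by simp
    qed
  qed
  ultimately have "z = std (kdif {} (kaug \<omega>))"
    using z1 by (simp add: additive_add[OF additive_std] kdif_kaug)
  then have "z = kdif N (std (kaug \<omega>))" by (simp add: kdif_std)
  then show ?thesis using std_kC[OF kaug_kC[OF o(1)]] by blast
qed

end

section \<open>Comparison of the two models\<close>

text \<open>Transport of structure. No ring axioms are assumed for \<open>A\<close>; the bijection
  \<Phi> supplies what is needed.\<close>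

locale massey_transfer = cdga C mul d bar G
  for C :: "'x::ab_group_add set" and mul (infixl "\<star>" 70) and d bar G +
  fixes A :: "('y, 'm) dga_scheme" and \<Phi> :: "'x \<Rightarrow> 'y"
  assumes bij: "bij_betw \<Phi> C (carrier A)"
    and mul_C: "x \<in> C \<Longrightarrow> y \<in> C \<Longrightarrow> x \<star> y \<in> C"
    and d_C: "x \<in> C \<Longrightarrow> d x \<in> C"
    and bar_C: "x \<in> C \<Longrightarrow> bar x \<in> C"
    and \<Phi>_add: "x \<in> C \<Longrightarrow> y \<in> C \<Longrightarrow> \<Phi> (x + y) = \<Phi> x \<oplus>\<^bsub>A\<^esub> \<Phi> y"
    and \<Phi>_0: "\<Phi> 0 = \<zero>\<^bsub>A\<^esub>"
    and \<Phi>_mul: "x \<in> C \<Longrightarrow> y \<in> C \<Longrightarrow> \<Phi> (x \<star> y) = \<Phi> x \<otimes>\<^bsub>A\<^esub> \<Phi> y"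
    and \<Phi>_d: "x \<in> C \<Longrightarrow> \<Phi> (d x) = diff A (\<Phi> x)"
    and \<Phi>_piece: "piece A p = \<Phi> ` G p"
begin

lemma carrier_eq: "carrier A = \<Phi> ` C" using bij by (simp add: bij_betw_def)

lemma \<Phi>_inj: "x \<in> C \<Longrightarrow> y \<in> C \<Longrightarrow> \<Phi> x = \<Phi> y \<longleftrightarrow> x = y"
  using bij by (auto simp: bij_betw_def inj_on_def)

lemma GC: "x \<in> G p \<Longrightarrow> x \<in> C" using G_sub by auto

lemma abelian: "abelian_group A"
proof (rule abelian_groupI)
  fix x assume "x \<in> carrier A"
  then obtain a where a: "a \<in> C" "x = \<Phi> a" by (auto simp: carrier_eq)
  have "\<Phi> (- a) \<oplus>\<^bsub>A\<^esub> x = \<zero>\<^bsub>A\<^esub>"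
    using a C_neg[OF a(1)] by (simp add: \<Phi>_add[symmetric] \<Phi>_0)
  then show "\<exists>y\<in>carrier A. y \<oplus>\<^bsub>A\<^esub> x = \<zero>\<^bsub>A\<^esub>" using C_neg[OF a(1)] by (auto simp: carrier_eq)
qed (auto simp: carrier_eq \<Phi>_add[symmetric] \<Phi>_0[symmetric] C_add C_0 ac_simps)

lemma \<Phi>_neg: "x \<in> C \<Longrightarrow> \<ominus>\<^bsub>A\<^esub> \<Phi> x = \<Phi> (- x)"
proof -
  assume x: "x \<in> C"
  interpret abelian_group A by (rule abelian)
  show ?thesis
    by (rule minus_equality) (use x C_neg in \<open>auto simp: \<Phi>_add[symmetric] \<Phi>_0 carrier_eq\<close>)
qed

lemma \<Phi>_signed: "x \<in> C \<Longrightarrow> signed A k (\<Phi> x) = \<Phi> (sg k x)"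
  by (simp add: signed_def sg_def \<Phi>_neg)

lemma C_sum: "(\<And>i. i \<in> S \<Longrightarrow> f i \<in> C) \<Longrightarrow> sum f S \<in> C"
  by (induction S rule: infinite_finite_induct) (auto intro: C_add C_0)

lemma \<Phi>_sum: "finite S \<Longrightarrow> (\<And>i. i \<in> S \<Longrightarrow> f i \<in> C) \<Longrightarrow> (\<Oplus>\<^bsub>A\<^esub>i\<in>S. \<Phi> (f i)) = \<Phi> (sum f S)"
proof (induction S rule: finite_induct)
  case empty
  interpret abelian_group A by (rule abelian)
  show ?case by (simp add: \<Phi>_0)
next
  case (insert i S)
  interpret abelian_group A by (rule abelian)
  have "(\<Oplus>\<^bsub>A\<^esub>i\<in>insert i S. \<Phi> (f i)) = \<Phi> (f i) \<oplus>\<^bsub>A\<^esub> (\<Oplus>\<^bsub>A\<^esub>i\<in>S. \<Phi> (f i))"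
    using insert by (intro finsum_insert) (auto simp: carrier_eq)
  then show ?case using insert by (simp add: \<Phi>_add C_sum)
qed

lemma boundaries_eq: "boundaries A = \<Phi> ` D"
  by (auto simp: boundaries_def D_def carrier_eq image_image \<Phi>_d)

lemma D_C: "x \<in> D \<Longrightarrow> x \<in> C" by (auto simp: D_def d_C)

lemma hclass_eq: "x \<in> C \<Longrightarrow> hclass A (\<Phi> x) = (\<lambda>b. \<Phi> (b + x)) ` D"
  by (auto simp: hclass_def a_r_coset_def r_coset_def boundaries_eq \<Phi>_add D_C)

lemma \<Phi>_in_boundaries: "x \<in> C \<Longrightarrow> \<Phi> x \<in> boundaries A \<longleftrightarrow> x \<in> D"
  unfolding boundaries_eq using \<Phi>_inj D_C by blast

lemma hclass_boundaries: "x \<in> D \<Longrightarrow> hclass A (\<Phi> x) = boundaries A"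
proof -
  assume x: "x \<in> D"
  have "(\<lambda>b. b + x) ` D = D"
  proof
    show "D \<subseteq> (\<lambda>b. b + x) ` D"
    proof
      fix y assume "y \<in> D"
      then have "y - x \<in> D" using D_diff x by blast
      then show "y \<in> (\<lambda>b. b + x) ` D" by (intro image_eqI[of _ _ "y - x"]) auto
    qed
  qed (use x D_add in auto)
  then show ?thesis using hclass_eq[OF D_C[OF x]] boundaries_eq by (metis image_image)
qed

lemma hclass_boundaries_iff: "x \<in> C \<Longrightarrow> hclass A (\<Phi> x) = boundaries A \<longleftrightarrow> x \<in> D"
proof
  assume x: "x \<in> C" and e: "hclass A (\<Phi> x) = boundaries A"
  have "\<Phi> (0 + x) \<in> hclass A (\<Phi> x)" unfolding hclass_eq[OF x] using D_0 by blast
  then show "x \<in> D" using e \<Phi>_in_boundaries[OF x] by simp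
qed (rule hclass_boundaries)

lemma zero_homology: "\<zero>\<^bsub>homology A\<^esub> = boundaries A"
  by (simp add: homology_def FactRing_def)

lemma homology_piece_eq: "homology_piece A p = (\<lambda>z. hclass A (\<Phi> z)) ` {z \<in> G p. d z = 0}"
proof -
  have "cycles A \<inter> piece A p = \<Phi> ` {z \<in> G p. d z = 0}"
  proof -
    have "diff A (\<Phi> z) = \<zero>\<^bsub>A\<^esub> \<longleftrightarrow> d z = 0" if "z \<in> G p" for z
      using \<Phi>_inj[OF d_C[OF GC[OF that]] C_0] \<Phi>_d[OF GC[OF that]] by (simp add: \<Phi>_0)
    then show ?thesis by (auto simp: cycles_def \<Phi>_piece carrier_eq GC)
  qed
  then show ?thesis by (auto simp: homology_piece_def)
qed

lemma massey_sum_eq: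
  assumes "\<And>i' j'. i \<le> i' \<Longrightarrow> i' \<le> j' \<Longrightarrow> j' \<le> j \<Longrightarrow> (i', j') \<noteq> (i, j) \<Longrightarrow>
      b i' j' = \<Phi> (a i' j') \<and> a i' j' \<in> G (entry_deg p i' j')"
  shows "massey_sum A p b i j = \<Phi> (msum a i j)" "msum a i j \<in> C"
proof -
  interpret abelian_group A by (rule abelian)
  have m: "bar (a i v) \<star> a (Suc v) j \<in> C \<and>
      signed A (entry_deg p i v + 1) (b i v) \<otimes>\<^bsub>A\<^esub> b (v + 1) j = \<Phi> (bar (a i v) \<star> a (Suc v) j)" if v: "v \<in> {i..<j}" for v
  proof -
    have 1: "b i v = \<Phi> (a i v)" "a i v \<in> G (entry_deg p i v)" using assms[of i v] v by auto
    have 2: "b (Suc v) j = \<Phi> (a (Suc v) j)" "a (Suc v) j \<in> G (entry_deg p (Suc v) j)" using assms[of "Suc v" j] v by auto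
    have "signed A (entry_deg p i v + 1) (b i v) = \<Phi> (bar (a i v))"
      using 1 by (simp add: \<Phi>_signed GC bar_G)
    then show ?thesis using 1 2 by (simp add: \<Phi>_mul GC bar_C mul_C)
  qed
  show "msum a i j \<in> C" unfolding msum_def by (rule C_sum) (use m in simp)
  have "massey_sum A p b i j = (\<Oplus>\<^bsub>A\<^esub>v\<in>{i..<j}. \<Phi> (bar (a i v) \<star> a (Suc v) j))"
    unfolding massey_sum_def using m by (intro finsum_cong') (auto simp: carrier_eq)
  then show "massey_sum A p b i j = \<Phi> (msum a i j)"
    unfolding msum_def using m by (subst \<Phi>_sum[symmetric]) auto
qed

lemma mult_homology:
  "\<alpha> \<otimes>\<^bsub>homology A\<^esub> \<beta> = (\<Union>a\<in>\<alpha>. \<Union>b\<in>\<beta>. hclass A (a \<otimes>\<^bsub>A\<^esub> b))"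
  by (simp add: homology_def FactRing_def rcoset_mult_def hclass_def a_r_coset_def r_coset_def)

lemma defining_system_eq:
  assumes k: "2 \<le> k" and a: "system k p a" and \<alpha>: "\<And>i. i \<in> {1..k} \<Longrightarrow> \<alpha> i = hclass A (\<Phi> (a i i))"
  shows "defining_system A k p \<alpha> (\<lambda>i j. \<Phi> (a i j))"
  unfolding defining_system_def
proof (intro conjI allI impI ballI)
  have s: "a i j \<in> G (entry_deg p i j)" "d (a i j) = msum a i j"
    if "1 \<le> i" "i \<le> j" "j \<le> k" "(i, j) \<noteq> (1, k)" for i j
    using a that unfolding system_def by blast+
  fix i j assume ij: "1 \<le> i \<and> i \<le> j \<and> j \<le> k \<and> (i, j) \<noteq> (1, k)"
  then show "\<Phi> (a i j) \<in> piece A (entry_deg p i j)" using s[of i j] by (auto simp: \<Phi>_piece)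
next
  fix i assume i: "i \<in> {1..k}"
  then have "a i i \<in> G (entry_deg p i i)" "d (a i i) = msum a i i"
    using a k unfolding system_def by auto
  then show "diff A (\<Phi> (a i i)) = \<zero>\<^bsub>A\<^esub>" by (simp add: \<Phi>_d[symmetric] GC msum_def \<Phi>_0)
  show "hclass A (\<Phi> (a i i)) = \<alpha> i" using \<alpha>[OF i] by simp
next
  fix i j assume ij: "1 \<le> i \<and> i < j \<and> j \<le> k \<and> (i, j) \<noteq> (1, k)"
  have s: "a i j \<in> G (entry_deg p i j)" "d (a i j) = msum a i j"
    if "1 \<le> i" "i \<le> j" "j \<le> k" "(i, j) \<noteq> (1, k)" for i j
    using a that unfolding system_def by blast+
  have "massey_sum A p (\<lambda>i j. \<Phi> (a i j)) i j = \<Phi> (msum a i j)"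
    by (rule massey_sum_eq) (use s ij in auto)
  then show "diff A (\<Phi> (a i j)) = massey_sum A p (\<lambda>i j. \<Phi> (a i j)) i j"
    using s[of i j] ij by (simp add: \<Phi>_d[symmetric] GC)
qed

lemma massey_trivial_imp:
  assumes k: "2 \<le> k" and t: "massey_trivial A k"
  shows "trivial_systems k"
  unfolding trivial_systems_def
proof (intro allI impI)
  fix p a assume p: "\<forall>i\<in>{1..k}. 0 < p i" and a: "system k p a"
  have s: "a i j \<in> G (entry_deg p i j)" "d (a i j) = msum a i j"
    if "1 \<le> i" "i \<le> j" "j \<le> k" "(i, j) \<noteq> (1, k)" for i j
    using a that unfolding system_def by blast+
  define \<alpha> where "\<alpha> i = hclass A (\<Phi> (a i i))" for i
  have cyc: "a i i \<in> G (p i)" "d (a i i) = 0" if "i \<in> {1..k}" for i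
    using s[of i i] that k by (auto simp: entry_deg_def msum_def)
  have "\<forall>i\<in>{1..k}. 0 < p i \<and> \<alpha> i \<in> homology_piece A (p i)"
    using p cyc by (auto simp: homology_piece_eq \<alpha>_def)
  then have prod: "massey_product A k p \<alpha> \<subseteq> {\<zero>\<^bsub>homology A\<^esub>}"
    using t unfolding massey_trivial_def by blast
  show "msum a 1 k \<in> D"
  \<comment> \<open>The binary product carries no \<open>bar\<close>, so it differs from
    \<open>msum\<close> by a sign.\<close>
  proof (cases "k = 2")
    case True
    have c: "a 1 1 \<in> C" "a 2 2 \<in> C" using cyc[of 1] cyc[of 2] True GC by auto
    have "\<alpha> 1 \<otimes>\<^bsub>homology A\<^esub> \<alpha> 2 = boundaries A"
      using prod True by (simp add: massey_product_def zero_homology)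
    moreover have "\<Phi> (0 + a 1 1) \<in> \<alpha> 1" "\<Phi> (0 + a 2 2) \<in> \<alpha> 2"
      unfolding \<alpha>_def hclass_eq[OF c(1)] hclass_eq[OF c(2)] using D_0 by blast+
    ultimately have "hclass A (\<Phi> (a 1 1) \<otimes>\<^bsub>A\<^esub> \<Phi> (a 2 2)) \<subseteq> boundaries A"
      unfolding mult_homology by auto
    moreover have "\<Phi> (0 + a 1 1 \<star> a 2 2) \<in> hclass A (\<Phi> (a 1 1 \<star> a 2 2))"
      unfolding hclass_eq[OF mul_C[OF c]] using D_0 by blast
    ultimately have "a 1 1 \<star> a 2 2 \<in> D"
      using c \<Phi>_in_boundaries[OF mul_C[OF c]] by (auto simp: \<Phi>_mul)
    moreover have "bar (a 1 1) = sg (Suc (p 1)) (a 1 1)" using cyc[of 1] True by (simp add: bar_G)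
    moreover have "{1..<2::nat} = {1}" by auto
    then have "msum a 1 k = bar (a 1 1) \<star> a 2 2" by (simp add: msum_def True numeral_2_eq_2)
    ultimately show ?thesis by (simp add: mul_sg D_sg)
  next
    case False
    have "defining_system A k p \<alpha> (\<lambda>i j. \<Phi> (a i j))"
      by (rule defining_system_eq[OF k a]) (simp add: \<alpha>_def)
    then have "hclass A (massey_sum A p (\<lambda>i j. \<Phi> (a i j)) 1 k) \<in> massey_product A k p \<alpha>"
      using False by (auto simp: massey_product_def)
    then have "hclass A (massey_sum A p (\<lambda>i j. \<Phi> (a i j)) 1 k) = boundaries A"
      using prod zero_homology by auto
    moreover have "massey_sum A p (\<lambda>i j. \<Phi> (a i j)) 1 k = \<Phi> (msum a 1 k)" "msum a 1 k \<in> C"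
      by (rule massey_sum_eq; use s in auto)+
    ultimately show ?thesis using hclass_boundaries_iff by simp
  qed
qed

text \<open>A product of cosets is a union over all representatives, so vanishing has to be checked
  for each pair. By the Leibniz rule a change of representatives changes the product by
  boundaries.\<close>

lemma product_D:
  assumes z: "z1 \<in> C" "d z1 = 0" "z2 \<in> C" "d z2 = 0" "z1 \<star> z2 \<in> D" and b: "b1 \<in> D" "b2 \<in> D"
  shows "(b1 + z1) \<star> (b2 + z2) \<in> D"
proof -
  obtain y1 y2 where y: "y1 \<in> C" "b1 = d y1" "y2 \<in> C" "b2 = d y2" using b by (auto simp: D_def)
  have dd: "d (y1 \<star> (b2 + z2)) = b1 \<star> (b2 + z2)"
    using y z by (simp add: d_mul d_add d_d)
  have bz: "d (bar z1) = 0" using bar_d[of z1] z by simp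
  have "d (bar z1 \<star> y2) = - (z1 \<star> b2)"
    using y bz by (simp add: d_mul bar_bar)
  then have "z1 \<star> b2 \<in> D"
    using D_neg_iff[of "z1 \<star> b2"] mul_C[OF bar_C[OF z(1)] y(3)] unfolding D_def by (metis imageI)
  moreover have "b1 \<star> (b2 + z2) \<in> D"
    using dd mul_C[OF y(1) C_add[OF D_C[OF b(2)] z(3)]] unfolding D_def by (metis imageI)
  moreover have "(b1 + z1) \<star> (b2 + z2) = b1 \<star> (b2 + z2) + (z1 \<star> b2 + z1 \<star> z2)"
    by (simp only: mul_add_left mul_add_right[of z1])
  ultimately show ?thesis
    using z(5) by (simp only: D_add)
qed

text \<open>Beyond vanishing, a system must exist for every choice of classes; the canonical one
  serves. An arbitrary system in \<open>A\<close> is pulled back along \<Phi>.\<close>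

lemma massey_trivialI:
  assumes k: "2 \<le> k" and ts: "\<And>j. 2 \<le> j \<Longrightarrow> j \<le> k \<Longrightarrow> trivial_systems j"
    and h: "homotopy_op h" "\<And>y. y \<in> D \<Longrightarrow> d (h y) = y"
  shows "massey_trivial A k"
  unfolding massey_trivial_def
proof (intro allI impI)
  fix p \<alpha> assume \<alpha>: "\<forall>i\<in>{1..k}. 0 < p i \<and> \<alpha> i \<in> homology_piece A (p i)"
  then have "\<forall>i\<in>{1..k}. \<exists>z. z \<in> G (p i) \<and> d z = 0 \<and> \<alpha> i = hclass A (\<Phi> z)"
    by (auto simp: homology_piece_eq)
  then obtain z where z: "\<forall>i\<in>{1..k}. z i \<in> G (p i) \<and> d (z i) = 0 \<and> \<alpha> i = hclass A (\<Phi> (z i))"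
    by (rule bchoice[THEN exE])
  have good: "good letters k h"
    by (rule good_trivial_systems[OF order_refl h(1)]) (use ts h(2) in auto)
  let ?w = "map z [1..<Suc k]" and ?ps = "map p [1..<Suc k]"
  have hw: "homogeneous_word ?w ?ps"
    unfolding homogeneous_word_def list.rel_map using z \<alpha> by (intro list.rel_refl_strong) auto
  have wl: "set ?w \<subseteq> letters" by (rule homogeneous_word_letters[OF hw])
  have len: "length ?w = k" by simp
  show "massey_defined A k p \<alpha> \<and> massey_product A k p \<alpha> \<subseteq> {\<zero>\<^bsub>homology A\<^esub>}"
  proof (cases "k = 2")
    case True
    have z12: "z 1 \<in> G (p 1)" "d (z 1) = 0" "z 2 \<in> G (p 2)" "d (z 2) = 0"
      "\<alpha> 1 = hclass A (\<Phi> (z 1))" "\<alpha> 2 = hclass A (\<Phi> (z 2))" using z True by auto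
    then have C: "z 1 \<in> C" "z 2 \<in> C" using GC by auto
    have "system 2 p (\<lambda>i j. if i = j then z i else 0)"
    proof -
      have "(i, j) = (1, 1) \<or> (i, j) = (2, 2)" if "1 \<le> i" "i \<le> j" "j \<le> 2" "(i, j) \<noteq> (1, 2)" for i j :: nat
        using that by (auto simp: le_Suc_eq numeral_2_eq_2)
      then show ?thesis unfolding system_def
        using z12 by (fastforce simp: entry_deg_def msum_def)
    qed
    moreover have "\<forall>i\<in>{1..2}. 0 < p i" using \<alpha> True by auto
    ultimately have "msum (\<lambda>i j. if i = j then z i else 0) 1 2 \<in> D"
      using ts[of 2] True unfolding trivial_systems_def by blast
    moreover have "{1..<2::nat} = {1}" by auto
    ultimately have "bar (z 1) \<star> z 2 \<in> D" by (simp add: msum_def numeral_2_eq_2)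
    then have zz: "z 1 \<star> z 2 \<in> D" using z12(1) by (simp add: bar_G mul_sg D_sg)
    have "hclass A (a \<otimes>\<^bsub>A\<^esub> b) = boundaries A" if ab: "a \<in> \<alpha> 1" "b \<in> \<alpha> 2" for a b
    proof -
      obtain b1 b2 where b: "b1 \<in> D" "a = \<Phi> (b1 + z 1)" "b2 \<in> D" "b = \<Phi> (b2 + z 2)"
        using ab unfolding z12(5,6) hclass_eq[OF C(1)] hclass_eq[OF C(2)] by blast
      then have "a \<otimes>\<^bsub>A\<^esub> b = \<Phi> ((b1 + z 1) \<star> (b2 + z 2))"
        using C by (simp add: \<Phi>_mul C_add D_C)
      then show ?thesis
        using hclass_boundaries[OF product_D[OF C(1) z12(2) C(2) z12(4) zz b(1,3)]] by simp
    qed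
    moreover have "\<alpha> 1 \<noteq> {}" "\<alpha> 2 \<noteq> {}"
      unfolding z12(5,6) hclass_eq[OF C(1)] hclass_eq[OF C(2)] using D_0 by auto
    ultimately have "\<alpha> 1 \<otimes>\<^bsub>homology A\<^esub> \<alpha> 2 = boundaries A"
      unfolding mult_homology by auto
    then show ?thesis by (simp add: massey_defined_def massey_product_def True zero_homology)
  next
    case False
    have S: "system k (\<lambda>i. ?ps ! (i - 1)) (\<lambda>i j. gam h (sub ?w i j))"
      by (rule gam_system[OF good wl len hw])
    have e: "entry_deg (\<lambda>i. ?ps ! (i - 1)) i j = entry_deg p i j" if "1 \<le> i" "j \<le> k" for i j
      unfolding entry_deg_def using that by (intro arg_cong2[where f = "(+)"] sum.cong) (auto simp del: upt_Suc)
    have sys: "system k p (\<lambda>i j. gam h (sub ?w i j))"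
      unfolding system_def
    proof (intro allI impI)
      fix i j assume ij: "1 \<le> i \<and> i \<le> j \<and> j \<le> k \<and> (i, j) \<noteq> (1, k)"
      from S[unfolded system_def, rule_format, OF this] e[of i j] ij
      show "gam h (sub ?w i j) \<in> G (entry_deg p i j) \<and> d (gam h (sub ?w i j)) = msum (\<lambda>i j. gam h (sub ?w i j)) i j"
        by (simp only:)
    qed
    have "defining_system A k p \<alpha> (\<lambda>i j. \<Phi> (gam h (sub ?w i j)))"
    proof (rule defining_system_eq[OF k sys])
      fix i assume i: "i \<in> {1..k}"
      then have "sub ?w i i = [z i]" by (subst sub_self) (auto simp del: upt_Suc)
      then show "\<alpha> i = hclass A (\<Phi> (gam h (sub ?w i i)))" using z i by simp
    qed
    then have def: "massey_defined A k p \<alpha>" unfolding massey_defined_def by blast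
    have "hclass A (massey_sum A p b 1 k) = boundaries A" if b: "defining_system A k p \<alpha> b" for b
    proof -
      have b1: "b i j \<in> \<Phi> ` G (entry_deg p i j)" if "1 \<le> i" "i \<le> j" "j \<le> k" "(i, j) \<noteq> (1, k)" for i j
        using b that unfolding defining_system_def \<Phi>_piece by blast
      \<comment> \<open>Preimages in the piece of the prescribed degree; the equations of the system
        then follow by injectivity of \<Phi>.\<close>
      define a where "a i j = (SOME x. x \<in> G (entry_deg p i j) \<and> b i j = \<Phi> x)" for i j
      have a: "a i j \<in> G (entry_deg p i j) \<and> b i j = \<Phi> (a i j)" if "1 \<le> i" "i \<le> j" "j \<le> k" "(i, j) \<noteq> (1, k)" for i j
        unfolding a_def by (rule someI_ex) (use b1[OF that] in blast)
      have "system k p a"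
        unfolding system_def
      proof (intro allI impI)
        fix i j assume ij: "1 \<le> i \<and> i \<le> j \<and> j \<le> k \<and> (i, j) \<noteq> (1, k)"
        note aij = a[of i j]
        have ms: "massey_sum A p b i j = \<Phi> (msum a i j)" "msum a i j \<in> C"
          by (rule massey_sum_eq[where p = p and b = b]; use a ij in auto)+
        have "diff A (b i j) = \<Phi> (msum a i j)"
        proof (cases "i = j")
          case True
          then show ?thesis using b ij unfolding defining_system_def by (auto simp: msum_def \<Phi>_0)
        next
          case False
          then show ?thesis using b ij ms(1) unfolding defining_system_def by auto
        qed
        moreover have aC: "a i j \<in> C" using aij ij GC by blast
        ultimately have "\<Phi> (d (a i j)) = \<Phi> (msum a i j)" using aij ij by (simp add: \<Phi>_d)
        then have "d (a i j) = msum a i j" using ms(2) by (simp add: \<Phi>_inj d_C aC)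
        then show "a i j \<in> G (entry_deg p i j) \<and> d (a i j) = msum a i j" using aij ij by blast
      qed
      moreover have "\<forall>i\<in>{1..k}. 0 < p i" using \<alpha> by blast
      ultimately have "msum a 1 k \<in> D" using ts[of k] k unfolding trivial_systems_def by blast
      moreover have "massey_sum A p b 1 k = \<Phi> (msum a 1 k)"
        by (rule massey_sum_eq) (use a in auto)
      ultimately show ?thesis by (simp add: hclass_boundaries)
    qed
    then have "massey_product A k p \<alpha> \<subseteq> {\<zero>\<^bsub>homology A\<^esub>}"
      using False by (auto simp: massey_product_def zero_homology)
    with def show ?thesis by blast
  qed
qed

end

section \<open>The quotient by a monomial ideal\<close>

lemma pol_ring_simps [simp]:
  "carrier (pol_ring n) = Sn n" "mult (pol_ring n) = (*)" "one (pol_ring n) = 1"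
  "zero (pol_ring n) = 0" "add (pol_ring n) = (+)"
  by (simp_all add: pol_ring_def Sn_def)

lemma Sn_neg: "p \<in> Sn n \<Longrightarrow> - p \<in> Sn n" by (simp add: Sn_def)

lemma Sn_1: "1 \<in> Sn n" by (simp add: Sn_def)

lemma Sn_diff: "p \<in> Sn n \<Longrightarrow> q \<in> Sn n \<Longrightarrow> p - q \<in> Sn n"
  using Sn_add[of p n "- q"] Sn_neg[of q n] by simp

lemma pol_ring_cring: "cring (pol_ring n :: 'k::field pol ring)"
proof (rule cringI)
  show "abelian_group (pol_ring n :: 'k pol ring)"
  proof (rule abelian_groupI)
    fix x :: "'k pol" assume "x \<in> carrier (pol_ring n)"
    then show "\<exists>y\<in>carrier (pol_ring n). y \<oplus>\<^bsub>pol_ring n\<^esub> x = \<zero>\<^bsub>pol_ring n\<^esub>"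
      by (intro bexI[of _ "- x"]) (auto simp: Sn_neg)
  qed (auto simp: Sn_add Sn_0 ac_simps)
  show "Group.comm_monoid (pol_ring n :: 'k pol ring)"
    by (rule comm_monoidI) (auto simp: Sn_mult Sn_1 ac_simps)
qed (auto simp: algebra_simps)

locale monomial_quotient =
  fixes n :: nat and M :: "mono set" and \<aa> :: "'k::field pol set"
  assumes M: "m \<in> M \<Longrightarrow> Poly_Mapping.keys m \<subseteq> {..<n}" and \<aa>: "\<aa> = Idl\<^bsub>pol_ring n\<^esub> (mon ` M)"
begin

abbreviation "S \<equiv> pol_ring n :: 'k pol ring"
abbreviation "R \<equiv> quot_ring n \<aa>"
abbreviation "q \<equiv> quot_class n \<aa>"

definition N :: "mono set" where "N = {m + m' | m m'. m \<in> M}"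

lemma up: "upset N"
  unfolding upset_def N_def by (auto simp: add.assoc) blast

sublocale S: cring S by (rule pol_ring_cring)

lemma mon_Sn: "Poly_Mapping.keys m \<subseteq> {..<n} \<Longrightarrow> (Poly_Mapping.single m c :: 'k pol) \<in> Sn n"
  by (simp add: Sn_def)

lemma mon_M: "mon ` M \<subseteq> carrier S"
proof
  fix x :: "'k pol" assume "x \<in> mon ` M"
  then obtain m where "x = mon m" "m \<in> M" by blast
  then show "x \<in> carrier S" using M[of m] by (simp add: mon_def Sn_def)
qed

lemma ideal_\<aa>: "ideal \<aa> S"
  unfolding \<aa> by (rule S.genideal_ideal[OF mon_M])

text \<open>Membership is decided term by term: the polynomials with all terms in \<open>N\<close>
  form an ideal that contains the generators, and each such term is a multiple of a
  generator.\<close>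

lemma mem_\<aa>: "p \<in> \<aa> \<longleftrightarrow> p \<in> Sn n \<and> Poly_Mapping.keys p \<subseteq> N"
proof
  interpret I: ideal \<aa> S by (rule ideal_\<aa>)
  assume p: "p \<in> Sn n \<and> Poly_Mapping.keys p \<subseteq> N"
  have sing: "Poly_Mapping.single a c \<in> \<aa>" if a: "a \<in> Poly_Mapping.keys p" for a c
  proof -
    obtain m m' where m: "a = m + m'" "m \<in> M" using a p by (auto simp: N_def)
    \<comment> \<open>\<open>N\<close> admits cofactors in variables beyond n; this one stays in
      range because m + m' does.\<close>
    have "Poly_Mapping.keys (m + m') \<subseteq> {..<n}" using p a m(1) by (simp add: Sn_def)
    then have "Poly_Mapping.keys m' \<subseteq> {..<n}" by (simp add: keys_mono_plus)
    then have "(Poly_Mapping.single m' c :: 'k pol) \<in> carrier S" by (simp add: mon_Sn)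
    moreover have "mon m \<in> \<aa>"
      unfolding \<aa> using S.genideal_self[OF mon_M] m(2) by blast
    ultimately have "mon m \<otimes>\<^bsub>S\<^esub> Poly_Mapping.single m' c \<in> \<aa>" by (intro I.I_r_closed)
    then show ?thesis by (simp add: mon_def mult_single m)
  qed
  have sm: "sum g A \<in> \<aa>" if "\<And>a. a \<in> A \<Longrightarrow> g a \<in> \<aa>" for g and A :: "mono set"
    using that
  proof (induction A rule: infinite_finite_induct)
    case (insert a A)
    then show ?case using I.a_closed[of "g a" "sum g A"] by simp
  qed (use I.zero_closed in auto)
  have "(\<Sum>a\<in>Poly_Mapping.keys p. Poly_Mapping.single a (Poly_Mapping.lookup p a)) \<in> \<aa>"
    by (rule sm, rule sing)
  then show "p \<in> \<aa>" by (simp add: sum_singles)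
next
  let ?J = "{p \<in> Sn n. Poly_Mapping.keys p \<subseteq> N} :: 'k pol set"
  have kmul: "Poly_Mapping.keys (x * p) \<subseteq> N" if "Poly_Mapping.keys p \<subseteq> N" for x p :: "'k pol"
    using keys_mult[of x p] that upsetD(2)[OF up] by blast
  have "ideal ?J S"
  proof (rule idealI[OF S.ring_axioms])
    show "subgroup ?J (add_monoid S)"
    proof (unfold_locales, goal_cases)
      case (4 x)
      have "\<ominus>\<^bsub>S\<^esub> x = - x"
        by (rule S.minus_equality) (use 4 in \<open>auto simp: Sn_neg\<close>)
      then have e: "inv\<^bsub>add_monoid S\<^esub> x = - x" by (simp only: a_inv_def)
      show ?case unfolding e using 4 by (simp add: Sn_neg)
    qed (auto simp: Sn_0 Sn_add dest: keys_add_sub)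
  next
    fix a x :: "'k pol" assume a: "a \<in> ?J" and x: "x \<in> carrier S"
    have *: "x * a \<in> ?J" using a x kmul[of a x] by (simp add: Sn_mult)
    then show "x \<otimes>\<^bsub>S\<^esub> a \<in> ?J" by simp
    show "a \<otimes>\<^bsub>S\<^esub> x \<in> ?J" using * by (simp add: mult.commute[of a x])
  qed
  moreover have "mon ` M \<subseteq> ?J"
  proof
    fix x :: "'k pol" assume "x \<in> mon ` M"
    then obtain m where m: "x = mon m" "m \<in> M" by auto
    have "m + 0 \<in> N" unfolding N_def using m(2) by blast
    then show "x \<in> ?J" using M[OF m(2)] by (simp add: m(1) mon_def Sn_def)
  qed
  ultimately have "\<aa> \<subseteq> ?J" unfolding \<aa> by (rule S.genideal_minimal)
  then show "p \<in> \<aa> \<Longrightarrow> p \<in> Sn n \<and> Poly_Mapping.keys p \<subseteq> N" by blast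
qed

sublocale I: ideal \<aa> S by (rule ideal_\<aa>)

sublocale R: cring R
  unfolding quot_ring_def by (rule I.quotient_is_cring[OF S.is_cring])

lemma q_hom: "ring_hom_ring S R q"
  unfolding quot_ring_def quot_class_def[abs_def] by (rule I.rcos_ring_hom_ring)

sublocale q: ring_hom_ring S R q by (rule q_hom)

lemma q_carrier: "p \<in> Sn n \<Longrightarrow> q p \<in> carrier R"
  using q.hom_closed by simp

lemma q_add: "p \<in> Sn n \<Longrightarrow> p' \<in> Sn n \<Longrightarrow> q (p + p') = q p \<oplus>\<^bsub>R\<^esub> q p'"
  using q.hom_add[of p p'] by simp

lemma q_mult: "p \<in> Sn n \<Longrightarrow> p' \<in> Sn n \<Longrightarrow> q (p * p') = q p \<otimes>\<^bsub>R\<^esub> q p'"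
  using q.hom_mult[of p p'] by simp

lemma q_0: "q 0 = \<zero>\<^bsub>R\<^esub>"
  using q.hom_zero by simp

lemma q_neg: "p \<in> Sn n \<Longrightarrow> q (- p) = \<ominus>\<^bsub>R\<^esub> q p"
proof -
  assume p: "p \<in> Sn n"
  have "q (- p) \<oplus>\<^bsub>R\<^esub> q p = \<zero>\<^bsub>R\<^esub>" using p by (simp add: q_add[symmetric] Sn_neg q_0)
  then show ?thesis using R.minus_equality[of "q (- p)" "q p"] p by (simp add: q_carrier Sn_neg)
qed

lemma q_signed: "p \<in> Sn n \<Longrightarrow> signed R k (q p) = q (sg k p)"
  by (simp add: signed_def sg_def q_neg)

lemma Sn_sg: "p \<in> Sn n \<Longrightarrow> sg k p \<in> Sn n" by (simp add: sg_def Sn_neg)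

lemma q_sum: "finite A \<Longrightarrow> (\<And>a. a \<in> A \<Longrightarrow> g a \<in> Sn n) \<Longrightarrow> (\<Oplus>\<^bsub>R\<^esub>a\<in>A. q (g a)) = q (sum g A)"
proof (induction A rule: finite_induct)
  case (insert a A)
  have "(\<Oplus>\<^bsub>R\<^esub>a\<in>insert a A. q (g a)) = q (g a) \<oplus>\<^bsub>R\<^esub> (\<Oplus>\<^bsub>R\<^esub>a\<in>A. q (g a))"
    using insert by (intro R.finsum_insert) (auto simp: q_carrier)
  then show ?case using insert by (simp add: q_add Sn_sum)
qed (simp add: q_0)

lemma q_eq_0: "p \<in> Sn n \<Longrightarrow> q p = \<zero>\<^bsub>R\<^esub> \<longleftrightarrow> Poly_Mapping.keys p \<subseteq> N"
proof -
  assume p: "p \<in> Sn n"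
  have "q p = \<zero>\<^bsub>R\<^esub> \<longleftrightarrow> p \<in> \<aa>"
    using S.quotient_eq_iff_same_a_r_cos[OF ideal_\<aa>, of p 0] p I.a_rcos_const[of p] I.a_rcos_self[of p]
    by (auto simp: quot_class_def quot_ring_def FactRing_def)
  then show ?thesis using p mem_\<aa> by simp
qed

lemma q_eq: "p \<in> Sn n \<Longrightarrow> p' \<in> Sn n \<Longrightarrow> q p = q p' \<longleftrightarrow> Poly_Mapping.keys (p - p') \<subseteq> N"
proof -
  assume p: "p \<in> Sn n" "p' \<in> Sn n"
  have 1: "q p = q (p - p') \<oplus>\<^bsub>R\<^esub> q p'" using q_add[OF Sn_diff[OF p] p(2)] by simp
  have "q (p + - p') = q p \<oplus>\<^bsub>R\<^esub> \<ominus>\<^bsub>R\<^esub> q p'" using p by (simp only: q_add Sn_neg q_neg)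
  then have 2: "q (p - p') = q p \<oplus>\<^bsub>R\<^esub> \<ominus>\<^bsub>R\<^esub> q p'" by simp
  have "q p = q p' \<longleftrightarrow> q (p - p') = \<zero>\<^bsub>R\<^esub>"
  proof
    assume "q p = q p'"
    then show "q (p - p') = \<zero>\<^bsub>R\<^esub>" unfolding 2 using R.r_neg[OF q_carrier[OF p(2)]] by simp
  next
    assume "q (p - p') = \<zero>\<^bsub>R\<^esub>"
    then show "q p = q p'" using 1 R.l_zero[OF q_carrier[OF p(2)]] by simp
  qed
  then show ?thesis using q_eq_0[OF Sn_diff[OF p]] by simp
qed

lemma carrier_R: "carrier R = q ` Sn n"
  by (auto simp: quot_ring_def FactRing_def A_RCOSETS_def' quot_class_def)

end

lemma additive_kcomp_mult_left: "additive_map (\<lambda>x. \<Sum>J\<in>Pow I. sg (inversions J (I - J)) (kcomp x J * kcomp y (I - J)))"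
  and additive_kcomp_mult_right: "additive_map (\<lambda>y. \<Sum>J\<in>Pow I. sg (inversions J (I - J)) (kcomp x J * kcomp y (I - J)))"
  by (simp_all add: additive_map_def additive_add[OF additive_comp] algebra_simps sg_add_right sum.distrib)

text \<open>Passes from the product on basis elements to the coefficient formula in
  \<open>koszul\<close>; \<open>restr\<close> drops the terms that vanish in the quotient.\<close>

lemma kcomp_kmul:
  fixes x y :: "'k::field kel"
  assumes I: "finite I"
  shows "kcomp (kmul N x y) I = restr (- N) (\<Sum>J\<in>Pow I. sg (inversions J (I - J)) (kcomp x J * kcomp y (I - J)))"
proof (rule additive_eq_pair[where x = x and f = "\<lambda>x. kcomp (kmul N x y) I"])
  fix m :: mono and J :: "nat set" and a :: 'k
  let ?x = "Poly_Mapping.single (m, J) a"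
  show "kcomp (kmul N ?x y) I = restr (- N) (\<Sum>J\<in>Pow I. sg (inversions J (I - J)) (kcomp ?x J * kcomp y (I - J)))"
  proof (rule additive_eq_pair[where x = y and f = "\<lambda>y. kcomp (kmul N ?x y) I"])
    fix m' :: mono and L :: "nat set" and b :: 'k
    let ?y = "Poly_Mapping.single (m', L) b"
    have "(\<Sum>J'\<in>Pow I. sg (inversions J' (I - J')) (kcomp ?x J' * kcomp ?y (I - J'))) =
       (\<Sum>J'\<in>Pow I. if J' = J then if L = I - J then Poly_Mapping.single (m + m') (sg (inversions J L) (a * b)) else 0 else 0)"
      by (rule sum.cong) (auto simp: comp_single mult_single single_sg)
    also have "\<dots> = (if J \<subseteq> I \<and> L = I - J then Poly_Mapping.single (m + m') (sg (inversions J L) (a * b)) else 0)"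
      using I by (simp add: sum.delta)
    finally have r: "(\<Sum>J'\<in>Pow I. sg (inversions J' (I - J')) (kcomp ?x J' * kcomp ?y (I - J'))) =
       (if J \<subseteq> I \<and> L = I - J then Poly_Mapping.single (m + m') (sg (inversions J L) (a * b)) else 0)" .
    have eq: "J \<subseteq> I \<and> L = I - J \<longleftrightarrow> finite J \<and> finite L \<and> J \<inter> L = {} \<and> J \<union> L = I"
      using I by (auto intro: finite_subset)
    show "kcomp (kmul N ?x ?y) I = restr (- N) (\<Sum>J\<in>Pow I. sg (inversions J (I - J)) (kcomp ?x J * kcomp ?y (I - J)))"
      unfolding r eq by (auto simp: kmul_single comp_single restr_single additive_0[OF additive_restr] additive_0[OF additive_comp])
    show "additive_map (\<lambda>y. restr (- N) (\<Sum>J\<in>Pow I. sg (inversions J (I - J)) (kcomp ?x J * kcomp y (I - J))))"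
      using additive_kcomp_mult_right[of I ?x] by (simp add: additive_map_def additive_add[OF additive_restr])
  qed (simp add: additive_map_def kmul_add_right additive_add[OF additive_comp])
  show "additive_map (\<lambda>x. restr (- N) (\<Sum>J\<in>Pow I. sg (inversions J (I - J)) (kcomp x J * kcomp y (I - J))))"
    using additive_kcomp_mult_left[of I y] by (simp add: additive_map_def additive_add[OF additive_restr])
qed (simp add: additive_map_def kmul_add_left additive_add[OF additive_comp])

lemma var_eq: "var i = Poly_Mapping.single (xvar i) 1"
  by (simp add: var_def mon_def xvar_def)

lemma kcomp_kdif:
  fixes x :: "'k::field kel"
  assumes x: "x \<in> kC n N'" and I: "I \<subseteq> {..<n}"
  shows "kcomp (kdif N x) I = restr (- N) (\<Sum>i\<in>{..<n} - I. sg (below I i) (var i * kcomp x (insert i I)))"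
proof (rule additive_eq_on[where x = x and K = "kbasis n N'" and f = "\<lambda>x. kcomp (kdif N x) I"])
  show "Poly_Mapping.keys x \<subseteq> kbasis n N'" using x by (simp add: kC_def)
  fix p and a :: 'k assume p: "p \<in> kbasis n N'"
  obtain m J where pmJ: "p = (m, J)" by (cases p)
  have J: "J \<subseteq> {..<n}" "finite J" using p pmJ kbasis_fin by (auto simp: kbasis_def)
  let ?x = "Poly_Mapping.single p a"
  let ?K = "{i. i \<notin> I \<and> J = insert i I}"
  have fK: "finite ?K" by (rule finite_subset[OF _ J(2)]) auto
  have "kcomp (kdif N ?x) I = (\<Sum>j\<in>J. if j \<in> ?K then if m + xvar j \<notin> N then Poly_Mapping.single (m + xvar j) (sg (below J j) a) else 0 else 0)"
    unfolding pmJ kdif_single additive_sum[OF additive_comp]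
    by (rule sum.cong) (auto simp: comp_single additive_0[OF additive_comp])
  also have "\<dots> = (\<Sum>j\<in>?K. if m + xvar j \<notin> N then Poly_Mapping.single (m + xvar j) (sg (below J j) a) else 0)"
    by (rule sum.mono_neutral_cong_right[OF J(2)]) auto
  also have "\<dots> = restr (- N) (\<Sum>j\<in>?K. Poly_Mapping.single (m + xvar j) (sg (below I j) a))"
    unfolding additive_sum[OF additive_restr]
  proof (rule sum.cong[OF refl])
    fix j assume j: "j \<in> ?K"
    then have "I = J - {j}" by auto
    then have "below I j = below J j" by (simp add: below_remove_self)
    then show "(if m + xvar j \<notin> N then Poly_Mapping.single (m + xvar j) (sg (below J j) a) else 0) =
        restr (- N) (Poly_Mapping.single (m + xvar j) (sg (below I j) a))" by (simp add: restr_single)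
  qed
  also have "(\<Sum>j\<in>?K. Poly_Mapping.single (m + xvar j) (sg (below I j) a)) =
     (\<Sum>i\<in>{..<n} - I. sg (below I i) (var i * kcomp ?x (insert i I)))"
    by (rule sum.mono_neutral_cong_left)
       (use J in \<open>auto simp: pmJ comp_single var_eq mult_single single_sg add.commute\<close>)
  finally show "kcomp (kdif N ?x) I = restr (- N) (\<Sum>i\<in>{..<n} - I. sg (below I i) (var i * kcomp ?x (insert i I)))" .
next
  show "additive_map (\<lambda>x. restr (- N) (\<Sum>i\<in>{..<n} - I. sg (below I i) (var i * kcomp x (insert i I))))"
    by (simp add: additive_map_def additive_add[OF additive_comp] algebra_simps sg_add_right sum.distrib additive_add[OF additive_restr])
qed (simp add: additive_map_def additive_add[OF additive_kdif] additive_add[OF additive_comp])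

section \<open>The basis model is the Koszul complex over the quotient\<close>

context monomial_quotient
begin

abbreviation "K \<equiv> koszul_quot n \<aa>"

definition \<Phi> :: "'k kel \<Rightarrow> nat set \<Rightarrow> 'k pol set" where
  "\<Phi> x = (\<lambda>I\<in>Pow {..<n}. q (kcomp x I))"

lemma q_restr: "p \<in> Sn n \<Longrightarrow> q (restr (- N) p) = q p"
proof -
  assume p: "p \<in> Sn n"
  have "restr (- N) p \<in> Sn n" using p by (auto simp: Sn_def keys_restr)
  moreover have "Poly_Mapping.keys (restr (- N) p - p) \<subseteq> N"
    by (auto simp: in_keys_iff lookup_minus lookup_restr split: if_splits)
  ultimately show ?thesis using q_eq p by blast
qed

lemma kcomp_keys_N: "x \<in> kC n N \<Longrightarrow> Poly_Mapping.keys (kcomp x I) \<inter> N = {}"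
  by (auto simp: kC_def kbasis_def in_keys_iff lookup_comp)

lemma q_kcomp_eq:
  assumes "x \<in> kC n N" "y \<in> kC n N"
  shows "q (kcomp x I) = q (kcomp y I) \<longleftrightarrow> kcomp x I = kcomp y I"
proof
  assume "q (kcomp x I) = q (kcomp y I)"
  then have "Poly_Mapping.keys (kcomp x I - kcomp y I) \<subseteq> N"
    using q_eq comp_Sn assms by blast
  moreover have "Poly_Mapping.keys (kcomp x I - kcomp y I) \<inter> N = {}"
    using Poly_Mapping.keys_diff[of "kcomp x I" "kcomp y I"] kcomp_keys_N assms by blast
  ultimately have "Poly_Mapping.keys (kcomp x I - kcomp y I) = {}" by blast
  then show "kcomp x I = kcomp y I" by simp
qed simp

text \<open>Every class has a unique representative without terms in \<open>N\<close>: the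
  difference of two such has terms outside \<open>N\<close> only, whereas equal classes differ by
  terms inside.\<close>

lemma \<Phi>_bij: "bij_betw \<Phi> (kC n N) (carrier K)"
  unfolding bij_betw_def
proof
  show "inj_on \<Phi> (kC n N)"
  proof (rule inj_onI)
    fix x y assume xy: "x \<in> kC n N" "y \<in> kC n N" "\<Phi> x = \<Phi> y"
    show "x = y"
    proof (rule comp_eqI)
      fix I
      show "kcomp x I = kcomp y I"
      proof (cases "I \<subseteq> {..<n}")
        case True
        then have "q (kcomp x I) = q (kcomp y I)"
          using fun_cong[OF xy(3), of I] by (simp add: \<Phi>_def)
        then show ?thesis using q_kcomp_eq xy by blast
      qed (use comp_out xy in metis)
    qed
  qed
  show "\<Phi> ` kC n N = carrier K"
  proof
    show "\<Phi> ` kC n N \<subseteq> carrier K"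
    proof
      fix g assume "g \<in> \<Phi> ` kC n N"
      then obtain x where x: "x \<in> kC n N" and g: "g = (\<lambda>I\<in>Pow {..<n}. q (kcomp x I))"
        unfolding \<Phi>_def by blast
      have "(\<lambda>I\<in>Pow {..<n}. q (kcomp x I)) \<in> Pow {..<n} \<rightarrow>\<^sub>E carrier R"
        unfolding restrict_PiE_iff using q_carrier[OF comp_Sn[OF x]] by blast
      then show "g \<in> carrier K" by (simp add: g koszul_quot_def koszul_def)
    qed
    show "carrier K \<subseteq> \<Phi> ` kC n N"
    proof
      fix g assume "g \<in> carrier K"
      then have g: "g \<in> Pow {..<n} \<rightarrow>\<^sub>E q ` Sn n" by (simp add: koszul_quot_def koszul_def carrier_R)
      then have "\<forall>I\<in>Pow {..<n}. \<exists>p. p \<in> Sn n \<and> g I = q p" by blast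
      then obtain p where p: "\<forall>I\<in>Pow {..<n}. p I \<in> Sn n \<and> g I = q (p I)" by (rule bchoice[THEN exE])
      define x where "x = assemble n (\<lambda>I. restr (- N) (p I))"
      have cx: "kcomp x I = (if I \<subseteq> {..<n} then restr (- N) (p I) else 0)" for I
        by (simp add: x_def comp_assemble)
      have "x \<in> kC n N"
        unfolding kC_def kbasis_def
      proof clarify
        fix m I assume "(m, I) \<in> Poly_Mapping.keys x"
        then have "m \<in> Poly_Mapping.keys (kcomp x I)" by (simp add: in_keys_iff lookup_comp)
        then have "I \<subseteq> {..<n}" "m \<in> Poly_Mapping.keys (restr (- N) (p I))"
          unfolding cx by (auto split: if_splits)
        then show "Poly_Mapping.keys m \<subseteq> {..<n} \<and> I \<subseteq> {..<n} \<and> m \<notin> N"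
          using p by (auto simp: keys_restr Sn_def)
      qed
      moreover have "g = \<Phi> x"
      proof
        fix I show "g I = \<Phi> x I"
          using p PiE_arb[OF g, of I] by (cases "I \<subseteq> {..<n}") (auto simp: \<Phi>_def cx q_restr)
      qed
      ultimately show "g \<in> \<Phi> ` kC n N" by blast
    qed
  qed
qed

lemma \<Phi>_piece: "piece K p = \<Phi> ` kG n N p"
proof -
  have key: "(\<forall>I\<in>Pow {..<n}. card I \<noteq> p \<longrightarrow> \<Phi> x I = \<zero>\<^bsub>R\<^esub>) \<longleftrightarrow> x \<in> kG n N p" if x: "x \<in> kC n N" for x
  proof -
    have "(\<forall>I\<in>Pow {..<n}. card I \<noteq> p \<longrightarrow> \<Phi> x I = \<zero>\<^bsub>R\<^esub>) \<longleftrightarrow> (\<forall>I\<in>Pow {..<n}. card I \<noteq> p \<longrightarrow> kcomp x I = 0)"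
    proof -
      have "\<Phi> x I = \<zero>\<^bsub>R\<^esub> \<longleftrightarrow> kcomp x I = 0" if "I \<in> Pow {..<n}" for I
        using q_eq_0[OF comp_Sn[OF x], of I] kcomp_keys_N[OF x, of I] that
        by (auto simp: \<Phi>_def) (metis inf.absorb1 keys_eq_empty)
      then show ?thesis by blast
    qed
    also have "\<dots> \<longleftrightarrow> x \<in> kG n N p"
    proof
      assume a: "\<forall>I\<in>Pow {..<n}. card I \<noteq> p \<longrightarrow> kcomp x I = 0"
      have "card I = p" if mI: "(m, I) \<in> Poly_Mapping.keys x" for m I
      proof (rule ccontr)
        assume "card I \<noteq> p"
        moreover have "I \<in> Pow {..<n}" using mI x by (auto simp: kC_def kbasis_def)
        ultimately have "kcomp x I = 0" using a by blast
        then show False using mI by (metis in_keys_iff lookup_comp lookup_zero)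
      qed
      then show "x \<in> kG n N p" using x by (auto simp: kG_def kC_def)
    next
      assume x: "x \<in> kG n N p"
      have "kcomp x I = 0" if "card I \<noteq> p" for I
      proof (rule poly_mapping_eqI)
        fix m
        have "(m, I) \<notin> Poly_Mapping.keys x" using x that by (auto simp: kG_def)
        then show "Poly_Mapping.lookup (kcomp x I) m = Poly_Mapping.lookup 0 m"
          by (simp add: lookup_comp in_keys_iff)
      qed
      then show "\<forall>I\<in>Pow {..<n}. card I \<noteq> p \<longrightarrow> kcomp x I = 0" by blast
    qed
    finally show ?thesis .
  qed
  have "piece K p = {g \<in> carrier K. \<forall>I\<in>Pow {..<n}. card I \<noteq> p \<longrightarrow> g I = \<zero>\<^bsub>R\<^esub>}"
    by (simp add: koszul_quot_def koszul_def)
  also have "\<dots> = \<Phi> ` {x \<in> kC n N. \<forall>I\<in>Pow {..<n}. card I \<noteq> p \<longrightarrow> \<Phi> x I = \<zero>\<^bsub>R\<^esub>}"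
    unfolding bij_betw_imp_surj_on[OF \<Phi>_bij, symmetric] by (rule Compr_image_eq)
  also have "{x \<in> kC n N. \<forall>I\<in>Pow {..<n}. card I \<noteq> p \<longrightarrow> \<Phi> x I = \<zero>\<^bsub>R\<^esub>} = kG n N p"
  proof (rule Set.set_eqI)
    fix x :: "'k kel"
    have sub: "kG n N p \<subseteq> (kC n N :: 'k kel set)" by (auto simp: kG_def kC_def)
    show "x \<in> {x \<in> kC n N. \<forall>I\<in>Pow {..<n}. card I \<noteq> p \<longrightarrow> \<Phi> x I = \<zero>\<^bsub>R\<^esub>} \<longleftrightarrow> x \<in> kG n N p"
    proof (cases "x \<in> kC n N")
      case True
      then show ?thesis unfolding mem_Collect_eq key[OF True] by simp
    qed (use sub in blast)
  qed
  finally show ?thesis .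
qed

lemma \<Phi>_mul:
  assumes x: "x \<in> kC n N" and y: "y \<in> kC n N"
  shows "\<Phi> (kmul N x y) = \<Phi> x \<otimes>\<^bsub>K\<^esub> \<Phi> y"
proof
  fix I
  show "\<Phi> (kmul N x y) I = (\<Phi> x \<otimes>\<^bsub>K\<^esub> \<Phi> y) I"
  proof (cases "I \<subseteq> {..<n}")
    case True
    then have fin: "finite I" by (rule finite_subset) simp
    let ?t = "\<lambda>J. sg (inversions J (I - J)) (kcomp x J * kcomp y (I - J))"
    have t: "?t J \<in> Sn n" for J using comp_Sn[OF x] comp_Sn[OF y] by (intro Sn_sg Sn_mult)
    have "(\<Phi> x \<otimes>\<^bsub>K\<^esub> \<Phi> y) I = (\<Oplus>\<^bsub>R\<^esub>J\<in>Pow I. signed R (inversions J (I - J)) (\<Phi> x J \<otimes>\<^bsub>R\<^esub> \<Phi> y (I - J)))"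
      using True by (simp add: koszul_quot_def koszul_def)
    also have "\<dots> = (\<Oplus>\<^bsub>R\<^esub>J\<in>Pow I. q (?t J))"
    proof (rule R.finsum_cong')
      fix J assume J: "J \<in> Pow I"
      then have "J \<subseteq> {..<n}" "I - J \<subseteq> {..<n}" using True by auto
      then show "signed R (inversions J (I - J)) (\<Phi> x J \<otimes>\<^bsub>R\<^esub> \<Phi> y (I - J)) = q (?t J)"
        using comp_Sn[OF x] comp_Sn[OF y] by (simp add: \<Phi>_def q_mult[symmetric] q_signed Sn_mult)
    qed (use t q_carrier in auto)
    also have "\<dots> = q (\<Sum>J\<in>Pow I. ?t J)" using fin t by (intro q_sum) auto
    also have "\<dots> = q (kcomp (kmul N x y) I)"
      unfolding kcomp_kmul[OF fin] using t by (intro q_restr[symmetric] Sn_sum)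
    finally show ?thesis using True by (simp add: \<Phi>_def)
  qed (simp add: \<Phi>_def koszul_quot_def koszul_def)
qed

lemma \<Phi>_d:
  assumes x: "x \<in> kC n N"
  shows "\<Phi> (kdif N x) = diff K (\<Phi> x)"
proof
  fix I
  show "\<Phi> (kdif N x) I = diff K (\<Phi> x) I"
  proof (cases "I \<subseteq> {..<n}")
    case True
    let ?t = "\<lambda>i. sg (below I i) (var i * kcomp x (insert i I))"
    have v: "(var i :: 'k pol) \<in> Sn n" if "i < n" for i using that by (simp add: var_eq mon_Sn)
    have t: "?t i \<in> Sn n" if "i \<in> {..<n} - I" for i using comp_Sn[OF x] v that by (intro Sn_sg Sn_mult) auto
    have "diff K (\<Phi> x) I = (\<Oplus>\<^bsub>R\<^esub>i\<in>{..<n} - I. signed R (below I i) (q (var i) \<otimes>\<^bsub>R\<^esub> \<Phi> x (insert i I)))"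
      using True by (simp add: koszul_quot_def koszul_def below_def)
    also have "\<dots> = (\<Oplus>\<^bsub>R\<^esub>i\<in>{..<n} - I. q (?t i))"
    proof (rule R.finsum_cong')
      fix i assume i: "i \<in> {..<n} - I"
      then have "insert i I \<subseteq> {..<n}" using True by auto
      then show "signed R (below I i) (q (var i) \<otimes>\<^bsub>R\<^esub> \<Phi> x (insert i I)) = q (?t i)"
        using comp_Sn[OF x] v i by (simp add: \<Phi>_def q_mult[symmetric] q_signed Sn_mult)
    qed (use t q_carrier in auto)
    also have "\<dots> = q (\<Sum>i\<in>{..<n} - I. ?t i)" using t by (intro q_sum) auto
    also have "\<dots> = q (kcomp (kdif N x) I)"
      unfolding kcomp_kdif[OF x True] using t by (intro q_restr[symmetric] Sn_sum)
    finally show ?thesis using True by (simp add: \<Phi>_def)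
  qed (simp add: \<Phi>_def koszul_quot_def koszul_def)
qed

lemma kbar_kC: "x \<in> kC n N \<Longrightarrow> kbar x \<in> kC n N"
  unfolding kC_def mem_Collect_eq by (rule order_trans[OF keys_kbar])

lemma kmul_kC: "x \<in> kC n N \<Longrightarrow> y \<in> kC n N \<Longrightarrow> kmul N x y \<in> kC n N"
  unfolding kC_def mem_Collect_eq by (rule keys_kmul[where K = "kbasis n N" and L = "kbasis n N"]) (simp_all add: kbasis_kmul)

sublocale T: massey_transfer "kC n N" "kmul N" "kdif N" kbar "kG n N :: nat \<Rightarrow> 'k kel set" K \<Phi>
proof (intro massey_transfer.intro cdga_koszul up massey_transfer_axioms.intro)
  fix x y :: "'k kel" assume xy: "x \<in> kC n N" "y \<in> kC n N"
  show "\<Phi> (x + y) = \<Phi> x \<oplus>\<^bsub>K\<^esub> \<Phi> y"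
    using comp_Sn[OF xy(1)] comp_Sn[OF xy(2)]
    by (intro ext) (simp add: \<Phi>_def koszul_quot_def koszul_def additive_add[OF additive_comp] q_add)
next
  show "\<Phi> 0 = \<zero>\<^bsub>K\<^esub>"
    by (intro ext) (simp add: \<Phi>_def koszul_quot_def koszul_def additive_0[OF additive_comp] q_0)
qed (simp_all add: \<Phi>_bij \<Phi>_mul \<Phi>_d \<Phi>_piece kmul_kC kdif_kC kbar_kC)


section \<open>Resolutions over the quotient and the induction on k\<close>

lemma res_aug_eq:
  assumes F: "\<And>c. c < rank F 0 \<Longrightarrow> f c \<in> Sn n \<and> aug F c = q (f c)" and v: "\<And>c. c < rank F 0 \<Longrightarrow> v c \<in> Sn n"
  shows "res_aug n \<aa> F v = q (\<Sum>c<rank F 0. f c * v c)"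
proof -
  have t: "f c * v c \<in> Sn n" if "c < rank F 0" for c using F[OF that] v[OF that] by (simp add: Sn_mult)
  have "res_aug n \<aa> F v = (\<Oplus>\<^bsub>R\<^esub>c\<in>{..<rank F 0}. q (f c * v c))"
    unfolding res_aug_def
  proof (rule R.finsum_cong')
    fix c assume "c \<in> {..<rank F 0}"
    then have c: "c < rank F 0" by simp
    show "q (v c) \<otimes>\<^bsub>R\<^esub> aug F c = q (f c * v c)"
      using F[OF c] v[OF c] by (simp add: q_mult[symmetric] mult.commute)
  qed (use t q_carrier in auto)
  also have "\<dots> = q (\<Sum>c<rank F 0. f c * v c)" using t by (intro q_sum) auto
  finally show ?thesis .
qed

text \<open>Translation between the two descriptions. Vectors given below the rank are made
  extensional by \<open>restrict\<close> before the set equations for kernels and images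
  apply.\<close>

lemma free_res_graded:
  assumes F: "graded_free_resolution n \<aa> F"
  shows "\<exists>f. free_res n N F f"
proof -
  note F' = F[unfolded graded_free_resolution_def]
  have gen: "\<forall>c<rank F 0. \<exists>p\<in>carrier S. homogeneous (gdeg F 0 c) p \<and> aug F c = q p"
    and dm: "\<forall>i. \<forall>c<rank F i. \<forall>b<rank F (i + 1). dmat F i c b \<in> carrier S \<and>
        homogeneous (gdeg F (i + 1) b - gdeg F i c) (dmat F i c b)"
    and sj: "res_aug n \<aa> F ` free_mod n F 0 = carrier R"
    and k0: "{v \<in> free_mod n F 0. res_aug n \<aa> F v = \<zero>\<^bsub>R\<^esub>} = res_map F 0 ` free_mod n F 1"
    and k1: "\<forall>i. {v \<in> free_mod n F (i + 1). res_map F i v = res_zero F i} = res_map F (i + 1) ` free_mod n F (i + 2)"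
    by (rule F'[THEN conjunct1] F'[THEN conjunct2, THEN conjunct1] F'[THEN conjunct2, THEN conjunct2, THEN conjunct1]
        F'[THEN conjunct2, THEN conjunct2, THEN conjunct2, THEN conjunct1]
        F'[THEN conjunct2, THEN conjunct2, THEN conjunct2, THEN conjunct2])+
  obtain f where f: "\<And>c. c < rank F 0 \<Longrightarrow> f c \<in> Sn n \<and> homogeneous (gdeg F 0 c) (f c) \<and> aug F c = q (f c)"
    using gen unfolding pol_ring_simps Bex_def by metis
  note dm = dm[unfolded pol_ring_simps, rule_format] and sj = sj[unfolded carrier_R] and k1 = spec[OF k1]
  have fm: "v \<in> free_mod n F i \<Longrightarrow> c < rank F i \<Longrightarrow> v c \<in> Sn n" for v i c
    unfolding free_mod_def pol_ring_simps by (erule PiE_mem) simp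
  have fr: "(\<And>c. c < rank F i \<Longrightarrow> v c \<in> Sn n) \<Longrightarrow> restrict v {..<rank F i} \<in> free_mod n F i" for v i
    unfolding free_mod_def pol_ring_simps by (simp add: restrict_PiE_iff)
  have ra: "res_aug n \<aa> F v = q (\<Sum>c<rank F 0. f c * v c)" if "\<And>c. c < rank F 0 \<Longrightarrow> v c \<in> Sn n" for v
    by (rule res_aug_eq) (use f that in auto)
  have fv: "(\<Sum>c<rank F 0. f c * v c) \<in> Sn n" if "\<And>c. c < rank F 0 \<Longrightarrow> v c \<in> Sn n" for v
    by (intro Sn_sum Sn_mult) (use f that in auto)
  have rm: "res_map F i v c = (\<Sum>b<rank F (i + 1). dmat F i c b * v b)" if "c < rank F i" for i v c
    using that by (simp add: res_map_def)
  have rm_0: "res_map F i v = res_zero F i \<longleftrightarrow> (\<forall>c<rank F i. (\<Sum>b<rank F (i + 1). dmat F i c b * v b) = 0)" for i v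
    by (auto simp: res_map_def res_zero_def fun_eq_iff restrict_def)
  have rm_r: "res_map F i (restrict v {..<rank F (i + 1)}) = res_map F i v" for i v
    by (auto simp: res_map_def fun_eq_iff restrict_def intro!: sum.cong)
  show ?thesis
  proof (intro exI[of _ f], unfold_locales, goal_cases)
    case 1 then show ?case by (rule up)
  next
    case (2 c) then show ?case using f by blast
  next
    case (3 c) then show ?case using f by blast
  next
    case (4 c i b) then show ?case using dm by blast
  next
    case (5 c i b) then show ?case using dm by blast
  next
    case (6 p)
    then have "q p \<in> res_aug n \<aa> F ` free_mod n F 0" unfolding sj by blast
    then obtain v where v: "v \<in> free_mod n F 0" "q p = res_aug n \<aa> F v" by blast
    then have "q p = q (\<Sum>c<rank F 0. f c * v c)" using ra[of v] fm[OF v(1)] by simp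
    then show ?case using q_eq[OF 6 fv[of v]] fm[OF v(1)] by blast
  next
    case (7 v)
    let ?v = "restrict v {..<rank F 0}"
    have "res_aug n \<aa> F ?v = q (\<Sum>c<rank F 0. f c * v c)" using ra[of ?v] 7(1) by simp
    also have "\<dots> = \<zero>\<^bsub>R\<^esub>" using q_eq_0[OF fv[of v]] 7 by blast
    finally have "?v \<in> res_map F 0 ` free_mod n F 1" using k0 fr[of 0 v] 7(1) by blast
    then obtain w where w: "w \<in> free_mod n F 1" "?v = res_map F 0 w" by blast
    have "v c = (\<Sum>b<rank F 1. dmat F 0 c b * w b)" if "c < rank F 0" for c
      using fun_cong[OF w(2), of c] rm[OF that, of w] that by simp
    then show ?case using fm[OF w(1)] by blast
  next
    case (8 w)
    let ?w = "restrict w {..<rank F 1}"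
    let ?v = "res_map F 0 ?w"
    have v: "?v \<in> free_mod n F 0" "res_aug n \<aa> F ?v = \<zero>\<^bsub>R\<^esub>" using k0 fr[of 1 w] 8 by blast+
    have vc: "?v c \<in> Sn n" if "c < rank F 0" for c by (rule fm[OF v(1) that])
    have "Poly_Mapping.keys (\<Sum>c<rank F 0. f c * ?v c) \<subseteq> N"
      using q_eq_0[OF fv[of ?v, OF vc]] ra[of ?v, OF vc] v(2) by simp
    also have "(\<Sum>c<rank F 0. f c * ?v c) = (\<Sum>c<rank F 0. f c * (\<Sum>b<rank F 1. dmat F 0 c b * w b))"
    proof (rule sum.cong[OF refl])
      fix c assume "c \<in> {..<rank F 0}"
      then show "f c * ?v c = f c * (\<Sum>b<rank F 1. dmat F 0 c b * w b)" using rm[of c 0 ?w] by simp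
    qed
    finally show ?case .
  next
    case (9 i v)
    let ?v = "restrict v {..<rank F (i + 1)}"
    have "res_map F i ?v = res_zero F i" unfolding rm_r rm_0 using 9(2) by blast
    then have "?v \<in> res_map F (i + 1) ` free_mod n F (i + 2)" using k1[of i] fr[of "i + 1" v] 9(1) by blast
    then obtain w where w: "w \<in> free_mod n F (i + 2)" "?v = res_map F (i + 1) w" by blast
    have "v c = (\<Sum>b<rank F (i + 2). dmat F (i + 1) c b * w b)" if "c < rank F (i + 1)" for c
      using fun_cong[OF w(2), of c] rm[OF that, of w] that by simp
    then show ?case using fm[OF w(1)] by blast
  next
    case (10 i w c)
    let ?w = "restrict w {..<rank F (i + 2)}"
    let ?v = "res_map F (i + 1) ?w"
    have "?v \<in> res_map F (i + 1) ` free_mod n F (i + 2)" using fr[of "i + 2" w] 10(1) by blast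
    then have "res_map F i ?v = res_zero F i" using k1[of i] by blast
    then have "(\<Sum>b<rank F (i + 1). dmat F i c b * ?v b) = 0" unfolding rm_0 using 10(2) by blast
    also have "(\<Sum>b<rank F (i + 1). dmat F i c b * ?v b) =
       (\<Sum>b<rank F (i + 1). dmat F i c b * (\<Sum>b'<rank F (i + 2). dmat F (i + 1) b b' * w b'))"
    proof (rule sum.cong[OF refl])
      fix b assume "b \<in> {..<rank F (i + 1)}"
      then show "dmat F i c b * ?v b = dmat F i c b * (\<Sum>b'<rank F (i + 2). dmat F (i + 1) b b' * w b')"
        using rm[of b "i + 1" ?w] by simp
    qed
    finally show ?case .
  qed
qed

text \<open>Strong induction on k. Up to r the hypothesis B_r is used; beyond, r at least 2 gives k
  at least 3, as \<open>koszul_step\<close> requires.\<close>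

lemma golodI:
  assumes B: "satisfies_B K r" and F: "graded_free_resolution n \<aa> F"
    and reg: "\<And>i c. c < rank F i \<Longrightarrow> gdeg F i c \<le> int (i + r + 2)" and r: "2 \<le> r"
  shows "golod n \<aa>"
proof -
  obtain f where f: "free_res n N F f" using free_res_graded[OF F] by blast
  obtain h :: "'k kel \<Rightarrow> 'k kel" where h: "additive_map h" "\<And>x. h x \<in> kC n N"
    "\<And>x a. a \<in> Poly_Mapping.keys (h x) \<Longrightarrow>
        \<exists>b\<in>Poly_Mapping.keys x. mdeg a = mdeg b \<and> card (snd a) = Suc (card (snd b))"
    "\<And>y. y \<in> kC n N \<Longrightarrow> kdif N (h (kdif N y)) = kdif N y"
    using koszul_homotopy[of n N] by metis
  have hop: "T.homotopy_op h"
    unfolding T.homotopy_op_def using kG_homotopy[of h, OF h(2,3)] additive_add[OF h(1)] by blast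
  have ts: "T.trivial_systems k" if "2 \<le> k" for k
    using that
  proof (induction k rule: less_induct)
    case (less k)
    show ?case
    proof (cases "k \<le> r \<or> 0 \<in> N")
      case True
      then show ?thesis
      proof
        assume "k \<le> r"
        then show ?thesis using B less.prems unfolding satisfies_B_def by (intro T.massey_trivial_imp) auto
      next
        \<comment> \<open>The ideal is all of S, so the complex is zero.\<close>
        assume "0 \<in> N"
        then have "x \<in> N" for x using upsetD(1)[OF up, of 0 x] by simp
        then have "kC n N = ({0} :: 'k kel set)" by (auto simp: kC_def kbasis_def)
        then have C0: "x \<in> kC n N \<Longrightarrow> x = 0" for x :: "'k kel" by blast
        show ?thesis unfolding T.trivial_systems_def
        proof (intro allI impI)
          fix p and a :: "nat \<Rightarrow> nat \<Rightarrow> 'k kel" assume s: "T.system k p a"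
          have "a v w \<in> kG n N (entry_deg p v w)" if "1 \<le> v" "v \<le> w" "w \<le> k" "(v, w) \<noteq> (1, k)" for v w
            using s that unfolding T.system_def by blast
          then have "a v w = 0" if "1 \<le> v" "v \<le> w" "w \<le> k" "(v, w) \<noteq> (1, k)" for v w
            using that by (intro C0) (auto simp: kG_def kC_def)
          then have "kmul N (kbar (a 1 v)) (a (Suc v) k) = 0" if "v \<in> {1..<k}" for v
            using that by (simp add: additive_0[OF additive_kmul_right])
          then have "T.msum a 1 k = 0" unfolding T.msum_def by (intro sum.neutral) blast
          then show "T.msum a 1 k \<in> T.D" using T.D_0 by simp
        qed
      qed
    next
      case False
      then have k: "r < k" and N0: "0 \<notin> N" by auto
      interpret koszul_step n N k h
        by unfold_locales
          (use k r less.IH h N0 up in \<open>auto simp: additive_add[OF h(1)]\<close>)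
      show ?thesis
      proof (rule trivial_systems_step)
        fix z :: "'k kel" and P J
        assume z: "z \<in> kG n N P" "kdif N z = 0"
          "\<And>a. a \<in> Poly_Mapping.keys z \<Longrightarrow> total_deg (mdeg a) = J" and J: "P + k + 2 \<le> J"
        show "z \<in> T.D" unfolding T.D_def
        proof (rule free_res.koszul_cycle_bounds[OF f z(1,2)])
          show "a \<in> Poly_Mapping.keys z \<Longrightarrow> wt a = int J" for a using z(3) by (simp add: wt_def)
          \<comment> \<open>Generators of F P have degree at most P + r + 2, while J is at least P +
            k + 2 with k > r.\<close>
          show "gdeg F P c \<noteq> int J" if "c < rank F P" for c using reg[OF that] J k by linarith
        qed
      qed
    qed
  qed
  show ?thesis unfolding golod_def
  proof (intro allI impI)
    fix k :: nat assume "2 \<le> k"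
    then show "massey_trivial K k"
      by (rule T.massey_trivialI[OF _ _ hop]) (use ts h(4) in \<open>auto simp: T.D_def\<close>)
  qed
qed

end

text \<open>To pick a resolution from the infimum a strict bound is needed, hence r + 3; integrality
  of the degrees brings it back to r + 2.\<close>

lemma regularity_bound:
  assumes "ereal (real r) = max 2 (regularity n \<aa> - 2)"
  obtains F where "graded_free_resolution n \<aa> F" "\<And>i c. c < rank F i \<Longrightarrow> gdeg F i c \<le> int (i + r + 2)"
proof -
  have "regularity n \<aa> - 2 \<le> ereal (real r)" using assms by simp
  then have "regularity n \<aa> < ereal (real r + 3)" by (cases "regularity n \<aa>") auto
  then obtain F where F: "minimal_graded_free_resolution n \<aa> F"
    "(SUP (i, c) \<in> {(i, c). c < rank F i}. ereal (of_int (gdeg F i c - int i))) < ereal (real r + 3)"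
    unfolding regularity_def INF_less_iff by blast
  have "gdeg F i c \<le> int (i + r + 2)" if "c < rank F i" for i c
  proof -
    have "ereal (of_int (gdeg F i c - int i)) \<le> (SUP (i, c) \<in> {(i, c). c < rank F i}. ereal (of_int (gdeg F i c - int i)))"
      by (rule SUP_upper2[of "(i, c)"]) (use that in auto)
    then have "ereal (of_int (gdeg F i c - int i)) < ereal (real r + 3)" using F(2) by (rule le_less_trans)
    then have "real_of_int (gdeg F i c - int i) < real r + 3" by simp
    then show ?thesis by linarith
  qed
  then show ?thesis using that F(1) unfolding minimal_graded_free_resolution_def by blast
qed

theorem theorem4p1:
  fixes n r :: nat
    and \<aa> :: "'k::field pol set"
  assumes "monomial_ideal n \<aa>"
    and "ereal (real r) = max 2 (regularity n \<aa> - 2)"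
    and "satisfies_B (koszul_quot n \<aa>) r"
  shows "golod n \<aa>"
proof -
  obtain M where M: "\<forall>m\<in>M. Poly_Mapping.keys m \<subseteq> {..<n}" "\<aa> = Idl\<^bsub>pol_ring n\<^esub> (mon ` M)"
    using assms(1) unfolding monomial_ideal_def by blast
  interpret monomial_quotient n M \<aa> by unfold_locales (use M in blast)+
  obtain F where F: "graded_free_resolution n \<aa> F" "\<And>i c. c < rank F i \<Longrightarrow> gdeg F i c \<le> int (i + r + 2)"
    using regularity_bound[OF assms(2)] by blast
  have "ereal 2 \<le> ereal (real r)" unfolding assms(2) by simp
  then have "2 \<le> r" by simp
  then show ?thesis using golodI[OF assms(3) F] by blast
qed

end
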